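(* Let $k\in\mathbb{N}$ be fixed. Then for every $r=1,\dots,k$, $$\int_{\overset{r}{T}}^{\overset{r+1}{T}}\left|\zeta\left(\tfrac12+it\right)\right|^2dt=\int_{\overset{r}{T}}^{\overset{r}{T}+1}\ln\Gamma(t)\,dt-\int_{\overset{r-1}{T}}^{\overset{r-1}{T}+1}\ln\Gamma(t)\,dt-(\ln 2\pi-1-c)\left(\overset{r}{T}-\overset{r-1}{T}\right)+\mathcal{O}\left(\frac{\ln T}{T}\right),\quad T\to\infty,$$ where $\ln 2\pi-1-c\approx 0.26$.
   Context: $\zeta$ is the Riemann zeta-function, $\Gamma$ is Euler's Gamma function, and $c$ is Euler's constant ($1-c\approx 0.42$). Jacob's ladder: $\varphi_1(T)=\frac12\varphi(T)$, where $x(T)=\varphi(T)$ (defined for all sufficiently large $T$, tending to infinity with $T$) is an arbitrary solution of the nonlinear integral equation $$\int_0^{\mu[x(T)]}\left|\zeta\left(\tfrac12+it\right)\right|^2e^{-\frac{2}{x(T)}t}\,dt=\int_0^T\left|\zeta\left(\tfrac12+it\right)\right|^2dt,$$ and $\mu$ is any admissible function, i.e. a smooth, increasing, unbounded function (for large arguments) with $\mu(y)\ge 7y\ln y$; each admissible $\mu$ generates a solution $\varphi(T)=\varphi(T;\mu)$. For large arguments $\varphi_1$ is increasing and $\varphi_1^{-1}$ denotes its inverse function. Reverse iterations: for sufficiently large $T>0$, $\overset{0}{T}=T$ and $\overset{r}{T}=\overset{r}{T}(T)=\varphi_1^{-1}\big(\overset{r-1}{T}\big)$ for $r\ge1$,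 so that $\varphi_1(\overset{r}{T})=\overset{r-1}{T}$. *)

theory Defs
  imports "HOL-Complex_Analysis.Complex_Analysis" "HOL-Library.Landau_Symbols"
begin

(* The analytic continuation of the Dirichlet series to the complex plane without 1. By the
   identity theorem its values off the pole are uniquely determined; its value at 1 is
   unspecified. *)
definition zeta :: "complex \<Rightarrow> complex" where
  "zeta = (SOME f. f holomorphic_on (- {1}) \<and>
     (\<forall>s. Re s > 1 \<longrightarrow> (\<lambda>n. 1 / of_nat (Suc n) powr s) sums f s))"

definition zeta_sq :: "real \<Rightarrow> real" where
  "zeta_sq t = (cmod (zeta (1 / 2 + \<i> * of_real t)))\<^sup>2"

definition smooth_on_ray :: "real \<Rightarrow> (real \<Rightarrow> real) \<Rightarrow> bool" where
  "smooth_on_ray y0 f \<longleftrightarrow> (\<forall>n. \<forall>y>y0. (deriv ^^ n) f field_differentiable at y)"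

(* Monotonicity is not required to be strict. *)
definition admissible :: "(real \<Rightarrow> real) \<Rightarrow> bool" where
  "admissible \<mu> \<longleftrightarrow> (\<exists>y0>0. smooth_on_ray y0 \<mu> \<and> mono_on {y0<..} \<mu> \<and>
     \<not> bdd_above (\<mu> ` {y0<..}) \<and> (\<forall>y>y0. \<mu> y \<ge> 7 * y * ln y))"

(* phi is a solution, defined on the ray from T0 on, of the nonlinear integral equation. *)
definition ladder_solution :: "(real \<Rightarrow> real) \<Rightarrow> real \<Rightarrow> (real \<Rightarrow> real) \<Rightarrow> bool" where
  "ladder_solution \<mu> T0 \<phi> \<longleftrightarrow> T0 > 0 \<and> filterlim \<phi> at_top at_top \<and>
     (\<forall>T\<ge>T0. integral {0..\<mu> (\<phi> T)} (\<lambda>t. zeta_sq t * exp (- (2 / \<phi> T) * t))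
            = integral {0..T} zeta_sq)"

definition jacobs_ladder :: "(real \<Rightarrow> real) \<Rightarrow> real \<Rightarrow> real" where
  "jacobs_ladder \<phi> T = \<phi> T / 2"

(* For a solution phi on the ray from T0 on, the ladder is injective on that ray, because
   phi T determines the strictly increasing right-hand side of the equation; its range
   contains all large reals. So at large arguments inv_into is the inverse function of the
   ladder and does not depend on the choice of T0. *)
definition reverse_iterate :: "real \<Rightarrow> (real \<Rightarrow> real) \<Rightarrow> nat \<Rightarrow> real \<Rightarrow> real" where
  "reverse_iterate T0 \<phi> r T = (inv_into {T0..} (jacobs_ladder \<phi>) ^^ r) T"

end

(* Write Z(p) for the integral of |zeta(1/2+it)|^2 exp(-pt) over t > 0, F(y) = y ln y + (c - ln 2 pi) y and
   B(w) = 1/(exp w - 1). On 0 < Re s < 1 the function Gamma(s) zeta(s) is the Mellin transform of B(x) - 1/x.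
   Turning the ray of integration to the direction z = exp(i(pi - p)/2) and applying Parseval expresses Z(p),
   up to O(norm p), as the integral over x > 0 of the product of the kernel B(w) - 1/w at w = x z and at w = x/z.
   The identity B(v) B(w) = B(v+w) (1 + B(v) + B(w)) reduces it to elementary integrals, so that
   Z(p) = (c - ln 2 pi - ln p)/p + pi + O(norm p (1 + norm(ln p) + (norm p / Re p)^3)).

   With p = 2/x, and because mu(x) >= 7 x ln x makes the truncation harmless, this turns the equation of the
   ladder into: the integral of |zeta|^2 over [0, J(y)] is F(y) + pi + O(ln y / y), where J is the inverse of
   phi_1. Subtracting this for two consecutive iterates and using Raabe's formula, F(b) - F(a) is the
   combination of ln Gamma integrals, provided J(y) >= y, which keeps the iterates ordered and above T.

   If J(y) < y, the integral over [0, y] would be at least F(y) + pi - o(1). This is excluded by the upper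
   bound F(y) - y/5, since the true main term is smaller than F(y) by about (1 - c) y. To see this, compare
   |zeta|^2 with the step function harm(floor t) + c - ln 2 pi: the Laplace transform of the integrated difference
   V is small at all p = 1/T - iy, so the averages of V against narrow Gaussians are o(T), and since V cannot
   drop quickly, V(T) is at most eps T for large T. *)
theory Submission
  imports Defs "HOL-Probability.Probability" "HOL-Real_Asymp.Real_Asymp"
begin

section \<open>Fourier transforms and contour rotation\<close>

text \<open>The ladder equation fixes the integral of |zeta|^2 over [0, J(y)] but not the position
  of J(y) relative to y, so some knowledge of the plain mean square is needed. A one-sided bound
  that loses a fixed multiple of T is enough, which is why Gaussian averages together with slow
  decrease suffice here. In the Parseval step the obstacle is that for small p the direction z is
  close to i, and B has poles at all nonzero multiples of 2 pi i; subtracting 1/w removes only the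
  pole at 0. Whatever can be integrated exactly is split off. The rest is rotated once more, by a
  factor of size norm p / Re p, and the cube of this ratio in the error is the price of that
  rotation. For the ladder p is real and the ratio is 1. For the averages, at p = 1/T - iy, it
  produces a transform of size T + T^3 y^2, which is harmless for a Gaussian of width only slightly
  below T. The constant pi is the limit of (1/z - z) Ln z as z tends to i; it cancels between
  consecutive iterates.\<close>

lemma set_lebesgue_integral_FTC_Ioi:
  fixes F f :: "real \<Rightarrow> complex"
  assumes deriv: "\<And>x. x > 0 \<Longrightarrow> (F has_vector_derivative f x) (at x)"
    and cont: "continuous_on {0<..} f"
    and int: "set_integrable lborel {0<..} f"
    and lim0: "(F \<longlongrightarrow> A) (at_right 0)" and liminf: "(F \<longlongrightarrow> B) at_top"
  shows "(LINT x:{0<..}|lborel. f x) = B - A"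
proof -
  have "(LBINT x=ereal 0..\<infinity>. f x) = B - A"
  proof (rule interval_integral_FTC_integrable)
    show "(F has_vector_derivative f x) (at x)" if "ereal 0 < ereal x" for x
      using that deriv by simp
    show "isCont f x" if "ereal 0 < ereal x" for x
      using that cont by (simp add: continuous_on_eq_continuous_at)
    show "set_integrable lborel (einterval (ereal 0) \<infinity>) f" using int by (simp add: einterval_eq)
    show "((F \<circ> real_of_ereal) \<longlongrightarrow> A) (at_right (ereal 0))"
      using lim0 by (subst ereal_tendsto_simps)
    show "((F \<circ> real_of_ereal) \<longlongrightarrow> B) (at_left \<infinity>)"
      using liminf by (subst ereal_tendsto_simps)
  qed auto
  thus ?thesis by (simp add: interval_integral_to_infinity_eq)
qed

text \<open>The two bounds describe x^(-1/2) times a function that is bounded at 0 and of order 1/x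
  at infinity, as met on the critical line. Together they yield the majorant
  \<open>2 * M / (sqrt x * (1 + x))\<close>, whose primitive is a multiple of
  \<open>arctan (sqrt x)\<close>.\<close>

lemma set_integrable_Ioi_bound:
  fixes f :: "real \<Rightarrow> 'a :: {banach, second_countable_topology}"
  assumes cont: "continuous_on {0<..} f"
    and b0: "\<And>x. x > 0 \<Longrightarrow> norm (f x) \<le> M / sqrt x"
    and b1: "\<And>x. x > 0 \<Longrightarrow> norm (f x) \<le> M / (x * sqrt x)"
  shows "set_integrable lborel {0<..} f"
proof -
  have M: "M \<ge> 0" using b0[of 1] by (smt (verit) norm_ge_zero div_by_1 real_sqrt_one)
  have "set_integrable lborel (einterval (ereal 0) \<infinity>) (\<lambda>x. 2 * M / (sqrt x * (1 + x)))"
  proof (rule interval_integral_FTC_nonneg)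
    show "DERIV (\<lambda>x. 4 * M * arctan (sqrt x)) x :> 2 * M / (sqrt x * (1 + x))" if "ereal 0 < ereal x" for x
    proof -
      have x: "x > 0" using that by simp
      have "DERIV (\<lambda>x. 4 * M * arctan (sqrt x)) x :> 4 * M * (inverse (sqrt x) / 2 * inverse (1 + (sqrt x)\<^sup>2))"
        using x by (auto intro!: derivative_eq_intros)
      also have "4 * M * (inverse (sqrt x) / 2 * inverse (1 + (sqrt x)\<^sup>2)) = 2 * M / (sqrt x * (1 + x))"
        using x by (simp add: inverse_eq_divide)
      finally show ?thesis .
    qed
    show "isCont (\<lambda>x. 2 * M / (sqrt x * (1 + x))) x" if "ereal 0 < ereal x" for x
      using that by (intro continuous_intros) auto
    show "AE x in lborel. ereal 0 < ereal x \<longrightarrow> ereal x < \<infinity> \<longrightarrow> 0 \<le> 2 * M / (sqrt x * (1 + x))"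
      using M by (intro AE_I2) auto
    have "((\<lambda>x. 4 * M * arctan (sqrt x)) \<longlongrightarrow> 4 * M * arctan (sqrt 0)) (at_right 0)"
      by (intro tendsto_intros)
    thus "(((\<lambda>x. 4 * M * arctan (sqrt x)) \<circ> real_of_ereal) \<longlongrightarrow> 4 * M * arctan (sqrt 0)) (at_right (ereal 0))"
      by (subst ereal_tendsto_simps)
    have "((\<lambda>x. 4 * M * arctan (sqrt x)) \<longlongrightarrow> 4 * M * (pi / 2)) at_top"
      by (intro tendsto_intros filterlim_compose[OF tendsto_arctan_at_top] sqrt_at_top)
    thus "(((\<lambda>x. 4 * M * arctan (sqrt x)) \<circ> real_of_ereal) \<longlongrightarrow> 4 * M * (pi / 2)) (at_left \<infinity>)"
      by (subst ereal_tendsto_simps)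
  qed auto
  hence int: "set_integrable lborel {0<..} (\<lambda>x. 2 * M / (sqrt x * (1 + x)))" by (simp add: einterval_eq)
  have meas: "set_borel_measurable lborel {0<..} f"
    using cont unfolding set_borel_measurable_def
    by (auto intro: borel_measurable_continuous_on_indicator)
  have bd: "norm (f x) \<le> norm (2 * M / (sqrt x * (1 + x)))" if x: "x > 0" for x
  proof -
    have "norm (f x) \<le> M / sqrt x * (2 / (1 + x))"
    proof (cases "x \<le> 1")
      case True
      have "M / sqrt x * 1 \<le> M / sqrt x * (2 / (1 + x))"
        using M x True by (intro mult_left_mono) auto
      with b0[OF x] show ?thesis by linarith
    next
      case False
      have "1 / x \<le> 2 / (1 + x)" using False by (simp add: field_simps)
      hence "M / sqrt x * (1 / x) \<le> M / sqrt x * (2 / (1 + x))" using M x by (intro mult_left_mono) auto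
      moreover have "M / sqrt x * (1 / x) = M / (x * sqrt x)" by simp
      ultimately show ?thesis using b1[OF x] by linarith
    qed
    also have "\<dots> = 2 * M / (sqrt x * (1 + x))" by simp
    also have "\<dots> \<le> norm \<dots>" unfolding real_norm_def by (rule abs_ge_self)
    finally show ?thesis .
  qed
  show ?thesis
    by (rule set_integrable_bound[OF int meas], rule AE_I2) (use bd in simp)
qed

text \<open>With a primitive \<open>Q\<close> of \<open>F\<close> on the convex domain,
  \<open>Q (y a) - Q (y b)\<close> has the difference of the two integrands as its derivative. It
  vanishes at both ends: the segment has length \<open>y * norm (a - b)\<close>, which is beaten by
  the first bound at 0 and by the second at infinity. This replaces a closed contour with
  arcs.\<close>

lemma ray_rotation:
  fixes F :: "complex \<Rightarrow> complex"
  assumes hol: "F holomorphic_on \<Omega>" and op: "open \<Omega>" and cvx: "convex \<Omega>"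
    and seg: "\<And>y. y > 0 \<Longrightarrow> closed_segment (of_real y * a) (of_real y * b) \<subseteq> \<Omega>"
    and b0: "\<And>y x. y > 0 \<Longrightarrow> x \<in> closed_segment (of_real y * a) (of_real y * b) \<Longrightarrow> norm (F x) \<le> M / sqrt y"
    and b1: "\<And>y x. y > 0 \<Longrightarrow> x \<in> closed_segment (of_real y * a) (of_real y * b) \<Longrightarrow> norm (F x) \<le> M / (y * sqrt y)"
  shows "set_integrable lborel {0<..} (\<lambda>y. F (of_real y * a))"
    and "set_integrable lborel {0<..} (\<lambda>y. F (of_real y * b))"
    and "a * (LINT y:{0<..}|lborel. F (of_real y * a)) = b * (LINT y:{0<..}|lborel. F (of_real y * b))"
proof -
  have contF: "continuous_on \<Omega> F" using hol by (rule holomorphic_on_imp_continuous_on)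
  have in\<Omega>: "of_real y * a \<in> \<Omega>" "of_real y * b \<in> \<Omega>" if "y > 0" for y
    using seg[OF that] by auto
  have ca: "continuous_on {0<..} (\<lambda>y. F (of_real y * a))"
    using in\<Omega> by (intro continuous_on_compose2[OF contF] continuous_intros) auto
  have cb: "continuous_on {0<..} (\<lambda>y. F (of_real y * b))"
    using in\<Omega> by (intro continuous_on_compose2[OF contF] continuous_intros) auto
  show ia: "set_integrable lborel {0<..} (\<lambda>y. F (of_real y * a))"
    by (rule set_integrable_Ioi_bound[OF ca, of M]) (use b0 b1 in auto)
  show ib: "set_integrable lborel {0<..} (\<lambda>y. F (of_real y * b))"
    by (rule set_integrable_Ioi_bound[OF cb, of M]) (use b0 b1 in auto)
  obtain Q where Q: "\<And>x. x \<in> \<Omega> \<Longrightarrow> (Q has_field_derivative F x) (at x)"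
    using holomorphic_convex_primitive'[OF cvx op hol] op by (metis at_within_open)
  define G where "G = (\<lambda>y::real. Q (of_real y * a) - Q (of_real y * b))"
  have "(LINT y:{0<..}|lborel. a * F (of_real y * a) - b * F (of_real y * b)) = 0 - 0"
  proof (rule set_lebesgue_integral_FTC_Ioi)
    show "(G has_vector_derivative a * F (of_real y * a) - b * F (of_real y * b)) (at y)" if "y > 0" for y
    proof -
      have "((\<lambda>z. Q (z * a) - Q (z * b)) has_field_derivative a * F (of_real y * a) - b * F (of_real y * b)) (at (of_real y))"
        by (auto intro!: derivative_eq_intros DERIV_chain'[OF _ Q] in\<Omega> that)
      from has_vector_derivative_real_field[OF this] show ?thesis by (simp add: G_def)
    qed
    show "continuous_on {0<..} (\<lambda>y. a * F (of_real y * a) - b * F (of_real y * b))"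
      by (intro continuous_intros ca cb)
    show "set_integrable lborel {0<..} (\<lambda>y. a * F (of_real y * a) - b * F (of_real y * b))"
      by (intro set_integral_diff set_integrable_mult_right ia ib)
    have bd: "norm (G y) \<le> B * (y * norm (a - b))"
      if "y > 0" "\<And>x. x \<in> closed_segment (of_real y * a) (of_real y * b) \<Longrightarrow> norm (F x) \<le> B" for y B
    proof -
      have "norm (Q (of_real y * a) - Q (of_real y * b)) \<le> B * norm (of_real y * a - of_real y * b)"
      proof (rule field_differentiable_bound)
        show "(Q has_field_derivative F z) (at z within closed_segment (of_real y * a) (of_real y * b))"
          if "z \<in> closed_segment (of_real y * a) (of_real y * b)" for z
          using Q[of z] seg[OF \<open>y > 0\<close>] that by (auto intro: has_field_derivative_at_within)
      qed (use that in auto)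
      also have "of_real y * a - of_real y * b = of_real y * (a - b)" by (simp add: algebra_simps)
      finally show ?thesis using that by (simp add: G_def norm_mult)
    qed
    have l0: "((\<lambda>y. M / sqrt y * (y * norm (a - b))) \<longlongrightarrow> 0) (at_right 0)" by real_asymp
    have l1: "((\<lambda>y. M / (y * sqrt y) * (y * norm (a - b))) \<longlongrightarrow> 0) at_top" by real_asymp
    show "(G \<longlongrightarrow> 0) (at_right 0)"
      by (rule Lim_null_comparison[OF _ l0], rule eventually_mono[OF eventually_at_right_less])
         (rule bd, simp, rule b0, auto)
    show "(G \<longlongrightarrow> 0) at_top"
      by (rule Lim_null_comparison[OF _ l1], rule eventually_mono[OF eventually_gt_at_top[of 0]])
         (rule bd, simp, rule b1, auto)
  qed
  thus "a * (LINT y:{0<..}|lborel. F (of_real y * a)) = b * (LINT y:{0<..}|lborel. F (of_real y * b))"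
    using ia ib by (subst (asm) set_integral_diff) (auto intro!: set_integrable_mult_right)
qed

text \<open>The change of variables theorem speaks about completed Lebesgue measure, so Borel
  measurability is carried along in order to return to \<open>lborel\<close>. Through this
  substitution Mellin integrals on a vertical line become Fourier integrals.\<close>

lemma exp_substitution:
  fixes F :: "real \<Rightarrow> complex"
  assumes "set_integrable lborel {0<..} F"
  shows "integrable lborel (\<lambda>u. exp u *\<^sub>R F (exp u))"
    and "(LINT u|lborel. exp u *\<^sub>R F (exp u)) = (LINT x:{0<..}|lborel. F x)"
proof -
  define F0 where "F0 = (\<lambda>x. indicator {0<..} x *\<^sub>R F x)"
  have i0: "integrable lborel F0" using assms by (simp add: F0_def set_integrable_def)
  hence m0: "F0 \<in> borel_measurable lborel" by simp
  have i1: "F0 absolutely_integrable_on {0<..}"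
  proof -
    have "(\<lambda>x. indicator {0<..} x *\<^sub>R F0 x) = F0" by (auto simp: F0_def indicator_def)
    thus ?thesis using i0 m0 unfolding set_integrable_def by (simp add: integrable_completion)
  qed
  have rng: "exp ` (UNIV :: real set) = {0<..}" by (auto simp: image_iff exp_total intro: exp_ln[symmetric])
  have "F0 absolutely_integrable_on (exp ` (UNIV::real set)) \<and> integral (exp ` (UNIV::real set)) F0 = integral {0<..} F0"
    using i1 by (simp add: rng)
  hence *: "(\<lambda>u. \<bar>exp u\<bar> *\<^sub>R F0 (exp u)) absolutely_integrable_on UNIV \<and> 
      integral UNIV (\<lambda>u. \<bar>exp u\<bar> *\<^sub>R F0 (exp u)) = integral {0<..} F0"
    by (subst has_absolute_integral_change_of_variables_real) (auto intro!: derivative_eq_intros injI)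
  have eq: "(\<lambda>u. \<bar>exp u\<bar> *\<^sub>R F0 (exp u)) = (\<lambda>u. exp u *\<^sub>R F (exp u))" by (simp add: F0_def)
  have m1: "(\<lambda>u. \<bar>exp u\<bar> *\<^sub>R F0 (exp u)) \<in> borel_measurable lborel" using m0 by measurable
  show i2: "integrable lborel (\<lambda>u. exp u *\<^sub>R F (exp u))"
    using * m1 unfolding eq set_integrable_def by (simp add: integrable_completion)
  have "(LINT u|lborel. exp u *\<^sub>R F (exp u)) = integral UNIV (\<lambda>u. exp u *\<^sub>R F (exp u))"
    by (rule integral_lborel[symmetric]) fact
  also have "\<dots> = integral {0<..} F0" using * unfolding eq by simp
  also have "\<dots> = integral {0<..} F" by (rule integral_cong) (simp add: F0_def)
  also have "\<dots> = (LINT x:{0<..}|lborel. F x)" using set_borel_integral_eq_integral(2)[OF assms] by simp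
  finally show "(LINT u|lborel. exp u *\<^sub>R F (exp u)) = (LINT x:{0<..}|lborel. F x)" .
qed

section \<open>Fourier inversion and Parseval by Gaussian smoothing\<close>

definition fourier :: "(real \<Rightarrow> complex) \<Rightarrow> real \<Rightarrow> complex" where
  "fourier F y = (LINT v|lborel. F v * cis (y * v))"

lemma borel_measurable_cis [measurable]: "cis \<in> borel_measurable borel"
  by (intro borel_measurable_continuous_onI continuous_intros)

lemma borel_measurable_cnj [measurable]: "cnj \<in> borel_measurable borel"
  by (intro borel_measurable_continuous_onI continuous_intros)

text \<open>Fubini's theorem asks for integrability on the product; in each application below the
  integrand is dominated by a product of two integrable functions of one variable.\<close>

lemma integrable_lborel_prod:
  fixes f :: "real \<Rightarrow> real \<Rightarrow> complex"
  assumes m: "(\<lambda>(x, y). f x y) \<in> borel_measurable (lborel \<Otimes>\<^sub>M lborel)"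
    and g: "integrable lborel g" and h: "integrable lborel h"
    and bd: "\<And>x y. norm (f x y) \<le> norm (g x :: complex) * norm (h y :: complex)"
  shows "integrable (lborel \<Otimes>\<^sub>M lborel) (\<lambda>(x, y). f x y)"
proof (rule lborel_pair.Fubini_integrable[OF m])
  have mx: "f x \<in> borel_measurable lborel" for x using measurable_compose_Pair1[OF _ m, of x] by simp
  have ix: "integrable lborel (f x)" for x
    by (rule Bochner_Integration.integrable_bound[of _ "\<lambda>y. g x * h y"])
       (use h bd mx in \<open>auto simp: norm_mult\<close>)
  thus "AE x in lborel. integrable lborel (\<lambda>y. case (x, y) of (x, y) \<Rightarrow> f x y)" by simp
  show "integrable lborel (\<lambda>x. LINT y|lborel. norm (case (x, y) of (x, y) \<Rightarrow> f x y))"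
  proof (rule Bochner_Integration.integrable_bound[of _ "\<lambda>x. norm (g x) * (LINT y|lborel. norm (h y))"])
    show "(\<lambda>x. LINT y|lborel. norm (case (x, y) of (x, y) \<Rightarrow> f x y)) \<in> borel_measurable lborel"
      using measurable_compose[OF m borel_measurable_norm]
      by (intro lborel.borel_measurable_lebesgue_integral) (simp add: case_prod_beta')
    show "AE x in lborel. norm (LINT y|lborel. norm (case (x, y) of (x, y) \<Rightarrow> f x y))
        \<le> norm (norm (g x) * (LINT y|lborel. norm (h y)))"
    proof (rule AE_I2)
      fix x
      have "(LINT y|lborel. norm (f x y)) \<le> (LINT y|lborel. norm (g x) * norm (h y))"
        using ix h bd by (intro integral_mono) auto
      also have "\<dots> = norm (g x) * (LINT y|lborel. norm (h y))" by simp
      finally show "norm (LINT y|lborel. norm (case (x, y) of (x, y) \<Rightarrow> f x y))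
        \<le> norm (norm (g x) * (LINT y|lborel. norm (h y)))" by simp
    qed
  qed (use g h in auto)
qed

text \<open>The characteristic function of the normal distribution, written with \<open>cis\<close>
  so that a Gaussian weight can be replaced by an integral of oscillations.\<close>

lemma std_normal_char: "(LINT x|lborel. of_real (std_normal_density x) * cis (s * x)) = of_real (exp (- s\<^sup>2 / 2))"
proof -
  have "char std_normal_distribution s = (LINT x|lborel. std_normal_density x *\<^sub>R iexp (s * x))"
    unfolding char_def by (subst integral_density) auto
  thus ?thesis by (simp add: char_std_normal_distribution scaleR_conv_of_real cis_conv_exp)
qed

lemma integrable_std_normal: "integrable lborel (\<lambda>x. complex_of_real (std_normal_density x))"
  by (intro integrable_of_real) simp

text \<open>Writing the Gaussian weight as a characteristic function and exchanging the integrals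
  turns an average of \<open>F\<close> near \<open>a\<close> at scale \<open>b\<close> into an
  average of its transform at frequencies of order 1/b. This is used twice: with \<open>b\<close>
  tending to 0 for the inversion formula, and with large \<open>b\<close> to bound averages of
  \<open>mean_excess\<close>.\<close>

lemma gaussian_fourier:
  fixes F :: "real \<Rightarrow> complex"
  assumes F: "integrable lborel F" and b: "b > 0"
  shows "(LINT v|lborel. F v * of_real (exp (- ((v - a) / b)\<^sup>2 / 2))) =
     (LINT x|lborel. of_real (std_normal_density x) * cis (- (a / b * x)) * fourier F (x / b))"
proof -
  have [measurable]: "F \<in> borel_measurable lborel" using F by simp
  have int: "integrable (lborel \<Otimes>\<^sub>M lborel) (\<lambda>(v, x). F v * (of_real (std_normal_density x) * cis ((v - a) / b * x)))"
  proof (rule integrable_lborel_prod[OF _ F integrable_std_normal])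
    show "(\<lambda>(v, x). F v * (of_real (std_normal_density x) * cis ((v - a) / b * x))) \<in> borel_measurable (lborel \<Otimes>\<^sub>M lborel)"
      by measurable
  qed (auto simp: norm_mult)
  have "(LINT v|lborel. F v * of_real (exp (- ((v - a) / b)\<^sup>2 / 2))) =
     (LINT v|lborel. LINT x|lborel. F v * (of_real (std_normal_density x) * cis ((v - a) / b * x)))"
    by (simp only: std_normal_char[symmetric] integral_mult_right_zero)
  also have "\<dots> = (LINT x|lborel. LINT v|lborel. F v * (of_real (std_normal_density x) * cis ((v - a) / b * x)))"
    by (rule lborel_pair.Fubini_integral[OF int, symmetric])
  also have "\<dots> = (LINT x|lborel. LINT v|lborel. (of_real (std_normal_density x) * cis (- (a / b * x))) * (F v * cis (x / b * v)))"
  proof (intro Bochner_Integration.integral_cong refl)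
    fix x v
    have "cis ((v - a) / b * x) = cis (- (a / b * x)) * cis (x / b * v)"
      by (simp add: cis_mult) (simp add: algebra_simps diff_divide_distrib)
    thus "F v * (of_real (std_normal_density x) * cis ((v - a) / b * x)) =
       (of_real (std_normal_density x) * cis (- (a / b * x))) * (F v * cis (x / b * v))" by simp
  qed
  also have "\<dots> = (LINT x|lborel. of_real (std_normal_density x) * cis (- (a / b * x)) * fourier F (x / b))"
    by (simp only: integral_mult_right_zero fourier_def)
  finally show ?thesis .
qed

lemma norm_fourier_le: "integrable lborel F \<Longrightarrow> norm (fourier F y) \<le> (LINT v|lborel. norm (F v))"
  unfolding fourier_def by (rule order.trans[OF integral_norm_bound]) (simp add: norm_mult)

lemma fourier_measurable [measurable]:
  assumes [measurable]: "F \<in> borel_measurable borel"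
  shows "fourier F \<in> borel_measurable borel"
proof -
  have "(\<lambda>(y, v). F v * cis (y * v)) \<in> borel_measurable (borel \<Otimes>\<^sub>M lborel)" by measurable
  from lborel.borel_measurable_lebesgue_integral[OF this] show ?thesis
    by (simp add: fourier_def[abs_def])
qed

text \<open>Both sides of the Gaussian identity are rescaled and the width is sent to 0. One side
  becomes an average of \<open>F\<close> concentrating at \<open>a\<close>, the other the transform
  damped by a density that tends to its value \<open>1 / sqrt (2 * pi)\<close> at 0. As
  \<open>fourier\<close> carries no normalising factor, two such square roots combine to
  \<open>2 * pi\<close>.\<close>

lemma fourier_inversion:
  fixes F :: "real \<Rightarrow> complex"
  assumes F: "integrable lborel F" and cont: "continuous_on UNIV F" and bd: "\<And>x. norm (F x) \<le> C"
    and Fh: "integrable lborel (fourier F)"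
  shows "(LINT y|lborel. fourier F y * cis (- (a * y))) = 2 * pi * F a"
proof -
  have [measurable]: "F \<in> borel_measurable borel" using cont by (rule borel_measurable_continuous_onI)
  have [measurable]: "fourier F \<in> borel_measurable borel" using Fh by simp
  define b where "b = (\<lambda>n. 1 / real (Suc n))"
  have b: "b n > 0" for n by (simp add: b_def)
  have b0: "b \<longlonglongrightarrow> 0" unfolding b_def by real_asymp
  define L where "L = (\<lambda>n. LINT x|lborel. of_real (std_normal_density x) * F (a + b n * x))"
  define R where "R = (\<lambda>n. LINT y|lborel. of_real (std_normal_density (b n * y)) * cis (- (a * y)) * fourier F y)"
  have LR: "of_real (sqrt (2 * pi)) * L n = R n" for n
  proof -
    note bn = b[of n]
    have "(LINT v|lborel. F v * of_real (exp (- ((v - a) / b n)\<^sup>2 / 2))) 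
        = \<bar>b n\<bar> *\<^sub>R (LINT x|lborel. F (a + b n * x) * of_real (exp (- ((a + b n * x - a) / b n)\<^sup>2 / 2)))"
      using bn by (intro lborel_integral_real_affine) auto
    also have "(\<lambda>x. F (a + b n * x) * of_real (exp (- ((a + b n * x - a) / b n)\<^sup>2 / 2))) =
        (\<lambda>x. of_real (sqrt (2 * pi)) * (of_real (std_normal_density x) * F (a + b n * x)))"
      using bn by (intro ext) (simp add: std_normal_density_def)
    also have "(LINT x|lborel. of_real (sqrt (2 * pi)) * (of_real (std_normal_density x) * F (a + b n * x)))
       = of_real (sqrt (2 * pi)) * L n" by (simp add: L_def)
    finally have 1: "(LINT v|lborel. F v * of_real (exp (- ((v - a) / b n)\<^sup>2 / 2))) = b n *\<^sub>R (of_real (sqrt (2 * pi)) * L n)"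
      using bn by simp
    have "(LINT x|lborel. of_real (std_normal_density x) * cis (- (a / b n * x)) * fourier F (x / b n))
      = \<bar>b n\<bar> *\<^sub>R (LINT y|lborel. of_real (std_normal_density (0 + b n * y)) * cis (- (a / b n * (0 + b n * y))) * fourier F ((0 + b n * y) / b n))"
      using bn by (intro lborel_integral_real_affine) auto
    also have "\<dots> = b n *\<^sub>R R n" using bn by (simp add: R_def)
    finally show ?thesis using gaussian_fourier[OF F bn, of a] 1 bn by simp
  qed
  have "L \<longlonglongrightarrow> (LINT x|lborel. of_real (std_normal_density x) * F a)"
    unfolding L_def
  proof (rule integral_dominated_convergence)
    show "integrable lborel (\<lambda>x. std_normal_density x * C)" by simp
    show "AE x in lborel. (\<lambda>n. of_real (std_normal_density x) * F (a + b n * x)) \<longlonglongrightarrow> of_real (std_normal_density x) * F a"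
    proof (intro AE_I2 tendsto_mult tendsto_const)
      fix x
      have "isCont F (a + 0 * x)" using cont by (simp add: continuous_on_eq_continuous_at)
      moreover have "(\<lambda>n. a + b n * x) \<longlonglongrightarrow> a + 0 * x" by (intro tendsto_intros b0)
      ultimately show "(\<lambda>n. F (a + b n * x)) \<longlonglongrightarrow> F a" using isCont_tendsto_compose by force
    qed
    show "AE x in lborel. norm (of_real (std_normal_density x) * F (a + b n * x)) \<le> std_normal_density x * C" for n
      by (intro AE_I2) (use bd in \<open>auto simp: norm_mult intro!: mult_left_mono\<close>)
  qed measurable
  also have "(LINT x|lborel. of_real (std_normal_density x) * F a) = F a"
    using std_normal_char[of 0] by simp
  finally have L: "(\<lambda>n. of_real (sqrt (2 * pi)) * L n) \<longlonglongrightarrow> of_real (sqrt (2 * pi)) * F a" by (intro tendsto_intros)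
  have d0: "std_normal_density 0 = 1 / sqrt (2 * pi)" by (simp add: std_normal_density_def)
  have "R \<longlonglongrightarrow> (LINT y|lborel. of_real (std_normal_density 0) * cis (- (a * y)) * fourier F y)"
    unfolding R_def
  proof (rule integral_dominated_convergence)
    show "integrable lborel (\<lambda>y. 1 / sqrt (2 * pi) * norm (fourier F y))" using Fh by simp
    show "AE y in lborel. (\<lambda>n. of_real (std_normal_density (b n * y)) * cis (- (a * y)) * fourier F y)
       \<longlonglongrightarrow> of_real (std_normal_density 0) * cis (- (a * y)) * fourier F y"
    proof (intro AE_I2 tendsto_intros)
      fix y
      have "(\<lambda>n. std_normal_density (b n * y)) \<longlonglongrightarrow> 1 / sqrt (2 * pi) * exp (- (0 * y)\<^sup>2 / 2)"
        unfolding std_normal_density_def by (intro tendsto_intros b0) auto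
      thus "(\<lambda>n. std_normal_density (b n * y)) \<longlonglongrightarrow> std_normal_density 0" by (simp add: d0)
    qed
    show "AE y in lborel. norm (of_real (std_normal_density (b n * y)) * cis (- (a * y)) * fourier F y)
       \<le> 1 / sqrt (2 * pi) * norm (fourier F y)" for n
    proof (intro AE_I2)
      fix y
      have d: "std_normal_density (b n * y) \<le> 1 / sqrt (2 * pi)"
        unfolding std_normal_density_def by (intro mult_left_le) auto
      thus "norm (of_real (std_normal_density (b n * y)) * cis (- (a * y)) * fourier F y) \<le> 1 / sqrt (2 * pi) * norm (fourier F y)"
        using mult_right_mono[OF d norm_ge_zero[of "fourier F y"]] by (simp add: norm_mult)
    qed
  qed measurable
  with L have "of_real (sqrt (2 * pi)) * F a = (LINT y|lborel. of_real (std_normal_density 0) * cis (- (a * y)) * fourier F y)"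
    unfolding LR by (rule LIMSEQ_unique)
  also have "\<dots> = of_real (std_normal_density 0) * (LINT y|lborel. fourier F y * cis (- (a * y)))"
    unfolding integral_mult_right_zero[symmetric]
    by (intro Bochner_Integration.integral_cong refl) algebra
  finally have e: "of_real (sqrt (2 * pi)) * F a = of_real (1 / sqrt (2 * pi)) * (LINT y|lborel. fourier F y * cis (- (a * y)))"
    by (simp only: d0)
  have "of_real (2 * pi) * F a = of_real (sqrt (2 * pi) * sqrt (2 * pi)) * F a" by (subst real_sqrt_mult_self) simp
  also have "\<dots> = of_real (sqrt (2 * pi)) * (of_real (sqrt (2 * pi)) * F a)" by (simp only: of_real_mult mult.assoc)
  also have "\<dots> = of_real (sqrt (2 * pi) * (1 / sqrt (2 * pi))) * (LINT y|lborel. fourier F y * cis (- (a * y)))"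
    by (simp only: e of_real_mult mult.assoc)
  also have "sqrt (2 * pi) * (1 / sqrt (2 * pi)) = 1" by simp
  finally show ?thesis by simp
qed

text \<open>Only \<open>G\<close> is inverted: once \<open>fourier F\<close> is expanded and the
  integrals are exchanged, the inner integral is the conjugate of the inversion formula for
  \<open>G\<close> at \<open>u\<close>. This explains the asymmetric hypotheses.\<close>

lemma parseval:
  fixes F G :: "real \<Rightarrow> complex"
  assumes F: "integrable lborel F" and G: "integrable lborel G" "continuous_on UNIV G" "\<And>x. norm (G x) \<le> C"
    and Gh: "integrable lborel (fourier G)"
  shows "(LINT y|lborel. fourier F y * cnj (fourier G y)) = 2 * pi * (LINT u|lborel. F u * cnj (G u))"
proof -
  have [measurable]: "F \<in> borel_measurable borel" "fourier G \<in> borel_measurable borel" using F Gh by simp_all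
  have int: "integrable (lborel \<Otimes>\<^sub>M lborel) (\<lambda>(u, y). F u * (cnj (fourier G y) * cis (u * y)))"
  proof (rule integrable_lborel_prod[OF _ F Gh])
    show "(\<lambda>(u, y). F u * (cnj (fourier G y) * cis (u * y))) \<in> borel_measurable (lborel \<Otimes>\<^sub>M lborel)"
      by measurable
  qed (auto simp: norm_mult)
  have "(LINT y|lborel. fourier F y * cnj (fourier G y)) =
     (LINT y|lborel. LINT u|lborel. cnj (fourier G y) * (F u * cis (y * u)))"
    by (simp only: integral_mult_right_zero fourier_def[of F] mult.commute)
  also have "\<dots> = (LINT y|lborel. LINT u|lborel. F u * (cnj (fourier G y) * cis (u * y)))"
    by (simp add: mult_ac)
  also have "\<dots> = (LINT u|lborel. LINT y|lborel. F u * (cnj (fourier G y) * cis (u * y)))"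
    by (rule lborel_pair.Fubini_integral[OF int])
  also have "\<dots> = (LINT u|lborel. F u * cnj (LINT y|lborel. fourier G y * cis (- (u * y))))"
  proof (intro Bochner_Integration.integral_cong refl)
    fix u
    have "cnj (LINT y|lborel. fourier G y * cis (- (u * y))) = (LINT y|lborel. cnj (fourier G y) * cis (u * y))"
      by (simp add: cis_cnj flip: Bochner_Integration.integral_cnj)
    thus "(LINT y|lborel. F u * (cnj (fourier G y) * cis (u * y))) = F u * cnj (LINT y|lborel. fourier G y * cis (- (u * y)))"
      by simp
  qed
  also have "\<dots> = (LINT u|lborel. (2 * pi) * (F u * cnj (G u)))"
    by (subst fourier_inversion[OF G Gh]) (simp add: mult_ac)
  also have "\<dots> = 2 * pi * (LINT u|lborel. F u * cnj (G u))" by simp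
  finally show ?thesis .
qed

section \<open>The Bose kernel\<close>

definition bose :: "complex \<Rightarrow> complex" where "bose w = 1 / (exp w - 1)"

text \<open>At 0 the kernel expands as 1/w - 1/2 + w/12 + ...; with both leading terms removed it
  vanishes there, and in cones around the positive axis it stays bounded.\<close>

definition bose_rem :: "complex \<Rightarrow> complex" where "bose_rem w = bose w - 1 / w + 1 / 2"

definition bose_cut :: "complex \<Rightarrow> complex" where "bose_cut w = bose w - 1 / w"

text \<open>Half of \<open>bose w\<close> cancels the simple pole that
  \<open>(bose w - 1 / w) / w\<close> still has at 0, so this combination is bounded at 0 and decays
  like the inverse square in cones. Twice its integral over the half-line is the constant in the
  expansion of Z(p).\<close>

definition bose_quot :: "complex \<Rightarrow> complex" where "bose_quot w = bose w / w - 1 / w\<^sup>2 + bose w / 2"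

section \<open>Size of the kernel in cones around the positive axis\<close>

lemma exp_neq_1_Re_pos: "Re w > 0 \<Longrightarrow> exp w \<noteq> (1::complex)"
  by (metis norm_exp_eq_Re norm_one exp_eq_one_iff less_irrefl)

lemma norm_bose_le: assumes "Re w > 0" shows "norm (bose w) \<le> 1 / (exp (Re w) - 1)"
proof -
  have "exp (Re w) - 1 \<le> norm (exp w - 1)"
    using norm_triangle_ineq2[of "exp w" 1] by simp
  thus ?thesis using assms unfolding bose_def norm_divide
    by (intro frac_le) auto
qed

lemma norm_bose_le_inverse: assumes "Re w > 0" shows "norm (bose w) \<le> 1 / Re w"
proof -
  have "Re w \<le> exp (Re w) - 1" using exp_ge_add_one_self[of "Re w"] by linarith
  hence "1 / (exp (Re w) - 1) \<le> 1 / Re w" using assms by (intro frac_le) auto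
  thus ?thesis using norm_bose_le[OF assms] by linarith
qed

lemma norm_bose_le_inverse_square: assumes "Re w > 0" shows "norm (bose w) \<le> 2 / (Re w)\<^sup>2"
proof -
  have "1 + Re w + (Re w)\<^sup>2 / 2 \<le> exp (Re w)" using assms by (intro exp_lower_Taylor_quadratic) auto
  hence "(Re w)\<^sup>2 / 2 \<le> exp (Re w) - 1" using assms by linarith
  hence "1 / (exp (Re w) - 1) \<le> 1 / ((Re w)\<^sup>2 / 2)" using assms by (intro frac_le) auto
  thus ?thesis using norm_bose_le[OF assms] by simp
qed

lemma bose_holomorphic: assumes "\<And>w. w \<in> S \<Longrightarrow> Re w > 0" shows "bose holomorphic_on S"
  unfolding bose_def using assms exp_neq_1_Re_pos by (intro holomorphic_intros) auto

lemma bose_rem_holomorphic: assumes "\<And>w. w \<in> S \<Longrightarrow> Re w > 0" shows "bose_rem holomorphic_on S"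
proof -
  have eq: "bose_rem = (\<lambda>w. bose w - 1 / w + 1 / 2)" by (simp add: bose_rem_def fun_eq_iff)
  show ?thesis unfolding eq by (intro holomorphic_intros bose_holomorphic) (use assms in force)+
qed

lemma bose_cut_holomorphic: assumes "\<And>w. w \<in> S \<Longrightarrow> Re w > 0" shows "bose_cut holomorphic_on S"
proof -
  have eq: "bose_cut = (\<lambda>w. bose w - 1 / w)" by (simp add: bose_cut_def fun_eq_iff)
  show ?thesis unfolding eq by (intro holomorphic_intros bose_holomorphic) (use assms in force)+
qed

lemma bose_quot_holomorphic: assumes "\<And>w. w \<in> S \<Longrightarrow> Re w > 0" shows "bose_quot holomorphic_on S"
proof -
  have eq: "bose_quot = (\<lambda>w. bose w / w - 1 / w\<^sup>2 + bose w / 2)" by (simp add: bose_quot_def fun_eq_iff)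
  show ?thesis unfolding eq by (intro holomorphic_intros bose_holomorphic) (use assms in force)+
qed

text \<open>Over a common denominator the terms of order one and two cancel, and the numerator is
  \<open>w ^ 3 / 2 + (w - 2) * r\<close> with the cubic Taylor remainder \<open>r\<close>, while the
  denominator is of exact order two.\<close>

lemma norm_bose_rem_small:
  assumes w: "w \<noteq> 0" "norm w \<le> 1 / 2"
  shows "norm (bose_rem w) \<le> 7 * norm w"
proof -
  define r where "r = exp w - (1 + w + w\<^sup>2 / 2)"
  have "norm r \<le> exp \<bar>Re w\<bar> * norm w ^ Suc 2 / fact 2"
    using Taylor_exp[of w 2] by (simp add: r_def numeral_2_eq_2 algebra_simps)
  also have "\<dots> \<le> 3 * norm w ^ Suc 2 / fact 2"
  proof -
    have "exp \<bar>Re w\<bar> \<le> exp 1" using w abs_Re_le_cmod[of w] by simp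
    also have "\<dots> \<le> (3::real)" by (rule exp_le)
    finally show ?thesis by (intro divide_right_mono mult_right_mono) auto
  qed
  finally have r: "norm r \<le> 3 / 2 * norm w ^ 3" by (simp add: numeral_3_eq_3 fact_numeral)
  have sq: "norm w ^ 2 \<le> norm w / 2" using w mult_left_mono[of "norm w" "1/2" "norm w"] by (simp add: power2_eq_square)
  have "norm w ^ 3 = norm w ^ 2 * norm w" by (simp add: power2_eq_square power3_eq_cube)
  also have "\<dots> \<le> norm w / 2 * (1/2)" using sq w by (intro mult_mono) auto
  finally have cu: "norm w ^ 3 \<le> norm w / 4" by simp
  have "norm (w\<^sup>2 / 2 + r) \<le> norm w ^ 2 / 2 + 3 / 2 * norm w ^ 3"
    using norm_triangle_ineq[of "w\<^sup>2 / 2" r] r by (simp add: norm_power norm_divide)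
  also have "\<dots> \<le> 5 / 8 * norm w" using sq cu by linarith
  finally have "norm w - norm (w\<^sup>2 / 2 + r) \<ge> 3 / 8 * norm w" by linarith
  moreover have "exp w - 1 = w - (- (w\<^sup>2 / 2 + r))" by (simp add: r_def)
  ultimately have den: "norm (exp w - 1) \<ge> 3 / 8 * norm w"
    using norm_triangle_ineq2[of w "- (w\<^sup>2 / 2 + r)"] by (simp del: minus_add_distrib add: norm_minus_cancel)
  hence nz: "exp w - 1 \<noteq> 0" using w by auto
  have "bose_rem w = (2 * w - 2 * (exp w - 1) + w * (exp w - 1)) / (2 * w * (exp w - 1))"
    using nz w by (simp add: bose_rem_def bose_def field_simps)
  also have "2 * w - 2 * (exp w - 1) + w * (exp w - 1) = w ^ 3 / 2 + (w - 2) * r"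
    unfolding r_def power2_eq_square power3_eq_cube by (simp add: field_simps)
  finally have "norm (bose_rem w) = norm (w ^ 3 / 2 + (w - 2) * r) / (2 * norm w * norm (exp w - 1))"
    by (simp add: norm_divide norm_mult)
  also have "\<dots> \<le> (5 * norm w ^ 3) / (2 * norm w * (3 / 8 * norm w))"
  proof (rule frac_le)
    have "norm (w - 2) \<le> 5 / 2" using norm_triangle_ineq4[of w 2] w by simp
    hence "norm ((w - 2) * r) \<le> 5 / 2 * (3 / 2 * norm w ^ 3)"
      unfolding norm_mult using r by (intro mult_mono) auto
    moreover have "norm (w ^ 3 / 2 + (w - 2) * r) \<le> norm w ^ 3 / 2 + norm ((w - 2) * r)"
      using norm_triangle_ineq[of "w ^ 3 / 2" "(w - 2) * r"] by (simp add: norm_power norm_divide)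
    moreover have "0 \<le> norm w ^ 3" by simp
    ultimately show "norm (w ^ 3 / 2 + (w - 2) * r) \<le> 5 * norm w ^ 3" by linarith
  qed (use den w in \<open>auto intro!: mult_left_mono\<close>)
  also have "\<dots> = 20 / 3 * norm w" using w by (simp add: field_simps power3_eq_cube)
  also have "\<dots> \<le> 7 * norm w" by simp
  finally show ?thesis .
qed

text \<open>\<open>\<rho>\<close> bounds the secant of the argument of \<open>w\<close>, so it
  measures how close \<open>w\<close> may come to the imaginary axis, where the poles lie.\<close>

lemma norm_bose_cone:
  assumes "Re w > 0" "norm w \<le> \<rho> * Re w"
  shows "norm (bose w) \<le> \<rho> / norm w" "norm (bose w) \<le> 2 * \<rho>\<^sup>2 / (norm w)\<^sup>2"
proof -
  have w: "norm w > 0" using assms by auto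
  have i: "1 / Re w \<le> \<rho> / norm w" using assms w by (simp add: field_simps)
  thus "norm (bose w) \<le> \<rho> / norm w" using norm_bose_le_inverse[OF assms(1)] by linarith
  have "(1 / Re w)\<^sup>2 \<le> (\<rho> / norm w)\<^sup>2" using i assms by (intro power_mono) auto
  thus "norm (bose w) \<le> 2 * \<rho>\<^sup>2 / (norm w)\<^sup>2" using norm_bose_le_inverse_square[OF assms(1)]
    by (simp add: power_divide)
qed

lemma norm_bose_rem_cone:
  assumes "Re w > 0" "norm w \<le> \<rho> * Re w" "\<rho> \<ge> 1"
  shows "norm (bose_rem w) \<le> 9 * \<rho> * norm w" "norm (bose_rem w) \<le> 9 * \<rho>"
proof -
  have w: "norm w > 0" using assms by auto
  have A: "norm (bose_rem w) \<le> (\<rho> + 1) / norm w + 1 / 2"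
  proof -
    have "norm (bose_rem w) \<le> norm (bose w) + norm (1 / w) + norm (1 / 2 :: complex)"
      unfolding bose_rem_def by (intro order.trans[OF norm_triangle_ineq] add_mono norm_triangle_ineq4) simp
    moreover have "norm (bose w) \<le> \<rho> / norm w"
      by (rule norm_bose_cone(1)[OF assms(1,2)])
    ultimately show ?thesis by (simp add: norm_divide add_divide_distrib)
  qed
  show "norm (bose_rem w) \<le> 9 * \<rho> * norm w"
  proof (cases "norm w \<le> 1 / 2")
    case True
    with norm_bose_rem_small[of w] w have "norm (bose_rem w) \<le> 7 * norm w" by auto
    also have "\<dots> \<le> 9 * \<rho> * norm w" using assms by (intro mult_right_mono) auto
    finally show ?thesis .
  next
    case False
    have "(\<rho> + 1) / norm w \<le> (2 * \<rho>) / (1 / 2)" using False assms by (intro frac_le) auto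
    hence "norm (bose_rem w) \<le> 4 * \<rho> + 1 / 2" using A by simp
    also have "\<dots> \<le> 9 * \<rho> * (1 / 2)" using assms by simp
    also have "\<dots> \<le> 9 * \<rho> * norm w" using False assms by (intro mult_left_mono) auto
    finally show ?thesis .
  qed
  hence B: "norm (bose_rem w) \<le> 9 * \<rho> * norm w" .
  show "norm (bose_rem w) \<le> 9 * \<rho>"
  proof (cases "norm w \<le> 1")
    case True
    hence "9 * \<rho> * norm w \<le> 9 * \<rho> * 1" using assms by (intro mult_left_mono) auto
    thus ?thesis using B by simp
  next
    case False
    have "(\<rho> + 1) / norm w \<le> (2 * \<rho>) / 1" using False assms by (intro frac_le) auto
    thus ?thesis using A assms by simp
  qed
qed

lemma norm_bose_quot_cone:
  assumes "Re w > 0" "norm w \<le> \<rho> * Re w" "\<rho> \<ge> 1"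
  shows "norm (bose_quot w) \<le> 14 * \<rho>\<^sup>2 * (1 / norm w)\<^sup>2" "norm (bose_quot w) \<le> 14 * \<rho>\<^sup>2"
proof -
  have w: "norm w > 0" "w \<noteq> 0" using assms by auto
  have \<rho>: "\<rho> \<le> \<rho>\<^sup>2" "1 \<le> \<rho>\<^sup>2" using assms mult_mono[of 1 \<rho> 1 \<rho>] by (auto simp: power2_eq_square)
  have "norm (bose_quot w) \<le> norm (bose w / w) + norm (1 / w\<^sup>2) + norm (bose w / 2)"
    unfolding bose_quot_def by (intro order.trans[OF norm_triangle_ineq] add_mono norm_triangle_ineq4) simp
  also have "\<dots> \<le> \<rho> / norm w / norm w + 1 / (norm w)\<^sup>2 + 2 * \<rho>\<^sup>2 / (norm w)\<^sup>2 / 2"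
    unfolding norm_divide using norm_bose_cone[OF assms(1,2)] w
    by (intro add_mono divide_right_mono) (auto simp: norm_power mult.commute[of 2])
  also have "\<dots> = (\<rho> + 1 + \<rho>\<^sup>2) * (1 / norm w)\<^sup>2" using w by (simp add: field_simps power2_eq_square)
  also have "\<dots> \<le> (14 * \<rho>\<^sup>2) * (1 / norm w)\<^sup>2" using \<rho> by (intro mult_right_mono) auto
  finally show "norm (bose_quot w) \<le> 14 * \<rho>\<^sup>2 * (1 / norm w)\<^sup>2" .
  \<comment> \<open>In this form the poles at 0 have cancelled, and \<open>bose_rem w / w\<close> is
    bounded because \<open>bose_rem\<close> is of order \<open>w\<close>.\<close>
  have "bose_quot w = bose_rem w / w + (bose_rem w - 1 / 2) / 2"
    using w by (simp add: bose_quot_def bose_rem_def field_simps power2_eq_square)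
  also have "norm \<dots> \<le> norm (bose_rem w) / norm w + norm (bose_rem w) / 2 + 1 / 4"
    using norm_triangle_ineq[of "bose_rem w / w" "(bose_rem w - 1 / 2) / 2"] norm_triangle_ineq4[of "bose_rem w" "1 / 2"]
    by (simp add: norm_divide)
  also have "\<dots> \<le> 9 * \<rho> + 9 * \<rho> / 2 + 1 / 4"
    using norm_bose_rem_cone[OF assms] w by (intro add_mono) (auto simp: field_simps)
  also have "\<dots> \<le> 14 * \<rho>" using assms by simp
  also have "\<dots> \<le> 14 * \<rho>\<^sup>2" using \<rho> by simp
  finally show "norm (bose_quot w) \<le> 14 * \<rho>\<^sup>2" .
qed

text \<open>The minimum of \<open>B\<close> and \<open>B / y\<^sup>2\<close> lies below both power
  laws that \<open>ray_rotation\<close> demands.\<close>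

lemma bound_sqrt_of_bound_square:
  fixes y v B :: real
  assumes "y > 0" "v \<le> B" "v \<le> B / y\<^sup>2" "B \<ge> 0"
  shows "v \<le> B / sqrt y" "v \<le> B / (y * sqrt y)"
proof -
  have "v \<le> B / sqrt y \<and> v \<le> B / (y * sqrt y)"
  proof (cases "y \<le> 1")
    case True
    have "B / 1 \<le> B / sqrt y" "B / 1 \<le> B / (y * sqrt y)"
      using True assms by (intro frac_le; simp add: mult_le_one)+
    thus ?thesis using assms by auto
  next
    case False
    hence s: "1 \<le> sqrt y" "sqrt y * sqrt y = y" by auto
    have "sqrt y \<le> sqrt y * sqrt y" using s(1) mult_left_mono[of 1 "sqrt y" "sqrt y"] by simp
    hence sy: "sqrt y \<le> y" using s by simp
    have yy: "y * 1 \<le> y * y" "y * sqrt y \<le> y * y" using False sy by (intro mult_left_mono; simp)+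
    hence "sqrt y \<le> y * y" using sy by linarith
    hence "B / y\<^sup>2 \<le> B / sqrt y" "B / y\<^sup>2 \<le> B / (y * sqrt y)"
      using False assms yy by (intro frac_le; simp add: power2_eq_square)+
    thus ?thesis using assms by auto
  qed
  thus "v \<le> B / sqrt y" "v \<le> B / (y * sqrt y)" by auto
qed

lemma set_integrable_Ioi_bound_square:
  fixes f :: "real \<Rightarrow> complex"
  assumes cont: "continuous_on {0<..} f"
    and b: "\<And>x. x > 0 \<Longrightarrow> norm (f x) \<le> B" "\<And>x. x > 0 \<Longrightarrow> norm (f x) \<le> B / x\<^sup>2"
  shows "set_integrable lborel {0<..} f"
proof -
  have "B \<ge> 0" using b(1)[of 1] by (smt (verit) norm_ge_zero)
  with b show ?thesis
    by (intro set_integrable_Ioi_bound[OF cont, of B] bound_sqrt_of_bound_square) auto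
qed

section \<open>The product of two kernels as a sum of separately integrable pieces\<close>

lemma bose_mult:
  assumes "exp w \<noteq> 1" "exp v \<noteq> 1" "exp (w + v) \<noteq> 1"
  shows "bose w * bose v = bose (w + v) * (1 + bose w + bose v)"
proof -
  have "exp w - 1 \<noteq> 0" "exp v - 1 \<noteq> 0" "exp w * exp v - 1 \<noteq> 0" using assms by (auto simp: exp_add)
  thus ?thesis unfolding bose_def exp_add by (simp add: field_simps)
qed

text \<open>Here \<open>p\<close>, \<open>q\<close>, \<open>S\<close> stand for \<open>bose\<close>
  at x c, x k, x (c + k), and \<open>X\<close> for 1/x. Each piece is arranged to be integrable on
  its own: a product with \<open>bose_rem\<close>, a multiple of \<open>bose_quot\<close>, and a
  difference \<open>S - p * (c * t)\<close> of Frullani type, in which the poles at 0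
  cancel.\<close>

lemma bose_decomposition_identity:
  fixes p q S X c k t :: complex
  assumes "c * k = 1" "t * (c + k) = 1" "p * q = S * (1 + p + q)"
  shows "(p - X * k) * (q - X * c) =
     (p * (S - X * t + 1 / 2) - c ^ 3 * t * (p * (X * k) - (X * k)\<^sup>2 + p / 2) + (k\<^sup>2 + 1 - c\<^sup>2) / 2 * (S - p * (c * t)))
   + (q * (S - X * t + 1 / 2) - k ^ 3 * t * (q * (X * c) - (X * c)\<^sup>2 + q / 2) + (c\<^sup>2 + 1 - k\<^sup>2) / 2 * (S - q * (k * t)))"
    (is "_ = ?R")
proof -
  \<comment> \<open>The coefficients are determined by comparison: \<open>A\<close> matches the term
    in \<open>X\<^sup>2\<close>, \<open>B\<close> the terms in \<open>p * X\<close> and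
    \<open>q * X\<close>, and \<open>C\<close> makes the leftover multiples of \<open>p / 2\<close>
    and \<open>q / 2\<close> vanish.\<close>
  have A: "c ^ 3 * t * k\<^sup>2 + k ^ 3 * t * c\<^sup>2 = 1" using assms(1,2) by algebra
  have B: "t + c ^ 3 * t * k = c" "t + k ^ 3 * t * c = k" using assms(1,2) by algebra+
  have C: "c ^ 3 * t + (k\<^sup>2 + 1 - c\<^sup>2) * (c * t) = 1" "k ^ 3 * t + (c\<^sup>2 + 1 - k\<^sup>2) * (k * t) = 1"
    using assms(1,2) by algebra+
  have *: "r * (S - X * t + 1 / 2) - A * (r * (X * m) - (X * m)\<^sup>2 + r / 2) + K / 2 * (S - r * u)
     = r * S + K / 2 * S + X\<^sup>2 * (A * m\<^sup>2) - r * X * (t + A * m) + r / 2 * (1 - (A + K * u))" for r A m K u :: complex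
    by (simp add: field_simps power2_eq_square)
  have "?R = (p * S + q * S + ((k\<^sup>2 + 1 - c\<^sup>2) / 2 + (c\<^sup>2 + 1 - k\<^sup>2) / 2) * S) + X\<^sup>2 * (c ^ 3 * t * k\<^sup>2 + k ^ 3 * t * c\<^sup>2)
      - p * X * (t + c ^ 3 * t * k) - q * X * (t + k ^ 3 * t * c)
     + p / 2 * (1 - (c ^ 3 * t + (k\<^sup>2 + 1 - c\<^sup>2) * (c * t))) + q / 2 * (1 - (k ^ 3 * t + (c\<^sup>2 + 1 - k\<^sup>2) * (k * t)))"
    unfolding * distrib_right[of _ _ S] distrib_left[of "X\<^sup>2"] by simp
  also have "(k\<^sup>2 + 1 - c\<^sup>2) / 2 + (c\<^sup>2 + 1 - k\<^sup>2) / 2 = 1" by (simp add: field_simps)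
  also have "p * S + q * S + 1 * S = p * q" unfolding assms(3) by (simp add: algebra_simps)
  also have "p * q + X\<^sup>2 * (c ^ 3 * t * k\<^sup>2 + k ^ 3 * t * c\<^sup>2)
      - p * X * (t + c ^ 3 * t * k) - q * X * (t + k ^ 3 * t * c)
     + p / 2 * (1 - (c ^ 3 * t + (k\<^sup>2 + 1 - c\<^sup>2) * (c * t))) + q / 2 * (1 - (k ^ 3 * t + (c\<^sup>2 + 1 - k\<^sup>2) * (k * t)))
     = p * q + X\<^sup>2 - p * X * c - q * X * k" unfolding A B C by simp
  also have "\<dots> = p * q + X\<^sup>2 * (c * k) - p * X * c - q * X * k" unfolding assms(1) by simp
  also have "\<dots> = (p - X * k) * (q - X * c)" by (simp add: algebra_simps power2_eq_square)
  finally show ?thesis by simp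
qed

lemma bose_cut_mult:
  fixes c x :: complex
  assumes c: "c \<noteq> 0" "c + 1 / c \<noteq> 0" "x \<noteq> 0"
    and e: "exp (x * c) \<noteq> 1" "exp (x / c) \<noteq> 1" "exp (x * (c + 1 / c)) \<noteq> 1"
  defines "t \<equiv> 1 / (c + 1 / c)"
  shows "bose_cut (x * c) * bose_cut (x / c) =
     (bose (x * c) * bose_rem (x * (c + 1 / c)) - c ^ 3 * t * bose_quot (x * c)
        + ((1 / c)\<^sup>2 + 1 - c\<^sup>2) / 2 * (bose (x * (c + 1 / c)) - bose (x * c) * (c * t)))
   + (bose (x / c) * bose_rem (x * (c + 1 / c)) - (1 / c) ^ 3 * t * bose_quot (x / c)
        + (c\<^sup>2 + 1 - (1 / c)\<^sup>2) / 2 * (bose (x * (c + 1 / c)) - bose (x / c) * (1 / c * t)))"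
proof -
  have 1: "x * c + x / c = x * (c + 1 / c)" by (simp add: algebra_simps)
  have "bose (x * c) * bose (x / c) = bose (x * (c + 1 / c)) * (1 + bose (x * c) + bose (x / c))"
    using bose_mult[of "x * c" "x / c"] e unfolding 1 by simp
  hence m: "bose (x * c) * bose (x / c) = bose (x * (c + 1 / c)) * (1 + bose (x * c) + bose (x / c))" .
  have e1: "bose_cut (x * c) = bose (x * c) - 1 / x * (1 / c)" "bose_cut (x / c) = bose (x / c) - 1 / x * c"
    by (simp_all add: bose_cut_def)
  have e2: "bose_rem (x * (c + 1 / c)) = bose (x * (c + 1 / c)) - 1 / x * t + 1 / 2"
    unfolding bose_rem_def t_def by simp
  have e3: "bose_quot (x * c) = bose (x * c) * (1 / x * (1 / c)) - (1 / x * (1 / c))\<^sup>2 + bose (x * c) / 2"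
     "bose_quot (x / c) = bose (x / c) * (1 / x * c) - (1 / x * c)\<^sup>2 + bose (x / c) / 2"
    by (simp_all add: bose_quot_def power_divide power_mult_distrib)
  have h: "c * (1 / c) = 1" "t * (c + 1 / c) = 1" using c by (simp_all add: t_def)
  show ?thesis unfolding e1 e2 e3 by (rule bose_decomposition_identity[OF h m])
qed

text \<open>A primitive of m B(x m) is Ln (1 - exp (-x m)), which behaves like ln x + Ln m at 0 and
  tends to 0 at infinity. In the difference for \<open>k\<close> and \<open>l\<close> the term ln x
  drops out.\<close>

lemma frullani_bose:
  assumes k: "Re k > 0" and l: "Re l > 0"
  shows "set_integrable lborel {0<..} (\<lambda>x. k * bose (of_real x * k) - l * bose (of_real x * l))"
    and "(LINT x:{0<..}|lborel. k * bose (of_real x * k) - l * bose (of_real x * l)) = Ln l - Ln k"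
proof -
  define f where "f = (\<lambda>x::real. k * bose (of_real x * k) - l * bose (of_real x * l))"
  have hol: "bose holomorphic_on {w. Re w > 0}" by (rule bose_holomorphic) auto
  note contb = holomorphic_on_imp_continuous_on[OF hol]
  have cont: "continuous_on {0<..} f" unfolding f_def
    using k l by (intro continuous_intros continuous_on_compose2[OF contb]) auto
  define rk where "rk = max 1 (norm k / Re k)"
  define rl where "rl = max 1 (norm l / Re l)"
  have rk: "norm (of_real x * k) \<le> rk * Re (of_real x * k)" "Re (of_real x * k) > 0" "rk \<ge> 1"
    and rl: "norm (of_real x * l) \<le> rl * Re (of_real x * l)" "Re (of_real x * l) > 0" "rl \<ge> 1" if "x > 0" for x
  proof -
    have "norm k = norm k / Re k * Re k" "norm l = norm l / Re l * Re l" using k l by auto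
    moreover have "norm k / Re k * Re k \<le> rk * Re k" "norm l / Re l * Re l \<le> rl * Re l"
      using k l unfolding rk_def rl_def by (intro mult_right_mono; simp)+
    ultimately have "norm k \<le> rk * Re k" "norm l \<le> rl * Re l" by linarith+
    hence "x * norm k \<le> x * (rk * Re k)" "x * norm l \<le> x * (rl * Re l)" using that by (auto intro!: mult_left_mono)
    thus "norm (of_real x * k) \<le> rk * Re (of_real x * k)" "norm (of_real x * l) \<le> rl * Re (of_real x * l)"
      using that by (auto simp: norm_mult mult_ac)
    show "Re (of_real x * k) > 0" "Re (of_real x * l) > 0" using that k l by auto
  qed (auto simp: rk_def rl_def)
  define B where "B = norm k * (9 * rk + 1 / 2) + norm l * (9 * rl + 1 / 2) + norm k * (2 * rk\<^sup>2 / (norm k)\<^sup>2) + norm l * (2 * rl\<^sup>2 / (norm l)\<^sup>2)"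
  have r1: "rk \<ge> 1" "rl \<ge> 1" by (auto simp: rk_def rl_def)
  have nz: "k \<noteq> 0" "l \<noteq> 0" using k l by auto
  have b1: "norm (f x) \<le> B" if x: "x > 0" for x
  proof -
    \<comment> \<open>Both terms have the same pole 1/x at 0, so the difference is bounded
      there.\<close>
    have "f x = k * (bose_rem (of_real x * k) - 1 / 2) - l * (bose_rem (of_real x * l) - 1 / 2)"
      using x nz by (simp add: f_def bose_rem_def field_simps)
    also have "norm \<dots> \<le> norm k * (9 * rk + 1 / 2) + norm l * (9 * rl + 1 / 2)"
    proof (rule order.trans[OF norm_triangle_ineq4], unfold norm_mult, intro add_mono mult_left_mono)
      show "norm (bose_rem (of_real x * k) - 1 / 2) \<le> 9 * rk + 1 / 2"
        using norm_bose_rem_cone(2)[OF rk(2,1,3)[OF x]] norm_triangle_ineq4[of "bose_rem (of_real x * k)" "1 / 2"] by simp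
      show "norm (bose_rem (of_real x * l) - 1 / 2) \<le> 9 * rl + 1 / 2"
        using norm_bose_rem_cone(2)[OF rl(2,1,3)[OF x]] norm_triangle_ineq4[of "bose_rem (of_real x * l)" "1 / 2"] by simp
    qed auto
    also have "\<dots> \<le> B" unfolding B_def by simp
    finally show ?thesis .
  qed
  have b2: "norm (f x) \<le> B / x\<^sup>2" if x: "x > 0" for x
  proof -
    have "norm (f x) \<le> norm k * (2 * rk\<^sup>2 / (norm (of_real x * k))\<^sup>2) + norm l * (2 * rl\<^sup>2 / (norm (of_real x * l))\<^sup>2)"
      unfolding f_def
    proof (rule order.trans[OF norm_triangle_ineq4], unfold norm_mult[of k] norm_mult[of l], intro add_mono mult_left_mono)
      show "norm (bose (of_real x * k)) \<le> 2 * rk\<^sup>2 / (norm (of_real x * k))\<^sup>2" by (rule norm_bose_cone(2)[OF rk(2,1)[OF x]])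
      show "norm (bose (of_real x * l)) \<le> 2 * rl\<^sup>2 / (norm (of_real x * l))\<^sup>2" by (rule norm_bose_cone(2)[OF rl(2,1)[OF x]])
    qed auto
    also have "\<dots> = (norm k * (2 * rk\<^sup>2 / (norm k)\<^sup>2) + norm l * (2 * rl\<^sup>2 / (norm l)\<^sup>2)) / x\<^sup>2"
      using x nz by (simp add: norm_mult power_mult_distrib add_divide_distrib mult.commute[of "x\<^sup>2"])
    also have "\<dots> \<le> B / x\<^sup>2" unfolding B_def using r1 by (intro divide_right_mono) auto
    finally show ?thesis .
  qed
  show int: "set_integrable lborel {0<..} f"
    by (rule set_integrable_Ioi_bound_square[OF cont, of B]) (use b1 b2 in auto)
  define L where "L = (\<lambda>k x. Ln (1 - exp (- (of_real x * k :: complex))))"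
  \<comment> \<open>The argument of \<open>Ln\<close> stays in the right half-plane along the whole
    ray, so the principal branch may be differentiated.\<close>
  have pos: "Re (1 - exp (- (of_real x * m))) > 0" if "x > 0" "Re m > 0" for x m
  proof -
    have "Re (exp (- (of_real x * m))) \<le> norm (exp (- (of_real x * m)))" by (rule complex_Re_le_cmod)
    also have "\<dots> < 1" using that by (simp add: norm_exp_eq_Re)
    finally show ?thesis by simp
  qed
  have derL: "((\<lambda>x::real. L m x) has_vector_derivative m * bose (of_real x * m)) (at x)" if "x > 0" "Re m > 0" for x m
  proof -
    have nn: "1 - exp (- (of_real x * m)) \<notin> \<real>\<^sub>\<le>\<^sub>0" using pos[OF that] by (auto simp: complex_nonpos_Reals_iff)
    define E where "E = exp (of_real x * m)"
    have E: "E \<noteq> 0" "E \<noteq> 1" unfolding E_def using that exp_neq_1_Re_pos[of "of_real x * m"] by simp_all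
    have "((\<lambda>z. Ln (1 - exp (- (z * m)))) has_field_derivative inverse (1 - exp (- (of_real x * m))) * (exp (- (of_real x * m)) * m)) (at (of_real x))"
      using nn by (auto intro!: derivative_eq_intros)
    also have "exp (- (of_real x * m)) = inverse E" by (simp add: exp_minus E_def)
    also have "1 - inverse E = (E - 1) / E" using E by (simp add: field_simps)
    also have "inverse ((E - 1) / E) * (inverse E * m) = m * bose (of_real x * m)"
    proof -
      define F where "F = E - 1"
      have "F \<noteq> 0" using E by (simp add: F_def)
      hence "inverse (F / E) * (inverse E * m) = m * (1 / F)" using E(1) by (simp add: field_simps)
      thus ?thesis unfolding bose_def F_def E_def .
    qed
    finally have "((\<lambda>z. Ln (1 - exp (- (z * m)))) has_field_derivative m * bose (of_real x * m)) (at (of_real x))" .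
    hence "((\<lambda>x::real. Ln (1 - exp (- (of_real x * m)))) has_vector_derivative m * bose (of_real x * m)) (at x)"
      by (rule has_vector_derivative_real_field[where f = "\<lambda>z. Ln (1 - exp (- (z * m)))"])
    thus ?thesis unfolding L_def .
  qed
  have lim0: "((\<lambda>x::real. L m x - of_real (ln x)) \<longlongrightarrow> Ln m) (at_right 0)" if m: "Re m > 0" for m
  proof -
    have nz: "m \<noteq> 0" "m \<notin> \<real>\<^sub>\<le>\<^sub>0" using m by (auto simp: complex_nonpos_Reals_iff)
    have "((\<lambda>z. 1 - exp (- (z * m))) has_field_derivative m) (at 0)"
      by (auto intro!: derivative_eq_intros)
    hence "((\<lambda>z. (1 - exp (- (z * m))) / z) \<longlongrightarrow> m) (at 0)"
      by (simp add: has_field_derivative_iff)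
    moreover have "filterlim (\<lambda>x::real. complex_of_real x) (at 0) (at_right 0)"
      by (rule filterlim_atI) (auto intro!: tendsto_eq_intros eventually_mono[OF eventually_at_right_less])
    ultimately have "((\<lambda>x::real. (1 - exp (- (of_real x * m))) / of_real x) \<longlongrightarrow> m) (at_right 0)"
      by (rule filterlim_compose)
    hence "((\<lambda>x::real. Ln ((1 - exp (- (of_real x * m))) / of_real x)) \<longlongrightarrow> Ln m) (at_right 0)"
      using nz by (intro tendsto_Ln)
    moreover have "\<forall>\<^sub>F x::real in at_right 0. Ln ((1 - exp (- (of_real x * m))) / of_real x) = L m x - of_real (ln x)"
    proof (rule eventually_mono[OF eventually_at_right_less])
      fix x :: real assume x: "0 < x"
      have "1 - exp (- (of_real x * m)) \<noteq> 0" using pos[OF x m] by auto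
      thus "Ln ((1 - exp (- (of_real x * m))) / of_real x) = L m x - of_real (ln x)"
        using x Ln_times_of_real[of x "(1 - exp (- (of_real x * m))) / of_real x"] by (simp add: L_def Ln_of_real)
    qed
    ultimately show ?thesis by (rule Lim_transform_eventually)
  qed
  have liminf: "((\<lambda>x::real. L m x) \<longlongrightarrow> 0) at_top" if m: "Re m > 0" for m
  proof -
    have "((\<lambda>x::real. exp (- (of_real x * m))) \<longlongrightarrow> 0) at_top"
    proof (rule tendsto_norm_zero_cancel)
      show "((\<lambda>x::real. norm (exp (- (of_real x * m)))) \<longlongrightarrow> 0) at_top"
        using m unfolding norm_exp_eq_Re by simp real_asymp
    qed
    hence "((\<lambda>x::real. Ln (1 - exp (- (of_real x * m)))) \<longlongrightarrow> Ln (1 - 0)) at_top"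
      by (intro tendsto_intros) auto
    thus ?thesis by (simp add: L_def)
  qed
  have "(LINT x:{0<..}|lborel. f x) = (0 - 0) - (Ln k - Ln l)"
  proof (rule set_lebesgue_integral_FTC_Ioi[OF _ cont int, where F = "\<lambda>x. L k x - L l x"])
    show "((\<lambda>x. L k x - L l x) has_vector_derivative f x) (at x)" if "x > 0" for x
      unfolding f_def using that k l by (intro has_vector_derivative_diff derL)
    have "((\<lambda>x. (L k x - of_real (ln x)) - (L l x - of_real (ln x))) \<longlongrightarrow> Ln k - Ln l) (at_right 0)"
      by (intro tendsto_diff lim0 k l)
    thus "((\<lambda>x. L k x - L l x) \<longlongrightarrow> Ln k - Ln l) (at_right 0)" by simp
    show "((\<lambda>x. L k x - L l x) \<longlongrightarrow> 0 - 0) at_top" by (intro tendsto_diff liminf k l)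
  qed
  thus "(LINT x:{0<..}|lborel. f x) = Ln l - Ln k" by simp
qed

section \<open>Mellin transforms and the continuation of zeta\<close>

definition mellin_kernel :: "complex \<Rightarrow> real \<Rightarrow> complex" where
  "mellin_kernel s x = exp ((s - 1) * of_real (ln x))"

lemma norm_mellin_kernel: "x > 0 \<Longrightarrow> norm (mellin_kernel s x) = x powr (Re s - 1)"
  by (simp add: mellin_kernel_def norm_exp_eq_Re powr_def)

lemma mellin_kernel_continuous: "continuous_on {0<..} (mellin_kernel s)"
  unfolding mellin_kernel_def by (intro continuous_intros) auto

lemma mellin_kernel_measurable [measurable]: "mellin_kernel s \<in> borel_measurable borel"
  unfolding mellin_kernel_def[abs_def] by measurable

lemma mellin_kernel_powr: "x > 0 \<Longrightarrow> of_real x powr (s - 1) = mellin_kernel s x"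
  by (simp add: mellin_kernel_def powr_def Ln_of_real)

lemma mellin_kernel_mult: "x > 0 \<Longrightarrow> y > 0 \<Longrightarrow> mellin_kernel s (x * y) = mellin_kernel s x * mellin_kernel s y"
  by (simp add: mellin_kernel_def ln_mult ring_distribs exp_add)

lemma mellin_kernel_times_power: "x > 0 \<Longrightarrow> mellin_kernel s x * of_real x ^ n = mellin_kernel (s + of_nat n) x"
proof -
  assume x: "x > 0"
  have "complex_of_real x ^ n = exp (of_nat n * of_real (ln x))"
    using x by (simp add: exp_of_nat_mult exp_of_real)
  thus ?thesis by (simp add: mellin_kernel_def exp_add[symmetric] algebra_simps)
qed

lemma mellin_kernel_divide: "x > 0 \<Longrightarrow> mellin_kernel s x / of_real x = mellin_kernel (s - 1) x"
proof -
  assume x: "x > 0"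
  have "mellin_kernel (s - 1) x * of_real x ^ 1 = mellin_kernel (s - 1 + of_nat 1) x"
    by (rule mellin_kernel_times_power[OF x])
  thus ?thesis using x by (simp add: field_simps)
qed

lemma mellin_kernel_antideriv:
  assumes "x > 0" "w \<noteq> 0"
  shows "((\<lambda>x. exp (w * of_real (ln x)) / w) has_vector_derivative mellin_kernel w x) (at x)"
proof -
  have "((\<lambda>x. w * of_real (ln x)) has_vector_derivative w * of_real (1 / x)) (at x)"
    using assms by (intro has_vector_derivative_mult_right has_vector_derivative_of_real)
      (auto intro!: derivative_eq_intros simp flip: has_real_derivative_iff_has_vector_derivative)
  moreover have "((\<lambda>z. exp z / w) has_field_derivative exp (w * of_real (ln x)) / w) (at (w * of_real (ln x)))"
    using assms by (auto intro!: derivative_eq_intros)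
  ultimately have "((\<lambda>z. exp z / w) \<circ> (\<lambda>x. w * of_real (ln x)) has_vector_derivative
      w * of_real (1 / x) * (exp (w * of_real (ln x)) / w)) (at x)"
    by (rule field_vector_diff_chain_at)
  moreover have "w * of_real (1 / x) * (exp (w * of_real (ln x)) / w) = mellin_kernel w x"
  proof -
    have "exp (w * of_real (ln x)) = mellin_kernel (w + 1) x" by (simp add: mellin_kernel_def)
    also have "\<dots> = mellin_kernel w x * of_real x" using mellin_kernel_times_power[OF assms(1), of w 1] by simp
    finally show ?thesis using assms by simp
  qed
  ultimately show ?thesis by (simp add: o_def)
qed

lemma mellin_kernel_integral_01:
  assumes w: "Re w > 0"
  shows "set_integrable lborel {0<..<1} (mellin_kernel w)" "(LINT x:{0<..<1}|lborel. mellin_kernel w x) = 1 / w"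
    "(LINT x:{0<..<1}|lborel. norm (mellin_kernel w x)) = 1 / Re w"
proof -
  have w0: "w \<noteq> 0" using w by auto
  define r where "r = Re w"
  have r: "r > 0" using w by (simp add: r_def)
  have ein: "einterval (ereal 0) (ereal 1) = {0<..<1}" by (simp add: einterval_eq)
  have nl: "((\<lambda>x. x powr r / r) \<longlongrightarrow> 0) (at_right 0)" using r by real_asymp
  have nr: "((\<lambda>x::real. x powr r / r) \<longlongrightarrow> 1 powr r / r) (at_left 1)"
    by (intro tendsto_intros) (use r in auto)
  have F: "DERIV (\<lambda>x. x powr r / r) x :> x powr (r - 1)" if "x > 0" for x
    using r that by (auto intro!: derivative_eq_intros simp: powr_diff)
  \<comment> \<open>The modulus is a real power, so the fundamental theorem for nonnegative
    functions gives integrability first; the complex primitive then gives the value.\<close>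
  have I: "set_integrable lborel (einterval (ereal 0) (ereal 1)) (\<lambda>x. x powr (r - 1))"
    "(LBINT x=ereal 0..ereal 1. x powr (r - 1)) = 1 powr r / r - 0"
    by (rule interval_integral_FTC_nonneg[where F = "\<lambda>x. x powr r / r"];
        (use F nl nr in \<open>auto intro!: continuous_intros simp: ereal_tendsto_simps\<close>))+
  have I1: "set_integrable lborel {0<..<1} (\<lambda>x. x powr (r - 1))" using I(1) unfolding ein .
  show int: "set_integrable lborel {0<..<1} (mellin_kernel w)"
    by (rule set_integrable_bound[OF I1])
       (auto simp: set_borel_measurable_def norm_mellin_kernel r_def intro!: AE_I2)
  have "(LINT x:{0<..<1}|lborel. norm (mellin_kernel w x)) = (LINT x:{0<..<1}|lborel. x powr (r - 1))"
    by (intro set_lebesgue_integral_cong) (auto simp: norm_mellin_kernel r_def)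
  also have "\<dots> = 1 / r" using I(2) by (simp add: interval_lebesgue_integral_def ein)
  finally show "(LINT x:{0<..<1}|lborel. norm (mellin_kernel w x)) = 1 / Re w" by (simp add: r_def)
  have "(LBINT x=ereal 0..ereal 1. mellin_kernel w x) = exp (w * of_real (ln 1)) / w - 0"
  proof (rule interval_integral_FTC_integrable)
    show "((\<lambda>x. exp (w * of_real (ln x)) / w) has_vector_derivative mellin_kernel w x) (at x)"
      if "ereal 0 < ereal x" for x using that w0 by (intro mellin_kernel_antideriv) auto
    show "isCont (mellin_kernel w) x" if "ereal 0 < ereal x" for x
      using that mellin_kernel_continuous[of w] by (simp add: continuous_on_eq_continuous_at)
    show "set_integrable lborel (einterval (ereal 0) (ereal 1)) (mellin_kernel w)" using int unfolding ein .
    have "((\<lambda>x. exp (w * of_real (ln x)) / w) \<longlongrightarrow> 0) (at_right 0)"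
    proof (rule tendsto_norm_zero_cancel, rule Lim_transform_eventually)
      show "((\<lambda>x. x powr r / norm w) \<longlongrightarrow> 0) (at_right 0)" using r w0 by real_asymp
      show "\<forall>\<^sub>F x in at_right 0. x powr r / norm w = norm (exp (w * of_real (ln x)) / w)"
        by (rule eventually_mono[OF eventually_at_right_less]) (simp add: norm_divide norm_exp_eq_Re powr_def r_def)
    qed
    thus "(((\<lambda>x. exp (w * of_real (ln x)) / w) \<circ> real_of_ereal) \<longlongrightarrow> 0) (at_right (ereal 0))"
      by (subst ereal_tendsto_simps)
    have "((\<lambda>x. exp (w * of_real (ln x)) / w) \<longlongrightarrow> exp (w * of_real (ln 1)) / w) (at_left 1)"
      by (intro tendsto_intros) (use w0 in auto)
    thus "(((\<lambda>x. exp (w * of_real (ln x)) / w) \<circ> real_of_ereal) \<longlongrightarrow> exp (w * of_real (ln 1)) / w) (at_left (ereal 1))"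
      by (subst ereal_tendsto_simps)
  qed auto
  thus "(LINT x:{0<..<1}|lborel. mellin_kernel w x) = 1 / w" by (simp add: interval_lebesgue_integral_def ein)
qed

lemma mellin_kernel_integral_1inf:
  assumes w: "Re w < 0"
  shows "set_integrable lborel {1<..} (mellin_kernel w)" "(LINT x:{1<..}|lborel. mellin_kernel w x) = - 1 / w"
proof -
  have w0: "w \<noteq> 0" using w by auto
  define r where "r = Re w"
  have r: "r < 0" using w by (simp add: r_def)
  have ein: "einterval (ereal 1) \<infinity> = {1<..}" by (simp add: einterval_eq)
  have nl: "((\<lambda>x. x powr r / r) \<longlongrightarrow> 0) at_top" using r by real_asymp
  have nr: "((\<lambda>x::real. x powr r / r) \<longlongrightarrow> 1 powr r / r) (at_right 1)"
    by (intro tendsto_intros) (use r in auto)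
  have F: "DERIV (\<lambda>x. x powr r / r) x :> x powr (r - 1)" if "x > 1" for x
    using r that by (auto intro!: derivative_eq_intros simp: powr_diff)
  have I: "set_integrable lborel (einterval (ereal 1) \<infinity>) (\<lambda>x. x powr (r - 1))"
    by (rule interval_integral_FTC_nonneg[where F = "\<lambda>x. x powr r / r"];
        (use F nl nr in \<open>auto intro!: continuous_intros simp: ereal_tendsto_simps\<close>))
  have I1: "set_integrable lborel {1<..} (\<lambda>x. x powr (r - 1))" using I(1) unfolding ein .
  show int: "set_integrable lborel {1<..} (mellin_kernel w)"
    by (rule set_integrable_bound[OF I1])
       (auto simp: set_borel_measurable_def norm_mellin_kernel r_def intro!: AE_I2)
  have "(LBINT x=ereal 1..\<infinity>. mellin_kernel w x) = 0 - exp (w * of_real (ln 1)) / w"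
  proof (rule interval_integral_FTC_integrable)
    show "((\<lambda>x. exp (w * of_real (ln x)) / w) has_vector_derivative mellin_kernel w x) (at x)"
      if "ereal 1 < ereal x" for x using that w0 by (intro mellin_kernel_antideriv) auto
    show "isCont (mellin_kernel w) x" if "ereal 1 < ereal x" for x
      using that mellin_kernel_continuous[of w] by (simp add: continuous_on_eq_continuous_at)
    show "set_integrable lborel (einterval (ereal 1) \<infinity>) (mellin_kernel w)" using int unfolding ein .
    have "((\<lambda>x. exp (w * of_real (ln x)) / w) \<longlongrightarrow> 0) at_top"
    proof (rule tendsto_norm_zero_cancel, rule Lim_transform_eventually)
      show "((\<lambda>x. x powr r / norm w) \<longlongrightarrow> 0) at_top" using r w0 by real_asymp
      show "\<forall>\<^sub>F x in at_top. x powr r / norm w = norm (exp (w * of_real (ln x)) / w)"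
        by (rule eventually_mono[OF eventually_gt_at_top[of 0]]) (simp add: norm_divide norm_exp_eq_Re powr_def r_def)
    qed
    thus "(((\<lambda>x. exp (w * of_real (ln x)) / w) \<circ> real_of_ereal) \<longlongrightarrow> 0) (at_left \<infinity>)"
      by (subst ereal_tendsto_simps)
    have "((\<lambda>x. exp (w * of_real (ln x)) / w) \<longlongrightarrow> exp (w * of_real (ln 1)) / w) (at_right 1)"
      by (intro tendsto_intros) (use w0 in auto)
    thus "(((\<lambda>x. exp (w * of_real (ln x)) / w) \<circ> real_of_ereal) \<longlongrightarrow> exp (w * of_real (ln 1)) / w) (at_right (ereal 1))"
      by (subst ereal_tendsto_simps)
  qed auto
  thus "(LINT x:{1<..}|lborel. mellin_kernel w x) = - 1 / w" by (simp add: interval_lebesgue_integral_def ein)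
qed

lemma set_integral_split_01:
  fixes f :: "real \<Rightarrow> complex"
  assumes a: "set_integrable lborel {0<..<1} f" and b: "set_integrable lborel {1<..} f"
  shows "set_integrable lborel {0<..} f"
    "(LINT x:{0<..}|lborel. f x) = (LINT x:{0<..<1}|lborel. f x) + (LINT x:{1<..}|lborel. f x)"
proof -
  have c: "integrable lborel (\<lambda>x. indicator {1::real} x *\<^sub>R f 1)"
    by (intro integrable_scaleR_left integrable_real_indicator) auto
  have eq: "(\<lambda>x. indicator {0<..} x *\<^sub>R f x) = (\<lambda>x. indicator {0<..<1} x *\<^sub>R f x + indicator {1<..} x *\<^sub>R f x + indicator {1} x *\<^sub>R f 1)"
    by (auto simp: indicator_def fun_eq_iff)
  show "set_integrable lborel {0<..} f"
    using a b c unfolding set_integrable_def eq by (intro Bochner_Integration.integrable_add)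
  have "(LINT x|lborel. indicator {1::real} x *\<^sub>R f 1) = 0" by simp
  thus "(LINT x:{0<..}|lborel. f x) = (LINT x:{0<..<1}|lborel. f x) + (LINT x:{1<..}|lborel. f x)"
    using a b c unfolding set_lebesgue_integral_def set_integrable_def eq by simp
qed

lemma set_integral_Ioi_scale:
  fixes f :: "real \<Rightarrow> 'a :: {banach, second_countable_topology}"
  assumes f: "set_integrable lborel {0<..} f" and c: "c > 0"
  shows "set_integrable lborel {0<..} (\<lambda>x. f (c * x))"
    "(LINT x:{0<..}|lborel. f (c * x)) = (1 / c) *\<^sub>R (LINT x:{0<..}|lborel. f x)"
proof -
  have eq: "(\<lambda>x. indicator {0<..} (0 + c * x) *\<^sub>R f (0 + c * x)) = (\<lambda>x. indicator {0<..} x *\<^sub>R f (c * x))"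
    using c by (auto simp: indicator_def fun_eq_iff zero_less_mult_iff)
  show "set_integrable lborel {0<..} (\<lambda>x. f (c * x))"
    using lborel_integrable_real_affine[of "\<lambda>x. indicator {0<..} x *\<^sub>R f x" c 0] f c
    unfolding set_integrable_def eq by simp
  have "(LINT x:{0<..}|lborel. f x) = c *\<^sub>R (LINT x:{0<..}|lborel. f (c * x))"
    using lborel_integral_real_affine[of c "\<lambda>x. indicator {0<..} x *\<^sub>R f x" 0] c
    unfolding set_lebesgue_integral_def eq by simp
  thus "(LINT x:{0<..}|lborel. f (c * x)) = (1 / c) *\<^sub>R (LINT x:{0<..}|lborel. f x)" using c by simp
qed

section \<open>The Mellin transform of the Bose kernel, split at 1\<close>

lemma bose_cut_power_series:
  "\<exists>a. summable (\<lambda>n. norm (a n :: complex)) \<and> (\<forall>z. z \<noteq> 0 \<longrightarrow> norm z \<le> 1 \<longrightarrow> (\<lambda>n. a n * z ^ n) sums bose_cut z)"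
proof -
  \<comment> \<open>\<open>h\<close> is (exp z - 1)/z with the singularity at 0 filled in. It has no
    zeros in the disc of radius 6 < 2 pi, so its reciprocal \<open>F\<close> is holomorphic there,
    and the difference quotient \<open>G\<close> of \<open>F\<close> at 0 extends
    \<open>bose_cut\<close>.\<close>
  define h where "h = (\<lambda>z::complex. if z = 0 then deriv exp 0 else (exp z - exp 0) / (z - 0))"
  have hh: "h holomorphic_on ball 0 6" unfolding h_def
    by (rule pole_lemma_open) (auto intro!: holomorphic_intros)
  have hnz: "h z \<noteq> 0" if "z \<in> ball 0 6" for z
  proof (cases "z = 0")
    case True
    have "deriv exp (0::complex) = 1" by (rule DERIV_imp_deriv) (auto intro!: derivative_eq_intros)
    with True show ?thesis by (simp add: h_def)
  next
    case False
    have "exp z \<noteq> 1"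
    proof
      assume "exp z = 1"
      then obtain n :: int where n: "Re z = 0" "Im z = of_int (2 * n) * pi" using exp_eq_1 by metis
      have "n \<noteq> 0" using n False by (auto simp: complex_eq_iff)
      hence "\<bar>of_int n :: real\<bar> \<ge> 1" by linarith
      hence "1 * pi \<le> \<bar>of_int n\<bar> * pi" by (intro mult_right_mono) auto
      hence "\<bar>Im z\<bar> \<ge> 2 * pi" using n by (simp add: abs_mult)
      hence "norm z \<ge> 2 * pi" using abs_Im_le_cmod[of z] by linarith
      thus False using that pi_gt3 by simp
    qed
    thus ?thesis using False by (simp add: h_def)
  qed
  define F where "F = (\<lambda>z. 1 / h z)"
  have hF: "F holomorphic_on ball 0 6" unfolding F_def by (intro holomorphic_intros hh hnz)
  have F0: "F 0 = 1"
  proof -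
    have "deriv exp (0::complex) = 1" by (rule DERIV_imp_deriv) (auto intro!: derivative_eq_intros)
    thus ?thesis by (simp add: F_def h_def)
  qed
  define G where "G = (\<lambda>z. if z = 0 then deriv F 0 else (F z - F 0) / (z - 0))"
  have hG: "G holomorphic_on ball 0 6" unfolding G_def by (rule pole_lemma_open[OF hF]) auto
  define a where "a = (\<lambda>n. (deriv ^^ n) G 0 / fact n)"
  have ps: "(\<lambda>n. a n * z ^ n) sums G z" if "norm z < 6" for z
    using holomorphic_power_series[OF hG, of z] that by (simp add: a_def)
  \<comment> \<open>Convergence at a point of modulus greater than 1 forces absolute summability of
    the coefficients themselves, which the termwise integration over (0, 1) relies on.\<close>
  have "summable (\<lambda>n. a n * 2 ^ n)" using ps[of 2] by (auto simp: sums_iff)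
  hence "summable (\<lambda>n. norm (a n * 1 ^ n))" by (rule powser_insidea) auto
  moreover have "(\<lambda>n. a n * z ^ n) sums bose_cut z" if "z \<noteq> 0" "norm z \<le> 1" for z
  proof -
    have "exp z - 1 \<noteq> 0" using hnz[of z] that by (simp add: h_def)
    hence "G z = bose_cut z" using that F0 by (simp add: G_def F_def h_def bose_cut_def bose_def field_simps)
    thus ?thesis using ps[of z] that by simp
  qed
  ultimately show ?thesis by auto
qed

text \<open>One term of the exponential series, of index \<open>m + 2\<close>, is enough; the two
  extra powers leave an integrable factor \<open>1 / x\<^sup>2\<close>.\<close>

lemma norm_bose_rapid:
  assumes "x \<ge> 1"
  shows "x ^ m * norm (bose (of_real x)) \<le> 2 * fact (m + 2) / x\<^sup>2"
proof -
  have "norm (bose (of_real x)) \<le> 1 / (exp x - 1)" using norm_bose_le[of "of_real x"] assms by simp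
  also have "\<dots> \<le> 2 / exp x"
  proof -
    have "exp x \<ge> 2" using exp_ge_add_one_self[of x] assms by linarith
    hence "1 / (exp x - 1) \<le> 1 / (exp x / 2)" by (intro frac_le) auto
    thus ?thesis by simp
  qed
  finally have 1: "norm (bose (of_real x)) \<le> 2 / exp x" .
  define K :: real where "K = fact (m + 2)"
  have K: "K > 0" unfolding K_def by (rule fact_gt_zero)
  have "(\<Sum>n\<in>{m+2}. inverse (fact n) * x ^ n) \<le> (\<Sum>n. inverse (fact n) * x ^ n)"
    by (rule sum_le_suminf) (use summable_exp[of x] assms in auto)
  also have "(\<Sum>n. inverse (fact n) * x ^ n) = exp x" by (simp add: exp_def)
  finally have "inverse K * x ^ (m + 2) \<le> exp x" unfolding K_def by (simp only: sum.insert sum.empty finite.emptyI empty_iff not_False_eq_True add_0_right)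
  hence "K * (inverse K * x ^ (m + 2)) \<le> K * exp x" using K by (intro mult_left_mono) auto
  moreover have "K * (inverse K * x ^ (m + 2)) = x ^ (m + 2)" using K by simp
  ultimately have 2: "x ^ (m + 2) \<le> K * exp x" by linarith
  have x: "x > 0" using assms by simp
  have "x ^ m * norm (bose (of_real x)) \<le> x ^ m * (2 / exp x)" using 1 assms by (intro mult_left_mono) auto
  also have "\<dots> = 2 * x ^ (m + 2) / (exp x * x\<^sup>2)" using x by (simp add: power2_eq_square)
  also have "\<dots> \<le> 2 * (K * exp x) / (exp x * x\<^sup>2)"
    using 2 by (intro divide_right_mono mult_left_mono) auto
  also have "\<dots> = 2 * K / x\<^sup>2" by simp
  finally show ?thesis unfolding K_def .
qed

lemma bose_real_continuous: "continuous_on {0<..} (\<lambda>x. bose (of_real x))"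
proof -
  have "bose holomorphic_on {w. Re w > 0}" by (rule bose_holomorphic) auto
  from holomorphic_on_imp_continuous_on[OF this] show ?thesis
    by (rule continuous_on_compose2) (auto intro!: continuous_intros)
qed

lemma bose_measurable [measurable]: "bose \<in> borel_measurable borel"
  unfolding bose_def[abs_def] by measurable

lemma bose_cut_measurable [measurable]: "bose_cut \<in> borel_measurable borel"
  unfolding bose_cut_def[abs_def] by measurable

text \<open>The part of the Mellin integral that converges for every \<open>s\<close>; it is the
  entire summand in the continuation of zeta.\<close>

definition zeta_tail :: "complex \<Rightarrow> complex" where
  "zeta_tail s = (LINT x:{1<..}|lborel. mellin_kernel s x * bose (of_real x))"

lemma inverse_square_integral_Ioi:
  fixes N :: real assumes "N \<ge> 1"
  shows "set_integrable lborel {N<..} (\<lambda>x. 1 / x\<^sup>2)" "(LINT x:{N<..}|lborel. 1 / x\<^sup>2) = 1 / N"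
proof -
  have ein: "einterval (ereal N) \<infinity> = {N<..}" by (simp add: einterval_eq)
  have nl: "((\<lambda>x. - 1 / x :: real) \<longlongrightarrow> 0) at_top" by real_asymp
  have nr: "((\<lambda>x::real. - 1 / x) \<longlongrightarrow> - 1 / N) (at_right N)"
    by (intro tendsto_intros) (use assms in auto)
  have F: "DERIV (\<lambda>x. - 1 / x) x :> 1 / x\<^sup>2" if "x > N" for x :: real
    using that assms by (auto intro!: derivative_eq_intros simp: power2_eq_square)
  have I: "set_integrable lborel (einterval (ereal N) \<infinity>) (\<lambda>x. 1 / x\<^sup>2)"
    "(LBINT x=ereal N..\<infinity>. 1 / x\<^sup>2) = 0 - (- 1 / N)"
    by (rule interval_integral_FTC_nonneg[where F = "\<lambda>x. - 1 / x"];
        (use F nl nr assms in \<open>auto intro!: continuous_intros simp: ereal_tendsto_simps\<close>))+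
  show "set_integrable lborel {N<..} (\<lambda>x. 1 / x\<^sup>2)" using I(1) unfolding ein .
  show "(LINT x:{N<..}|lborel. 1 / x\<^sup>2) = 1 / N" using I(2) by (simp add: interval_lebesgue_integral_def ein)
qed

lemma norm_mellin_kernel_bose:
  assumes "x \<ge> 1" "Re s \<le> real m + 1"
  shows "norm (mellin_kernel s x * bose (of_real x)) \<le> 2 * fact (m + 2) * (1 / x\<^sup>2)"
proof -
  have "x powr (Re s - 1) \<le> x powr (real m)" using assms by (intro powr_mono) auto
  also have "\<dots> = x ^ m" using assms by (simp add: powr_realpow)
  finally have "norm (mellin_kernel s x * bose (of_real x)) \<le> x ^ m * norm (bose (of_real x))"
    using assms by (simp add: norm_mult norm_mellin_kernel mult_right_mono)
  also have "\<dots> \<le> 2 * fact (m + 2) / x\<^sup>2" by (rule norm_bose_rapid[OF assms(1)])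
  finally show ?thesis by simp
qed

lemma zeta_tail_integrable:
  assumes "N \<ge> 1"
  shows "set_integrable lborel {N<..} (\<lambda>x. mellin_kernel s x * bose (of_real x))"
proof -
  obtain m :: nat where m: "Re s \<le> real m + 1" using real_arch_simple[of "Re s - 1"] by (auto simp: algebra_simps)
  have "set_integrable lborel {N<..} (\<lambda>x. 2 * fact (m + 2) * (1 / x\<^sup>2) :: real)"
    using inverse_square_integral_Ioi(1)[OF assms] by (rule set_integrable_mult_right)
  thus ?thesis
  proof (rule set_integrable_bound)
    show "AE x in lborel. x \<in> {N<..} \<longrightarrow> norm (mellin_kernel s x * bose (of_real x)) \<le> norm (2 * fact (m + 2) * (1 / x\<^sup>2) :: real)"
    proof (intro AE_I2 impI)
      fix x assume "x \<in> {N<..}"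
      hence "norm (mellin_kernel s x * bose (of_real x)) \<le> 2 * fact (m + 2) * (1 / x\<^sup>2)"
        using assms m by (intro norm_mellin_kernel_bose) auto
      thus "norm (mellin_kernel s x * bose (of_real x)) \<le> norm (2 * fact (m + 2) * (1 / x\<^sup>2) :: real)" by simp
    qed
  qed (simp add: set_borel_measurable_def)
qed

text \<open>Integrals over [1, n + 1] are holomorphic by differentiation under the integral sign. On
  a unit disc one exponent \<open>m\<close> bounds all real parts, so the neglected tails are at
  most C / (n + 1) uniformly and the limit is holomorphic.\<close>

lemma zeta_tail_holomorphic: "zeta_tail holomorphic_on UNIV"
proof (rule holomorphic_uniform_sequence)
  define f where "f = (\<lambda>s x. mellin_kernel s x * bose (of_real x))"
  define E where "E = (\<lambda>n s. integral (cbox 1 (real (Suc n))) (f s))"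
  show "E n holomorphic_on UNIV" for n
    unfolding E_def
  proof (rule leibniz_rule_holomorphic)
    define fx where "fx = (\<lambda>s x. mellin_kernel s x * of_real (ln x) * bose (of_real x))"
    show "((\<lambda>s. f s x) has_field_derivative fx s x) (at s within UNIV)" if "x \<in> cbox 1 (real (Suc n))" for s x
      unfolding f_def fx_def mellin_kernel_def by (auto intro!: derivative_eq_intros)
    have cb: "continuous_on {1..real (Suc n)} (\<lambda>x. bose (of_real x))"
      by (rule continuous_on_subset[OF bose_real_continuous]) auto
    show "f s integrable_on cbox 1 (real (Suc n))" for s
      unfolding f_def cbox_interval
      by (intro integrable_continuous_real continuous_intros cb continuous_on_subset[OF mellin_kernel_continuous]) auto
    show "continuous_on (UNIV \<times> cbox 1 (real (Suc n))) (\<lambda>(s, x). fx s x)"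
      unfolding fx_def mellin_kernel_def cbox_interval split_def
      by (intro continuous_intros continuous_on_compose2[OF cb]) auto
  qed auto
  show "\<exists>d>0. cball s d \<subseteq> UNIV \<and> uniform_limit (cball s d) E zeta_tail sequentially" for s
  proof (intro exI[of _ 1] conjI)
    obtain m :: nat where m: "Re s + 1 \<le> real m + 1" using real_arch_simple[of "Re s"] by auto
    define C :: real where "C = 2 * fact (m + 2)"
    have diff: "dist (E n w) (zeta_tail w) \<le> C / real (Suc n)" if "w \<in> cball s 1" for w n
    proof -
      define N where "N = real (Suc n)"
      have N: "N \<ge> 1" by (simp add: N_def)
      have "\<bar>Re (w - s)\<bar> \<le> norm (w - s)" by (rule abs_Re_le_cmod)
      hence rw: "Re w \<le> real m + 1" using that m by (simp add: dist_norm norm_minus_commute)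
      have i0: "set_integrable lborel {1<..} (f w)" unfolding f_def by (rule zeta_tail_integrable) simp
      have i1: "set_integrable lborel {N<..} (f w)" unfolding f_def by (rule zeta_tail_integrable[OF N])
      have i2: "set_integrable lborel {1<..N} (f w)" by (rule set_integrable_subset[OF i0]) auto
      have un: "{1<..} = {1<..N} \<union> {N<..}" using N by auto
      have "zeta_tail w = (LINT x:{1<..}|lborel. f w x)" by (simp add: zeta_tail_def f_def)
      also have "\<dots> = (LINT x:{1<..N}|lborel. f w x) + (LINT x:{N<..}|lborel. f w x)"
        unfolding un by (rule set_integral_Un[OF _ i2 i1]) auto
      also have "(LINT x:{1<..N}|lborel. f w x) = integral {1<..N} (f w)"
        by (rule set_borel_integral_eq_integral(2)[OF i2])
      also have "\<dots> = integral {1..N} (f w)"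
      proof (rule integral_spike_set)
        show "negligible {x \<in> {1<..N} - {1..N}. f w x \<noteq> 0}" by (rule negligible_subset[of "{1}"]) auto
        show "negligible {x \<in> {1..N} - {1<..N}. f w x \<noteq> 0}" by (rule negligible_subset[of "{1}"]) auto
      qed
      also have "\<dots> = E n w" by (simp add: E_def N_def)
      finally have "dist (E n w) (zeta_tail w) = norm (LINT x:{N<..}|lborel. f w x)" by (simp add: dist_norm)
      also have "\<dots> \<le> (LINT x:{N<..}|lborel. norm (f w x))" by (rule set_integral_norm_bound[OF i1])
      also have "\<dots> \<le> (LINT x:{N<..}|lborel. C * (1 / x\<^sup>2))"
      proof (rule set_integral_mono)
        show "set_integrable lborel {N<..} (\<lambda>x. norm (f w x))" by (rule set_integrable_norm[OF i1])
        show "set_integrable lborel {N<..} (\<lambda>x. C * (1 / x\<^sup>2))"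
          by (intro set_integrable_mult_right inverse_square_integral_Ioi(1) N)
        show "norm (f w x) \<le> C * (1 / x\<^sup>2)" if "x \<in> {N<..}" for x
          unfolding f_def C_def using that N rw by (intro norm_mellin_kernel_bose) auto
      qed
      also have "\<dots> = C * (1 / N)" by (subst set_integral_mult_right) (simp only: inverse_square_integral_Ioi(2)[OF N])
      finally show ?thesis by (simp add: N_def)
    qed
    show "uniform_limit (cball s 1) E zeta_tail sequentially"
    proof (rule uniform_limitI)
      fix e :: real assume e: "e > 0"
      have "(\<lambda>n. C / real (Suc n)) \<longlonglongrightarrow> 0" by real_asymp
      hence "\<forall>\<^sub>F n in sequentially. C / real (Suc n) < e" using e by (rule order_tendstoD)
      thus "\<forall>\<^sub>F n in sequentially. \<forall>w\<in>cball s 1. dist (E n w) (zeta_tail w) < e"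
      proof eventually_elim
        case (elim n)
        show ?case by (intro ballI le_less_trans[OF diff elim])
      qed
    qed
  qed auto
qed auto

text \<open>The Taylor coefficients at 0, that is, Bernoulli numbers divided by factorials.\<close>

definition bose_cut_coeff :: "nat \<Rightarrow> complex" where
  "bose_cut_coeff = (SOME a. summable (\<lambda>n. norm (a n)) \<and> (\<forall>z. z \<noteq> 0 \<longrightarrow> norm z \<le> 1 \<longrightarrow> (\<lambda>n. a n * z ^ n) sums bose_cut z))"

lemma bose_cut_coeff: "summable (\<lambda>n. norm (bose_cut_coeff n))"
  "z \<noteq> 0 \<Longrightarrow> norm z \<le> 1 \<Longrightarrow> (\<lambda>n. bose_cut_coeff n * z ^ n) sums bose_cut z"
  using someI_ex[OF bose_cut_power_series] unfolding bose_cut_coeff_def by auto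

text \<open>The power series is integrated term by term, x^(s+n-1) having integral 1/(s+n) over (0,
  1). The resulting series makes the poles at the nonpositive integers visible.\<close>

lemma mellin_bose_cut_01:
  assumes s: "Re s > 0"
  shows "set_integrable lborel {0<..<1} (\<lambda>x. mellin_kernel s x * bose_cut (of_real x))"
    "(\<lambda>n. bose_cut_coeff n / (s + of_nat n)) sums (LINT x:{0<..<1}|lborel. mellin_kernel s x * bose_cut (of_real x))"
proof -
  define f where "f = (\<lambda>n x. indicator {0<..<1::real} x *\<^sub>R (bose_cut_coeff n * mellin_kernel (s + of_nat n) x))"
  have int: "integrable lborel (f n)" for n
    using mellin_kernel_integral_01(1)[of "s + of_nat n"] s
    unfolding f_def set_integrable_def[symmetric] by (intro set_integrable_mult_right) auto
  have val: "(LINT x|lborel. f n x) = bose_cut_coeff n / (s + of_nat n)" for n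
    using mellin_kernel_integral_01(2)[of "s + of_nat n"] s
    unfolding f_def set_lebesgue_integral_def[symmetric] by simp
  have nval: "(LINT x|lborel. norm (f n x)) = norm (bose_cut_coeff n) / (Re s + n)" for n
  proof -
    have "(LINT x|lborel. norm (f n x)) = (LINT x:{0<..<1}|lborel. norm (bose_cut_coeff n) * norm (mellin_kernel (s + of_nat n) x))"
      unfolding set_lebesgue_integral_def f_def by (simp add: norm_mult)
    thus ?thesis using mellin_kernel_integral_01(3)[of "s + of_nat n"] s by simp
  qed
  have eq: "f n x = indicator {0<..<1} x *\<^sub>R (mellin_kernel s x * (bose_cut_coeff n * of_real x ^ n))" for n x
    using mellin_kernel_times_power[of x s n] by (auto simp: f_def indicator_def mult_ac)
  have sm: "(\<lambda>n. f n x) sums (indicator {0<..<1} x *\<^sub>R (mellin_kernel s x * bose_cut (of_real x)))" for x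
  proof (cases "x \<in> {0<..<1}")
    case True
    have "(\<lambda>n. mellin_kernel s x * (bose_cut_coeff n * of_real x ^ n)) sums (mellin_kernel s x * bose_cut (of_real x))"
      by (intro sums_mult bose_cut_coeff) (use True in auto)
    with True show ?thesis by (simp add: eq)
  next
    case False thus ?thesis by (simp add: f_def)
  qed
  have smn: "summable (\<lambda>n. norm (f n x))" for x
  proof (cases "x \<in> {0<..<1}")
    case True
    have "summable (\<lambda>n. norm (mellin_kernel s x) * norm (bose_cut_coeff n))"
      by (intro summable_mult bose_cut_coeff)
    moreover have "norm (norm (f n x)) \<le> norm (mellin_kernel s x) * norm (bose_cut_coeff n)" for n
    proof -
      have "x ^ n \<le> 1" using True by (intro power_le_one) auto
      hence "norm (mellin_kernel s x) * (norm (bose_cut_coeff n) * x ^ n) \<le> norm (mellin_kernel s x) * (norm (bose_cut_coeff n) * 1)"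
        by (intro mult_left_mono) auto
      thus ?thesis using True by (simp add: eq norm_mult norm_power)
    qed
    ultimately show ?thesis by (rule summable_comparison_test'[where N = 0])
  qed (simp add: f_def)
  have sni: "summable (\<lambda>n. LINT x|lborel. norm (f n x))"
  proof (rule summable_comparison_test'[where N = 0])
    show "summable (\<lambda>n. norm (bose_cut_coeff n) / Re s)" by (intro summable_divide bose_cut_coeff)
    show "norm (LINT x|lborel. norm (f n x)) \<le> norm (bose_cut_coeff n) / Re s" for n
      unfolding nval using s by (simp add: frac_le)
  qed
  have sumeq: "(\<Sum>n. f n x) = indicator {0<..<1} x *\<^sub>R (mellin_kernel s x * bose_cut (of_real x))" for x
    using sm[of x] by (simp add: sums_iff)
  show "set_integrable lborel {0<..<1} (\<lambda>x. mellin_kernel s x * bose_cut (of_real x))"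
    using integrable_suminf[OF int _ sni] smn unfolding set_integrable_def sumeq by auto
  show "(\<lambda>n. bose_cut_coeff n / (s + of_nat n)) sums (LINT x:{0<..<1}|lborel. mellin_kernel s x * bose_cut (of_real x))"
    using sums_integral[OF int _ sni] smn unfolding set_lebesgue_integral_def sumeq val by auto
qed

text \<open>On x > 1 the term -1/x is integrated separately; this converges because
  \<open>Re s < 1\<close> and contributes \<open>1 / (s - 1)\<close>.\<close>

lemma mellin_bose_strip:
  assumes s: "0 < Re s" "Re s < 1"
  shows "set_integrable lborel {0<..} (\<lambda>x. mellin_kernel s x * bose_cut (of_real x))"
    "(LINT x:{0<..}|lborel. mellin_kernel s x * bose_cut (of_real x))
       = (\<Sum>n. bose_cut_coeff n / (s + of_nat n)) + (zeta_tail s + 1 / (s - 1))"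
proof -
  note a = mellin_bose_cut_01[OF s(1)]
  have i: "set_integrable lborel {1<..} (\<lambda>x. mellin_kernel s x * bose (of_real x))"
    by (rule zeta_tail_integrable) simp
  have r: "Re (s - 1) < 0" using s by simp
  have eq: "mellin_kernel s x * bose_cut (of_real x) = mellin_kernel s x * bose (of_real x) - mellin_kernel (s - 1) x"
    if "x \<in> {1<..}" for x using that by (simp add: bose_cut_def right_diff_distrib mellin_kernel_divide)
  have b: "set_integrable lborel {1<..} (\<lambda>x. mellin_kernel s x * bose_cut (of_real x))"
    using set_integral_diff(1)[OF i mellin_kernel_integral_1inf(1)[OF r]]
    by (subst set_integrable_cong[OF refl refl eq]) auto
  have "(LINT x:{1<..}|lborel. mellin_kernel s x * bose_cut (of_real x)) = 
      (LINT x:{1<..}|lborel. mellin_kernel s x * bose (of_real x) - mellin_kernel (s - 1) x)"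
    by (rule set_lebesgue_integral_cong) (use eq in auto)
  also have "\<dots> = zeta_tail s - (- 1 / (s - 1))"
    using set_integral_diff(2)[OF i mellin_kernel_integral_1inf(1)[OF r]] mellin_kernel_integral_1inf(2)[OF r]
    by (simp add: zeta_tail_def)
  finally have v: "(LINT x:{1<..}|lborel. mellin_kernel s x * bose_cut (of_real x)) = zeta_tail s + 1 / (s - 1)"
    by simp
  show "set_integrable lborel {0<..} (\<lambda>x. mellin_kernel s x * bose_cut (of_real x))"
    by (rule set_integral_split_01(1)[OF a(1) b])
  show "(LINT x:{0<..}|lborel. mellin_kernel s x * bose_cut (of_real x))
       = (\<Sum>n. bose_cut_coeff n / (s + of_nat n)) + (zeta_tail s + 1 / (s - 1))"
    using set_integral_split_01(2)[OF a(1) b] v a(2) by (simp add: sums_iff)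
qed

text \<open>For \<open>Re s > 1\<close> the term 1/x can be restored on (0, 1), where it again
  contributes \<open>1 / (s - 1)\<close>. The outcome is literally the expression found in the
  strip, and this coincidence carries the Mellin transform across \<open>Re s = 1\<close>.\<close>

lemma mellin_bose_right:
  assumes s: "Re s > 1"
  shows "(LINT x:{0<..}|lborel. mellin_kernel s x * bose (of_real x))
       = (\<Sum>n. bose_cut_coeff n / (s + of_nat n)) + (zeta_tail s + 1 / (s - 1))"
proof -
  have s0: "Re s > 0" using s by simp
  have r: "Re (s - 1) > 0" using s by simp
  note a = mellin_bose_cut_01[OF s0]
  have i: "set_integrable lborel {1<..} (\<lambda>x. mellin_kernel s x * bose (of_real x))"
    by (rule zeta_tail_integrable) simp
  have eq: "mellin_kernel s x * bose (of_real x) = mellin_kernel s x * bose_cut (of_real x) + mellin_kernel (s - 1) x"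
    if "x \<in> {0<..<1}" for x using that by (simp add: bose_cut_def right_diff_distrib mellin_kernel_divide)
  have b: "set_integrable lborel {0<..<1} (\<lambda>x. mellin_kernel s x * bose (of_real x))"
    using set_integral_add(1)[OF a(1) mellin_kernel_integral_01(1)[OF r]]
    by (subst set_integrable_cong[OF refl refl eq]) auto
  have "(LINT x:{0<..<1}|lborel. mellin_kernel s x * bose (of_real x)) = 
      (LINT x:{0<..<1}|lborel. mellin_kernel s x * bose_cut (of_real x) + mellin_kernel (s - 1) x)"
    by (rule set_lebesgue_integral_cong) (use eq in auto)
  also have "\<dots> = (\<Sum>n. bose_cut_coeff n / (s + of_nat n)) + 1 / (s - 1)"
    using set_integral_add(2)[OF a(1) mellin_kernel_integral_01(1)[OF r]] mellin_kernel_integral_01(2)[OF r] a(2)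
    by (simp add: sums_iff)
  finally show ?thesis using set_integral_split_01(2)[OF b i] by (simp add: zeta_tail_def)
qed

section \<open>The Dirichlet series as a Mellin transform\<close>

lemma mellin_exp:
  assumes "Re s > 0"
  shows "set_integrable lborel {0<..} (\<lambda>x. mellin_kernel s x * of_real (exp (- x)))"
   "(LINT x:{0<..}|lborel. mellin_kernel s x * of_real (exp (- x))) = Gamma s"
proof -
  have eq: "complex_of_real x powr (s - 1) / of_real (exp x) = mellin_kernel s x * of_real (exp (- x))"
    if "x \<in> {0<..}" for x
    using that by (simp add: mellin_kernel_powr exp_minus divide_inverse)
  have "set_integrable lebesgue {0<..} (\<lambda>x. complex_of_real x powr (s - 1) / of_real (exp x))
      = set_integrable lebesgue {0<..} (\<lambda>x. mellin_kernel s x * of_real (exp (- x)))"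
    by (rule set_integrable_cong[OF refl refl]) (rule eq)
  hence "set_integrable lebesgue {0<..} (\<lambda>x. mellin_kernel s x * of_real (exp (- x)))"
    using absolutely_integrable_Gamma_integral'[OF assms] by simp
  moreover have "(\<lambda>x. indicator {0<..} x *\<^sub>R (mellin_kernel s x * of_real (exp (- x)))) \<in> borel_measurable lborel"
    by measurable
  ultimately show i: "set_integrable lborel {0<..} (\<lambda>x. mellin_kernel s x * of_real (exp (- x)))"
    unfolding set_integrable_def by (simp add: integrable_completion)
  have "((\<lambda>x. mellin_kernel s x * of_real (exp (- x))) has_integral Gamma s) {0<..}"
    by (rule has_integral_eq[OF _ Gamma_integral_complex'[OF assms]]) (rule eq)
  thus "(LINT x:{0<..}|lborel. mellin_kernel s x * of_real (exp (- x))) = Gamma s"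
    using set_borel_integral_eq_integral(2)[OF i] by (simp add: integral_unique)
qed

lemma mellin_exp_scaled:
  assumes s: "Re s > 0"
  shows "set_integrable lborel {0<..} (\<lambda>x. mellin_kernel s x * of_real (exp (- (real (Suc n) * x))))" (is ?A)
   "(LINT x:{0<..}|lborel. mellin_kernel s x * of_real (exp (- (real (Suc n) * x)))) = Gamma s / of_nat (Suc n) powr s" (is ?B)
   "(LINT x:{0<..}|lborel. norm (mellin_kernel s x * of_real (exp (- (real (Suc n) * x)))))
      = (LINT x:{0<..}|lborel. norm (mellin_kernel s x * of_real (exp (- x)))) * real (Suc n) powr - Re s" (is ?C)
proof -
  define k where "k = real (Suc n)"
  have k: "k > 0" by (simp add: k_def)
  define f where "f = (\<lambda>x. mellin_kernel s x * of_real (exp (- x)))"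
  define c where "c = mellin_kernel s k"
  have c0: "c \<noteq> 0" by (simp add: c_def mellin_kernel_def)
  have nc: "norm c = k powr (Re s - 1)" using k by (simp add: c_def norm_mellin_kernel)
  have eq: "mellin_kernel s x * of_real (exp (- (k * x))) = f (k * x) / c" if "x \<in> {0<..}" for x
    using that k c0 mellin_kernel_mult[of k x s] by (simp add: f_def c_def)
  have neq: "norm (mellin_kernel s x * of_real (exp (- (k * x)))) = norm (f (k * x)) / norm c" if "x \<in> {0<..}" for x
    unfolding eq[OF that] by (rule norm_divide)
  note fi = mellin_exp[OF s, folded f_def]
  have i: "set_integrable lborel {0<..} (\<lambda>x. f (k * x) / c)"
    using set_integral_Ioi_scale(1)[OF fi(1) k] by (rule set_integrable_divide)
  have "set_integrable lborel {0<..} (\<lambda>x. mellin_kernel s x * of_real (exp (- (k * x))))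
      = set_integrable lborel {0<..} (\<lambda>x. f (k * x) / c)"
    by (rule set_integrable_cong[OF refl refl]) (rule eq)
  with i show ?A unfolding k_def[symmetric] by simp
  have "(LINT x:{0<..}|lborel. mellin_kernel s x * of_real (exp (- (k * x)))) = (LINT x:{0<..}|lborel. f (k * x) / c)"
    by (intro set_lebesgue_integral_cong) (use eq in auto)
  also have "\<dots> = (LINT x:{0<..}|lborel. f (k * x)) / c" by simp
  also have "\<dots> = (1 / k) *\<^sub>R Gamma s / c" using set_integral_Ioi_scale(2)[OF fi(1) k] fi(2) by simp
  also have "\<dots> = Gamma s / (c * of_real k)" by (simp add: scaleR_conv_of_real)
  also have "c * of_real k = of_nat (Suc n) powr s"
  proof -
    have "c * of_real k = mellin_kernel (s + 1) k"
      unfolding c_def using mellin_kernel_times_power[OF k, of s 1] by simp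
    also have "\<dots> = of_real k powr s" using mellin_kernel_powr[OF k, of "s + 1"] by simp
    finally show ?thesis by (simp add: k_def)
  qed
  finally show ?B by (simp add: k_def)
  have "(LINT x:{0<..}|lborel. norm (mellin_kernel s x * of_real (exp (- (k * x))))) = (LINT x:{0<..}|lborel. norm (f (k * x)) / norm c)"
    by (intro set_lebesgue_integral_cong) (use neq in auto)
  also have "\<dots> = (LINT x:{0<..}|lborel. norm (f (k * x))) / norm c" by simp
  also have "\<dots> = (1 / k) * (LINT x:{0<..}|lborel. norm (f x)) / norm c"
    using set_integral_Ioi_scale(2)[OF set_integrable_norm[OF fi(1)] k] by simp
  also have "\<dots> = (LINT x:{0<..}|lborel. norm (f x)) / (k * k powr (Re s - 1))" by (simp add: nc)
  also have "k * k powr (Re s - 1) = k powr Re s" using k by (simp add: powr_diff)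
  finally show ?C unfolding k_def[symmetric] f_def[symmetric] using k
    by (simp add: powr_minus divide_inverse f_def)
qed

text \<open>\<open>bose\<close> is the geometric series of the exponentials exp (-(n+1) x). The
  integrals of the absolute values are a fixed multiple of (n+1)^(-Re s), so summation and
  integration may be exchanged for \<open>Re s > 1\<close>.\<close>

lemma dirichlet_series_mellin:
  assumes s: "Re s > 1"
  shows "(\<lambda>n. Gamma s / of_nat (Suc n) powr s) sums (LINT x:{0<..}|lborel. mellin_kernel s x * bose (of_real x))"
proof -
  have s0: "Re s > 0" using s by simp
  define f where "f = (\<lambda>n x. indicator {0<..} x *\<^sub>R (mellin_kernel s x * of_real (exp (- (real (Suc n) * x)))))"
  define C where "C = (LINT x:{0<..}|lborel. norm (mellin_kernel s x * of_real (exp (- x))))"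
  have int: "integrable lborel (f n)" for n
    using mellin_exp_scaled(1)[OF s0] unfolding f_def set_integrable_def .
  have val: "(LINT x|lborel. f n x) = Gamma s / of_nat (Suc n) powr s" for n
    using mellin_exp_scaled(2)[OF s0] unfolding f_def set_lebesgue_integral_def .
  have nval: "(LINT x|lborel. norm (f n x)) = C * real (Suc n) powr - Re s" for n
    using mellin_exp_scaled(3)[OF s0, of n] unfolding f_def C_def set_lebesgue_integral_def by simp
  have sni: "summable (\<lambda>n. LINT x|lborel. norm (f n x))"
    unfolding nval using s summable_real_powr_iff[of "- Re s"]
    by (intro summable_mult) (subst summable_Suc_iff, simp)
  have geo: "(\<lambda>n. complex_of_real (exp (- (real (Suc n) * x)))) sums bose (of_real x)" 
    "summable (\<lambda>n. exp (- (real (Suc n) * x)))" if x: "x > 0" for x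
  proof -
    define z where "z = exp (- x)"
    have z: "0 < z" "z < 1" using x by (simp_all add: z_def)
    have zn: "exp (- (real (Suc n) * x)) = z * z ^ n" for n
      by (simp add: z_def exp_of_nat_mult[symmetric] exp_add[symmetric] algebra_simps)
    show "summable (\<lambda>n. exp (- (real (Suc n) * x)))" unfolding zn using z by (intro summable_mult summable_geometric) auto
    have "(\<lambda>n. of_real z * of_real z ^ n) sums (complex_of_real z * (1 / (1 - of_real z)))"
      using z by (intro sums_mult geometric_sums) auto
    moreover have "complex_of_real z * (1 / (1 - of_real z)) = bose (of_real x)"
    proof -
      define F where "F = complex_of_real (exp x)"
      have F: "F \<noteq> 0" "F \<noteq> 1" using x by (auto simp: F_def)
      have zz: "complex_of_real z = inverse F" by (simp add: z_def F_def exp_minus)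
      have "1 - inverse F = (F - 1) / F" using F by (simp add: field_simps)
      hence "inverse F * (1 / (1 - inverse F)) = 1 / (F - 1)" using F by simp
      thus ?thesis by (simp add: zz bose_def F_def exp_of_real)
    qed
    ultimately show "(\<lambda>n. complex_of_real (exp (- (real (Suc n) * x)))) sums bose (of_real x)"
      unfolding zn by simp
  qed
  have sumeq: "(\<Sum>n. f n x) = indicator {0<..} x *\<^sub>R (mellin_kernel s x * bose (of_real x))" for x
  proof (cases "x > 0")
    case True
    have "(\<lambda>n. mellin_kernel s x * of_real (exp (- (real (Suc n) * x)))) sums (mellin_kernel s x * bose (of_real x))"
      by (intro sums_mult geo True)
    thus ?thesis using True by (simp add: f_def sums_iff)
  qed (simp add: f_def)
  have smn: "summable (\<lambda>n. norm (f n x))" for x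
  proof (cases "x > 0")
    case True
    have "summable (\<lambda>n. norm (mellin_kernel s x) * exp (- (real (Suc n) * x)))"
      by (intro summable_mult geo True)
    thus ?thesis using True by (simp add: f_def norm_mult)
  qed (simp add: f_def)
  show ?thesis
    using sums_integral[OF int _ sni] smn unfolding set_lebesgue_integral_def sumeq val by auto
qed

section \<open>Continuation of zeta to the punctured plane\<close>

definition rGamma_quot :: "nat \<Rightarrow> complex \<Rightarrow> complex" where
  "rGamma_quot n s = (if s = - of_nat n then deriv rGamma (- of_nat n) else rGamma s / (s + of_nat n))"

text \<open>1/Gamma vanishes at -n, so the division by s + n has a removable singularity, filled in
  with the derivative.\<close>

lemma rGamma_quot_holomorphic: "rGamma_quot n holomorphic_on UNIV"
proof -
  have "(\<lambda>z. if z = - of_nat n then deriv rGamma (- of_nat n) else (rGamma z - rGamma (- of_nat n)) / (z - - of_nat n))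
      holomorphic_on UNIV" by (rule pole_lemma_open) (auto intro!: holomorphic_intros)
  moreover have "rGamma_quot n = (\<lambda>z. if z = - of_nat n then deriv rGamma (- of_nat n)
      else (rGamma z - rGamma (- of_nat n)) / (z - - of_nat n))"
    by (rule ext) (simp add: rGamma_quot_def rGamma_eq_zero_iff)
  ultimately show ?thesis by simp
qed

text \<open>On the unit disc around \<open>s\<close> all points -n with n >= norm s + 2 are at
  distance at least 1, so the M-test applies with a bound of \<open>rGamma\<close> on that disc; the
  finitely many earlier terms do not affect uniform convergence.\<close>

lemma rGamma_quot_series_holomorphic:
  "(\<lambda>s. \<Sum>n. bose_cut_coeff n * rGamma_quot n s) holomorphic_on UNIV"
proof (rule holomorphic_uniform_sequence)
  show "(\<lambda>s. \<Sum>i<n. bose_cut_coeff i * rGamma_quot i s) holomorphic_on UNIV" for n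
    by (intro holomorphic_intros rGamma_quot_holomorphic)
  show "\<exists>d>0. cball s d \<subseteq> UNIV \<and> uniform_limit (cball s d) (\<lambda>n s. \<Sum>i<n. bose_cut_coeff i * rGamma_quot i s)
     (\<lambda>s. \<Sum>n. bose_cut_coeff n * rGamma_quot n s) sequentially" for s
  proof (intro exI[of _ 1] conjI)
    have "compact (rGamma ` cball s 1)"
      by (intro compact_continuous_image holomorphic_on_imp_continuous_on holomorphic_intros) auto
    then obtain B where B: "\<And>z. z \<in> cball s 1 \<Longrightarrow> norm (rGamma z) \<le> B"
      using compact_imp_bounded bounded_iff by (metis imageI)
    show "uniform_limit (cball s 1) (\<lambda>n s. \<Sum>i<n. bose_cut_coeff i * rGamma_quot i s)
     (\<lambda>s. \<Sum>n. bose_cut_coeff n * rGamma_quot n s) sequentially"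
    proof (rule Weierstrass_m_test_ev)
      show "summable (\<lambda>n. norm (bose_cut_coeff n) * B)" by (intro summable_mult2 bose_cut_coeff)
      obtain N :: nat where N: "norm s + 2 \<le> real N" using real_arch_simple by blast
      show "\<forall>\<^sub>F n in sequentially. \<forall>z\<in>cball s 1. norm (bose_cut_coeff n * rGamma_quot n z) \<le> norm (bose_cut_coeff n) * B"
      proof (rule eventually_mono[OF eventually_ge_at_top[of N]], intro ballI)
        fix n z assume n: "N \<le> n" and z: "z \<in> cball s 1"
        have "norm z \<le> norm s + 1" using z norm_triangle_ineq2[of z s] by (simp add: dist_norm norm_minus_commute)
        moreover have "real N \<le> real n" using n by simp
        ultimately have "norm z + 1 \<le> real n" using N by linarith
        moreover have "real n \<le> norm (z + of_nat n) + norm z"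
          using norm_triangle_ineq4[of "z + of_nat n" z] by simp
        ultimately have ge: "norm (z + of_nat n) \<ge> 1" by linarith
        hence "z + of_nat n \<noteq> 0" by auto
        hence "z \<noteq> - of_nat n" by (metis add.commute add.right_inverse)
        hence "norm (rGamma_quot n z) = norm (rGamma z) / norm (z + of_nat n)" by (simp add: rGamma_quot_def norm_divide)
        also have "\<dots> \<le> norm (rGamma z) / 1" using ge by (intro divide_left_mono) auto
        also have "\<dots> \<le> B" using B[OF z] by simp
        finally show "norm (bose_cut_coeff n * rGamma_quot n z) \<le> norm (bose_cut_coeff n) * B"
          by (simp add: norm_mult mult_left_mono)
      qed
    qed
  qed auto
qed auto

text \<open>The common Mellin expression multiplied by 1/Gamma, distributed so that every summand is
  visibly holomorphic away from 1.\<close>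

definition zeta_cont :: "complex \<Rightarrow> complex" where
  "zeta_cont s = rGamma s * (zeta_tail s + 1 / (s - 1)) + (\<Sum>n. bose_cut_coeff n * rGamma_quot n s)"

lemma zeta_cont_holomorphic: "zeta_cont holomorphic_on (- {1})"
proof -
  have eq: "zeta_cont = (\<lambda>s. rGamma s * (zeta_tail s + 1 / (s - 1)) + (\<Sum>n. bose_cut_coeff n * rGamma_quot n s))"
    by (simp add: zeta_cont_def fun_eq_iff)
  show ?thesis unfolding eq
    by (intro holomorphic_intros holomorphic_on_subset[OF zeta_tail_holomorphic]
          holomorphic_on_subset[OF rGamma_quot_series_holomorphic]) auto
qed

lemma zeta_cont_eq:
  assumes "Re s > 0"
  shows "zeta_cont s = rGamma s * ((\<Sum>n. bose_cut_coeff n / (s + of_nat n)) + (zeta_tail s + 1 / (s - 1)))"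
proof -
  have "s \<noteq> - of_nat n" for n using assms by auto
  hence "bose_cut_coeff n * rGamma_quot n s = rGamma s * (bose_cut_coeff n / (s + of_nat n))" for n
    by (simp add: rGamma_quot_def)
  moreover have "(\<Sum>n. rGamma s * (bose_cut_coeff n / (s + of_nat n))) = rGamma s * (\<Sum>n. bose_cut_coeff n / (s + of_nat n))"
    by (rule suminf_mult) (use mellin_bose_cut_01(2)[OF assms] in \<open>simp add: sums_iff\<close>)
  ultimately show ?thesis by (simp add: zeta_cont_def ring_distribs)
qed

lemma Gamma_nonzero_right: "Re s > 0 \<Longrightarrow> Gamma s \<noteq> (0::complex)"
  by (subst Gamma_eq_zero_iff) (auto elim!: nonpos_Ints_cases)

lemma zeta_cont_sums:
  assumes "Re s > 1"
  shows "(\<lambda>n. 1 / of_nat (Suc n) powr s) sums zeta_cont s"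
proof -
  have s: "Re s > 0" using assms by simp
  have "(\<lambda>n. rGamma s * (Gamma s / of_nat (Suc n) powr s)) sums zeta_cont s"
    unfolding zeta_cont_eq[OF s] mellin_bose_right[OF assms, symmetric]
    by (intro sums_mult dirichlet_series_mellin assms)
  moreover have eq: "rGamma s * (Gamma s / x) = 1 / x" for x
    using Gamma_nonzero_right[OF s] by (simp add: rGamma_inverse_Gamma)
  ultimately show ?thesis unfolding eq by simp
qed

text \<open>The explicit continuation is a witness for the choice by which \<open>zeta\<close> is
  defined.\<close>

lemma zeta_characterisation:
  "zeta holomorphic_on (- {1}) \<and> (\<forall>s. Re s > 1 \<longrightarrow> (\<lambda>n. 1 / of_nat (Suc n) powr s) sums zeta s)"
proof -
  have "\<exists>f. f holomorphic_on (- {1}) \<and> (\<forall>s. Re s > 1 \<longrightarrow> (\<lambda>n. 1 / of_nat (Suc n) powr s) sums f s)"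
    using zeta_cont_holomorphic zeta_cont_sums by blast
  from someI_ex[OF this] show ?thesis unfolding zeta_def .
qed

text \<open>The punctured plane is connected, so agreement on the half-plane of the Dirichlet series
  propagates to all of it.\<close>

lemma zeta_eq_zeta_cont: assumes "s \<noteq> 1" shows "zeta s = zeta_cont s"
proof (rule analytic_continuation_open[where f = zeta and g = zeta_cont and s = "{s. Re s > 1}" and s' = "- {1}"])
  have "(2::complex) \<in> {s. Re s > 1}" by simp
  thus "{s. Re s > 1} \<noteq> {}" by blast
  show "connected (- {1::complex})" by (intro connected_punctured_universe) simp
  show "zeta w = zeta_cont w" if "w \<in> {s. Re s > 1}" for w
    using zeta_characterisation zeta_cont_sums[of w] that by (auto simp: sums_iff)
qed (use zeta_characterisation zeta_cont_holomorphic assms in \<open>auto simp: open_halfspace_Re_gt\<close>)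

text \<open>The strip and the half-plane of convergence share one formula, so in the strip the
  continued zeta is represented by the kernel with its pole removed.\<close>

lemma Gamma_zeta_mellin:
  assumes s: "0 < Re s" "Re s < 1"
  shows "Gamma s * zeta s = (LINT x:{0<..}|lborel. mellin_kernel s x * bose_cut (of_real x))"
proof -
  have "zeta s = zeta_cont s" using s by (intro zeta_eq_zeta_cont) auto
  also have "Gamma s * zeta_cont s = (Gamma s * rGamma s) * (LINT x:{0<..}|lborel. mellin_kernel s x * bose_cut (of_real x))"
    unfolding zeta_cont_eq[OF s(1)] mellin_bose_strip(2)[OF s] by simp
  also have "Gamma s * rGamma s = 1" using Gamma_nonzero_right[OF s(1)] by (simp add: rGamma_inverse_Gamma)
  finally show ?thesis by simp
qed

lemma zeta_sq_continuous: "continuous_on UNIV zeta_sq"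
proof -
  have "continuous_on (- {1}) zeta" using zeta_characterisation by (auto intro: holomorphic_on_imp_continuous_on)
  hence "continuous_on UNIV (\<lambda>t::real. zeta (1 / 2 + \<i> * of_real t))"
    by (rule continuous_on_compose2) (auto intro!: continuous_intros simp: complex_eq_iff)
  thus ?thesis unfolding zeta_sq_def[abs_def] by (intro continuous_intros)
qed

section \<open>Integrals of products of Bose kernels\<close>

lemma exp_integral_Ioi:
  assumes t: "t > 0"
  shows "set_integrable lborel {0<..} (\<lambda>x. complex_of_real (exp (- (t * x))))"
    "(LINT x:{0<..}|lborel. complex_of_real (exp (- (t * x)))) = 1 / of_real t"
proof -
  have eq: "(\<lambda>x. mellin_kernel 1 x * of_real (exp (- x))) = (\<lambda>x. complex_of_real (exp (- x)))"
    by (simp add: mellin_kernel_def)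
  have m: "set_integrable lborel {0<..} (\<lambda>x. complex_of_real (exp (- x)))"
    "(LINT x:{0<..}|lborel. complex_of_real (exp (- x))) = 1"
    using mellin_exp[of 1, unfolded eq] by simp_all
  show "set_integrable lborel {0<..} (\<lambda>x. complex_of_real (exp (- (t * x))))"
    by (rule set_integral_Ioi_scale(1)[OF m(1) t])
  show "(LINT x:{0<..}|lborel. complex_of_real (exp (- (t * x)))) = 1 / of_real t"
    using set_integral_Ioi_scale(2)[OF m(1) t] m(2) by (simp add: scaleR_conv_of_real)
qed

text \<open>The quotient is the integral of exp (-t x) over a <= t <= b; integrating first over
  \<open>x\<close> leaves 1/t.\<close>

lemma frullani_exp:
  assumes ab: "0 < a" "a \<le> b"
  shows "set_integrable lborel {0<..} (\<lambda>x. complex_of_real ((exp (- (a * x)) - exp (- (b * x))) / x))"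
    "(LINT x:{0<..}|lborel. complex_of_real ((exp (- (a * x)) - exp (- (b * x))) / x)) = of_real (ln b - ln a)"
proof -
  define f where "f = (\<lambda>x t. complex_of_real (indicator {0<..} x * indicator {a..b} t * exp (- (t * x))))"
  define g where "g = (\<lambda>x. indicator {0<..} x *\<^sub>R complex_of_real (exp (- (a * x))))"
  define h where "h = (\<lambda>t. complex_of_real (indicator {a..b} t))"
  have gi: "integrable lborel g"
    using exp_integral_Ioi(1)[OF ab(1)] unfolding g_def set_integrable_def .
  have hi: "integrable lborel h" unfolding h_def by (intro integrable_of_real integrable_real_indicator) (auto simp: emeasure_lborel_Icc_eq)
  have int: "integrable (lborel \<Otimes>\<^sub>M lborel) (\<lambda>(x, t). f x t)"
  proof (rule integrable_lborel_prod[OF _ gi hi])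
    show "(\<lambda>(x, t). f x t) \<in> borel_measurable (lborel \<Otimes>\<^sub>M lborel)" unfolding f_def by measurable
    show "norm (f x t) \<le> norm (g x) * norm (h t)" for x t
      unfolding f_def g_def h_def by (auto simp: indicator_def)
  qed
  have inner: "(LINT t|lborel. f x t) = indicator {0<..} x *\<^sub>R complex_of_real ((exp (- (a * x)) - exp (- (b * x))) / x)" for x
  proof (cases "x > 0")
    case True
    have "(LINT t|lborel. exp (- (t * x)) * indicator {a..b} t) = - exp (- (b * x)) / x - (- exp (- (a * x)) / x)"
      by (rule integral_FTC_Icc_real[OF ab(2)])
         (use True in \<open>auto intro!: derivative_eq_intros continuous_intros\<close>)
    also have "\<dots> = (exp (- (a * x)) - exp (- (b * x))) / x" by (simp add: diff_divide_distrib)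
    finally have "complex_of_real (LINT t|lborel. exp (- (t * x)) * indicator {a..b} t) = complex_of_real ((exp (- (a * x)) - exp (- (b * x))) / x)"
      by simp
    moreover have "(LINT t|lborel. f x t) = complex_of_real (LINT t|lborel. exp (- (t * x)) * indicator {a..b} t)"
      unfolding integral_complex_of_real[symmetric] f_def using True by (simp add: mult.commute)
    ultimately show ?thesis using True by simp
  qed (simp add: f_def)
  have outer: "(LINT x|lborel. f x t) = complex_of_real (1 / t * indicator {a..b} t)" for t
  proof (cases "t \<in> {a..b}")
    case True
    hence t: "t > 0" using ab by simp
    have "(LINT x|lborel. f x t) = (LINT x:{0<..}|lborel. complex_of_real (exp (- (t * x))))"
      unfolding set_lebesgue_integral_def using True by (simp add: f_def scaleR_conv_of_real)
    thus ?thesis using exp_integral_Ioi(2)[OF t] True by simp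
  qed (simp add: f_def)
  show "set_integrable lborel {0<..} (\<lambda>x. complex_of_real ((exp (- (a * x)) - exp (- (b * x))) / x))"
    using lborel_pair.integrable_fst[OF int] unfolding inner set_integrable_def .
  have "(LINT x|lborel. LINT t|lborel. f x t) = (LINT t|lborel. LINT x|lborel. f x t)"
    by (rule lborel_pair.Fubini_integral[OF int, symmetric])
  also have "\<dots> = complex_of_real (LINT t|lborel. 1 / t * indicator {a..b} t)"
    unfolding outer by (rule integral_complex_of_real)
  also have "(LINT t|lborel. 1 / t * indicator {a..b} t) = ln b - ln a"
    by (rule integral_FTC_Icc_real[OF ab(2)])
       (use ab in \<open>auto intro!: derivative_eq_intros continuous_intros\<close>)
  finally show "(LINT x:{0<..}|lborel. complex_of_real ((exp (- (a * x)) - exp (- (b * x))) / x)) = of_real (ln b - ln a)"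
    unfolding inner set_lebesgue_integral_def .
qed

section \<open>Evaluation of the constant (gamma - ln (2 pi)) / 2\<close>

lemma bose_geometric:
  assumes "x > 0"
  shows "bose (of_real x) * (1 - of_real (exp (- (real N * x)))) = (\<Sum>n=1..N. of_real (exp (- (real n * x))))"
proof (induction N)
  case (Suc N)
  define F where "F = complex_of_real (exp x)"
  have F: "F \<noteq> 0" "F - 1 \<noteq> 0" using assms by (auto simp: F_def)
  define y where "y = complex_of_real (exp (- (real (Suc N) * x)))"
  have y: "complex_of_real (exp (- (real N * x))) = y * F"
    by (simp add: y_def F_def exp_add[symmetric] algebra_simps flip: of_real_mult)
  have b: "bose (of_real x) = 1 / (F - 1)" by (simp add: bose_def F_def exp_of_real)
  have "bose (of_real x) * (1 - y) = bose (of_real x) * (1 - y * F) + y"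
    unfolding b using F(2) by (simp add: divide_simps) (simp add: algebra_simps)
  thus ?case using Suc.IH by (simp add: y y_def)
qed simp

definition bose_const :: complex where
  "bose_const = (LINT x:{0<..}|lborel. bose_quot (of_real x))"

lemma bose_quot_integrable: "set_integrable lborel {0<..} (\<lambda>x. bose_quot (of_real x))"
proof (rule set_integrable_Ioi_bound_square)
  have "bose_quot holomorphic_on {w. Re w > 0}" by (rule bose_quot_holomorphic) auto
  from holomorphic_on_imp_continuous_on[OF this] show "continuous_on {0<..} (\<lambda>x. bose_quot (of_real x))"
    by (rule continuous_on_compose2) (auto intro!: continuous_intros)
  show "norm (bose_quot (of_real x)) \<le> 14" "norm (bose_quot (of_real x)) \<le> 14 / x\<^sup>2" if "x > 0" for x
    using norm_bose_quot_cone[of "of_real x" 1] that by (auto simp: power_divide)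
qed

lemma set_integral_finite_sum:
  fixes f :: "'i \<Rightarrow> real \<Rightarrow> complex"
  assumes "\<And>i. i \<in> I \<Longrightarrow> set_integrable lborel S (f i)"
  shows "set_integrable lborel S (\<lambda>x. \<Sum>i\<in>I. f i x)"
    "(LINT x:S|lborel. \<Sum>i\<in>I. f i x) = (\<Sum>i\<in>I. LINT x:S|lborel. f i x)"
  using assms unfolding set_integrable_def set_lebesgue_integral_def scaleR_sum_right
  by (auto intro!: Bochner_Integration.integrable_sum Bochner_Integration.integral_sum)

lemma norm_one_minus_exp_le: "x \<ge> 0 \<Longrightarrow> norm (1 - complex_of_real (exp (- (real N * x)))) \<le> 1"
proof -
  assume x: "x \<ge> 0"
  have "norm (complex_of_real (1 - exp (- (real N * x)))) \<le> 1"
    unfolding norm_of_real using x by simp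
  thus ?thesis by simp
qed

text \<open>The factor 1 - exp (-N x) turns \<open>bose\<close> into a finite sum of exponentials.
  What results consists of Frullani differences \<open>A\<close>, exponentials \<open>B\<close>, and
  the derivative of \<open>F\<close>, which absorbs the remaining terms in 1/x and 1/x^2 and
  contributes -N since \<open>F\<close> falls from \<open>N\<close> to 0.\<close>

lemma truncated_bose_integral:
  assumes N: "N \<ge> 1"
  shows "(LINT x:{0<..}|lborel. bose_quot (of_real x) * (1 - of_real (exp (- (real N * x))))) =
     of_real (real N * ln (real N) - ln (fact N) - real N + harm N / 2)"
proof -
  define P where "P = (\<lambda>x. bose_quot (of_real x) * (1 - complex_of_real (exp (- (real N * x)))))"
  define A where "A = (\<lambda>x. \<Sum>n=1..N. complex_of_real ((exp (- (real n * x)) - exp (- (real N * x))) / x))"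
  define B where "B = (\<lambda>x. \<Sum>n=1..N. complex_of_real (exp (- (real n * x))))"
  define F where "F = (\<lambda>x. (1 - exp (- (real N * x))) / x)"
  define F' where "F' = (\<lambda>x. real N * exp (- (real N * x)) / x - (1 - exp (- (real N * x))) / x\<^sup>2)"
  have P: "set_integrable lborel {0<..} P"
  proof (rule set_integrable_bound[OF bose_quot_integrable])
    show "set_borel_measurable lborel {0<..} P"
      unfolding P_def set_borel_measurable_def bose_quot_def by measurable
    show "AE x in lborel. x \<in> {0<..} \<longrightarrow> norm (P x) \<le> norm (bose_quot (of_real x))"
    proof (intro AE_I2 impI)
      fix x :: real assume "x \<in> {0<..}"
      hence "norm (1 - complex_of_real (exp (- (real N * x)))) \<le> 1" 
        by (intro norm_one_minus_exp_le) auto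
      thus "norm (P x) \<le> norm (bose_quot (of_real x))" unfolding P_def norm_mult by (intro mult_left_le) auto
    qed
  qed
  have A: "set_integrable lborel {0<..} A" unfolding A_def
    by (intro set_integral_finite_sum frullani_exp) auto
  have B: "set_integrable lborel {0<..} B" unfolding B_def
    by (intro set_integral_finite_sum exp_integral_Ioi) auto
  have vA: "(LINT x:{0<..}|lborel. A x) = of_real (real N * ln (real N) - ln (fact N))"
  proof -
    have "(LINT x:{0<..}|lborel. A x) = (\<Sum>n=1..N. of_real (ln (real N) - ln (real n)))"
      unfolding A_def
      by (rule trans[OF set_integral_finite_sum(2)[OF frullani_exp(1)] sum.cong[OF refl frullani_exp(2)]]) auto
    also have "\<dots> = of_real (\<Sum>n=1..N. ln (real N) - ln (real n))" by simp
    also have "(\<Sum>n=1..N. ln (real N) - ln (real n)) = real N * ln (real N) - (\<Sum>n=1..N. ln (real n))"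
      by (simp add: sum_subtractf)
    also have "(\<Sum>n=1..N. ln (real n)) = ln (fact N)"
      by (induction N) (simp_all add: ln_mult)
    finally show ?thesis .
  qed
  have vB: "(LINT x:{0<..}|lborel. B x) = of_real (harm N)"
  proof -
    have "(LINT x:{0<..}|lborel. B x) = (\<Sum>n=1..N. 1 / of_real (real n))"
      unfolding B_def
      by (rule trans[OF set_integral_finite_sum(2)[OF exp_integral_Ioi(1)] sum.cong[OF refl exp_integral_Ioi(2)]]) auto
    also have "\<dots> = of_real (harm N)" by (simp add: harm_def inverse_eq_divide)
    finally show ?thesis .
  qed
  have eq: "P x = A x + of_real (F' x) + B x / 2" if "x > 0" for x
  proof -
    have B2: "bose (of_real x) * (1 - of_real (exp (- (real N * x)))) = B x" unfolding B_def by (rule bose_geometric[OF that])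
    have "A x = (\<Sum>n=1..N. complex_of_real (exp (- (real n * x))) / of_real x - complex_of_real (exp (- (real N * x))) / of_real x)"
      unfolding A_def by (intro sum.cong refl) (simp add: diff_divide_distrib)
    also have "\<dots> = B x / of_real x - of_nat N * (complex_of_real (exp (- (real N * x))) / of_real x)"
      unfolding B_def sum_subtractf by (simp add: sum_divide_distrib)
    finally have A2: "A x = B x / of_real x - of_nat N * (complex_of_real (exp (- (real N * x))) / of_real x)" .
    have "P x = (bose (of_real x) * (1 - of_real (exp (- (real N * x))))) / of_real x
        - (1 - of_real (exp (- (real N * x)))) / (of_real x)\<^sup>2 + (bose (of_real x) * (1 - of_real (exp (- (real N * x))))) / 2"
      unfolding P_def bose_quot_def by (simp add: ring_distribs diff_divide_distrib)
    thus ?thesis unfolding B2 A2 by (simp add: F'_def)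
  qed
  have F'i: "set_integrable lborel {0<..} (\<lambda>x. complex_of_real (F' x))"
  proof -
    have "set_integrable lborel {0<..} (\<lambda>x. P x - A x - B x / 2)"
      by (intro set_integral_diff(1) P A set_integrable_divide B)
    moreover have "set_integrable lborel {0<..} (\<lambda>x. P x - A x - B x / 2) = set_integrable lborel {0<..} (\<lambda>x. complex_of_real (F' x))"
      by (rule set_integrable_cong[OF refl refl]) (simp add: eq)
    ultimately show ?thesis by simp
  qed
  have vF: "(LINT x:{0<..}|lborel. complex_of_real (F' x)) = 0 - of_real (real N)"
  proof (rule set_lebesgue_integral_FTC_Ioi[OF _ _ F'i, where F = "\<lambda>x. complex_of_real (F x)"])
    show "((\<lambda>x. complex_of_real (F x)) has_vector_derivative complex_of_real (F' x)) (at x)" if "x > 0" for x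
    proof -
      have d: "(F has_real_derivative F' x) (at x)" unfolding F_def F'_def using that
        by (auto intro!: derivative_eq_intros simp: power2_eq_square diff_divide_distrib)
      show ?thesis
        by (rule has_vector_derivative_of_real)
           (use d d[unfolded has_real_derivative_iff_has_vector_derivative] in blast)
    qed
    show "continuous_on {0<..} (\<lambda>x. complex_of_real (F' x))"
      unfolding F'_def by (intro continuous_intros) auto
    have "(F \<longlongrightarrow> real N) (at_right 0)" unfolding F_def using N by real_asymp
    thus "((\<lambda>x. complex_of_real (F x)) \<longlongrightarrow> of_real (real N)) (at_right 0)" by (rule tendsto_of_real)
    have "(F \<longlongrightarrow> 0) at_top" unfolding F_def using N by real_asymp
    thus "((\<lambda>x. complex_of_real (F x)) \<longlongrightarrow> 0) at_top" using tendsto_of_real[of F 0] by simp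
  qed
  have "(LINT x:{0<..}|lborel. P x) = (LINT x:{0<..}|lborel. A x + of_real (F' x) + B x / 2)"
    by (rule set_lebesgue_integral_cong) (auto simp: eq)
  also have "\<dots> = of_real (real N * ln (real N) - ln (fact N)) + (0 - of_real (real N)) + of_real (harm N) / 2"
    using A B F'i vA vB vF by (simp add: set_integral_add)
  finally show ?thesis by (simp add: P_def)
qed

lemma truncated_bose_limit:
  "(\<lambda>N. LINT x:{0<..}|lborel. bose_quot (of_real x) * (1 - of_real (exp (- (real N * x))))) \<longlonglongrightarrow> bose_const"
  unfolding bose_const_def set_lebesgue_integral_def
proof (rule integral_dominated_convergence)
  show "integrable lborel (\<lambda>x. norm (indicator {0<..} x *\<^sub>R bose_quot (complex_of_real x)))"
    using bose_quot_integrable unfolding set_integrable_def by (rule integrable_norm)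
  show "AE x in lborel. (\<lambda>N. indicator {0<..} x *\<^sub>R (bose_quot (of_real x) * (1 - complex_of_real (exp (- (real N * x))))))
      \<longlonglongrightarrow> indicator {0<..} x *\<^sub>R bose_quot (of_real x)"
  proof (rule AE_I2)
    fix x :: real
    show "(\<lambda>N. indicator {0<..} x *\<^sub>R (bose_quot (of_real x) * (1 - complex_of_real (exp (- (real N * x))))))
      \<longlonglongrightarrow> indicator {0<..} x *\<^sub>R bose_quot (of_real x)"
    proof (cases "x > 0")
      case True
      have "(\<lambda>N. exp (- (real N * x))) \<longlonglongrightarrow> 0" using True by real_asymp
      hence "(\<lambda>N. indicator {0<..} x *\<^sub>R (bose_quot (of_real x) * (1 - complex_of_real (exp (- (real N * x))))))
        \<longlonglongrightarrow> indicator {0<..} x *\<^sub>R (bose_quot (of_real x) * (1 - complex_of_real 0))"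
        by (intro tendsto_intros)
      thus ?thesis by simp
    qed simp
  qed
  show "AE x in lborel. norm (indicator {0<..} x *\<^sub>R (bose_quot (of_real x) * (1 - complex_of_real (exp (- (real N * x))))))
     \<le> norm (indicator {0<..} x *\<^sub>R bose_quot (complex_of_real x))" for N
  proof (rule AE_I2)
    fix x :: real
    show "norm (indicator {0<..} x *\<^sub>R (bose_quot (of_real x) * (1 - complex_of_real (exp (- (real N * x))))))
     \<le> norm (indicator {0<..} x *\<^sub>R bose_quot (complex_of_real x))"
    proof (cases "x > 0")
      case True
      hence "norm (1 - complex_of_real (exp (- (real N * x)))) \<le> 1" 
        by (intro norm_one_minus_exp_le) auto
      thus ?thesis using True by (simp add: norm_mult mult_left_le)
    qed simp
  qed
qed (unfold bose_quot_def, measurable)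

text \<open>The truncated integrals equal N ln N - ln N! - N + H_N / 2, so their limit combines
  Euler's constant with the constant of Stirling's formula.\<close>

lemma bose_const_eq: "bose_const = of_real ((euler_mascheroni - ln (2 * pi)) / 2)"
proof -
  define L where "L = (\<lambda>N. real N * ln (real N) - ln (fact N) - real N + harm N / 2 :: real)"
  have "(\<lambda>N. complex_of_real (L N)) \<longlonglongrightarrow> bose_const"
    using truncated_bose_limit
    by (rule Lim_transform_eventually) 
       (use truncated_bose_integral in \<open>auto simp: L_def intro!: eventually_mono[OF eventually_ge_at_top[of 1]]\<close>)
  hence L: "L \<longlonglongrightarrow> Re bose_const" and im: "bose_const = of_real (Re bose_const)"
  proof -
    assume *: "(\<lambda>N. complex_of_real (L N)) \<longlonglongrightarrow> bose_const"
    from tendsto_Re[OF *] show "L \<longlonglongrightarrow> Re bose_const" by simp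
    from tendsto_Im[OF *] have "(\<lambda>N::nat. 0) \<longlonglongrightarrow> Im bose_const" by simp
    hence "Im bose_const = 0" using LIMSEQ_unique tendsto_const by blast
    thus "bose_const = of_real (Re bose_const)" by (simp add: complex_eq_iff)
  qed
  \<comment> \<open>\<open>e\<close> tends to Stirling's constant. It converges because the
    truncated integrals and H_N - ln N do, hence its limit is also that of
    \<open>2 * e N - e (2 * N)\<close>. The latter is evaluated by \<open>fact_double\<close> and
    the Gamma series at 1/2, whose limit is sqrt pi.\<close>
  define e where "e = (\<lambda>N. ln (fact N) - real N * ln (real N) + real N - ln (real N) / 2 :: real)"
  have "(\<lambda>N. (harm N - ln (real N)) / 2 - L N) \<longlonglongrightarrow> euler_mascheroni / 2 - Re bose_const"
    by (intro tendsto_intros euler_mascheroni_LIMSEQ L) simp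
  moreover have "(\<lambda>N. (harm N - ln (real N)) / 2 - L N) = e" by (simp add: e_def L_def fun_eq_iff field_simps)
  ultimately have e: "e \<longlonglongrightarrow> euler_mascheroni / 2 - Re bose_const" by simp
  have dbl: "filterlim (\<lambda>N::nat. 2 * N) at_top sequentially"
    by (rule filterlim_at_top_mono[OF filterlim_ident]) auto
  have e2: "(\<lambda>N. e (2 * N)) \<longlonglongrightarrow> euler_mascheroni / 2 - Re bose_const"
    by (rule filterlim_compose[OF e dbl])
  have lim1: "(\<lambda>N. 2 * e N - e (2 * N)) \<longlonglongrightarrow> 2 * (euler_mascheroni / 2 - Re bose_const) - (euler_mascheroni / 2 - Re bose_const)"
    by (intro tendsto_intros e e2)
  have "Gamma_series (1 / 2 :: real) \<longlonglongrightarrow> sqrt pi"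
    using Gamma_series_LIMSEQ[of "1 / 2 :: real"] by (simp add: Gamma_one_half_real)
  hence G: "(\<lambda>N. ln (Gamma_series (1 / 2) N)) \<longlonglongrightarrow> ln (sqrt pi)" by (intro tendsto_ln) auto
  have eqG: "\<forall>\<^sub>F N in sequentially. 2 * e N - e (2 * N) = ln (Gamma_series (1 / 2) N) + (ln 2 / 2 + ln ((real N + 1 / 2) / real N))"
  proof (rule eventually_mono[OF eventually_ge_at_top[of 1]])
    fix N :: nat assume N: "1 \<le> N"
    define p where "p = pochhammer (1 / 2 :: real) N"
    have p: "p > 0" unfolding p_def by (intro pochhammer_pos) auto
    have "fact (2 * N) = 2 ^ (2 * N) * p * (fact N :: real)" unfolding p_def by (rule fact_double)
    hence f2: "ln (fact (2 * N)) = real (2 * N) * ln 2 + ln p + ln (fact N :: real)"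
      using p by (simp add: ln_mult ln_realpow)
    have "Gamma_series (1 / 2) N = fact N * exp (1 / 2 * ln (real N)) / (p * (1 / 2 + real N))"
      by (simp add: Gamma_series_def p_def pochhammer_Suc)
    hence g: "ln (Gamma_series (1 / 2) N) = ln (fact N) + ln (real N) / 2 - ln p - ln (1 / 2 + real N)"
      using p N by (simp add: ln_mult ln_div)
    have l2: "ln (real (2 * N)) = ln 2 + ln (real N)" using N by (simp add: ln_mult)
    have l3: "ln ((real N + 1 / 2) / real N) = ln (1 / 2 + real N) - ln (real N)"
      using N by (simp add: ln_div add.commute)
    show "2 * e N - e (2 * N) = ln (Gamma_series (1 / 2) N) + (ln 2 / 2 + ln ((real N + 1 / 2) / real N))"
      unfolding e_def f2 g l2 l3 by (simp add: field_simps)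
  qed
  have "(\<lambda>N. ln ((real N + 1 / 2) / real N)) \<longlonglongrightarrow> 0" by real_asymp
  hence "(\<lambda>N. ln (Gamma_series (1 / 2) N) + (ln 2 / 2 + ln ((real N + 1 / 2) / real N))) \<longlonglongrightarrow> ln (sqrt pi) + (ln 2 / 2 + 0)"
    by (intro tendsto_add G tendsto_const)
  hence "(\<lambda>N. 2 * e N - e (2 * N)) \<longlonglongrightarrow> ln (sqrt pi) + (ln 2 / 2 + 0)"
    by (rule Lim_transform_eventually) (use eqG in \<open>auto elim: eventually_mono\<close>)
  with lim1 have "euler_mascheroni / 2 - Re bose_const = ln (sqrt pi) + ln 2 / 2"
    using LIMSEQ_unique by force
  also have "ln (sqrt pi) + ln 2 / 2 = ln (2 * pi) / 2" by (simp add: ln_sqrt ln_mult add_divide_distrib)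
  finally have "Re bose_const = (euler_mascheroni - ln (2 * pi)) / 2" by (simp add: field_simps)
  with im show ?thesis by metis
qed

text \<open>The two bounds give the majorant \<open>2 * B / (1 + x\<^sup>2)\<close> with integral
  \<open>B * pi\<close>; the 4 is pi rounded up.\<close>

lemma norm_set_integral_Ioi_bound_square:
  fixes f :: "real \<Rightarrow> complex"
  assumes cont: "continuous_on {0<..} f"
    and b: "\<And>x. x > 0 \<Longrightarrow> norm (f x) \<le> B" "\<And>x. x > 0 \<Longrightarrow> norm (f x) \<le> B / x\<^sup>2"
  shows "norm (LINT x:{0<..}|lborel. f x) \<le> 4 * B"
proof -
  have B: "B \<ge> 0" using b(1)[of 1] by (smt (verit) norm_ge_zero)
  have fi: "set_integrable lborel {0<..} f" by (rule set_integrable_Ioi_bound_square[OF cont b])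
  have ein: "einterval (ereal 0) \<infinity> = {0<..}" by (simp add: einterval_eq)
  have l0: "((\<lambda>x. 2 * B * arctan x) \<longlongrightarrow> 2 * B * arctan 0) (at_right 0)" by (intro tendsto_intros)
  have l1: "((\<lambda>x. 2 * B * arctan x) \<longlongrightarrow> 2 * B * (pi / 2)) at_top" by (intro tendsto_intros tendsto_arctan_at_top)
  have F: "DERIV (\<lambda>x. 2 * B * arctan x) x :> 2 * B * inverse (1 + x\<^sup>2)" for x
    by (auto intro!: derivative_eq_intros)
  have cc: "isCont (\<lambda>x. 2 * B * inverse (1 + x\<^sup>2)) x" for x :: real
  proof -
    have "1 + x\<^sup>2 > 0" by (rule add_pos_nonneg) auto
    thus ?thesis by (intro continuous_intros) auto
  qed
  have I: "set_integrable lborel (einterval (ereal 0) \<infinity>) (\<lambda>x. 2 * B * inverse (1 + x\<^sup>2))"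
    "(LBINT x=ereal 0..\<infinity>. 2 * B * inverse (1 + x\<^sup>2)) = 2 * B * (pi / 2) - 2 * B * arctan 0"
    by (rule interval_integral_FTC_nonneg[where F = "\<lambda>x. 2 * B * arctan x"];
        (use F l0 l1 B cc in \<open>simp add: ereal_tendsto_simps\<close>))+
  have I': "set_integrable lborel {0<..} (\<lambda>x. 2 * B * inverse (1 + x\<^sup>2))"
    "(LINT x:{0<..}|lborel. 2 * B * inverse (1 + x\<^sup>2)) = B * pi"
    using I unfolding interval_lebesgue_integral_def ein by simp_all
  have "norm (LINT x:{0<..}|lborel. f x) \<le> (LINT x:{0<..}|lborel. norm (f x))"
    by (rule set_integral_norm_bound[OF fi])
  also have "\<dots> \<le> (LINT x:{0<..}|lborel. 2 * B * inverse (1 + x\<^sup>2))"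
  proof (rule set_integral_mono[OF set_integrable_norm[OF fi] I'(1)])
    fix x :: real assume "x \<in> {0<..}"
    hence x: "x > 0" by simp
    have "1 + x\<^sup>2 > 0" by (rule add_pos_nonneg) auto
    moreover have "norm (f x) * x\<^sup>2 \<le> B" using b(2)[OF x] x by (simp add: field_simps)
    hence "norm (f x) * (1 + x\<^sup>2) \<le> 2 * B" using b(1)[OF x] by (simp add: ring_distribs)
    ultimately show "norm (f x) \<le> 2 * B * inverse (1 + x\<^sup>2)" 
      by (simp add: divide_inverse[symmetric] pos_le_divide_eq)
  qed
  also have "\<dots> = B * pi" by (rule I')
  also have "\<dots> \<le> B * 4" using pi_less_4 B by (intro mult_left_mono) auto
  finally show ?thesis by simp
qed

text \<open>Cubic decay leaves 1/x^2 after multiplication by the linear bound for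
  \<open>bose_rem\<close>.\<close>

lemma norm_bose_le_inverse_cube: assumes "Re w > 0" shows "norm (bose w) \<le> 6 / (Re w) ^ 3"
proof -
  define r where "r = Re w"
  have r: "r > 0" using assms by (simp add: r_def)
  have "(\<Sum>n\<in>{0, 3}. inverse (fact n) * r ^ n) \<le> (\<Sum>n. inverse (fact n) * r ^ n)"
    by (rule sum_le_suminf) (use summable_exp[of r] r in auto)
  also have "(\<Sum>n. inverse (fact n) * r ^ n) = exp r" by (simp add: exp_def)
  finally have "r ^ 3 / 6 \<le> exp r - 1" by (simp add: fact_numeral)
  hence "1 / (exp r - 1) \<le> 1 / (r ^ 3 / 6)" using r by (intro frac_le) auto
  thus ?thesis using norm_bose_le[OF assms] by (simp add: r_def)
qed

lemma Re_mult_segment: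
  assumes u: "u \<in> closed_segment a b" and "m \<le> Re (a * c)" "m \<le> Re (b * c)"
  shows "m \<le> Re (u * c)"
proof -
  obtain l where l: "0 \<le> l" "l \<le> 1" "u = (1 - l) *\<^sub>R a + l *\<^sub>R b" using u by (auto simp: in_segment)
  have "Re (u * c) = (1 - l) * Re (a * c) + l * Re (b * c)" unfolding l(3) by (simp add: algebra_simps)
  moreover have "(1 - l) * m \<le> (1 - l) * Re (a * c)" "l * m \<le> l * Re (b * c)"
    using l assms by (intro mult_left_mono; simp)+
  ultimately show ?thesis by (simp add: algebra_simps)
qed

lemma norm_segment_le:
  assumes "u \<in> closed_segment a b" shows "norm u \<le> max (norm a) (norm (b :: complex))"
proof -
  have "closed_segment a b \<subseteq> cball 0 (max (norm a) (norm b))"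
    by (rule closed_segment_subset) auto
  thus ?thesis using assms by (auto simp: subset_iff)
qed

lemma segment_scaled:
  assumes y: "y > 0" and x: "x \<in> closed_segment (of_real y * a) (of_real y * b)"
  obtains u where "u \<in> closed_segment a b" "x = of_real y * (u :: complex)"
proof -
  obtain l where l: "0 \<le> l" "l \<le> 1" "x = (1 - l) *\<^sub>R (of_real y * a) + l *\<^sub>R (of_real y * b)"
    using x by (auto simp: in_segment)
  have "x = of_real y * ((1 - l) *\<^sub>R a + l *\<^sub>R b)" unfolding l(3) by (simp add: algebra_simps scaleR_conv_of_real)
  thus ?thesis using l by (intro that[of "(1 - l) *\<^sub>R a + l *\<^sub>R b"]) (auto simp: in_segment)
qed

text \<open>\<open>Re (x * c)\<close> is affine in \<open>x\<close>, so on a segment it is at least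
  the smaller endpoint value. By homogeneity in \<open>y\<close> one opening \<open>\<rho>\<close>
  and one lower bound \<open>m\<close> then serve the whole sector between the two rays.\<close>

lemma cone_on_segment:
  assumes a: "Re (a * c) > 0" and b: "Re (b * c) > 0"
  obtains \<rho> m where "\<rho> \<ge> 1" "m > 0"
    "\<And>y x. y > 0 \<Longrightarrow> x \<in> closed_segment (of_real y * a) (of_real y * b) \<Longrightarrow> 
       Re (x * c) > 0 \<and> norm (x * c) \<le> \<rho> * Re (x * c) \<and> m * y \<le> norm (x * c)"
proof -
  define m where "m = min (Re (a * c)) (Re (b * c))"
  define K where "K = max (norm a) (norm b) * norm c"
  define \<rho> where "\<rho> = max 1 (K / m)"
  have m: "m > 0" using a b by (simp add: m_def)
  show ?thesis
  proof (rule that[of \<rho> m])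
    fix y :: real and x assume y: "y > 0" and x: "x \<in> closed_segment (of_real y * a) (of_real y * b)"
    obtain u where u: "u \<in> closed_segment a b" "x = of_real y * u" using segment_scaled[OF y x] .
    have 1: "m \<le> Re (u * c)" by (rule Re_mult_segment[OF u(1)]) (auto simp: m_def)
    have 2: "norm (u * c) \<le> K" unfolding K_def norm_mult using norm_segment_le[OF u(1)] by (intro mult_right_mono) auto
    have re: "Re (x * c) = y * Re (u * c)" unfolding u(2) by (simp add: mult.assoc)
    have no: "norm (x * c) = y * norm (u * c)" unfolding u(2) using y by (simp add: norm_mult mult.assoc)
    have 3: "Re (x * c) > 0" unfolding re using 1 m y by simp
    have "K = K / m * m" using m by simp
    also have "\<dots> \<le> \<rho> * Re (u * c)" using 1 m by (intro mult_mono) (auto simp: \<rho>_def)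
    finally have "norm (u * c) \<le> \<rho> * Re (u * c)" using 2 by linarith
    hence "y * norm (u * c) \<le> y * (\<rho> * Re (u * c))" using y by (intro mult_left_mono) auto
    hence 4: "norm (x * c) \<le> \<rho> * Re (x * c)" unfolding re no by (simp only: mult.left_commute)
    have "m \<le> norm (u * c)" using 1 complex_Re_le_cmod[of "u * c"] by linarith
    hence "m * y \<le> norm (x * c)" unfolding no using y mult_right_mono[of m "norm (u * c)" y] by (simp add: mult.commute)
    with 3 4 show "Re (x * c) > 0 \<and> norm (x * c) \<le> \<rho> * Re (x * c) \<and> m * y \<le> norm (x * c)" by blast
  qed (use m in \<open>auto simp: \<rho>_def\<close>)
qed

lemma open_Re_mult_pos: "open {x. Re (x * c) > 0}"
proof -
  have "{x. Re (x * c) > 0} = (\<lambda>x. x * c) -` {z. Re z > 0}" by auto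
  moreover have "open ((\<lambda>x. x * c) -` {z. Re z > 0})"
    by (intro open_vimage open_halfspace_Re_gt continuous_intros)
  ultimately show ?thesis by simp
qed

lemma convex_Re_mult_pos: "convex {x. Re (x * c) > 0}"
proof -
  have "{x. Re (x * c) > 0} = (\<lambda>x. x * c) -` {z. Re z > 0}" by auto
  moreover have "convex ((\<lambda>x. x * c) -` {z. Re z > 0})"
    by (intro convex_linear_vimage convex_halfspace_Re_gt) (auto intro!: linearI simp: ring_distribs)
  ultimately show ?thesis by simp
qed

text \<open>Rotation back to the positive axis, where the integral is \<open>bose_const\<close>; the
  factor 1/c is the Jacobian of the ray.\<close>

lemma bose_quot_ray:
  assumes c: "Re c > 0"
  shows "set_integrable lborel {0<..} (\<lambda>x. bose_quot (of_real x * c))"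
    "(LINT x:{0<..}|lborel. bose_quot (of_real x * c)) = bose_const / c"
proof -
  obtain \<rho> m where rm: "\<rho> \<ge> 1" "m > 0"
    "\<And>y x. y > 0 \<Longrightarrow> x \<in> closed_segment (of_real y * 1) (of_real y * c) \<Longrightarrow> 
       Re (x * 1) > 0 \<and> norm (x * 1) \<le> \<rho> * Re (x * 1) \<and> m * y \<le> norm (x * 1)"
    using cone_on_segment[of 1 1 c] c by auto
  define B where "B = 14 * \<rho>\<^sup>2 * max 1 (1 / m\<^sup>2)"
  have hol: "bose_quot holomorphic_on {x. Re (x * 1) > 0}" by (rule bose_quot_holomorphic) auto
  have bd: "norm (bose_quot x) \<le> B" "norm (bose_quot x) \<le> B / y\<^sup>2"
    if y: "y > 0" and x: "x \<in> closed_segment (of_real y * 1) (of_real y * c)" for x y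
  proof -
    have X: "Re x > 0" "norm x \<le> \<rho> * Re x" "m * y \<le> norm x" using rm(3)[OF y x] by auto
    have "norm (bose_quot x) \<le> 14 * \<rho>\<^sup>2 * 1" using norm_bose_quot_cone(2)[OF X(1,2) rm(1)] by simp
    also have "\<dots> \<le> B" unfolding B_def by (intro mult_left_mono) auto
    finally show "norm (bose_quot x) \<le> B" .
    have "norm (bose_quot x) \<le> 14 * \<rho>\<^sup>2 * (1 / norm x)\<^sup>2" by (rule norm_bose_quot_cone(1)[OF X(1,2) rm(1)])
    also have "\<dots> \<le> 14 * \<rho>\<^sup>2 * (1 / (m * y))\<^sup>2"
      using X rm y by (intro mult_left_mono power_mono frac_le) auto
    also have "\<dots> = 14 * \<rho>\<^sup>2 * (1 / m\<^sup>2) / y\<^sup>2" by (simp add: power_divide power_mult_distrib)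
    also have "\<dots> \<le> B / y\<^sup>2" unfolding B_def by (intro divide_right_mono mult_left_mono) auto
    finally show "norm (bose_quot x) \<le> B / y\<^sup>2" .
  qed
  have B0: "B \<ge> 0" by (simp add: B_def)
  have seg: "closed_segment (of_real y * 1) (of_real y * c) \<subseteq> {x. Re (x * 1) > 0}" if "y > 0" for y
    using rm(3)[OF that] by blast
  note r = ray_rotation[OF hol open_Re_mult_pos convex_Re_mult_pos seg
     bound_sqrt_of_bound_square(1)[OF _ bd B0] bound_sqrt_of_bound_square(2)[OF _ bd B0]]
  show "set_integrable lborel {0<..} (\<lambda>x. bose_quot (of_real x * c))" by (rule r(2)) auto
  have "1 * (LINT x:{0<..}|lborel. bose_quot (of_real x * 1)) = c * (LINT x:{0<..}|lborel. bose_quot (of_real x * c))"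
    by (rule r(3)) auto
  moreover have "c \<noteq> 0" using c by auto
  ultimately show "(LINT x:{0<..}|lborel. bose_quot (of_real x * c)) = bose_const / c"
    by (simp add: bose_const_def field_simps)
qed

text \<open>The part of the pair integral that is only estimated: \<open>bose_rem\<close> is small
  because its argument contains c + 1/c, which is small in the intended application.\<close>

definition bose_error :: "complex \<Rightarrow> complex" where
  "bose_error c = (LINT x:{0<..}|lborel. bose (of_real x * c) * bose_rem (of_real x * (c + 1 / c)))"

lemma Re_inverse_pos: "Re c > 0 \<Longrightarrow> Re (1 / c) > 0"
  by (simp add: Re_divide_numeral complex_div_gt_0 Re_divide)
     (metis complex_neq_0 divide_pos_pos less_irrefl zero_complex.simps(1))

text \<open>The new direction \<open>d\<close> is left free, subject to the two sign conditions that
  keep both arguments in the right half-plane throughout the sector. It serves later to leave the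
  neighbourhood of the imaginary axis.\<close>

lemma bose_error_ray:
  assumes c: "Re c > 0" and d: "Re (d * c) > 0" "Re (d * (c + 1 / c)) > 0"
  shows "set_integrable lborel {0<..} (\<lambda>x. bose (of_real x * c) * bose_rem (of_real x * (c + 1 / c)))"
    "bose_error c = d * (LINT x:{0<..}|lborel. bose (of_real x * d * c) * bose_rem (of_real x * d * (c + 1 / c)))"
proof -
  define S where "S = c + 1 / c"
  have S: "Re S > 0" using c Re_inverse_pos[OF c] by (simp add: S_def)
  define \<Omega> where "\<Omega> = {x. Re (x * c) > 0} \<inter> {x. Re (x * S) > 0}"
  define F where "F = (\<lambda>x. bose (x * c) * bose_rem (x * S))"
  have op: "open \<Omega>" unfolding \<Omega>_def by (intro open_Int open_Re_mult_pos)
  have cv: "convex \<Omega>" unfolding \<Omega>_def by (intro convex_Int convex_Re_mult_pos)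
  have hb: "bose holomorphic_on {w. Re w > 0}" by (rule bose_holomorphic) auto
  have hr: "bose_rem holomorphic_on {w. Re w > 0}" by (rule bose_rem_holomorphic) auto
  have h1: "(\<lambda>x. bose (x * c)) holomorphic_on \<Omega>"
    by (rule holomorphic_on_compose_gen[OF _ hb, unfolded o_def]) (auto intro!: holomorphic_intros simp: \<Omega>_def)
  have h2: "(\<lambda>x. bose_rem (x * S)) holomorphic_on \<Omega>"
    by (rule holomorphic_on_compose_gen[OF _ hr, unfolded o_def]) (auto intro!: holomorphic_intros simp: \<Omega>_def)
  have hol: "F holomorphic_on \<Omega>" unfolding F_def by (intro holomorphic_intros h1 h2)
  obtain \<rho> m where rm: "\<rho> \<ge> 1" "m > 0"
    "\<And>y x. y > 0 \<Longrightarrow> x \<in> closed_segment (of_real y * 1) (of_real y * d) \<Longrightarrow> 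
       Re (x * c) > 0 \<and> norm (x * c) \<le> \<rho> * Re (x * c) \<and> m * y \<le> norm (x * c)"
    using cone_on_segment[of 1 c d] c d by auto
  obtain \<rho>' m' where rm': "\<rho>' \<ge> 1" "m' > 0"
    "\<And>y x. y > 0 \<Longrightarrow> x \<in> closed_segment (of_real y * 1) (of_real y * d) \<Longrightarrow> 
       Re (x * S) > 0 \<and> norm (x * S) \<le> \<rho>' * Re (x * S) \<and> m' * y \<le> norm (x * S)"
    using cone_on_segment[of 1 S d] S d unfolding S_def by auto
  define B where "B = max (\<rho> * 9 * \<rho>' * norm S / norm c) (2 * \<rho>\<^sup>2 / m\<^sup>2 * (9 * \<rho>'))"
  have c0: "norm c > 0" using c by auto
  have bd: "norm (F x) \<le> B" "norm (F x) \<le> B / y\<^sup>2"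
    if y: "y > 0" and x: "x \<in> closed_segment (of_real y * 1) (of_real y * d)" for x y
  proof -
    have X: "Re (x * c) > 0" "norm (x * c) \<le> \<rho> * Re (x * c)" "m * y \<le> norm (x * c)" using rm(3)[OF y x] by auto
    have Y: "Re (x * S) > 0" "norm (x * S) \<le> \<rho>' * Re (x * S)" using rm'(3)[OF y x] by auto
    have x0: "norm x > 0" using X by auto
    have "norm (F x) \<le> (\<rho> / norm (x * c)) * (9 * \<rho>' * norm (x * S))"
      unfolding F_def norm_mult[of "bose _"] using norm_bose_cone(1)[OF X(1,2)] norm_bose_rem_cone(1)[OF Y rm'(1)] rm
      by (intro mult_mono) auto
    also have "\<dots> = \<rho> * 9 * \<rho>' * norm S / norm c" using x0 c0 by (simp add: norm_mult field_simps)
    also have "\<dots> \<le> B" by (simp add: B_def)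
    finally show "norm (F x) \<le> B" .
    have "norm (F x) \<le> (2 * \<rho>\<^sup>2 / (norm (x * c))\<^sup>2) * (9 * \<rho>')"
      unfolding F_def norm_mult[of "bose _"] using norm_bose_cone(2)[OF X(1,2)] norm_bose_rem_cone(2)[OF Y rm'(1)] rm
      by (intro mult_mono) auto
    also have "\<dots> \<le> (2 * \<rho>\<^sup>2 / (m * y)\<^sup>2) * (9 * \<rho>')"
    proof -
      have my: "0 < m * y" using rm(2) y by simp
      have "0 < norm (x * c)" using my X(3) by linarith
      hence "0 < (norm (x * c))\<^sup>2 * (m * y)\<^sup>2" by (rule mult_pos_pos[OF zero_less_power zero_less_power[OF my]])
      moreover have "(m * y)\<^sup>2 \<le> (norm (x * c))\<^sup>2" using my X(3) by (intro power_mono) auto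
      ultimately show ?thesis using rm'(1) by (intro mult_right_mono divide_left_mono) auto
    qed
    also have "\<dots> = (2 * \<rho>\<^sup>2 / m\<^sup>2 * (9 * \<rho>')) / y\<^sup>2" by (simp add: power_mult_distrib)
    also have "\<dots> \<le> B / y\<^sup>2" unfolding B_def by (intro divide_right_mono) auto
    finally show "norm (F x) \<le> B / y\<^sup>2" .
  qed
  have B0: "B \<ge> 0" using bd(1)[of 1 1] by (smt (verit) norm_ge_zero ends_in_segment(1) mult.right_neutral of_real_1 zero_less_one)
  have seg: "closed_segment (of_real y * 1) (of_real y * d) \<subseteq> \<Omega>" if "y > 0" for y
    using rm(3)[OF that] rm'(3)[OF that] unfolding \<Omega>_def by blast
  note r = ray_rotation[OF hol op cv seg
     bound_sqrt_of_bound_square(1)[OF _ bd B0] bound_sqrt_of_bound_square(2)[OF _ bd B0]]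
  have "set_integrable lborel {0<..} (\<lambda>y. F (of_real y * 1))" by (rule r(1)) auto
  thus "set_integrable lborel {0<..} (\<lambda>x. bose (of_real x * c) * bose_rem (of_real x * (c + 1 / c)))"
    by (simp add: F_def S_def)
  have "1 * (LINT y:{0<..}|lborel. F (of_real y * 1)) = d * (LINT y:{0<..}|lborel. F (of_real y * d))" by (rule r(3)) auto
  thus "bose_error c = d * (LINT x:{0<..}|lborel. bose (of_real x * d * c) * bose_rem (of_real x * d * (c + 1 / c)))"
    by (simp add: F_def S_def bose_error_def)
qed

text \<open>The decomposition is integrated piece by piece: two remainders, \<open>bose_quot\<close>
  along the rays of \<open>c\<close> and \<open>1 / c\<close>, and two Frullani differences. The
  logarithms merge because Ln (1/c) = - Ln c in the right half-plane.\<close>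

lemma bose_pair_integral:
  assumes c: "Re c > 0"
  shows "(LINT x:{0<..}|lborel. bose_cut (of_real x * c) * bose_cut (of_real x / c)) =
     bose_error c + bose_error (1 / c) + (2 * bose_const - Ln (c + 1 / c)) / (c + 1 / c)
       - bose_const * (c + 1 / c) + (1 / c - c) * Ln c"
proof -
  define k where "k = 1 / c"
  define S where "S = c + 1 / c"
  define t where "t = 1 / S"
  have k: "Re k > 0" unfolding k_def by (rule Re_inverse_pos[OF c])
  have S: "Re S > 0" using c k by (simp add: S_def k_def)
  have c0: "c \<noteq> 0" "k \<noteq> 0" "S \<noteq> 0" using c k S by auto
  define T where "T = (\<lambda>c x. S * bose (of_real x * S) - c * bose (of_real x * c))"
  have Ti: "set_integrable lborel {0<..} (T m)" "(LINT x:{0<..}|lborel. T m x) = Ln m - Ln S" if "Re m > 0" for m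
    unfolding T_def by (rule frullani_bose[OF S that])+
  have err: "set_integrable lborel {0<..} (\<lambda>x. bose (of_real x * c) * bose_rem (of_real x * S))"
    using bose_error_ray(1)[OF c, of 1] c S by (simp add: S_def)
  have err': "set_integrable lborel {0<..} (\<lambda>x. bose (of_real x * k) * bose_rem (of_real x * S))"
    using bose_error_ray(1)[OF k, of 1] k S by (simp add: S_def k_def add.commute)
  have eq: "bose_cut (of_real x * c) * bose_cut (of_real x / c) =
      (bose (of_real x * c) * bose_rem (of_real x * S) - c ^ 3 * t * bose_quot (of_real x * c) + (k\<^sup>2 + 1 - c\<^sup>2) / 2 * t * T c x)
    + (bose (of_real x * k) * bose_rem (of_real x * S) - k ^ 3 * t * bose_quot (of_real x * k) + (c\<^sup>2 + 1 - k\<^sup>2) / 2 * t * T k x)"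
    if x: "x > 0" for x
  proof -
    have xk: "of_real x / c = of_real x * k" by (simp add: k_def)
    have "exp (of_real x * k) \<noteq> 1" using exp_neq_1_Re_pos[of "of_real x * k"] x k by simp
    hence e2: "exp (of_real x / c) \<noteq> 1" unfolding xk .
    have e: "exp (of_real x * c) \<noteq> 1" "exp (of_real x * (c + 1 / c)) \<noteq> 1"
      using exp_neq_1_Re_pos[of "of_real x * c"] exp_neq_1_Re_pos[of "of_real x * S"] x c S
      by (simp_all add: S_def)
    have tT: "t * T m x = bose (of_real x * S) - bose (of_real x * m) * (m * t)" for m
      using c0 by (simp add: T_def t_def right_diff_distrib)
    have S0: "c + 1 / c \<noteq> 0" using c0 by (simp add: S_def)
    have x0: "complex_of_real x \<noteq> 0" using x by simp
    show ?thesis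
      unfolding mult.assoc[of _ t "T _ _"] tT unfolding xk[symmetric] unfolding t_def S_def unfolding k_def
      by (rule bose_cut_mult[OF c0(1) S0 x0 e(1) e2 e(2)])
  qed
  have "(LINT x:{0<..}|lborel. bose_cut (of_real x * c) * bose_cut (of_real x / c)) = 
     (LINT x:{0<..}|lborel. (bose (of_real x * c) * bose_rem (of_real x * S) - c ^ 3 * t * bose_quot (of_real x * c) + (k\<^sup>2 + 1 - c\<^sup>2) / 2 * t * T c x)
    + (bose (of_real x * k) * bose_rem (of_real x * S) - k ^ 3 * t * bose_quot (of_real x * k) + (c\<^sup>2 + 1 - k\<^sup>2) / 2 * t * T k x))"
    by (rule set_lebesgue_integral_cong) (use eq in auto)
  also have "\<dots> = ((LINT x:{0<..}|lborel. bose (of_real x * c) * bose_rem (of_real x * S)) - c ^ 3 * t * (bose_const / c) 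
      + (k\<^sup>2 + 1 - c\<^sup>2) / 2 * t * (Ln c - Ln S))
    + ((LINT x:{0<..}|lborel. bose (of_real x * k) * bose_rem (of_real x * S)) - k ^ 3 * t * (bose_const / k)
      + (c\<^sup>2 + 1 - k\<^sup>2) / 2 * t * (Ln k - Ln S))"
    using err err' bose_quot_ray[OF c] bose_quot_ray[OF k] Ti[OF c] Ti[OF k]
    by (simp add: set_integral_add set_integral_diff)
  also have "(LINT x:{0<..}|lborel. bose (of_real x * c) * bose_rem (of_real x * S)) = bose_error c"
    by (simp add: bose_error_def S_def)
  also have "(LINT x:{0<..}|lborel. bose (of_real x * k) * bose_rem (of_real x * S)) = bose_error (1 / c)"
    by (simp add: bose_error_def S_def k_def add.commute)
  also have "Ln k = - Ln c"
  proof -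
    have "Ln (inverse c) = - Ln c" by (rule Ln_inverse) (use c in \<open>auto simp: complex_nonpos_Reals_iff\<close>)
    thus ?thesis by (simp add: k_def inverse_eq_divide)
  qed
  also have "(bose_error c - c ^ 3 * t * (bose_const / c) + (k\<^sup>2 + 1 - c\<^sup>2) / 2 * t * (Ln c - Ln S))
    + (bose_error (1 / c) - k ^ 3 * t * (bose_const / k) + (c\<^sup>2 + 1 - k\<^sup>2) / 2 * t * (- Ln c - Ln S))
    = bose_error c + bose_error (1 / c) + (2 * bose_const - Ln S) / S - bose_const * S + (k - c) * Ln c"
  proof -
    have ck: "c * k = 1" "t * (c + k) = 1" "S = c + k" using c0 by (simp_all add: k_def t_def S_def)
    have 1: "c ^ 3 * t * (bose_const / c) = c\<^sup>2 * t * bose_const" "k ^ 3 * t * (bose_const / k) = k\<^sup>2 * t * bose_const"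
      using c0 by (simp_all add: power3_eq_cube power2_eq_square)
    have 2: "(2 * bose_const - Ln S) / S = (2 * bose_const - Ln S) * t" by (simp add: t_def)
    \<comment> \<open>Since c k = 1, c^2 + k^2 is the square of c + k diminished by 2.\<close>
    have 3: "(c\<^sup>2 + k\<^sup>2) * t = S - 2 * t" unfolding ck(3) using ck(1,2) by algebra
    have 4: "(k\<^sup>2 - c\<^sup>2) * t = k - c" using ck(1,2) by algebra
    have "(k\<^sup>2 + 1 - c\<^sup>2) / 2 * t * (Ln c - Ln S) + (c\<^sup>2 + 1 - k\<^sup>2) / 2 * t * (- Ln c - Ln S)
       = (k\<^sup>2 - c\<^sup>2) * t * Ln c - t * Ln S" by (simp add: field_simps)
    moreover have "c\<^sup>2 * t * bose_const + k\<^sup>2 * t * bose_const = ((c\<^sup>2 + k\<^sup>2) * t) * bose_const" by (simp add: algebra_simps)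
    ultimately show ?thesis unfolding 1 2 3 4 by (simp add: algebra_simps)
  qed
  finally show ?thesis by (simp add: k_def S_def)
qed

section \<open>Directions close to the imaginary axis\<close>

definition zdir :: "complex \<Rightarrow> complex" where "zdir z = exp (\<i> * (of_real pi / 2 - z))"

lemma zdir_inverse: "1 / zdir z = exp (- (\<i> * (of_real pi / 2 - z)))"
  unfolding zdir_def exp_minus by (simp add: inverse_eq_divide)

text \<open>The two directions nearly cancel for small \<open>z\<close>. With z = p/2 the quantity
  \<open>2 * sin z\<close> plays the role of \<open>p\<close> until the final comparison.\<close>

lemma zdir_sum: "zdir z + 1 / zdir z = 2 * sin z"
proof -
  have "sin z = cos (of_real pi / 2 - z)" by (rule sin_cos_eq)
  also have "\<dots> = (zdir z + 1 / zdir z) / 2" unfolding zdir_inverse unfolding zdir_def by (rule cos_exp_eq)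
  finally show ?thesis by (simp add: mult.commute)
qed

lemma zdir_diff: "zdir z - 1 / zdir z = 2 * \<i> * cos z"
proof -
  have "cos z = sin (of_real pi / 2 - z)" by (rule cos_sin_eq)
  also have "\<dots> = (zdir z - 1 / zdir z) / (2 * \<i>)" unfolding zdir_inverse unfolding zdir_def by (rule sin_exp_eq)
  finally show ?thesis by simp
qed

lemma Re_zdir_pos: assumes "0 < Re z" "Re z < pi" shows "Re (zdir z) > 0"
proof -
  have "Re (zdir z) = exp (Im z) * cos (pi / 2 - Re z)" by (simp add: zdir_def Re_exp)
  also have "cos (pi / 2 - Re z) = sin (Re z)" by (simp add: sin_cos_eq)
  finally show ?thesis using sin_gt_zero[OF assms] by simp
qed

lemma Ln_zdir: assumes "0 < Re z" "Re z < pi" shows "Ln (zdir z) = \<i> * (of_real pi / 2 - z)"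
  unfolding zdir_def by (rule Ln_exp) (use assms in auto)

lemma zdir_cnj: "1 / zdir z = cnj (zdir (cnj z))"
  unfolding zdir_inverse unfolding zdir_def exp_cnj by simp

lemma bose_cnj: "bose (cnj w) = cnj (bose w)"
  by (simp add: bose_def exp_cnj)

lemma bose_cut_cnj: "bose_cut (cnj w) = cnj (bose_cut w)"
  by (simp add: bose_cut_def bose_cnj)

lemma bose_error_cnj: "bose_error (cnj c) = cnj (bose_error c)"
proof -
  have "bose (of_real x * cnj c) * bose_rem (of_real x * (cnj c + 1 / cnj c)) =
     cnj (bose (of_real x * c) * bose_rem (of_real x * (c + 1 / c)))" for x
  proof -
    have "bose_rem (cnj w) = cnj (bose_rem w)" for w by (simp add: bose_rem_def bose_cnj)
    from this[of "of_real x * (c + 1 / c)"] bose_cnj[of "of_real x * c"] show ?thesis by simp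
  qed
  thus ?thesis unfolding bose_error_def set_lebesgue_integral_def
    by (simp flip: Bochner_Integration.integral_cnj)
qed

lemma norm_exp_minus_one_le:
  assumes "norm w \<le> 1 / 6" shows "norm (exp w - 1) \<le> 3 * norm (w :: complex)"
proof -
  have "norm (exp w - 1) \<le> exp \<bar>Re w\<bar> * norm w" using Taylor_exp[of w 0] by simp
  also have "exp \<bar>Re w\<bar> \<le> exp 1" using abs_Re_le_cmod[of w] assms by simp
  also have "exp 1 \<le> (3::real)" by (rule exp_le)
  finally show ?thesis by (simp add: mult_right_mono)
qed

lemma sin_small_bounds:
  assumes "0 < Re z" "norm z \<le> 1 / 6"
  shows "norm (sin z) \<le> 3 * norm z" "Re z / 2 \<le> Re (sin z)"
proof -
  have "norm (exp (\<i> * z) - exp (- (\<i> * z))) \<le> norm (exp (\<i> * z) - 1) + norm (exp (- (\<i> * z)) - 1)"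
    using norm_triangle_ineq4[of "exp (\<i> * z) - 1" "exp (- (\<i> * z)) - 1"] by simp
  also have "\<dots> \<le> 3 * norm z + 3 * norm z"
    using norm_exp_minus_one_le[of "\<i> * z"] norm_exp_minus_one_le[of "- (\<i> * z)"] assms
    by (simp add: norm_mult)
  finally show "norm (sin z) \<le> 3 * norm z" by (simp add: sin_exp_eq norm_divide norm_mult)
  define x where "x = Re z"
  have x: "0 < x" "x \<le> 1 / 6" using assms complex_Re_le_cmod[of z] by (auto simp: x_def)
  have "\<bar>sin x - (\<Sum>m<3. sin_coeff m * x ^ m)\<bar> \<le> inverse (fact 3) * \<bar>x\<bar> ^ 3" by (rule Maclaurin_sin_bound)
  moreover have "(\<Sum>m<3. sin_coeff m * x ^ m) = x" by (simp add: sin_coeff_def numeral_3_eq_3)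
  ultimately have 1: "\<bar>sin x - x\<bar> \<le> x ^ 3 / 6" using x by (simp add: fact_numeral)
  have "x ^ 3 \<le> x * 1" unfolding power3_eq_cube mult.assoc using x
    by (intro mult_left_mono mult_le_one) auto
  hence 2: "sin x \<ge> x / 2" using 1 x by linarith
  \<comment> \<open>The real part of the sine is sin x times a hyperbolic cosine, which is at least
    1, so a lower bound for the real sine suffices.\<close>
  have "exp (Im z) + exp (- Im z) \<ge> 2" using exp_ge_add_one_self[of "Im z"] exp_ge_add_one_self[of "- Im z"] by linarith
  hence "sin x * (exp (Im z) + exp (- Im z)) \<ge> sin x * 2" using 2 x by (intro mult_left_mono) auto
  hence "Re (sin z) \<ge> sin x" by (simp add: Re_sin x_def)
  thus "Re z / 2 \<le> Re (sin z)" using 2 by (simp add: x_def)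
qed

text \<open>For small \<open>z\<close> the direction \<open>zdir z\<close> is close to \<i>, near
  the poles of \<open>bose\<close>. Multiplication by -\<i> moves it near 1 but may throw
  \<open>sin z\<close> out of the right half-plane; adding a real part \<open>\<rho>\<close> to
  -\<i> brings it back. The resulting \<open>d\<close> has norm at most 24 norm z / Re z and enters
  with its third power: once as Jacobian and twice through the bound for
  \<open>bose_rem\<close>.\<close>

lemma norm_bose_error_zdir:
  assumes z: "0 < Re z" "norm z \<le> 1 / 6"
  shows "norm (bose_error (zdir z)) \<le> 143327232 * (norm z / Re z) ^ 3 * norm z"
proof -
  note sb = sin_small_bounds[OF z]
  define c where "c = zdir z"
  \<comment> \<open>Twice the secant of the argument of \<open>sin z\<close>, chosen so that the
    real part of \<open>d * sin z\<close> is at least \<open>norm (sin z)\<close>.\<close>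
  define \<rho> where "\<rho> = 2 * norm (sin z) / Re (sin z)"
  define d where "d = of_real \<rho> - \<i>"
  have rez: "Re z < pi" using z complex_Re_le_cmod[of z] pi_gt3 by linarith
  have s0: "Re (sin z) > 0" using sb(2) z(1) by linarith
  have \<rho>: "\<rho> \<ge> 2" unfolding \<rho>_def using s0 complex_Re_le_cmod[of "sin z"] by (simp add: field_simps)
  have c: "Re c > 0" unfolding c_def using z rez by (intro Re_zdir_pos) auto
  have cE: "c = \<i> * exp (- (\<i> * z))"
  proof -
    have "exp (\<i> * of_real pi / 2) = \<i>" by (simp add: exp_eq_polar cis_conv_exp[symmetric] mult.commute)
    moreover have "\<i> * (of_real pi / 2 - z) = \<i> * of_real pi / 2 + - (\<i> * z)" by (simp add: algebra_simps)
    ultimately show ?thesis unfolding c_def zdir_def by (simp only: exp_add)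
  qed
  define E where "E = exp (- (\<i> * z))"
  have "norm (E - 1) \<le> 3 * norm z" unfolding E_def using norm_exp_minus_one_le[of "- (\<i> * z)"] z by (simp add: norm_mult)
  hence "norm (E - 1) \<le> 1 / 2" using z by linarith
  moreover have "\<bar>Re (E - 1)\<bar> \<le> norm (E - 1)" by (rule abs_Re_le_cmod)
  ultimately have ReE: "Re E \<ge> 1 / 2" by simp
  \<comment> \<open>\<open>E\<close> does not lie above the real axis, so the added
    \<open>\<rho>\<close> can only increase the real part of \<open>d * c\<close>.\<close>
  have ImE: "Im E \<le> 0"
  proof -
    have "Im E = - (exp (Im z) * sin (Re z))" by (simp add: E_def Im_exp)
    thus ?thesis using sin_gt_zero[OF z(1) rez] by simp
  qed
  have "d * c = (1 + \<i> * of_real \<rho>) * E" unfolding cE d_def E_def by (simp add: algebra_simps)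
  hence "Re (d * c) = Re E - \<rho> * Im E" by simp
  moreover have "\<rho> * Im E \<le> 0" using \<rho> ImE by (simp add: mult_nonneg_nonpos)
  ultimately have dc: "Re (d * c) \<ge> 1 / 2" using ReE by linarith
  have S: "c + 1 / c = 2 * sin z" unfolding c_def by (rule zdir_sum)
  have "Re (d * sin z) = \<rho> * Re (sin z) + Im (sin z)" by (simp add: d_def)
  also have "\<rho> * Re (sin z) = 2 * norm (sin z)" using s0 by (simp add: \<rho>_def)
  finally have "Re (d * sin z) \<ge> norm (sin z)" using abs_Im_le_cmod[of "sin z"] by linarith
  moreover have "Re (d * (2 * sin z)) = 2 * Re (d * sin z)" by simp
  ultimately have dS: "Re (d * (2 * sin z)) \<ge> 2 * norm (sin z)" by linarith
  have sn: "norm (sin z) > 0" using s0 by auto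
  have nd: "norm d \<le> 2 * \<rho>"
  proof -
    have "norm d \<le> norm (complex_of_real \<rho>) + norm \<i>" unfolding d_def by (rule norm_triangle_ineq4)
    thus ?thesis using \<rho> by simp
  qed
  have nd1: "norm d \<ge> 1"
    using abs_Re_le_cmod[of d] \<rho> by (simp add: d_def)
  define f where "f = (\<lambda>x::real. bose (of_real x * d * c) * bose_rem (of_real x * d * (c + 1 / c)))"
  have p1: "0 < Re (d * c)" using dc by linarith
  have p2: "0 < Re (d * (c + 1 / c))" unfolding S using dS sn by linarith
  have "bose_error c = d * (LINT x:{0<..}|lborel. f x)" unfolding f_def
    by (rule bose_error_ray(2)[OF c p1 p2])
  hence "norm (bose_error c) = norm d * norm (LINT x:{0<..}|lborel. f x)" by (simp add: norm_mult)
  also have "norm (LINT x:{0<..}|lborel. f x) \<le> 4 * (864 * (norm d)\<^sup>2 * norm (sin z))"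
  proof (rule norm_set_integral_Ioi_bound_square)
    have hb: "bose holomorphic_on {w. Re w > 0}" by (rule bose_holomorphic) auto
    have hr: "bose_rem holomorphic_on {w. Re w > 0}" by (rule bose_rem_holomorphic) auto
    have p1: "Re (of_real x * d * c) = x * Re (d * c)" "Re (of_real x * d * (c + 1 / c)) = x * Re (d * (2 * sin z))" for x
      unfolding S by (simp_all only: mult.assoc Re_complex_of_real times_complex.sel Im_complex_of_real mult_zero_left diff_zero)
    show "continuous_on {0<..} f" unfolding f_def
    proof (intro continuous_on_mult)
      show "continuous_on {0<..} (\<lambda>x. bose (of_real x * d * c))"
        by (rule continuous_on_compose2[OF holomorphic_on_imp_continuous_on[OF hb]])
           (use dc in \<open>auto intro!: continuous_intros mult_pos_pos simp only: p1 mem_Collect_eq greaterThan_iff image_subset_iff\<close>)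
      show "continuous_on {0<..} (\<lambda>x. bose_rem (of_real x * d * (c + 1 / c)))"
        by (rule continuous_on_compose2[OF holomorphic_on_imp_continuous_on[OF hr]])
           (use dS sn in \<open>auto intro!: continuous_intros mult_pos_pos simp only: p1 mem_Collect_eq greaterThan_iff image_subset_iff\<close>)
    qed
    fix x :: real assume x: "x > 0"
    have r1: "x / 2 \<le> Re (of_real x * d * c)" unfolding p1 using dc x mult_left_mono[of "1/2" "Re (d * c)" x] by simp
    have r1': "0 < Re (of_real x * d * c)" using r1 x by linarith
    have r2: "x * (2 * norm (sin z)) \<le> Re (of_real x * d * (c + 1 / c))" unfolding p1 using dS x by (intro mult_left_mono) auto
    have "0 < x * (2 * norm (sin z))" using x sn by simp
    hence r2': "0 < Re (of_real x * d * (c + 1 / c))" using r2 by linarith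
    have nS: "norm (of_real x * d * (c + 1 / c)) = x * norm d * (2 * norm (sin z))"
      unfolding S using x by (simp add: norm_mult)
    have "norm (of_real x * d * (c + 1 / c)) \<le> norm d * Re (of_real x * d * (c + 1 / c))"
      unfolding nS using mult_left_mono[OF r2, of "norm d"] by (simp add: mult_ac)
    from norm_bose_rem_cone(1)[OF r2' this nd1]
    have R: "norm (bose_rem (of_real x * d * (c + 1 / c))) \<le> 18 * (norm d)\<^sup>2 * norm (sin z) * x"
      unfolding nS by (simp add: power2_eq_square mult_ac)
    have "norm (bose (of_real x * d * c)) \<le> 1 / Re (of_real x * d * c)" by (rule norm_bose_le_inverse[OF r1'])
    also have "\<dots> \<le> 1 / (x / 2)" by (rule frac_le[OF _ _ _ r1]) (use x in auto)
    finally have b1: "norm (bose (of_real x * d * c)) \<le> 2 / x" by simp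
    have "norm (bose (of_real x * d * c)) \<le> 6 / Re (of_real x * d * c) ^ 3" by (rule norm_bose_le_inverse_cube[OF r1'])
    also have "\<dots> \<le> 6 / (x / 2) ^ 3" by (rule frac_le[OF _ _ _ power_mono[OF r1]]) (use x in auto)
    finally have b3: "norm (bose (of_real x * d * c)) \<le> 48 / x ^ 3" by (simp add: power_divide)
    \<comment> \<open>The linear bound for \<open>bose_rem\<close> compensates the pole of
      \<open>bose\<close> at 0; for the decay at infinity the cubic bound for \<open>bose\<close>
      takes over.\<close>
    have "norm (f x) \<le> (2 / x) * (18 * (norm d)\<^sup>2 * norm (sin z) * x)"
      unfolding f_def norm_mult[of "bose _"] using b1 R x by (intro mult_mono) auto
    also have "\<dots> = 36 * (norm d)\<^sup>2 * norm (sin z)" using x by simp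
    also have "\<dots> \<le> 864 * (norm d)\<^sup>2 * norm (sin z)" by (intro mult_right_mono) auto
    finally show "norm (f x) \<le> 864 * (norm d)\<^sup>2 * norm (sin z)" .
    have "norm (f x) \<le> (48 / x ^ 3) * (18 * (norm d)\<^sup>2 * norm (sin z) * x)"
      unfolding f_def norm_mult[of "bose _"] using b3 R x by (intro mult_mono) auto
    also have "\<dots> = 864 * (norm d)\<^sup>2 * norm (sin z) / x\<^sup>2" using x by (simp add: power3_eq_cube power2_eq_square)
    finally show "norm (f x) \<le> 864 * (norm d)\<^sup>2 * norm (sin z) / x\<^sup>2" .
  qed
  also have "norm d * (4 * (864 * (norm d)\<^sup>2 * norm (sin z))) = 3456 * norm d ^ 3 * norm (sin z)"
    by (simp add: power3_eq_cube power2_eq_square)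
  also have "\<dots> \<le> 3456 * (2 * \<rho>) ^ 3 * (3 * norm z)"
    using nd sb \<rho> by (intro mult_mono power_mono) auto
  also have "\<dots> \<le> 3456 * (2 * (12 * (norm z / Re z))) ^ 3 * (3 * norm z)"
  proof (intro mult_right_mono mult_left_mono power_mono)
    have "\<rho> \<le> 2 * (3 * norm z) / (Re z / 2)" unfolding \<rho>_def using sb z by (intro frac_le) auto
    thus "\<rho> \<le> 12 * (norm z / Re z)" by simp
  qed (use \<rho> in auto)
  \<comment> \<open>The constant is 3456 * 24^3 * 3.\<close>
  also have "\<dots> = 143327232 * (norm z / Re z) ^ 3 * norm z"
  proof -
    have e: "(2 * (12 * q)) ^ 3 = 13824 * q ^ 3" for q :: real by (simp add: power3_eq_cube)
    show ?thesis unfolding e by simp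
  qed
  finally show ?thesis by (simp add: c_def mult_left_mono)
qed

text \<open>\<open>1 / zdir z\<close> is the conjugate of \<open>zdir (cnj z)\<close>, so the second
  remainder is the conjugate of the first one at the conjugate point. This doubles the constant; all
  other terms are the exact ones, rewritten through \<open>sin z\<close> and
  \<open>cos z\<close>.\<close>

lemma bose_pair_zdir:
  assumes z: "0 < Re z" "norm z \<le> 1 / 6"
  shows "norm ((LINT x:{0<..}|lborel. bose_cut (of_real x * zdir z) * bose_cut (of_real x / zdir z))
     - ((2 * bose_const - Ln (2 * sin z)) / (2 * sin z) - bose_const * (2 * sin z) + 2 * cos z * (of_real pi / 2 - z)))
     \<le> 286654464 * (norm z / Re z) ^ 3 * norm z"
proof -
  have rez: "Re z < pi" using z complex_Re_le_cmod[of z] pi_gt3 by linarith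
  have c: "Re (zdir z) > 0" using z rez by (intro Re_zdir_pos) auto
  have 1: "(1 / zdir z - zdir z) * Ln (zdir z) = 2 * cos z * (of_real pi / 2 - z)"
  proof -
    have e: "1 / zdir z - zdir z = - (2 * \<i> * cos z)" using zdir_diff[of z] by (simp add: algebra_simps)
    show ?thesis unfolding e Ln_zdir[OF z(1) rez] by (simp add: algebra_simps)
  qed
  have "norm (bose_error (zdir z) + bose_error (1 / zdir z)) \<le> norm (bose_error (zdir z)) + norm (bose_error (zdir (cnj z)))"
    unfolding zdir_cnj bose_error_cnj using norm_triangle_ineq[of "bose_error (zdir z)" "cnj (bose_error (zdir (cnj z)))"] by simp
  also have "\<dots> \<le> 143327232 * (norm z / Re z) ^ 3 * norm z + 143327232 * (norm z / Re z) ^ 3 * norm z"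
    using norm_bose_error_zdir[OF z] norm_bose_error_zdir[of "cnj z"] z by (intro add_mono) auto
  finally have "norm (bose_error (zdir z) + bose_error (1 / zdir z)) \<le> 286654464 * (norm z / Re z) ^ 3 * norm z" by linarith
  moreover have "(LINT x:{0<..}|lborel. bose_cut (of_real x * zdir z) * bose_cut (of_real x / zdir z))
     - ((2 * bose_const - Ln (2 * sin z)) / (2 * sin z) - bose_const * (2 * sin z) + 2 * cos z * (of_real pi / 2 - z))
     = bose_error (zdir z) + bose_error (1 / zdir z)"
    unfolding bose_pair_integral[OF c] 1 zdir_sum by simp
  ultimately show ?thesis by simp
qed

section \<open>The Laplace transform of the mean square\<close>

lemma norm_bose_cut_cone:
  assumes "Re w > 0" "norm w \<le> \<rho> * Re w" "\<rho> \<ge> 1"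
  shows "norm (bose_cut w) \<le> 10 * \<rho>" "norm (bose_cut w) \<le> 2 * \<rho> / norm w"
proof -
  have w: "norm w > 0" using assms by auto
  have "bose_cut w = bose_rem w - 1 / 2" by (simp add: bose_cut_def bose_rem_def)
  hence "norm (bose_cut w) \<le> norm (bose_rem w) + norm (1 / 2 :: complex)" by (metis norm_triangle_ineq4)
  also have "\<dots> \<le> 10 * \<rho>" using norm_bose_rem_cone(2)[OF assms] assms by simp
  finally show "norm (bose_cut w) \<le> 10 * \<rho>" .
  have "norm (bose_cut w) \<le> norm (bose w) + norm (1 / w)" unfolding bose_cut_def by (rule norm_triangle_ineq4)
  also have "\<dots> \<le> \<rho> / norm w + \<rho> / norm w" using norm_bose_cone(1)[OF assms(1,2)] assms w
    by (intro add_mono) (auto simp: norm_divide divide_right_mono)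
  finally show "norm (bose_cut w) \<le> 2 * \<rho> / norm w" by simp
qed

section \<open>Gamma times zeta on the critical line as a Fourier transform\<close>

definition crit :: "real \<Rightarrow> complex" where "crit t = 1 / 2 + \<i> * of_real t"

definition completed_zeta :: "real \<Rightarrow> complex" where
  "completed_zeta t = Gamma (crit t) * zeta (crit t)"

text \<open>Rotating the Mellin integral multiplies it by c^(-s), with the principal logarithm of
  \<open>c\<close>. The modulus of x^(s-1) involves the argument of \<open>x\<close>, which costs at
  most the factor exp (|t| pi) and does not disturb the bounds in \<open>y\<close>.\<close>

lemma critical_ray:
  assumes c: "Re c > 0"
  shows "set_integrable lborel {0<..} (\<lambda>y. mellin_kernel (crit t) y * bose_cut (of_real y * c))"
    "(LINT y:{0<..}|lborel. mellin_kernel (crit t) y * bose_cut (of_real y * c)) = exp (- (crit t * Ln c)) * completed_zeta t"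
proof -
  define s where "s = crit t"
  have sr: "Re s = 1 / 2" "Im s = t" by (simp_all add: s_def crit_def)
  have c0: "c \<noteq> 0" using c by auto
  obtain \<rho> m where rm: "\<rho> \<ge> 1" "m > 0"
    "\<And>y x. y > 0 \<Longrightarrow> x \<in> closed_segment (of_real y * 1) (of_real y * c) \<Longrightarrow> 
       Re (x * 1) > 0 \<and> norm (x * 1) \<le> \<rho> * Re (x * 1) \<and> m * y \<le> norm (x * 1)"
    using cone_on_segment[of 1 1 c] c by auto
  define F where "F = (\<lambda>x. exp ((s - 1) * Ln x) * bose_cut x)"
  define M where "M = exp (\<bar>t\<bar> * pi) * (10 * \<rho> / sqrt m + 2 * \<rho> / (m * sqrt m))"
  have hol: "F holomorphic_on {x. Re (x * 1) > 0}" unfolding F_def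
    by (intro holomorphic_intros bose_cut_holomorphic) (auto simp: complex_nonpos_Reals_iff)
  have bd: "norm (F x) \<le> M / sqrt y" "norm (F x) \<le> M / (y * sqrt y)"
    if y: "y > 0" and x: "x \<in> closed_segment (of_real y * 1) (of_real y * c)" for x y
  proof -
    have X: "Re x > 0" "norm x \<le> \<rho> * Re x" "m * y \<le> norm x" using rm(3)[OF y x] by auto
    have x0: "x \<noteq> 0" using X by auto
    have my: "0 < m * y" using rm(2) y by simp
    have "Re ((s - 1) * Ln x) = - (1 / 2) * ln (norm x) - t * Im (Ln x)" using x0 by (simp add: sr)
    moreover have "- t * Im (Ln x) \<le> \<bar>t\<bar> * \<bar>Im (Ln x)\<bar>" using abs_ge_self[of "- t * Im (Ln x)"] by (simp add: abs_mult)
    moreover have "\<bar>t\<bar> * \<bar>Im (Ln x)\<bar> \<le> \<bar>t\<bar> * pi"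
      using mpi_less_Im_Ln[OF x0] Im_Ln_le_pi[OF x0] by (intro mult_left_mono) auto
    ultimately have "Re ((s - 1) * Ln x) \<le> - (1 / 2) * ln (norm x) + \<bar>t\<bar> * pi" by linarith
    hence "norm (exp ((s - 1) * Ln x)) \<le> exp (- (1 / 2) * ln (norm x) + \<bar>t\<bar> * pi)" by (simp only: norm_exp_eq_Re exp_le_cancel_iff)
    also have "\<dots> = exp (\<bar>t\<bar> * pi) / sqrt (norm x)"
    proof -
      have e1: "exp (- (1 / 2) * ln (norm x)) = 1 / sqrt (norm x)"
        using x0 by (simp add: exp_minus ln_sqrt[symmetric] inverse_eq_divide)
      show ?thesis unfolding exp_add e1 by simp
    qed
    also have "\<dots> \<le> exp (\<bar>t\<bar> * pi) / sqrt (m * y)" using X my by (intro frac_le) auto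
    finally have e: "norm (exp ((s - 1) * Ln x)) \<le> exp (\<bar>t\<bar> * pi) / sqrt (m * y)" .
    have "norm (F x) \<le> (exp (\<bar>t\<bar> * pi) / sqrt (m * y)) * (10 * \<rho>)"
      unfolding F_def norm_mult using e norm_bose_cut_cone(1)[OF X(1,2) rm(1)] my by (intro mult_mono) auto
    also have "\<dots> = exp (\<bar>t\<bar> * pi) * (10 * \<rho> / sqrt m) / sqrt y" by (simp add: real_sqrt_mult)
    also have "\<dots> \<le> M / sqrt y" unfolding M_def using rm y by (intro divide_right_mono mult_left_mono) auto
    finally show "norm (F x) \<le> M / sqrt y" .
    have "norm (bose_cut x) \<le> 2 * \<rho> / norm x" by (rule norm_bose_cut_cone(2)[OF X(1,2) rm(1)])
    also have "\<dots> \<le> 2 * \<rho> / (m * y)" using X(3) my rm(1) by (intro frac_le) auto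
    finally have "norm (F x) \<le> (exp (\<bar>t\<bar> * pi) / sqrt (m * y)) * (2 * \<rho> / (m * y))"
      unfolding F_def norm_mult using e my by (intro mult_mono) auto
    also have "\<dots> = exp (\<bar>t\<bar> * pi) * (2 * \<rho> / (m * sqrt m)) / (y * sqrt y)" by (simp add: real_sqrt_mult)
    also have "\<dots> \<le> M / (y * sqrt y)" unfolding M_def using rm y by (intro divide_right_mono mult_left_mono) auto
    finally show "norm (F x) \<le> M / (y * sqrt y)" .
  qed
  have seg: "closed_segment (of_real y * 1) (of_real y * c) \<subseteq> {x. Re (x * 1) > 0}" if "y > 0" for y
    using rm(3)[OF that] by blast
  note r = ray_rotation[OF hol open_Re_mult_pos convex_Re_mult_pos seg bd]
  have F1: "F (of_real y * 1) = mellin_kernel s y * bose_cut (of_real y)" if "y > 0" for y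
    using that by (simp add: F_def mellin_kernel_def Ln_of_real)
  have Fc: "F (of_real y * c) = exp ((s - 1) * Ln c) * (mellin_kernel s y * bose_cut (of_real y * c))" if "y > 0" for y
  proof -
    have L: "Ln (of_real y * c) = of_real (ln y) + Ln c" using Ln_times_of_real[OF that c0] that by (simp add: Ln_of_real)
    show ?thesis unfolding F_def mellin_kernel_def L distrib_left exp_add by simp
  qed
  have i: "set_integrable lborel {0<..} (\<lambda>y. F (of_real y * c))" by (rule r(2)) auto
  have "set_integrable lborel {0<..} (\<lambda>y. F (of_real y * c)) =
      set_integrable lborel {0<..} (\<lambda>y. exp ((s - 1) * Ln c) * (mellin_kernel s y * bose_cut (of_real y * c)))"
    by (rule set_integrable_cong[OF refl refl]) (simp add: Fc)
  with i have i2: "set_integrable lborel {0<..} (\<lambda>y. exp ((s - 1) * Ln c) * (mellin_kernel s y * bose_cut (of_real y * c)))" by simp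
  thus i3: "set_integrable lborel {0<..} (\<lambda>y. mellin_kernel (crit t) y * bose_cut (of_real y * c))"
    by (subst (asm) set_integrable_mult_right_iff) (auto simp: s_def)
  have "completed_zeta t = (LINT y:{0<..}|lborel. mellin_kernel s y * bose_cut (of_real y))"
    unfolding completed_zeta_def s_def[symmetric] by (rule Gamma_zeta_mellin) (simp_all add: sr)
  also have "\<dots> = (LINT y:{0<..}|lborel. F (of_real y * 1))"
    by (rule set_lebesgue_integral_cong) (use F1 in auto)
  also have "\<dots> = c * (LINT y:{0<..}|lborel. F (of_real y * c))" using r(3) by simp
  also have "(LINT y:{0<..}|lborel. F (of_real y * c)) = 
      (LINT y:{0<..}|lborel. exp ((s - 1) * Ln c) * (mellin_kernel s y * bose_cut (of_real y * c)))"
    by (rule set_lebesgue_integral_cong) (use Fc in auto)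
  also have "\<dots> = exp ((s - 1) * Ln c) * (LINT y:{0<..}|lborel. mellin_kernel s y * bose_cut (of_real y * c))" by simp
  also have "c * (exp ((s - 1) * Ln c) * (LINT y:{0<..}|lborel. mellin_kernel s y * bose_cut (of_real y * c)))
     = exp (s * Ln c) * (LINT y:{0<..}|lborel. mellin_kernel s y * bose_cut (of_real y * c))"
  proof -
    have "c * exp ((s - 1) * Ln c) = exp (Ln c) * exp ((s - 1) * Ln c)" using c0 by simp
    also have "\<dots> = exp (s * Ln c)" unfolding exp_add[symmetric] by (simp add: algebra_simps)
    finally show ?thesis by (simp only: mult.assoc[symmetric])
  qed
  finally have "exp (- (s * Ln c)) * completed_zeta t = 
     (exp (- (s * Ln c)) * exp (s * Ln c)) * (LINT y:{0<..}|lborel. mellin_kernel s y * bose_cut (of_real y * c))"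
    by simp
  also have "exp (- (s * Ln c)) * exp (s * Ln c) = 1" unfolding exp_add[symmetric] by simp
  finally show "(LINT y:{0<..}|lborel. mellin_kernel (crit t) y * bose_cut (of_real y * c)) = exp (- (crit t * Ln c)) * completed_zeta t"
    by (simp add: s_def)
qed

text \<open>With x = exp u the measure x^(s-1) dx becomes exp (s u) du; the factor exp (u/2) is the
  real part 1/2 of \<open>s\<close>, and the oscillation is left to the Fourier transform.\<close>

definition log_profile :: "complex \<Rightarrow> real \<Rightarrow> complex" where
  "log_profile c u = of_real (exp (u / 2)) * bose_cut (of_real (exp u) * c)"

lemma log_profile_fourier:
  assumes c: "Re c > 0"
  shows "integrable lborel (log_profile c)" "fourier (log_profile c) t = exp (- (crit t * Ln c)) * completed_zeta t"
proof -
  have eq: "exp u *\<^sub>R (mellin_kernel (crit t) (exp u) * bose_cut (of_real (exp u) * c)) = log_profile c u * cis (t * u)" for u t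
  proof -
    have "exp u *\<^sub>R mellin_kernel (crit t) (exp u) = exp (of_real u) * exp ((crit t - 1) * of_real u)"
      by (simp add: mellin_kernel_def scaleR_conv_of_real exp_of_real)
    also have "\<dots> = exp (of_real (u / 2)) * exp (\<i> * of_real (t * u))"
      unfolding exp_add[symmetric] by (simp add: crit_def algebra_simps)
    also have "\<dots> = of_real (exp (u / 2)) * cis (t * u)" by (simp only: exp_of_real cis_conv_exp)
    finally show ?thesis by (simp add: log_profile_def scaleR_conv_of_real)
  qed
  note E = exp_substitution[OF critical_ray(1)[OF c], unfolded eq]
  from E(1)[of 0] show "integrable lborel (log_profile c)" by simp
  show "fourier (log_profile c) t = exp (- (crit t * Ln c)) * completed_zeta t"
    using E(2)[of t] critical_ray(2)[OF c] by (simp add: fourier_def)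
qed

lemma log_profile_continuous:
  assumes c: "Re c > 0" shows "continuous_on UNIV (log_profile c)"
proof -
  have "bose_cut holomorphic_on {w. Re w > 0}" by (rule bose_cut_holomorphic) auto
  hence "continuous_on {w. Re w > 0} bose_cut" by (rule holomorphic_on_imp_continuous_on)
  hence "continuous_on UNIV (\<lambda>u. bose_cut (of_real (exp u) * c))"
    by (rule continuous_on_compose2) (use c in \<open>auto intro!: continuous_intros\<close>)
  thus ?thesis unfolding log_profile_def[abs_def] by (intro continuous_intros) auto
qed

lemma log_profile_bounded:
  assumes c: "Re c > 0" obtains C where "\<And>u. norm (log_profile c u) \<le> C"
proof -
  define \<rho> where "\<rho> = max 1 (norm c / Re c)"
  have \<rho>: "\<rho> \<ge> 1" by (simp add: \<rho>_def)
  have nc: "norm c \<le> \<rho> * Re c"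
  proof -
    have "norm c = norm c / Re c * Re c" using c by simp
    also have "\<dots> \<le> \<rho> * Re c" unfolding \<rho>_def using c by (intro mult_right_mono) auto
    finally show ?thesis .
  qed
  have c0: "norm c > 0" using c by auto
  show ?thesis
  proof (rule that[of "10 * \<rho> + 2 * \<rho> / norm c"])
    fix u :: real
    define w where "w = of_real (exp u) * c"
    have w: "Re w > 0" "norm w \<le> \<rho> * Re w" "norm w = exp u * norm c"
      using c nc mult_left_mono[OF nc, of "exp u"] by (auto simp: w_def norm_mult mult_ac)
    show "norm (log_profile c u) \<le> 10 * \<rho> + 2 * \<rho> / norm c"
    proof (cases "u \<le> 0")
      case True
      have "norm (log_profile c u) = exp (u / 2) * norm (bose_cut w)" by (simp add: log_profile_def w_def norm_mult)
      also have "\<dots> \<le> 1 * (10 * \<rho>)" using True norm_bose_cut_cone(1)[OF w(1,2) \<rho>] by (intro mult_mono) auto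
      also have "\<dots> \<le> 10 * \<rho> + 2 * \<rho> / norm c" using \<rho> by simp
      finally show ?thesis .
    next
      case False
      have "norm (log_profile c u) = exp (u / 2) * norm (bose_cut w)" by (simp add: log_profile_def w_def norm_mult)
      also have "\<dots> \<le> exp u * (2 * \<rho> / norm w)" using False norm_bose_cut_cone(2)[OF w(1,2) \<rho>] by (intro mult_mono) auto
      also have "\<dots> = 2 * \<rho> / norm c" using w c0 by simp
      also have "\<dots> \<le> 10 * \<rho> + 2 * \<rho> / norm c" using \<rho> by simp
      finally show ?thesis .
    qed
  qed
qed

lemma integrable_exp_abs:
  fixes a :: real
  assumes a: "a > 0" shows "integrable lborel (\<lambda>t::real. exp (- (a * \<bar>t\<bar>)))"
proof -
  have "set_integrable lborel {0<..} (\<lambda>x. norm (complex_of_real (exp (- (a * x)))))"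
    by (rule set_integrable_norm[OF exp_integral_Ioi(1)[OF a]])
  hence i: "integrable lborel (\<lambda>x::real. indicator {0<..} x * exp (- (a * x)))"
    by (simp add: set_integrable_def)
  have "integrable lborel (\<lambda>x. indicator {0<..} (0 + - 1 * x) * exp (- (a * (0 + - 1 * x))))"
    by (rule lborel_integrable_real_affine[OF i]) simp
  moreover have "integrable lborel (\<lambda>x. indicator {0::real} x * 1 :: real)" by simp
  ultimately have "integrable lborel (\<lambda>x. indicator {0<..} x * exp (- (a * x)) + indicator {0<..} (0 + - 1 * x) * exp (- (a * (0 + - 1 * x))) + indicator {0} x * 1)"
    using i by (intro Bochner_Integration.integrable_add)
  also have "(\<lambda>x. indicator {0<..} x * exp (- (a * x)) + indicator {0<..} (0 + - 1 * x) * exp (- (a * (0 + - 1 * x))) + indicator {0} x * 1)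
     = (\<lambda>t. exp (- (a * \<bar>t\<bar>)))" by (auto simp: fun_eq_iff indicator_def)
  finally show ?thesis .
qed

text \<open>In the direction exp (\<i> a) the factor c^(-s) has modulus exp (a t), while the Fourier
  transform is bounded by the L1 norm of the profile. Taking both signs of the angle gives decay on
  both sides at every rate below pi / 2.\<close>

lemma completed_zeta_decay:
  assumes th: "0 < \<theta>" "\<theta> < pi / 2"
  obtains B where "\<And>t. norm (completed_zeta t) \<le> B * exp (- (\<theta> * \<bar>t\<bar>))"
proof -
  have re: "Re (exp (\<i> * of_real a)) > 0" and ln: "Ln (exp (\<i> * of_real a)) = \<i> * of_real a" if "\<bar>a\<bar> < pi / 2" for a
  proof -
    have "cos a > 0" using that by (intro cos_gt_zero_pi) auto
    thus "Re (exp (\<i> * of_real a)) > 0" by (simp add: Re_exp)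
    show "Ln (exp (\<i> * of_real a)) = \<i> * of_real a" using that by (intro Ln_exp) auto
  qed
  define B where "B = (\<lambda>a. LINT v|lborel. norm (log_profile (exp (\<i> * of_real a)) v))"
  have "norm (completed_zeta t) \<le> B a * exp (- (a * t))" if a: "\<bar>a\<bar> < pi / 2" for a t
  proof -
    have "norm (fourier (log_profile (exp (\<i> * of_real a))) t) \<le> B a"
      unfolding B_def by (rule norm_fourier_le[OF log_profile_fourier(1)[OF re[OF a]]])
    also have "fourier (log_profile (exp (\<i> * of_real a))) t = exp (- (crit t * (\<i> * of_real a))) * completed_zeta t"
      using log_profile_fourier(2)[OF re[OF a]] by (simp add: ln[OF a])
    finally have n: "norm (exp (- (crit t * (\<i> * of_real a))) * completed_zeta t) \<le> B a" .
    have e: "norm (exp (- (crit t * (\<i> * of_real a)))) = exp (a * t)" by (simp add: norm_exp_eq_Re crit_def mult.commute)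
    from n have "exp (a * t) * norm (completed_zeta t) \<le> B a" unfolding norm_mult e .
    hence "exp (- (a * t)) * (exp (a * t) * norm (completed_zeta t)) \<le> exp (- (a * t)) * B a" by (intro mult_left_mono) auto
    moreover have "exp (- (a * t)) * (exp (a * t) * norm (completed_zeta t)) = norm (completed_zeta t)"
      by (simp add: exp_minus)
    moreover have "exp (- (a * t)) * B a = B a * exp (- (a * t))" by (rule mult.commute)
    ultimately show ?thesis by linarith
  qed
  from this[of \<theta>] this[of "- \<theta>"] th
  have *: "norm (completed_zeta t) \<le> B \<theta> * exp (- (\<theta> * t))" "norm (completed_zeta t) \<le> B (- \<theta>) * exp (\<theta> * t)" for t by auto
  show ?thesis
  proof (rule that[of "max (B \<theta>) (B (- \<theta>))"])
    fix t :: real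
    show "norm (completed_zeta t) \<le> max (B \<theta>) (B (- \<theta>)) * exp (- (\<theta> * \<bar>t\<bar>))"
    proof (cases "t \<ge> 0")
      case True
      have "B \<theta> * exp (- (\<theta> * t)) \<le> max (B \<theta>) (B (- \<theta>)) * exp (- (\<theta> * t))" by (intro mult_right_mono) auto
      moreover have e: "\<bar>t\<bar> = t" using True by simp
      ultimately show ?thesis using *(1)[of t] unfolding e by linarith
    next
      case False
      have "B (- \<theta>) * exp (\<theta> * t) \<le> max (B \<theta>) (B (- \<theta>)) * exp (\<theta> * t)" by (intro mult_right_mono) auto
      moreover have e: "- (\<theta> * \<bar>t\<bar>) = \<theta> * t" using False by simp
      ultimately show ?thesis using *(2)[of t] unfolding e by linarith
    qed
  qed
qed

lemma completed_zeta_continuous: "continuous_on UNIV completed_zeta"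
proof -
  have "continuous_on (- {1}) zeta" using zeta_characterisation by (auto intro: holomorphic_on_imp_continuous_on)
  hence 1: "continuous_on UNIV (\<lambda>t. zeta (crit t))"
    by (rule continuous_on_compose2) (auto intro!: continuous_intros simp: crit_def complex_eq_iff)
  have nn: "crit t \<notin> \<int>\<^sub>\<le>\<^sub>0" for t by (auto simp: crit_def complex_eq_iff elim!: nonpos_Ints_cases)
  have "continuous_on (- \<int>\<^sub>\<le>\<^sub>0) (Gamma :: complex \<Rightarrow> complex)"
    by (intro holomorphic_on_imp_continuous_on holomorphic_Gamma) auto
  hence 2: "continuous_on UNIV (\<lambda>t. Gamma (crit t))"
    by (rule continuous_on_compose2) (use nn in \<open>auto intro!: continuous_intros simp: crit_def\<close>)
  show ?thesis unfolding completed_zeta_def[abs_def] by (intro continuous_intros 1 2)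
qed

lemma completed_zeta_measurable [measurable]: "completed_zeta \<in> borel_measurable borel"
  using completed_zeta_continuous by (rule borel_measurable_continuous_onI)

lemma bose_pair_integrable:
  assumes c: "Re c > 0"
  shows "set_integrable lborel {0<..} (\<lambda>x. bose_cut (of_real x * c) * bose_cut (of_real x / c))"
proof -
  define k where "k = 1 / c"
  have k: "Re k > 0" unfolding k_def by (rule Re_inverse_pos[OF c])
  obtain \<rho> m where r: "\<rho> \<ge> 1" "m > 0"
    "\<And>y x. y > 0 \<Longrightarrow> x \<in> closed_segment (of_real y * 1) (of_real y * 1) \<Longrightarrow> 
       Re (x * c) > 0 \<and> norm (x * c) \<le> \<rho> * Re (x * c) \<and> m * y \<le> norm (x * c)"
    using cone_on_segment[of 1 c 1] c by auto
  obtain \<rho>' m' where r': "\<rho>' \<ge> 1" "m' > 0"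
    "\<And>y x. y > 0 \<Longrightarrow> x \<in> closed_segment (of_real y * 1) (of_real y * 1) \<Longrightarrow> 
       Re (x * k) > 0 \<and> norm (x * k) \<le> \<rho>' * Re (x * k) \<and> m' * y \<le> norm (x * k)"
    using cone_on_segment[of 1 k 1] k by auto
  have hol: "bose_cut holomorphic_on {w. Re w > 0}" by (rule bose_cut_holomorphic) auto
  note cont = holomorphic_on_imp_continuous_on[OF hol]
  have cm: "continuous_on {0<..} (\<lambda>x. bose_cut (of_real x * m))" if "Re m > 0" for m
    by (rule continuous_on_compose2[OF cont]) (use that in \<open>auto intro!: continuous_intros\<close>)
  have "set_integrable lborel {0<..} (\<lambda>x. bose_cut (of_real x * c) * bose_cut (of_real x * k))"
  proof (rule set_integrable_Ioi_bound_square[where B = "100 * \<rho> * \<rho>'"])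
    show "continuous_on {0<..} (\<lambda>x. bose_cut (of_real x * c) * bose_cut (of_real x * k))"
      by (intro continuous_intros cm c k)
    fix x :: real assume x: "x > 0"
    have X: "Re (of_real x * c) > 0" "norm (of_real x * c) \<le> \<rho> * Re (of_real x * c)"
      and Y: "Re (of_real x * k) > 0" "norm (of_real x * k) \<le> \<rho>' * Re (of_real x * k)"
      using r(3)[OF x, of "of_real x"] r'(3)[OF x, of "of_real x"] by auto
    note bX = norm_bose_cut_cone[OF X r(1)] and bY = norm_bose_cut_cone[OF Y r'(1)]
    have "norm (bose_cut (of_real x * c) * bose_cut (of_real x * k)) \<le> (10 * \<rho>) * (10 * \<rho>')"
      unfolding norm_mult[of "bose_cut _"] using bX(1) bY(1) r(1) by (intro mult_mono) auto
    thus "norm (bose_cut (of_real x * c) * bose_cut (of_real x * k)) \<le> 100 * \<rho> * \<rho>'" by simp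
    have nn: "norm (of_real x * c) * norm (of_real x * k) = x\<^sup>2"
      using c x by (auto simp: k_def norm_mult norm_divide power2_eq_square)
    have "norm (bose_cut (of_real x * c) * bose_cut (of_real x * k)) \<le> (2 * \<rho> / norm (of_real x * c)) * (2 * \<rho>' / norm (of_real x * k))"
      unfolding norm_mult[of "bose_cut _"] using bX(2) bY(2) r(1) by (intro mult_mono) auto
    also have "\<dots> = 4 * \<rho> * \<rho>' / x\<^sup>2" unfolding nn[symmetric] by simp
    also have "\<dots> \<le> 100 * \<rho> * \<rho>' / x\<^sup>2" using r(1) r'(1) by (intro divide_right_mono mult_right_mono) auto
    finally show "norm (bose_cut (of_real x * c) * bose_cut (of_real x * k)) \<le> 100 * \<rho> * \<rho>' / x\<^sup>2" .
  qed
  thus ?thesis by (simp add: k_def)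
qed

text \<open>Parseval's identity is applied to the profiles of \<open>c\<close> and of the conjugate
  of 1/c: conjugation of the second profile then produces \<open>bose_cut (x / c)\<close>, and the
  two powers multiply to exp ((pi - 2 z) t).\<close>

lemma bose_pair_parseval:
  assumes z: "0 < Re z" "Re z < pi"
  shows "integrable lborel (\<lambda>t. of_real ((norm (completed_zeta t))\<^sup>2) * exp ((of_real pi - 2 * z) * of_real t))" (is ?A)
    "(LINT t|lborel. of_real ((norm (completed_zeta t))\<^sup>2) * exp ((of_real pi - 2 * z) * of_real t)) =
       2 * pi * (LINT x:{0<..}|lborel. bose_cut (of_real x * zdir z) * bose_cut (of_real x / zdir z))" (is ?B)
proof -
  define c where "c = zdir z"
  define c' where "c' = cnj (1 / c)"
  have c: "Re c > 0" unfolding c_def by (rule Re_zdir_pos[OF z])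
  have c'z: "c' = zdir (cnj z)" unfolding c'_def c_def zdir_cnj by simp
  have c': "Re c' > 0" unfolding c'z by (rule Re_zdir_pos) (use z in auto)
  define q where "q = Re z"
  have L: "Ln c = \<i> * (of_real pi / 2 - z)" unfolding c_def by (rule Ln_zdir[OF z])
  have L': "Ln c' = \<i> * (of_real pi / 2 - cnj z)" unfolding c'z by (rule Ln_zdir) (use z in auto)
  \<comment> \<open>Midway between |pi/2 - Re z| and pi/2: still an available decay rate, and by
    \<open>a\<close> larger than the growth rate of the factor of modulus exp ((pi/2 - q)
    t).\<close>
  define \<theta> where "\<theta> = (\<bar>pi / 2 - q\<bar> + pi / 2) / 2"
  have th: "0 < \<theta>" "\<theta> < pi / 2" "\<bar>pi / 2 - q\<bar> < \<theta>" using z unfolding \<theta>_def q_def by (auto simp: abs_if)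
  obtain B where B: "\<And>t. norm (completed_zeta t) \<le> B * exp (- (\<theta> * \<bar>t\<bar>))" using completed_zeta_decay[OF th(1,2)] by metis
  have B0: "B \<ge> 0" using order.trans[OF norm_ge_zero B[of 0]] by simp
  have d: "(pi / 2 - q) * t \<le> \<bar>pi / 2 - q\<bar> * \<bar>t\<bar>" for t using abs_ge_self[of "(pi / 2 - q) * t"] by (simp add: abs_mult)
  define a where "a = \<theta> - \<bar>pi / 2 - q\<bar>"
  have a: "a > 0" using th by (simp add: a_def)
  have G: "fourier (log_profile c') t = exp (- (crit t * Ln c')) * completed_zeta t" for t by (rule log_profile_fourier(2)[OF c'])
  have F: "fourier (log_profile c) t = exp (- (crit t * Ln c)) * completed_zeta t" for t by (rule log_profile_fourier(2)[OF c])
  have nG: "norm (fourier (log_profile c') t) \<le> exp (Im z / 2) * B * exp (- (a * \<bar>t\<bar>))" for t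
  proof -
    have "Re (- (crit t * Ln c')) = (pi / 2 - q) * t + - (Im z / 2) * - 1" unfolding L' by (simp add: crit_def q_def algebra_simps)
    hence "norm (fourier (log_profile c') t) = exp (Im z / 2) * (exp ((pi / 2 - q) * t) * norm (completed_zeta t))"
      unfolding G norm_mult norm_exp_eq_Re by (simp add: exp_add)
    also have "\<dots> \<le> exp (Im z / 2) * (exp (\<bar>pi / 2 - q\<bar> * \<bar>t\<bar>) * (B * exp (- (\<theta> * \<bar>t\<bar>))))"
      using B d by (intro mult_left_mono mult_mono) auto
    also have "\<dots> = exp (Im z / 2) * B * (exp (\<bar>pi / 2 - q\<bar> * \<bar>t\<bar>) * exp (- (\<theta> * \<bar>t\<bar>)))" by simp
    also have "exp (\<bar>pi / 2 - q\<bar> * \<bar>t\<bar>) * exp (- (\<theta> * \<bar>t\<bar>)) = exp (- (a * \<bar>t\<bar>))"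
      unfolding exp_add[symmetric] a_def by (simp add: algebra_simps)
    finally show ?thesis .
  qed
  have m: "log_profile c' \<in> borel_measurable borel" 
    using log_profile_continuous[OF c'] by (rule borel_measurable_continuous_onI)
  have Gi: "integrable lborel (fourier (log_profile c'))"
  proof (rule Bochner_Integration.integrable_bound)
    show "integrable lborel (\<lambda>t. exp (Im z / 2) * B * exp (- (a * \<bar>t\<bar>)))"
      by (intro integrable_mult_right integrable_exp_abs a)
    show "AE t in lborel. norm (fourier (log_profile c') t) \<le> norm (exp (Im z / 2) * B * exp (- (a * \<bar>t\<bar>)))"
      using nG B0 by (intro AE_I2) simp
  qed (use fourier_measurable[OF m] in simp)
  obtain C where C: "\<And>u. norm (log_profile c' u) \<le> C" using log_profile_bounded[OF c'] by metis
  have P: "(LINT y|lborel. fourier (log_profile c) y * cnj (fourier (log_profile c') y)) =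
      2 * pi * (LINT u|lborel. log_profile c u * cnj (log_profile c' u))"
    by (rule parseval[OF log_profile_fourier(1)[OF c] log_profile_fourier(1)[OF c'] log_profile_continuous[OF c'] C Gi])
  have lhs: "fourier (log_profile c) t * cnj (fourier (log_profile c') t)
     = of_real ((norm (completed_zeta t))\<^sup>2) * exp ((of_real pi - 2 * z) * of_real t)" for t
  proof -
    have "fourier (log_profile c) t * cnj (fourier (log_profile c') t) = 
       (exp (- (crit t * Ln c)) * exp (cnj (- (crit t * Ln c')))) * (completed_zeta t * cnj (completed_zeta t))"
      unfolding F G by (simp add: exp_cnj)
    also have "exp (- (crit t * Ln c)) * exp (cnj (- (crit t * Ln c'))) = exp ((of_real pi - 2 * z) * of_real t)"
      unfolding exp_add[symmetric] L L' by (simp add: crit_def algebra_simps)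
    also have "completed_zeta t * cnj (completed_zeta t) = of_real ((norm (completed_zeta t))\<^sup>2)"
      by (rule complex_norm_square[symmetric])
    finally show ?thesis by (simp add: mult.commute)
  qed
  show ?A
  proof (rule Bochner_Integration.integrable_bound)
    show "integrable lborel (\<lambda>t. B\<^sup>2 * exp (- (2 * a * \<bar>t\<bar>)))"
      by (intro integrable_mult_right integrable_exp_abs) (use a in simp)
    show "AE t in lborel. norm (of_real ((norm (completed_zeta t))\<^sup>2) * exp ((of_real pi - 2 * z) * of_real t))
       \<le> norm (B\<^sup>2 * exp (- (2 * a * \<bar>t\<bar>)))"
    proof (rule AE_I2)
      fix t :: real
      have "norm (of_real ((norm (completed_zeta t))\<^sup>2) * exp ((of_real pi - 2 * z) * of_real t))
        = (norm (completed_zeta t))\<^sup>2 * exp (2 * ((pi / 2 - q) * t))"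
        unfolding norm_mult norm_of_real norm_exp_eq_Re by (simp add: q_def algebra_simps)
      also have "\<dots> \<le> (B * exp (- (\<theta> * \<bar>t\<bar>)))\<^sup>2 * exp (2 * (\<bar>pi / 2 - q\<bar> * \<bar>t\<bar>))"
        using B[of t] d[of t] by (intro mult_mono power_mono) auto
      also have "\<dots> = B\<^sup>2 * exp (- (2 * a * \<bar>t\<bar>))"
        unfolding power_mult_distrib exp_double[symmetric] mult.assoc exp_add[symmetric] a_def by (simp add: algebra_simps)
      finally show "norm (of_real ((norm (completed_zeta t))\<^sup>2) * exp ((of_real pi - 2 * z) * of_real t))
       \<le> norm (B\<^sup>2 * exp (- (2 * a * \<bar>t\<bar>)))" by simp
    qed
  qed measurable
  have rhs: "log_profile c u * cnj (log_profile c' u) = exp u *\<^sub>R (bose_cut (of_real (exp u) * c) * bose_cut (of_real (exp u) / c))" for u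
  proof -
    have e1: "cnj (log_profile c' u) = of_real (exp (u / 2)) * bose_cut (of_real (exp u) / c)"
      unfolding log_profile_def c'_def complex_cnj_mult bose_cut_cnj[symmetric] by simp
    have e2: "complex_of_real (exp (u / 2)) * of_real (exp (u / 2)) = of_real (exp u)"
      unfolding of_real_mult[symmetric] exp_add[symmetric] by simp
    have e3: "(r * X) * (r * Y) = (r * r) * (X * Y)" for r X Y :: complex by algebra
    have "log_profile c u * cnj (log_profile c' u) = (of_real (exp (u / 2)) * bose_cut (of_real (exp u) * c))
       * (of_real (exp (u / 2)) * bose_cut (of_real (exp u) / c))" unfolding e1 unfolding log_profile_def by (rule refl)
    also have "\<dots> = (of_real (exp (u / 2)) * of_real (exp (u / 2))) * (bose_cut (of_real (exp u) * c) * bose_cut (of_real (exp u) / c))"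
      by (rule e3)
    finally show ?thesis unfolding e2 scaleR_conv_of_real .
  qed
  have pint: "set_integrable lborel {0<..} (\<lambda>x. bose_cut (of_real x * c) * bose_cut (of_real x / c))"
    using bose_pair_integrable[OF c] .
  show ?B using P unfolding lhs rhs exp_substitution(2)[OF pint] by (simp add: c_def)
qed

section \<open>From the product with Gamma back to |zeta|^2\<close>

lemma norm_completed_zeta_sq:
  "(norm (completed_zeta t))\<^sup>2 = 2 * pi * zeta_sq t / (exp (pi * t) + exp (- (pi * t)))"
proof -
  have "Gamma (crit t) * Gamma (1 - crit t) = of_real pi / sin (of_real pi * crit t)"
    by (rule Gamma_reflection_complex)
  also have "1 - crit t = cnj (crit t)" by (simp add: crit_def complex_eq_iff)
  also have "Gamma (cnj (crit t)) = cnj (Gamma (crit t))" by (rule cnj_Gamma[symmetric])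
  also have "Gamma (crit t) * cnj (Gamma (crit t)) = of_real ((norm (Gamma (crit t)))\<^sup>2)"
    by (rule complex_norm_square[symmetric])
  also have "sin (of_real pi * crit t) = of_real ((exp (pi * t) + exp (- (pi * t))) / 2)"
  proof -
    have "sin (of_real pi * crit t) = cos (of_real pi / 2 - of_real pi * crit t)" by (rule sin_cos_eq)
    also have "of_real pi / 2 - of_real pi * crit t = - (\<i> * of_real (pi * t))" by (simp add: crit_def algebra_simps)
    also have "cos (- (\<i> * of_real (pi * t))) = cos (\<i> * of_real (pi * t))" by simp
    also have "\<dots> = (exp (\<i> * (\<i> * of_real (pi * t))) + exp (- (\<i> * (\<i> * of_real (pi * t))))) / 2" by (rule cos_exp_eq)
    also have "\<i> * (\<i> * of_real (pi * t)) = of_real (- (pi * t))" by simp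
    also have "(exp (of_real (- (pi * t))) + exp (- of_real (- (pi * t)))) / 2 = complex_of_real ((exp (pi * t) + exp (- (pi * t))) / 2)"
      by (simp add: exp_of_real[symmetric])
    finally show ?thesis .
  qed
  also have "of_real pi / complex_of_real ((exp (pi * t) + exp (- (pi * t))) / 2) = of_real (2 * pi / (exp (pi * t) + exp (- (pi * t))))"
    by simp
  finally have "(norm (Gamma (crit t)))\<^sup>2 = 2 * pi / (exp (pi * t) + exp (- (pi * t)))"
    unfolding of_real_eq_iff .
  thus ?thesis by (simp add: completed_zeta_def norm_mult power_mult_distrib zeta_sq_def crit_def)
qed

text \<open>The Mellin representation has a kernel that is real on the positive axis, so conjugation
  merely changes the sign of \<open>t\<close>.\<close>

lemma completed_zeta_cnj: "completed_zeta (- t) = cnj (completed_zeta t)"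
proof -
  have c: "completed_zeta t = (LINT y:{0<..}|lborel. mellin_kernel (crit t) y * bose_cut (of_real y))" for t
    using critical_ray(2)[of 1 t] by simp
  have "mellin_kernel (crit (- t)) y = cnj (mellin_kernel (crit t) y)" for y
  proof -
    have "(crit (- t) - 1) * of_real (ln y) = cnj ((crit t - 1) * of_real (ln y))"
      by (simp add: crit_def complex_eq_iff)
    thus ?thesis by (simp only: mellin_kernel_def exp_cnj)
  qed
  moreover have "bose_cut (of_real y) = cnj (bose_cut (of_real y))" for y
    using bose_cut_cnj[of "of_real y"] by simp
  ultimately have e: "mellin_kernel (crit (- t)) y * bose_cut (of_real y) = cnj (mellin_kernel (crit t) y * bose_cut (of_real y))" for y
    by (metis complex_cnj_mult)
  have "completed_zeta (- t) = (LINT y:{0<..}|lborel. cnj (mellin_kernel (crit t) y * bose_cut (of_real y)))"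
    unfolding c e ..
  also have "\<dots> = (LINT y|lborel. cnj (indicator {0<..} y *\<^sub>R (mellin_kernel (crit t) y * bose_cut (of_real y))))"
    unfolding set_lebesgue_integral_def by simp
  also have "\<dots> = cnj (completed_zeta t)" unfolding c[of t] set_lebesgue_integral_def by (rule Bochner_Integration.integral_cnj)
  finally show ?thesis .
qed

lemma integral_symmetrise:
  fixes f :: "real \<Rightarrow> complex"
  assumes f: "integrable lborel f"
  shows "set_integrable lborel {0<..} (\<lambda>t. f t + f (- t))"
    "(LINT t|lborel. f t) = (LINT t:{0<..}|lborel. f t + f (- t))"
proof -
  define g where "g = (\<lambda>t. indicator {0<..} t *\<^sub>R f t)"
  define h where "h = (\<lambda>t. indicator {..<0} t *\<^sub>R f t)"
  have g: "integrable lborel g" unfolding g_def by (intro integrable_mult_indicator f) simp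
  have h: "integrable lborel h" unfolding h_def by (intro integrable_mult_indicator f) simp
  have hr: "integrable lborel (\<lambda>t. h (0 + - 1 * t))" by (rule lborel_integrable_real_affine[OF h]) simp
  have hi: "(LINT t|lborel. h t) = (LINT t|lborel. h (0 + - 1 * t))" using lborel_integral_real_affine[of "- 1" h 0] by simp
  have e: "(\<lambda>t. indicator {0<..} t *\<^sub>R (f t + f (- t))) = (\<lambda>t. g t + h (0 + - 1 * t))"
    by (auto simp: g_def h_def indicator_def fun_eq_iff)
  show "set_integrable lborel {0<..} (\<lambda>t. f t + f (- t))"
    unfolding set_integrable_def e by (intro Bochner_Integration.integrable_add g hr)
  have i0: "integrable lborel (\<lambda>t. indicator {0::real} t *\<^sub>R f 0)"
    by (intro integrable_scaleR_left integrable_real_indicator) auto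
  have fe: "f = (\<lambda>t. (g t + h t) + indicator {0} t *\<^sub>R f 0)"
    by (auto simp: g_def h_def indicator_def fun_eq_iff)
  have "(LINT t|lborel. f t) = (LINT t|lborel. (g t + h t) + indicator {0::real} t *\<^sub>R f 0)"
    by (subst fe) (rule refl)
  also have "\<dots> = (LINT t|lborel. g t) + (LINT t|lborel. h t) + (LINT t|lborel. indicator {0::real} t *\<^sub>R f 0)"
    using g h i0 by simp
  also have "(LINT t|lborel. indicator {0::real} t *\<^sub>R f 0) = 0" by simp
  finally show "(LINT t|lborel. f t) = (LINT t:{0<..}|lborel. f t + f (- t))"
    unfolding set_lebesgue_integral_def e hi using g hr by simp
qed

definition zeta_laplace :: "complex \<Rightarrow> complex" where
  "zeta_laplace p = (LINT t:{0<..}|lborel. of_real (zeta_sq t) * exp (- (p * of_real t)))"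

lemma norm_exp_diff_le: "norm (exp w - exp (- w)) \<le> 2 * norm w * exp (norm (w :: complex))"
proof -
  have *: "norm (exp v - 1) \<le> norm v * exp (norm v)" for v :: complex
  proof -
    have "norm (exp v - 1) \<le> exp \<bar>Re v\<bar> * norm v" using Taylor_exp[of v 0] by simp
    also have "\<dots> \<le> exp (norm v) * norm v" using abs_Re_le_cmod[of v] by (intro mult_right_mono) auto
    finally show ?thesis by (simp add: mult.commute)
  qed
  have "norm (exp w - exp (- w)) \<le> norm (exp w - 1) + norm (exp (- w) - 1)"
    using norm_triangle_ineq4[of "exp w - 1" "exp (- w) - 1"] by simp
  also have "\<dots> \<le> norm w * exp (norm w) + norm w * exp (norm w)" using *[of w] *[of "- w"] by (intro add_mono) auto
  finally show ?thesis by simp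
qed

lemma zeta_sq_nonneg: "zeta_sq t \<ge> 0" by (simp add: zeta_sq_def)

lemma zeta_sq_measurable [measurable]: "zeta_sq \<in> borel_measurable borel"
  using zeta_sq_continuous by (rule borel_measurable_continuous_onI)

text \<open>The two-sided integral of |Gamma zeta|^2 exp ((pi - p) t) is folded onto t > 0. By the
  reflection formula |Gamma|^2 times 2 cosh (pi t) is 2 pi. The folded integrand contains exp (p t)
  exp (-pi t) where exp (-p t) exp (-pi t) would fit; the difference \<open>g\<close> is of order
  norm p and is damped by exp (-pi t).\<close>

lemma zeta_laplace_pair:
  assumes p: "0 < Re p" "Re p < pi"
  shows "set_integrable lborel {0<..} (\<lambda>t. of_real (zeta_sq t) * exp (- (p * of_real t)))"
    and "norm p \<le> 1 \<Longrightarrow> norm (zeta_laplace p - (LINT x:{0<..}|lborel. bose_cut (of_real x * zdir (p / 2)) * bose_cut (of_real x / zdir (p / 2))))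
       \<le> norm p * (LINT t|lborel. (norm (completed_zeta t))\<^sup>2)"
proof -
  define W where "W = (\<lambda>t. (norm (completed_zeta t))\<^sup>2)"
  define f where "f = (\<lambda>t. of_real (W t) * exp ((of_real pi - p) * of_real t))"
  have z: "0 < Re (p / 2)" "Re (p / 2) < pi" using p by auto
  have fi: "integrable lborel f" using bose_pair_parseval(1)[OF z] by (simp add: f_def W_def)
  have fv: "(LINT t|lborel. f t) = 2 * pi * (LINT x:{0<..}|lborel. bose_cut (of_real x * zdir (p / 2)) * bose_cut (of_real x / zdir (p / 2)))"
    using bose_pair_parseval(2)[OF z] by (simp add: f_def W_def)
  have Wm [measurable]: "W \<in> borel_measurable borel" unfolding W_def by measurable
  have We: "W (- t) = W t" for t by (simp add: W_def completed_zeta_cnj)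
  have W0: "W t \<ge> 0" for t by (simp add: W_def)
  have Wi: "integrable lborel W"
  proof -
    have "integrable lborel (\<lambda>t. complex_of_real (W t))"
      using bose_pair_parseval(1)[of "of_real pi / 2"] by (simp add: W_def)
    thus ?thesis using integrable_Re by fastforce
  qed
  have key: "f t + f (- t) = 2 * of_real pi * (of_real (zeta_sq t) * exp (- (p * of_real t)))
       + of_real (W t * exp (- (pi * t))) * (exp (p * of_real t) - exp (- (p * of_real t)))" for t
  proof -
    define A where "A = complex_of_real (exp (pi * t))"
    define A' where "A' = complex_of_real (exp (- (pi * t)))"
    define E where "E = exp (p * of_real t)"
    define E' where "E' = exp (- (p * of_real t))"
    have "exp (pi * t) + exp (- (pi * t)) \<noteq> 0" by (smt (verit) exp_gt_zero)
    hence "W t * (exp (pi * t) + exp (- (pi * t))) = 2 * pi * zeta_sq t" 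
      unfolding W_def norm_completed_zeta_sq by simp
    hence w: "of_real (W t) * (A + A') = 2 * of_real pi * of_real (zeta_sq t)"
      unfolding A_def A'_def of_real_add[symmetric] of_real_mult[symmetric] by simp
    have e1: "exp ((of_real pi - p) * of_real t) = A * E'"
    proof -
      have "(of_real pi - p) * of_real t = of_real (pi * t) + - (p * of_real t)" by (simp add: algebra_simps)
      thus ?thesis by (simp only: A_def E'_def exp_add exp_of_real)
    qed
    have e2: "exp ((of_real pi - p) * of_real (- t)) = A' * E"
    proof -
      have "(of_real pi - p) * of_real (- t) = of_real (- (pi * t)) + p * of_real t" by (simp add: algebra_simps)
      thus ?thesis by (simp only: A'_def E_def exp_add exp_of_real)
    qed
    have "f t + f (- t) = of_real (W t) * (A * E' + A' * E)"
      unfolding f_def e1 e2 We by (simp add: distrib_left)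
    also have "\<dots> = (of_real (W t) * (A + A')) * E' + of_real (W t) * A' * (E - E')" by (simp add: algebra_simps)
    also have "\<dots> = 2 * of_real pi * (of_real (zeta_sq t) * E') + of_real (W t * exp (- (pi * t))) * (E - E')"
      unfolding w by (simp add: A'_def)
    finally show ?thesis by (simp add: E_def E'_def)
  qed
  define g where "g = (\<lambda>t. of_real (W t * exp (- (pi * t))) * (exp (p * of_real t) - exp (- (p * of_real t))))"
  have [measurable]: "f \<in> borel_measurable borel" unfolding f_def by measurable
  show li: "set_integrable lborel {0<..} (\<lambda>t. of_real (zeta_sq t) * exp (- (p * of_real t)))"
  proof (rule set_integrable_bound)
    show "set_integrable lborel {0<..} f" unfolding set_integrable_def by (intro integrable_mult_indicator fi) simp
    show "AE t in lborel. t \<in> {0<..} \<longrightarrow> norm (of_real (zeta_sq t) * exp (- (p * of_real t))) \<le> norm (f t)"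
    proof (intro AE_I2 impI)
      fix t :: real assume t: "t \<in> {0<..}"
      have "zeta_sq t = W t * (exp (pi * t) + exp (- (pi * t))) / (2 * pi)"
      proof -
        have "exp (pi * t) + exp (- (pi * t)) \<noteq> 0" by (smt (verit) exp_gt_zero)
        thus ?thesis unfolding W_def norm_completed_zeta_sq by simp
      qed
      also have "\<dots> \<le> W t * (2 * exp (pi * t)) / 2"
      proof (rule frac_le)
        have "exp (- (pi * t)) \<le> exp (pi * t)" using t by simp
        thus "W t * (exp (pi * t) + exp (- (pi * t))) \<le> W t * (2 * exp (pi * t))" using W0 by (intro mult_left_mono) auto
      qed (use W0 pi_gt3 in auto)
      finally have "zeta_sq t \<le> W t * exp (pi * t)" by simp
      hence "zeta_sq t * exp (- (Re p * t)) \<le> (W t * exp (pi * t)) * exp (- (Re p * t))" by (intro mult_right_mono) auto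
      also have "\<dots> = W t * exp ((pi - Re p) * t)" unfolding mult.assoc exp_add[symmetric] by (simp add: algebra_simps)
      finally show "norm (of_real (zeta_sq t) * exp (- (p * of_real t))) \<le> norm (f t)"
        unfolding f_def norm_mult norm_of_real norm_exp_eq_Re using W0 zeta_sq_nonneg by simp
    qed
  qed (simp add: set_borel_measurable_def)
  assume p1: "norm p \<le> 1"
  have gb: "norm (g t) \<le> 2 * norm p * W t" if t: "t > 0" for t
  proof -
    have "norm (g t) = W t * (exp (- (pi * t)) * norm (exp (p * of_real t) - exp (- (p * of_real t))))"
      unfolding g_def norm_mult norm_of_real using W0 by simp
    also have "norm (exp (p * of_real t) - exp (- (p * of_real t))) \<le> 2 * norm (p * of_real t) * exp (norm (p * of_real t))"
      by (rule norm_exp_diff_le)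
    also have "\<dots> \<le> 2 * (norm p * t) * exp t" unfolding norm_mult
      using p1 t mult_right_mono[OF p1, of t] by (intro mult_mono) auto
    also have "exp (- (pi * t)) * (2 * (norm p * t) * exp t) \<le> 2 * norm p"
    proof -
      have "t \<le> exp t" using exp_ge_add_one_self[of t] by linarith
      hence "exp (- (pi * t)) * (t * exp t) \<le> exp (- (pi * t)) * (exp t * exp t)" by (intro mult_left_mono mult_right_mono) auto
      also have "\<dots> = exp (2 * t - pi * t)" unfolding exp_add[symmetric] by (simp add: algebra_simps)
      also have "\<dots> \<le> 1" using t pi_gt3 by (simp add: mult_right_mono)
      finally have "2 * norm p * (exp (- (pi * t)) * (t * exp t)) \<le> 2 * norm p * 1" by (intro mult_left_mono) auto
      thus ?thesis by (simp add: mult_ac)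
    qed
    finally have "norm (g t) \<le> W t * (2 * norm p)" using W0[of t] by (simp add: mult_left_mono)
    thus ?thesis by (simp add: mult.commute)
  qed
  have Wi2: "set_integrable lborel {0<..} (\<lambda>t. 2 * norm p * W t)" unfolding set_integrable_def
    by (intro integrable_mult_indicator integrable_mult_right Wi) simp
  have gi: "set_integrable lborel {0<..} g"
  proof (rule set_integrable_bound[OF Wi2])
    show "AE t in lborel. t \<in> {0<..} \<longrightarrow> norm (g t) \<le> norm (2 * norm p * W t)"
      using gb W0 by (intro AE_I2) simp
  qed (simp add: set_borel_measurable_def g_def)
  have "2 * pi * (LINT x:{0<..}|lborel. bose_cut (of_real x * zdir (p / 2)) * bose_cut (of_real x / zdir (p / 2)))
     = (LINT t:{0<..}|lborel. f t + f (- t))" using fv integral_symmetrise(2)[OF fi] by simp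
  also have "\<dots> = 2 * of_real pi * zeta_laplace p + (LINT t:{0<..}|lborel. g t)"
    unfolding key g_def[symmetric] zeta_laplace_def
    by (subst set_integral_add(2)) (use li gi in \<open>auto simp: g_def intro!: set_integrable_mult_right\<close>)
  finally have eq: "zeta_laplace p - (LINT x:{0<..}|lborel. bose_cut (of_real x * zdir (p / 2)) * bose_cut (of_real x / zdir (p / 2)))
     = - ((LINT t:{0<..}|lborel. g t) / (2 * of_real pi))" by (simp add: field_simps)
  have "norm (LINT t:{0<..}|lborel. g t) \<le> (LINT t:{0<..}|lborel. norm (g t))" by (rule set_integral_norm_bound[OF gi])
  also have "\<dots> \<le> (LINT t:{0<..}|lborel. 2 * norm p * W t)"
    by (rule set_integral_mono[OF set_integrable_norm[OF gi] Wi2]) (use gb in simp)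
  also have "\<dots> \<le> (LINT t|lborel. 2 * norm p * W t)" unfolding set_lebesgue_integral_def
  proof (rule integral_mono)
    show "integrable lborel (\<lambda>t. indicator {0<..} t *\<^sub>R (2 * norm p * W t))" using Wi2 unfolding set_integrable_def .
    show "integrable lborel (\<lambda>t. 2 * norm p * W t)" by (intro integrable_mult_right Wi)
    show "indicator {0<..} t *\<^sub>R (2 * norm p * W t) \<le> 2 * norm p * W t" for t
      using W0[of t] by (simp add: indicator_def)
  qed
  also have "\<dots> = 2 * norm p * (LINT t|lborel. W t)" by simp
  finally have "norm (LINT t:{0<..}|lborel. g t) / (2 * pi) \<le> 2 * norm p * (LINT t|lborel. W t) / (2 * 1)"
    by (rule frac_le[rotated]) (use pi_gt3 W0 in \<open>auto intro!: mult_nonneg_nonneg integral_nonneg_AE\<close>)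
  thus "norm (zeta_laplace p - (LINT x:{0<..}|lborel. bose_cut (of_real x * zdir (p / 2)) * bose_cut (of_real x / zdir (p / 2))))
       \<le> norm p * (LINT t|lborel. (norm (completed_zeta t))\<^sup>2)"
    unfolding eq norm_minus_cancel norm_divide by (simp add: W_def norm_mult)
qed

section \<open>Expansion of Z(p) for small p\<close>

lemma norm_sin_minus_le:
  fixes z :: complex
  assumes "norm z \<le> 1 / 6" shows "norm (sin z - z) \<le> 3 / 2 * norm z ^ 3"
proof -
  have T: "norm (exp w - (1 + w + w\<^sup>2 / 2)) \<le> 3 / 2 * norm w ^ 3" if "norm w \<le> 1 / 6" for w :: complex
  proof -
    have "norm (exp w - (1 + w + w\<^sup>2 / 2)) \<le> exp \<bar>Re w\<bar> * norm w ^ Suc 2 / fact 2"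
      using Taylor_exp[of w 2] by (simp add: numeral_2_eq_2 algebra_simps)
    also have "\<dots> \<le> 3 * norm w ^ Suc 2 / fact 2"
    proof -
      have "exp \<bar>Re w\<bar> \<le> exp 1" using that abs_Re_le_cmod[of w] by simp
      also have "\<dots> \<le> (3::real)" by (rule exp_le)
      finally show ?thesis by (intro divide_right_mono mult_right_mono) auto
    qed
    finally show ?thesis by (simp add: numeral_3_eq_3 fact_numeral)
  qed
  define w where "w = \<i> * z"
  have nw: "norm w = norm z" by (simp add: w_def norm_mult)
  have "sin z - z = ((exp w - (1 + w + w\<^sup>2 / 2)) - (exp (- w) - (1 + - w + (- w)\<^sup>2 / 2))) / (2 * \<i>)"
  proof -
    have num: "(exp w - (1 + w + w\<^sup>2 / 2)) - (exp (- w) - (1 + - w + (- w)\<^sup>2 / 2)) = (exp w - exp (- w)) - 2 * w" by simp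
    have z: "2 * w / (2 * \<i>) = z" by (simp add: w_def)
    have s: "sin z = (exp w - exp (- w)) / (2 * \<i>)" unfolding w_def by (rule sin_exp_eq)
    have "sin z - z = (exp w - exp (- w)) / (2 * \<i>) - 2 * w / (2 * \<i>)" unfolding s z ..
    thus ?thesis unfolding num diff_divide_distrib[of "exp w - exp (- w)"] .
  qed
  hence "norm (sin z - z) = norm ((exp w - (1 + w + w\<^sup>2 / 2)) - (exp (- w) - (1 + - w + (- w)\<^sup>2 / 2))) / 2"
    by (simp only: norm_divide) (simp add: norm_mult)
  also have "\<dots> \<le> (3 / 2 * norm w ^ 3 + 3 / 2 * norm (- w) ^ 3) / 2"
  proof -
    have t1: "norm ((exp w - (1 + w + w\<^sup>2 / 2)) - (exp (- w) - (1 + - w + (- w)\<^sup>2 / 2)))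
       \<le> norm (exp w - (1 + w + w\<^sup>2 / 2)) + norm (exp (- w) - (1 + - w + (- w)\<^sup>2 / 2))" by (rule norm_triangle_ineq4)
    have t2: "norm (exp w - (1 + w + w\<^sup>2 / 2)) \<le> 3 / 2 * norm w ^ 3" by (rule T) (use assms nw in simp)
    have t3: "norm (exp (- w) - (1 + - w + (- w)\<^sup>2 / 2)) \<le> 3 / 2 * norm (- w) ^ 3" by (rule T) (use assms nw in simp)
    show ?thesis by (rule divide_right_mono[OF order.trans[OF t1 add_mono[OF t2 t3]]]) simp
  qed
  finally show ?thesis by (simp add: nw)
qed

lemma norm_cos_minus_one_le:
  fixes z :: complex
  assumes "norm z \<le> 1 / 6" shows "norm (cos z - 1) \<le> 3 * norm z"
proof -
  have "cos z - 1 = ((exp (\<i> * z) - 1) + (exp (- (\<i> * z)) - 1)) / 2" by (simp add: cos_exp_eq field_simps)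
  hence "norm (cos z - 1) = norm ((exp (\<i> * z) - 1) + (exp (- (\<i> * z)) - 1)) / 2" by (simp only: norm_divide) simp
  also have "\<dots> \<le> (3 * norm z + 3 * norm z) / 2"
    using norm_exp_minus_one_le[of "\<i> * z"] norm_exp_minus_one_le[of "- (\<i> * z)"] assms
    by (intro divide_right_mono order.trans[OF norm_triangle_ineq] add_mono) (auto simp: norm_mult)
  finally show ?thesis by simp
qed

text \<open>Bookkeeping of the coefficients collected in the next proof: \<open>i\<close> is the
  integral of |Gamma zeta|^2, \<open>k\<close> the constant of the remainder, \<open>n\<close> the
  modulus of the constant in Z(p).\<close>

lemma zeta_laplace_constant_le:
  fixes i k n :: real
  assumes "0 \<le> n" "0 \<le> k"
  shows "i + k / 2 + 3 / 4 * n + 3 / 4 + 3 / 2 + 3 / 2 * n + 20 \<le> i + 2 * (n + 1) + 3 + 3 * n + 40 + k"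
  using assms by (simp add: field_simps)

text \<open>The pair integral is known in terms of \<open>sin z\<close> and \<open>cos z\<close>
  with z = p/2. It remains to replace \<open>2 * sin z\<close> by \<open>p\<close> and
  \<open>2 * cos z * (of_real pi / 2 - z)\<close> by pi, at a cost of order norm p up to the
  logarithm.\<close>

lemma zeta_laplace_asymp:
  defines "c2 \<equiv> complex_of_real (euler_mascheroni - ln (2 * pi))"
  obtains C where "C \<ge> 0" "\<And>p. 0 < Re p \<Longrightarrow> norm p \<le> 1 / 3 \<Longrightarrow>
    norm (zeta_laplace p - ((c2 - Ln p) / p + of_real pi)) \<le> C * (norm p * (1 + norm (Ln p) + (norm p / Re p) ^ 3))"
proof -
  define I where "I = (LINT t|lborel. (norm (completed_zeta t))\<^sup>2)"
  have I0: "I \<ge> 0" unfolding I_def by (intro integral_nonneg_AE) simp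
  obtain K2 where K2: "K2 \<ge> 0" "\<And>z. 0 < Re z \<Longrightarrow> norm z \<le> 1 / 6 \<Longrightarrow>
     norm ((LINT x:{0<..}|lborel. bose_cut (of_real x * zdir z) * bose_cut (of_real x / zdir z))
     - ((2 * bose_const - Ln (2 * sin z)) / (2 * sin z) - bose_const * (2 * sin z) + 2 * cos z * (of_real pi / 2 - z)))
     \<le> K2 * (norm z / Re z) ^ 3 * norm z"
  proof (rule that)
    show "(0::real) \<le> 286654464" by simp
  qed (rule bose_pair_zdir)
  define C where "C = I + 2 * (norm c2 + 1) + 3 + 3 * norm c2 + 40 + K2"
  show ?thesis
  proof (rule that[of C])
    show "C \<ge> 0" using I0 K2(1) by (simp add: C_def)
    fix p :: complex assume p: "0 < Re p" "norm p \<le> 1 / 3"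
    define z where "z = p / 2"
    have pz: "p = 2 * z" by (simp add: z_def)
    have z: "0 < Re z" "norm z \<le> 1 / 6" using p by (auto simp: z_def norm_divide)
    have z0: "norm z > 0" "z \<noteq> 0" using z by auto
    have rp: "Re p < pi" using p complex_Re_le_cmod[of p] pi_gt3 by linarith
    define K where "K = (LINT x:{0<..}|lborel. bose_cut (of_real x * zdir z) * bose_cut (of_real x / zdir z))"
    define q where "q = (norm z / Re z) ^ 3"
    have q: "(norm p / Re p) ^ 3 = q" "q \<ge> 0" using z by (auto simp: q_def pz norm_mult)
    have 1: "norm (zeta_laplace p - K) \<le> norm p * I"
      using zeta_laplace_pair(2)[OF p(1) rp] p unfolding I_def K_def z_def by simp
    have bc: "2 * bose_const = c2" by (simp add: bose_const_eq c2_def)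
    have 2: "norm (K - ((c2 - Ln (2 * sin z)) / (2 * sin z) - c2 * sin z + 2 * cos z * (of_real pi / 2 - z))) \<le> K2 * q * norm z"
    proof -
      have e: "bose_const * (2 * sin z) = c2 * sin z" by (simp add: bc[symmetric])
      show ?thesis using K2(2)[OF z] unfolding e bc K_def q_def by simp
    qed
    have sm: "norm (sin z - z) \<le> 3 / 2 * norm z ^ 3" by (rule norm_sin_minus_le[OF z(2)])
    have z2: "norm z ^ 2 \<le> 1 / 36"
      using power_mono[OF z(2), of 2] by (simp add: power2_eq_square)
    have z3: "norm z ^ 3 = norm z ^ 2 * norm z" by (simp add: power2_eq_square power3_eq_cube)
    have z3': "norm z ^ 3 \<le> 1 / 36 * norm z" unfolding z3 using z2 by (intro mult_right_mono) auto
    have sl: "norm (sin z) \<ge> norm z / 2"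
    proof -
      have "norm z - norm (z - sin z) \<le> norm (sin z)" using norm_triangle_ineq2[of z "z - sin z"] by simp
      moreover have "norm (z - sin z) = norm (sin z - z)" by (rule norm_minus_commute)
      ultimately show ?thesis using sm z3' z0(1) by linarith
    qed
    have s0: "sin z \<noteq> 0" using sl z0 by auto
    \<comment> \<open>The relative error of \<open>sin z\<close> against \<open>z\<close>. It is
      quadratic in \<open>z\<close>, so dividing by \<open>sin z\<close> still leaves an error of
      first order.\<close>
    define u where "u = sin z / z - 1"
    have u: "norm u \<le> 3 / 2 * norm z ^ 2"
    proof -
      have "u = (sin z - z) / z" using z0 by (simp add: u_def diff_divide_distrib)
      hence "norm u = norm (sin z - z) / norm z" by (simp add: norm_divide)
      also have "\<dots> \<le> (3 / 2 * norm z ^ 3) / norm z" using sm by (intro divide_right_mono) auto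
      also have "\<dots> = 3 / 2 * norm z ^ 2" unfolding z3 using z0 by simp
      finally show ?thesis .
    qed
    hence u24: "norm u \<le> 1 / 24" using z2 by linarith
    have Lu: "norm (Ln (1 + u)) \<le> 2 * norm u" by (rule norm_Ln_le) (use u24 in simp)
    have u1: "1 + u \<noteq> 0"
    proof
      assume "1 + u = 0" hence "u = - 1" by (simp add: add_eq_0_iff)
      thus False using u24 by simp
    qed
    have Lp: "\<bar>Im (Ln p)\<bar> < pi / 2" using p(1) Re_Ln_pos_lt[of p] by force
    \<comment> \<open>The principal logarithm is additive here because \<open>p\<close> lies in the
      right half-plane and \<open>1 + u\<close> is close to 1.\<close>
    have Ls: "Ln (2 * sin z) = Ln p + Ln (1 + u)"
    proof -
      have "2 * sin z = p * (1 + u)" using z0 by (simp add: u_def pz)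
      also have "Ln (p * (1 + u)) = Ln p + Ln (1 + u)"
      proof (rule Ln_times_simple)
        have "\<bar>Im (Ln (1 + u))\<bar> \<le> 1 / 12" using abs_Im_le_cmod[of "Ln (1 + u)"] Lu u24 by linarith
        thus "- pi < Im (Ln p) + Im (Ln (1 + u))" "Im (Ln p) + Im (Ln (1 + u)) \<le> pi"
          using Lp pi_gt3 by linarith+
      qed (use p u1 in auto)
      finally show ?thesis .
    qed
    have A: "norm ((c2 - Ln (2 * sin z)) / (2 * sin z) - (c2 - Ln p) / p) \<le> (norm c2 + norm (Ln p)) * (3 / 2 * norm z) + 3 * norm z"
    proof -
      have "(c2 - Ln (2 * sin z)) / (2 * sin z) - (c2 - Ln p) / p
         = (c2 - Ln p) * ((z - sin z) / (2 * z * sin z)) - Ln (1 + u) / (2 * sin z)"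
        unfolding Ls pz using z0 s0 by (simp add: field_simps)
      also have "norm \<dots> \<le> norm (c2 - Ln p) * norm ((z - sin z) / (2 * z * sin z)) + norm (Ln (1 + u)) / norm (2 * sin z)"
        using norm_triangle_ineq4[of "(c2 - Ln p) * ((z - sin z) / (2 * z * sin z))" "Ln (1 + u) / (2 * sin z)"]
        by (simp only: norm_mult norm_divide)
      also have "\<dots> \<le> (norm c2 + norm (Ln p)) * (3 / 2 * norm z) + 3 * norm z"
      proof (intro add_mono mult_mono)
        show "norm (c2 - Ln p) \<le> norm c2 + norm (Ln p)" by (rule norm_triangle_ineq4)
        have "norm ((z - sin z) / (2 * z * sin z)) = norm (sin z - z) / (2 * norm z * norm (sin z))"
          by (simp add: norm_divide norm_mult norm_minus_commute)
        also have "\<dots> \<le> (3 / 2 * norm z ^ 3) / (2 * norm z * (norm z / 2))"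
          using sm sl z0 by (intro frac_le mult_left_mono) auto
        also have "\<dots> = 3 / 2 * norm z" using z0 by (simp add: power3_eq_cube)
        finally show "norm ((z - sin z) / (2 * z * sin z)) \<le> 3 / 2 * norm z" .
        have "norm (Ln (1 + u)) / norm (2 * sin z) \<le> (2 * (3 / 2 * norm z ^ 2)) / (2 * (norm z / 2))"
          using Lu u sl z0 by (intro frac_le) (auto simp: norm_mult)
        also have "\<dots> = 3 * norm z" using z0 by (simp add: power2_eq_square)
        finally show "norm (Ln (1 + u)) / norm (2 * sin z) \<le> 3 * norm z" .
      qed auto
      finally show ?thesis .
    qed
    have B: "norm (c2 * sin z) \<le> norm c2 * (3 * norm z)"
      unfolding norm_mult using sin_small_bounds(1)[OF z] by (intro mult_left_mono) auto
    have D: "norm (2 * cos z * (of_real pi / 2 - z) - of_real pi) \<le> 40 * norm z"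
    proof -
      have cm: "norm (cos z - 1) \<le> 3 * norm z" by (rule norm_cos_minus_one_le[OF z(2)])
      have "2 * cos z * (of_real pi / 2 - z) - of_real pi = of_real pi * (cos z - 1) - 2 * z - 2 * z * (cos z - 1)"
        by (simp add: algebra_simps)
      also have "norm \<dots> \<le> pi * norm (cos z - 1) + 2 * norm z + 2 * norm z * norm (cos z - 1)"
        by (rule order.trans[OF norm_triangle_ineq4] , rule add_mono[OF order.trans[OF norm_triangle_ineq4]]) (auto simp: norm_mult)
      also have "\<dots> \<le> 4 * (3 * norm z) + 2 * norm z + 2 * norm z * (3 * norm z)"
        using cm pi_less_4 by (intro add_mono mult_mono) auto
      also have "2 * norm z * (3 * norm z) \<le> 2 * norm z * 1" using z by (intro mult_left_mono) auto
      also have "4 * (3 * norm z) + 2 * norm z + 2 * norm z * 1 \<le> 40 * norm z" by simp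
      finally show ?thesis by simp
    qed
    define X where "X = norm p * (1 + norm (Ln p) + q)"
    have np: "norm z = norm p / 2" by (simp add: z_def norm_divide)
    have X1: "norm p \<le> X" "norm p * norm (Ln p) \<le> X" "norm p * q \<le> X"
      unfolding X_def using q by (auto intro!: mult_left_mono simp: ring_distribs)
    have "zeta_laplace p - ((c2 - Ln p) / p + of_real pi) = (zeta_laplace p - K)
      + (K - ((c2 - Ln (2 * sin z)) / (2 * sin z) - c2 * sin z + 2 * cos z * (of_real pi / 2 - z)))
      + ((c2 - Ln (2 * sin z)) / (2 * sin z) - (c2 - Ln p) / p) - c2 * sin z
      + (2 * cos z * (of_real pi / 2 - z) - of_real pi)" by simp
    also have "norm \<dots> \<le> norm (zeta_laplace p - K)
      + norm (K - ((c2 - Ln (2 * sin z)) / (2 * sin z) - c2 * sin z + 2 * cos z * (of_real pi / 2 - z)))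
      + norm ((c2 - Ln (2 * sin z)) / (2 * sin z) - (c2 - Ln p) / p) + norm (c2 * sin z)
      + norm (2 * cos z * (of_real pi / 2 - z) - of_real pi)"
      by (intro order.trans[OF norm_triangle_ineq] order.trans[OF norm_triangle_ineq4] add_mono order_refl)
    also have "\<dots> \<le> norm p * I + K2 * q * norm z + ((norm c2 + norm (Ln p)) * (3 / 2 * norm z) + 3 * norm z)
       + norm c2 * (3 * norm z) + 40 * norm z"
      by (intro add_mono 1 2 A B D)
    also have "\<dots> = I * norm p + K2 / 2 * (norm p * q) + (3 / 4) * norm c2 * norm p + (3 / 4) * (norm p * norm (Ln p)) + (3 / 2) * norm p
       + (3 / 2) * norm c2 * norm p + 20 * norm p" unfolding np by (simp add: field_simps)
    also have "\<dots> \<le> I * X + K2 / 2 * X + (3 / 4) * norm c2 * X + (3 / 4) * X + (3 / 2) * X + (3 / 2) * norm c2 * X + 20 * X"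
      using X1 I0 K2(1) by (intro add_mono mult_left_mono) auto
    also have "\<dots> = (I + K2 / 2 + (3 / 4) * norm c2 + 3 / 4 + 3 / 2 + (3 / 2) * norm c2 + 20) * X" by (simp add: algebra_simps)
    also have "\<dots> \<le> C * X"
    proof (rule mult_right_mono)
      show "0 \<le> X" using X1(1) norm_ge_zero[of p] by linarith
      show "I + K2 / 2 + 3 / 4 * norm c2 + 3 / 4 + 3 / 2 + 3 / 2 * norm c2 + 20 \<le> C" unfolding C_def using K2(1) by (intro zeta_laplace_constant_le) auto
    qed
    finally show "norm (zeta_laplace p - ((c2 - Ln p) / p + of_real pi)) \<le> C * (norm p * (1 + norm (Ln p) + (norm p / Re p) ^ 3))"
      unfolding X_def q .
  qed
qed

section \<open>An upper bound for the mean square\<close>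

lemma complex_exp_integral:
  assumes p: "Re p > 0"
  shows "set_integrable lborel {0<..} (\<lambda>t. exp (- (p * of_real t)))"
    "(LINT t:{0<..}|lborel. exp (- (p * of_real t))) = 1 / p"
proof -
  have p0: "p \<noteq> 0" using p by auto
  show i: "set_integrable lborel {0<..} (\<lambda>t. exp (- (p * of_real t)))"
    by (rule set_integrable_bound[OF exp_integral_Ioi(1)[OF p]])
       (auto simp: set_borel_measurable_def norm_exp_eq_Re intro!: AE_I2)
  have "(LINT t:{0<..}|lborel. exp (- (p * of_real t))) = 0 - (- 1 / p)"
  proof (rule set_lebesgue_integral_FTC_Ioi[OF _ _ i, where F = "\<lambda>t. - exp (- (p * of_real t)) / p"])
    show "((\<lambda>t. - exp (- (p * of_real t)) / p) has_vector_derivative exp (- (p * of_real x))) (at x)" for x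
    proof -
      have "((\<lambda>z. - exp (- (p * z)) / p) has_field_derivative exp (- (p * of_real x))) (at (of_real x))"
        using p0 by (auto intro!: derivative_eq_intros)
      thus ?thesis by (rule has_vector_derivative_real_field)
    qed
    show "continuous_on {0<..} (\<lambda>t. exp (- (p * of_real t)))" by (intro continuous_intros)
    have "((\<lambda>t. - exp (- (p * of_real t)) / p) \<longlongrightarrow> - exp (- (p * of_real 0)) / p) (at_right 0)"
      using p0 by (intro tendsto_intros) auto
    thus "((\<lambda>t. - exp (- (p * of_real t)) / p) \<longlongrightarrow> - 1 / p) (at_right 0)" by simp
    have "((\<lambda>t. exp (- (Re p * t)) / norm p) \<longlongrightarrow> 0) at_top" using p p0 by real_asymp
    hence "((\<lambda>t. norm (- exp (- (p * of_real t)) / p)) \<longlongrightarrow> 0) at_top" by (simp add: norm_divide norm_exp_eq_Re)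
    thus "((\<lambda>t. - exp (- (p * of_real t)) / p) \<longlongrightarrow> 0) at_top" by (rule tendsto_norm_zero_cancel)
  qed
  thus "(LINT t:{0<..}|lborel. exp (- (p * of_real t))) = 1 / p" by simp
qed

lemma complex_exp_integral_from:
  assumes p: "Re p > 0"
  shows "integrable lborel (\<lambda>t. indicator {u<..} t *\<^sub>R exp (- (p * of_real t)))"
    "(LINT t|lborel. indicator {u<..} t *\<^sub>R exp (- (p * of_real t))) = exp (- (p * of_real u)) / p"
proof -
  define f where "f = (\<lambda>t::real. indicator {u<..} t *\<^sub>R exp (- (p * of_real t)))"
  have e: "f (u + 1 * t) = exp (- (p * of_real u)) * (indicator {0<..} t *\<^sub>R exp (- (p * of_real t)))" for t
  proof -
    have "exp (- (p * of_real (u + 1 * t))) = exp (- (p * of_real u)) * exp (- (p * of_real t))"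
      unfolding exp_add[symmetric] by (simp add: algebra_simps)
    thus ?thesis by (simp add: f_def indicator_def)
  qed
  have i: "integrable lborel (\<lambda>t. f (u + 1 * t))"
    unfolding e using complex_exp_integral(1)[OF p] unfolding set_integrable_def by (rule integrable_mult_right)
  show "integrable lborel (\<lambda>t. indicator {u<..} t *\<^sub>R exp (- (p * of_real t)))"
    using lborel_integrable_real_affine[OF i, of 1 "- u"] by (simp add: f_def)
  have "(LINT t|lborel. f t) = (LINT t|lborel. f (u + 1 * t))"
    using lborel_integral_real_affine[of 1 f u] by simp
  also have "\<dots> = exp (- (p * of_real u)) * (1 / p)"
    unfolding e integral_mult_right_zero complex_exp_integral(2)[OF p, unfolded set_lebesgue_integral_def] ..
  finally show "(LINT t|lborel. indicator {u<..} t *\<^sub>R exp (- (p * of_real t))) = exp (- (p * of_real u)) / p"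
    by (simp add: f_def)
qed

text \<open>Fubini over 0 < u < t. The decay exp (-Re p t) is shared equally: one half makes the
  integral in \<open>t\<close> converge, and the other half, as u < t, makes \<open>a\<close>
  integrable in \<open>u\<close>.\<close>

lemma laplace_of_primitive:
  fixes a :: "real \<Rightarrow> real"
  assumes m [measurable]: "a \<in> borel_measurable borel"
    and ai: "\<And>\<sigma>. \<sigma> > 0 \<Longrightarrow> set_integrable lborel {0<..} (\<lambda>t. a t * exp (- (\<sigma> * t)))"
    and p: "Re p > 0"
  shows "set_integrable lborel {0<..} (\<lambda>t. of_real (LINT u:{0<..<t}|lborel. a u) * exp (- (p * of_real t)))"
    "(LINT t:{0<..}|lborel. of_real (LINT u:{0<..<t}|lborel. a u) * exp (- (p * of_real t)))
       = (LINT t:{0<..}|lborel. of_real (a t) * exp (- (p * of_real t))) / p"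
proof -
  define s where "s = Re p / 2"
  have s: "s > 0" using p by (simp add: s_def)
  define f where "f = (\<lambda>t u. indicator {0<..} u *\<^sub>R (of_real (a u) * (indicator {u<..} t *\<^sub>R exp (- (p * of_real t)))))"
  define g where "g = (\<lambda>t. complex_of_real (indicator {0<..} t * exp (- (s * t))))"
  define h where "h = (\<lambda>u. complex_of_real (indicator {0<..} u * (a u * exp (- (s * u)))))"
  have gi: "integrable lborel g" 
    using exp_integral_Ioi(1)[OF s] unfolding g_def set_integrable_def by (simp add: scaleR_conv_of_real)
  have hi: "integrable lborel h"
    using ai[OF s] unfolding h_def set_integrable_def by (intro integrable_of_real) simp
  have int: "integrable (lborel \<Otimes>\<^sub>M lborel) (\<lambda>(t, u). f t u)"
  proof (rule integrable_lborel_prod[OF _ gi hi])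
    have m1: "(\<lambda>(t, u). indicator {0<..} u *\<^sub>R (of_real (a u) * ((if u < t then 1 else 0) *\<^sub>R exp (- (p * complex_of_real t))))) \<in> borel_measurable (lborel \<Otimes>\<^sub>M lborel)"
      by measurable
    have e: "(\<lambda>(t, u). indicator {0<..} u *\<^sub>R (of_real (a u) * ((if u < t then 1 else 0) *\<^sub>R exp (- (p * complex_of_real t))))) = (\<lambda>(t, u). f t u)"
      by (auto simp: f_def fun_eq_iff indicator_def)
    show "(\<lambda>(t, u). f t u) \<in> borel_measurable (lborel \<Otimes>\<^sub>M lborel)" using m1 unfolding e .
    show "norm (f t u) \<le> norm (g t) * norm (h u)" for t u
    proof (cases "0 < u \<and> u < t")
      case True
      have "exp (- (Re p * t)) = exp (- (s * t)) * exp (- (s * t))" unfolding exp_add[symmetric] by (simp add: s_def)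
      also have "\<dots> \<le> exp (- (s * t)) * exp (- (s * u))" using True s by (intro mult_left_mono) auto
      finally have "\<bar>a u\<bar> * exp (- (Re p * t)) \<le> \<bar>a u\<bar> * (exp (- (s * t)) * exp (- (s * u)))" by (intro mult_left_mono) auto
      thus ?thesis using True by (simp add: f_def g_def h_def norm_mult norm_exp_eq_Re abs_mult mult_ac)
    next
      case False
      hence "f t u = 0" by (auto simp: f_def indicator_def)
      thus ?thesis by simp
    qed
  qed
  have iu: "(LINT u|lborel. f t u) = indicator {0<..} t *\<^sub>R (of_real (LINT u:{0<..<t}|lborel. a u) * exp (- (p * of_real t)))" for t
  proof -
    have "f t u = of_real (indicator {0<..<t} u *\<^sub>R a u) * exp (- (p * of_real t))" for u
      by (auto simp: f_def indicator_def)
    hence "(LINT u|lborel. f t u) = (LINT u|lborel. of_real (indicator {0<..<t} u *\<^sub>R a u) * exp (- (p * of_real t)))" by simp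
    also have "\<dots> = (LINT u|lborel. of_real (indicator {0<..<t} u *\<^sub>R a u)) * exp (- (p * of_real t))" by (rule integral_mult_left_zero)
    also have "(LINT u|lborel. complex_of_real (indicator {0<..<t} u *\<^sub>R a u)) = of_real (LINT u:{0<..<t}|lborel. a u)"
      unfolding set_lebesgue_integral_def by (rule integral_complex_of_real)
    finally have e: "(LINT u|lborel. f t u) = of_real (LINT u:{0<..<t}|lborel. a u) * exp (- (p * of_real t))" .
    show ?thesis
    proof (cases "t > 0")
      case True
      thus ?thesis using e by simp
    next
      case False
      hence "{0<..<t} = {}" by auto
      thus ?thesis using e False by (simp add: set_lebesgue_integral_def)
    qed
  qed
  have it: "(LINT t|lborel. f t u) = indicator {0<..} u *\<^sub>R (of_real (a u) * exp (- (p * of_real u)) / p)" for u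
  proof -
    have "f t u = of_real (a u * indicator {0<..} u) * (indicator {u<..} t *\<^sub>R exp (- (p * of_real t)))" for t
      by (simp add: f_def scaleR_conv_of_real)
    thus ?thesis unfolding integral_mult_right_zero
      by (simp only: integral_mult_right_zero complex_exp_integral_from(2)[OF p]) (simp add: scaleR_conv_of_real)
  qed
  show "set_integrable lborel {0<..} (\<lambda>t. of_real (LINT u:{0<..<t}|lborel. a u) * exp (- (p * of_real t)))"
    using lborel_pair.integrable_fst[OF int] unfolding iu set_integrable_def .
  have "(LINT t|lborel. LINT u|lborel. f t u) = (LINT u|lborel. LINT t|lborel. f t u)"
    by (rule lborel_pair.Fubini_integral[OF int, symmetric])
  thus "(LINT t:{0<..}|lborel. of_real (LINT u:{0<..<t}|lborel. a u) * exp (- (p * of_real t)))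
       = (LINT t:{0<..}|lborel. of_real (a t) * exp (- (p * of_real t))) / p"
    unfolding iu it set_lebesgue_integral_def[symmetric] by simp
qed

text \<open>A step function asymptotic to ln t + gamma. Its Laplace transform is elementary and has
  the same logarithmic singularity at 0 as Z(p), which makes it a convenient comparison
  density.\<close>

definition harm_step :: "real \<Rightarrow> real" where "harm_step t = harm (nat \<lfloor>t\<rfloor>)"

lemma harm_step_measurable [measurable]: "harm_step \<in> borel_measurable borel"
  unfolding harm_step_def[abs_def] by measurable

lemma harm_step_nonneg: "harm_step t \<ge> 0"
  unfolding harm_step_def by (rule harm_nonneg)

lemma harm_step_sum:
  assumes "0 \<le> t" "t \<le> real N"
  shows "harm_step t = (\<Sum>n=1..N. indicator {real n..} t * (1 / real n))"
proof -
  have "(\<Sum>n=1..N. indicator {real n..} t * (1 / real n)) = (\<Sum>n\<in>{1..N} \<inter> {n. real n \<le> t}. 1 / real n)"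
    by (subst sum.inter_restrict) (auto intro!: sum.cong simp: indicator_def)
  also have "{1..N} \<inter> {n. real n \<le> t} = {1..nat \<lfloor>t\<rfloor>}"
  proof -
    have "real n \<le> t \<longleftrightarrow> n \<le> nat \<lfloor>t\<rfloor>" for n using assms by (simp add: le_nat_iff le_floor_iff)
    moreover have "n \<le> N" if "real n \<le> t" for n using that assms by linarith
    ultimately show ?thesis by auto
  qed
  finally show ?thesis by (simp add: harm_step_def harm_def inverse_eq_divide)
qed

lemma harm_step_le: assumes "t > 0" shows "harm_step t \<le> t"
proof -
  have h: "harm n \<le> real n" for n
  proof (induction n)
    case (Suc n)
    have "inverse (real (Suc n)) \<le> 1" by (rule inverse_le_1_iff[THEN iffD2]) simp
    thus ?case using Suc by (simp add: harm_Suc)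
  qed (simp add: harm_def)
  have "real (nat \<lfloor>t\<rfloor>) \<le> t" using assms by simp
  thus ?thesis using h[of "nat \<lfloor>t\<rfloor>"] unfolding harm_step_def by linarith
qed

lemma harm_step_le_ln: assumes "t \<ge> 1" shows "harm_step t \<le> 1 + ln t"
proof -
  define n where "n = nat \<lfloor>t\<rfloor>"
  have n: "n \<ge> 1" "real n \<le> t" using assms by (auto simp: n_def le_nat_iff le_floor_iff)
  have "harm n - ln (real n) \<le> harm 1 - ln (real 1)"
    using euler_mascheroni_sequence_decreasing[of 1 n] n by simp
  moreover have "ln (real n) \<le> ln t" using n by simp
  ultimately show ?thesis by (simp add: harm_step_def n_def[symmetric] harm_def)
qed

lemma id_times_exp_integrable:
  assumes s: "s > (0::real)"
  shows "set_integrable lborel {0<..} (\<lambda>t. t * exp (- (s * t)))"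
    "(LINT t:{0<..}|lborel. t * exp (- (s * t))) \<le> 4 / s\<^sup>2"
proof -
  have s2: "s / 2 > 0" using s by simp
  have e: "set_integrable lborel {0<..} (\<lambda>t. exp (- (s / 2 * t)))" "(LINT t:{0<..}|lborel. exp (- (s / 2 * t))) = 2 / s"
  proof -
    show i: "set_integrable lborel {0<..} (\<lambda>t. exp (- (s / 2 * t)))"
      using set_integrable_norm[OF exp_integral_Ioi(1)[OF s2]] by simp
    have "complex_of_real (LINT t:{0<..}|lborel. exp (- (s / 2 * t))) = (LINT t:{0<..}|lborel. complex_of_real (exp (- (s / 2 * t))))"
      by (rule set_integral_complex_of_real[symmetric])
    also have "\<dots> = complex_of_real (2 / s)" using exp_integral_Ioi(2)[OF s2] by simp
    finally show "(LINT t:{0<..}|lborel. exp (- (s / 2 * t))) = 2 / s" unfolding of_real_eq_iff .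
  qed
  have b: "t * exp (- (s * t)) \<le> 2 / s * exp (- (s / 2 * t))" for t
  proof -
    have "s / 2 * t \<le> exp (s / 2 * t)" using exp_ge_add_one_self[of "s / 2 * t"] by linarith
    hence "t \<le> 2 / s * exp (s / 2 * t)" using s by (simp add: field_simps)
    hence "t * exp (- (s * t)) \<le> 2 / s * exp (s / 2 * t) * exp (- (s * t))" by (intro mult_right_mono) auto
    also have "\<dots> = 2 / s * exp (- (s / 2 * t))" unfolding mult.assoc exp_add[symmetric] by (simp add: field_simps)
    finally show ?thesis .
  qed
  have i2: "set_integrable lborel {0<..} (\<lambda>t. 2 / s * exp (- (s / 2 * t)))" by (rule set_integrable_mult_right[OF e(1)])
  show i: "set_integrable lborel {0<..} (\<lambda>t. t * exp (- (s * t)))"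
    by (rule set_integrable_bound[OF i2]) (use b s in \<open>auto simp: set_borel_measurable_def abs_mult intro!: AE_I2\<close>)
  have "(LINT t:{0<..}|lborel. t * exp (- (s * t))) \<le> (LINT t:{0<..}|lborel. 2 / s * exp (- (s / 2 * t)))"
    by (rule set_integral_mono[OF i i2 b])
  also have "\<dots> = 2 / s * (2 / s)" by (subst set_integral_mult_right) (simp only: e(2))
  finally show "(LINT t:{0<..}|lborel. t * exp (- (s * t))) \<le> 4 / s\<^sup>2" by (simp add: power2_eq_square)
qed

text \<open>The function is a sum of unit steps at n with weight 1/n, and each step contributes exp
  (-n p) / (n p); together they form the logarithmic series in exp (-p).\<close>

lemma harm_step_laplace:
  assumes p: "Re p > 0"
  shows "set_integrable lborel {0<..} (\<lambda>t. of_real (harm_step t) * exp (- (p * of_real t)))"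
    "(LINT t:{0<..}|lborel. of_real (harm_step t) * exp (- (p * of_real t))) = - Ln (1 - exp (- p)) / p"
proof -
  show int0: "set_integrable lborel {0<..} (\<lambda>t. of_real (harm_step t) * exp (- (p * of_real t)))"
    by (rule set_integrable_bound[OF id_times_exp_integrable(1)[OF p]])
       (use harm_step_le harm_step_nonneg in \<open>auto simp: set_borel_measurable_def norm_mult norm_exp_eq_Re abs_mult intro!: AE_I2 mult_right_mono\<close>)
  \<comment> \<open>These steps start just after the integer \<open>Suc k\<close>, those of
    \<open>harm_step\<close> at the integer itself. The two sums differ only on the integers, a null
    set.\<close>
  define f where "f = (\<lambda>k t. of_real (1 / real (Suc k)) * (indicator {real (Suc k)<..} t *\<^sub>R exp (- (p * of_real t))))"
  have int: "integrable lborel (f k)" for k unfolding f_def by (intro integrable_mult_right complex_exp_integral_from p)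
  have val: "(LINT t|lborel. f k t) = exp (- p) ^ Suc k / of_nat (Suc k) / p" for k
  proof -
    have e: "exp (- (p * of_real (real (Suc k)))) = exp (- p) ^ Suc k"
      unfolding exp_of_nat_mult[symmetric] by (simp add: mult.commute)
    show ?thesis unfolding f_def integral_mult_right_zero complex_exp_integral_from(2)[OF p] e by simp
  qed
  have nf: "norm (f k t) = 1 / real (Suc k) * norm (indicator {real (Suc k)<..} t *\<^sub>R exp (- (of_real (Re p) * complex_of_real t)))" for k t
    unfolding f_def norm_mult[of "of_real _"] norm_of_real by (simp add: norm_exp_eq_Re)
  have nval: "(LINT t|lborel. norm (f k t)) = exp (- Re p) ^ Suc k / real (Suc k) / Re p" for k
  proof -
    have "complex_of_real (LINT t|lborel. norm (indicator {real (Suc k)<..} t *\<^sub>R exp (- (of_real (Re p) * complex_of_real t))))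
      = (LINT t|lborel. indicator {real (Suc k)<..} t *\<^sub>R exp (- (of_real (Re p) * complex_of_real t)))"
      unfolding integral_complex_of_real[symmetric]
      by (intro Bochner_Integration.integral_cong) (auto simp: indicator_def norm_exp_eq_Re exp_of_real[symmetric])
    also have "\<dots> = exp (- (of_real (Re p) * of_real (real (Suc k)))) / of_real (Re p)"
      by (rule complex_exp_integral_from(2)) (use p in simp)
    also have "\<dots> = of_real (exp (- Re p * real (Suc k)) / Re p)" by (simp add: exp_of_real[symmetric])
    finally have i: "(LINT t|lborel. norm (indicator {real (Suc k)<..} t *\<^sub>R exp (- (of_real (Re p) * complex_of_real t)))) = exp (- Re p * real (Suc k)) / Re p"
      unfolding of_real_eq_iff .
    have e: "exp (- Re p * real (Suc k)) = exp (- Re p) ^ Suc k" unfolding exp_of_nat_mult[symmetric] by (simp add: mult.commute)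
    show ?thesis unfolding nf integral_mult_right_zero i e by simp
  qed
  have e1: "exp (- Re p) < 1" using p by simp
  have sni: "summable (\<lambda>k. LINT t|lborel. norm (f k t))"
  proof (rule summable_comparison_test'[where N = 0])
    show "summable (\<lambda>k. exp (- Re p) ^ Suc k / Re p)"
      using e1 by (intro summable_divide summable_Suc_iff[THEN iffD2] summable_geometric) auto
    show "norm (LINT t|lborel. norm (f k t)) \<le> exp (- Re p) ^ Suc k / Re p" for k
    proof -
      have "exp (- Re p) ^ Suc k / real (Suc k) \<le> exp (- Re p) ^ Suc k / 1" by (intro divide_left_mono) auto
      hence "exp (- Re p) ^ Suc k / real (Suc k) / Re p \<le> exp (- Re p) ^ Suc k / 1 / Re p" using p by (intro divide_right_mono) auto
      thus ?thesis unfolding nval using p by simp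
    qed
  qed
  have fin: "f k t = 0" if "k \<notin> {..<nat \<lceil>t\<rceil>}" for k t
  proof -
    have "\<lceil>t\<rceil> \<le> int k" using that by (simp add: nat_le_iff)
    hence "t \<le> real k" by (simp add: ceiling_le_iff)
    thus ?thesis by (simp add: f_def indicator_def)
  qed
  have sumeq: "(\<Sum>k. f k t) = (\<Sum>k<nat \<lceil>t\<rceil>. f k t)" for t
    by (rule suminf_finite) (use fin in auto)
  have ae: "(\<Sum>k. f k t) = indicator {0<..} t *\<^sub>R (of_real (harm_step t) * exp (- (p * of_real t)))" if "t \<notin> real ` (UNIV :: nat set)" for t
  proof (cases "t > 0")
    case True
    define N where "N = nat \<lceil>t\<rceil>"
    have "harm_step t = (\<Sum>n=1..N. indicator {real n..} t * (1 / real n))"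
      by (rule harm_step_sum) (use True in \<open>auto simp: N_def\<close>)
    also have "\<dots> = (\<Sum>k<N. indicator {real (Suc k)..} t * (1 / real (Suc k)))"
      by (rule sum.reindex_bij_witness[of _ Suc "\<lambda>n. n - 1"]) auto
    also have "\<dots> = (\<Sum>k<N. indicator {real (Suc k)<..} t * (1 / real (Suc k)))"
    proof (intro sum.cong refl)
      fix k have "t \<noteq> real (Suc k)" using that by (metis rangeI)
      thus "indicator {real (Suc k)..} t * (1 / real (Suc k)) = indicator {real (Suc k)<..} t * (1 / real (Suc k))"
        by (auto simp: indicator_def)
    qed
    finally have h: "harm_step t = (\<Sum>k<N. indicator {real (Suc k)<..} t * (1 / real (Suc k)))" .
    have "of_real (harm_step t) * exp (- (p * of_real t)) = (\<Sum>k<N. f k t)"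
      unfolding h of_real_sum sum_distrib_right by (intro sum.cong refl) (simp add: f_def scaleR_conv_of_real)
    thus ?thesis using True by (simp add: sumeq N_def)
  next
    case False
    hence "nat \<lceil>t\<rceil> = 0" by simp
    thus ?thesis using False by (simp add: sumeq)
  qed
  have AE: "AE t in lborel. (\<Sum>k. f k t) = indicator {0<..} t *\<^sub>R (of_real (harm_step t) * exp (- (p * of_real t)))"
  proof (rule AE_I')
    have "countable (real ` (UNIV :: nat set))" by simp
    thus "real ` (UNIV :: nat set) \<in> null_sets lborel" by (rule countable_imp_null_set_lborel)
  qed (use ae in auto)
  have smn: "summable (\<lambda>k. norm (f k t))" for t
    by (rule summable_finite[of "{..<nat \<lceil>t\<rceil>}"]) (use fin in auto)
  have S: "(\<lambda>k. LINT t|lborel. f k t) sums (LINT t|lborel. (\<Sum>k. f k t))"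
    by (rule sums_integral[OF int _ sni]) (use smn in auto)
  have "(LINT t|lborel. (\<Sum>k. f k t)) = (LINT t:{0<..}|lborel. of_real (harm_step t) * exp (- (p * of_real t)))"
    unfolding set_lebesgue_integral_def
    by (rule integral_cong_AE) (use AE int0 in \<open>auto simp: set_integrable_def sumeq f_def\<close>)
  with S have S': "(\<lambda>k. exp (- p) ^ Suc k / of_nat (Suc k) / p) sums (LINT t:{0<..}|lborel. of_real (harm_step t) * exp (- (p * of_real t)))"
    unfolding val by simp
  have "(\<lambda>n. (- 1) ^ Suc n / of_nat n * (- exp (- p)) ^ n) sums Ln (1 + - exp (- p))"
    by (rule Ln_series) (use p in \<open>simp add: norm_exp_eq_Re\<close>)
  hence "(\<lambda>n. (- 1) ^ Suc (Suc n) / of_nat (Suc n) * (- exp (- p)) ^ Suc n) sums Ln (1 + - exp (- p))"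
    by (subst sums_Suc_iff) simp
  also have "(\<lambda>n. (- 1) ^ Suc (Suc n) / of_nat (Suc n) * (- exp (- p)) ^ Suc n) = (\<lambda>n. - (exp (- p) ^ Suc n / of_nat (Suc n)))"
  proof
    fix n
    have "(- exp (- p)) ^ Suc n = (- 1) ^ Suc n * exp (- p) ^ Suc n" by (rule power_minus)
    moreover have "(- 1) ^ Suc (Suc n) * (- 1) ^ Suc n = (- 1 :: complex)" by (simp flip: power_add add: power_mult_distrib[symmetric])
    ultimately show "(- 1) ^ Suc (Suc n) / of_nat (Suc n) * (- exp (- p)) ^ Suc n = - (exp (- p) ^ Suc n / of_nat (Suc n))"
      by (metis (no_types, lifting) mult.assoc mult.commute mult_minus1 times_divide_eq_right)
  qed
  finally have "(\<lambda>n. - (- (exp (- p) ^ Suc n / of_nat (Suc n))) / p) sums (- Ln (1 + - exp (- p)) / p)"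
    by (intro sums_divide sums_minus)
  hence "(\<lambda>n. exp (- p) ^ Suc n / of_nat (Suc n) / p) sums (- Ln (1 - exp (- p)) / p)" by simp
  with S' show "(LINT t:{0<..}|lborel. of_real (harm_step t) * exp (- (p * of_real t))) = - Ln (1 - exp (- p)) / p"
    by (rule sums_unique2)
qed

definition zeta_const :: real where "zeta_const = euler_mascheroni - ln (2 * pi)"

text \<open>The sign lets the constant be dropped in lower bounds for
  \<open>zeta_excess\<close>.\<close>

lemma zeta_const_neg: "zeta_const < 0"
proof -
  have "exp 1 \<le> (3::real)" by (rule exp_le)
  also have "\<dots> < 2 * pi" using pi_gt3 by linarith
  finally have "ln (exp 1) < ln (2 * pi)" by (subst ln_less_cancel_iff) auto
  hence "1 < ln (2 * pi)" by simp
  thus ?thesis using euler_mascheroni_less_13_over_22 by (simp add: zeta_const_def)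
qed

text \<open>The subtracted density is asymptotic to ln t + 2 gamma - ln (2 pi), the derivative of
  the classical main term of the mean square.\<close>

definition zeta_excess :: "real \<Rightarrow> real" where
  "zeta_excess t = zeta_sq t - (harm_step t + zeta_const)"

definition mean_excess :: "real \<Rightarrow> real" where
  "mean_excess T = (LINT u:{0<..<T}|lborel. zeta_excess u)"

lemma zeta_excess_measurable [measurable]: "zeta_excess \<in> borel_measurable borel"
  unfolding zeta_excess_def[abs_def] by measurable

lemma zeta_excess_laplace:
  assumes p: "0 < Re p" "Re p < pi"
  shows "set_integrable lborel {0<..} (\<lambda>t. of_real (zeta_excess t) * exp (- (p * of_real t)))"
    "(LINT t:{0<..}|lborel. of_real (zeta_excess t) * exp (- (p * of_real t))) =
       zeta_laplace p - (of_real zeta_const - Ln (1 - exp (- p))) / p"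
proof -
  have eq: "of_real (zeta_excess t) * exp (- (p * of_real t)) = of_real (zeta_sq t) * exp (- (p * of_real t))
      - (of_real (harm_step t) * exp (- (p * of_real t)) + of_real zeta_const * exp (- (p * of_real t)))" for t
    by (simp add: zeta_excess_def algebra_simps)
  note i1 = zeta_laplace_pair(1)[OF p] and i2 = harm_step_laplace[OF p(1)] and i3 = complex_exp_integral[OF p(1)]
  have i3': "set_integrable lborel {0<..} (\<lambda>t. of_real zeta_const * exp (- (p * of_real t)))"
    by (rule set_integrable_mult_right[OF i3(1)])
  show "set_integrable lborel {0<..} (\<lambda>t. of_real (zeta_excess t) * exp (- (p * of_real t)))"
    unfolding eq by (intro set_integral_diff(1) set_integral_add(1) i1 i2 i3')
  have "(LINT t:{0<..}|lborel. of_real (zeta_excess t) * exp (- (p * of_real t))) = 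
    zeta_laplace p - (- Ln (1 - exp (- p)) / p + of_real zeta_const * (1 / p))"
    unfolding eq set_integral_diff(2)[OF i1 set_integral_add(1)[OF i2(1) i3']] set_integral_add(2)[OF i2(1) i3']
      set_integral_mult_right i2(2) i3(2) zeta_laplace_def ..
  thus "(LINT t:{0<..}|lborel. of_real (zeta_excess t) * exp (- (p * of_real t))) =
       zeta_laplace p - (of_real zeta_const - Ln (1 - exp (- p))) / p"
    by (simp add: diff_divide_distrib)
qed

text \<open>The reflection argument covers the rates below pi; larger rates follow by comparison
  with the rate 1.\<close>

lemma set_integrable_exp_mono:
  fixes a :: "real \<Rightarrow> real"
  assumes [measurable]: "a \<in> borel_measurable borel"
    and small: "\<And>\<sigma>. 0 < \<sigma> \<Longrightarrow> \<sigma> < pi \<Longrightarrow> set_integrable lborel {0<..} (\<lambda>t. a t * exp (- (\<sigma> * t)))"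
    and s: "\<sigma> > 0"
  shows "set_integrable lborel {0<..} (\<lambda>t. a t * exp (- (\<sigma> * t)))"
proof (cases "\<sigma> < pi")
  case False
  have "set_integrable lborel {0<..} (\<lambda>t. a t * exp (- (1 * t)))" by (rule small) (use pi_gt3 in auto)
  thus ?thesis
  proof (rule set_integrable_bound)
    show "AE t in lborel. t \<in> {0<..} \<longrightarrow> norm (a t * exp (- (\<sigma> * t))) \<le> norm (a t * exp (- (1 * t)))"
    proof (intro AE_I2 impI)
      fix t :: real assume t: "t \<in> {0<..}"
      have "1 * t \<le> \<sigma> * t" using t False pi_gt3 by (intro mult_right_mono) auto
      thus "norm (a t * exp (- (\<sigma> * t))) \<le> norm (a t * exp (- (1 * t)))"
        unfolding norm_mult by (intro mult_left_mono) auto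
    qed
  qed (simp add: set_borel_measurable_def)
qed (use small s in auto)

lemma set_integrable_of_complex:
  fixes a :: "real \<Rightarrow> real"
  assumes "set_integrable lborel S (\<lambda>t. complex_of_real (a t))"
  shows "set_integrable lborel S a"
proof -
  have "integrable lborel (\<lambda>t. Re (indicator S t *\<^sub>R complex_of_real (a t)))"
    using assms unfolding set_integrable_def by (rule integrable_Re)
  thus ?thesis unfolding set_integrable_def by simp
qed

lemma zeta_excess_exp_integrable:
  "\<sigma> > 0 \<Longrightarrow> set_integrable lborel {0<..} (\<lambda>t. zeta_excess t * exp (- (\<sigma> * t)))"
proof (rule set_integrable_exp_mono)
  fix \<sigma> :: real assume s: "0 < \<sigma>" "\<sigma> < pi"
  have "set_integrable lborel {0<..} (\<lambda>t. of_real (zeta_excess t) * exp (- (of_real \<sigma> * complex_of_real t)))"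
    by (rule zeta_excess_laplace(1)) (use s in auto)
  hence "set_integrable lborel {0<..} (\<lambda>t. complex_of_real (zeta_excess t * exp (- (\<sigma> * t))))"
    by (simp add: exp_of_real[symmetric])
  thus "set_integrable lborel {0<..} (\<lambda>t. zeta_excess t * exp (- (\<sigma> * t)))" by (rule set_integrable_of_complex)
qed measurable

lemma zeta_sq_exp_integrable:
  "\<sigma> > 0 \<Longrightarrow> set_integrable lborel {0<..} (\<lambda>t. zeta_sq t * exp (- (\<sigma> * t)))"
proof (rule set_integrable_exp_mono)
  fix \<sigma> :: real assume s: "0 < \<sigma>" "\<sigma> < pi"
  have "set_integrable lborel {0<..} (\<lambda>t. of_real (zeta_sq t) * exp (- (of_real \<sigma> * complex_of_real t)))"
    by (rule zeta_laplace_pair(1)) (use s in auto)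
  hence "set_integrable lborel {0<..} (\<lambda>t. complex_of_real (zeta_sq t * exp (- (\<sigma> * t))))"
    by (simp add: exp_of_real[symmetric])
  thus "set_integrable lborel {0<..} (\<lambda>t. zeta_sq t * exp (- (\<sigma> * t)))" by (rule set_integrable_of_complex)
qed measurable

lemma set_integrable_finite_of_exp:
  fixes a :: "real \<Rightarrow> real"
  assumes [measurable]: "a \<in> borel_measurable borel"
    and ai: "set_integrable lborel {0<..} (\<lambda>t. a t * exp (- (1 * t)))"
  shows "set_integrable lborel {0<..<T} a"
proof (rule set_integrable_bound)
  have "set_integrable lborel {0<..<T} (\<lambda>t. a t * exp (- (1 * t)))"
    by (rule set_integrable_subset[OF ai]) auto
  thus "set_integrable lborel {0<..<T} (\<lambda>t. exp T * (a t * exp (- (1 * t))))" by (rule set_integrable_mult_right)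
  show "AE t in lborel. t \<in> {0<..<T} \<longrightarrow> norm (a t) \<le> norm (exp T * (a t * exp (- (1 * t))))"
  proof (intro AE_I2 impI)
    fix t assume t: "t \<in> {0<..<T}"
    have "1 \<le> exp T * exp (- (1 * t))" unfolding exp_add[symmetric] using t by simp
    hence "\<bar>a t\<bar> * 1 \<le> \<bar>a t\<bar> * (exp T * exp (- (1 * t)))" by (intro mult_left_mono) auto
    thus "norm (a t) \<le> norm (exp T * (a t * exp (- (1 * t))))" by (simp add: abs_mult mult_ac)
  qed
qed (simp add: set_borel_measurable_def)

lemma zeta_excess_integrable: "set_integrable lborel {0<..<T} zeta_excess"
  by (rule set_integrable_finite_of_exp) (use zeta_excess_exp_integrable[of 1] in auto)

lemma harm_step_integrable: "set_integrable lborel {0<..<T} harm_step"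
proof (rule set_integrable_finite_of_exp)
  have "set_integrable lborel {0<..} (\<lambda>t. complex_of_real (harm_step t) * exp (- (1 * complex_of_real t)))"
    by (rule harm_step_laplace(1)) simp
  hence "set_integrable lborel {0<..} (\<lambda>t. complex_of_real (harm_step t * exp (- (1 * t))))"
    by (simp add: exp_of_real[symmetric])
  thus "set_integrable lborel {0<..} (\<lambda>t. harm_step t * exp (- (1 * t)))" by (rule set_integrable_of_complex)
qed measurable

text \<open>1 - exp (-p) is p times a factor 1 + v with norm v at most 3 norm p. The radius 1/7
  keeps \<open>v\<close> below 1/2, as the estimate of the logarithm requires.\<close>

lemma Ln_one_minus_exp:
  assumes p: "0 < Re p" "norm p \<le> 1 / 7"
  shows "norm (Ln (1 - exp (- p)) - Ln p) \<le> 6 * norm p"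
proof -
  have p0: "p \<noteq> 0" using p by auto
  define v where "v = (1 - exp (- p)) / p - 1"
  have "norm (exp (- p) - (1 + - p)) \<le> exp \<bar>Re (- p)\<bar> * norm (- p) ^ Suc 1 / fact 1"
    using Taylor_exp[of "- p" 1] by simp
  also have "\<dots> \<le> 3 * norm p ^ 2"
  proof -
    have "exp \<bar>Re (- p)\<bar> \<le> exp 1" using p abs_Re_le_cmod[of p] by simp
    also have "\<dots> \<le> (3::real)" by (rule exp_le)
    finally show ?thesis by (simp add: numeral_2_eq_2 mult_right_mono)
  qed
  finally have 1: "norm (exp (- p) - (1 + - p)) \<le> 3 * norm p ^ 2" .
  have "v = - ((exp (- p) - (1 + - p)) / p)" using p0 by (simp add: v_def field_simps)
  hence "norm v = norm (exp (- p) - (1 + - p)) / norm p" by (simp add: norm_divide)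
  also have "\<dots> \<le> 3 * norm p ^ 2 / norm p" using 1 by (intro divide_right_mono) auto
  also have "\<dots> = 3 * norm p" using p0 by (simp add: power2_eq_square)
  finally have v: "norm v \<le> 3 * norm p" .
  hence v2: "norm v < 1 / 2" using p by linarith
  have Lv: "norm (Ln (1 + v)) \<le> 2 * norm v" by (rule norm_Ln_le[OF v2])
  have v1: "1 + v \<noteq> 0"
  proof
    assume "1 + v = 0" hence "v = - 1" by (simp add: add_eq_0_iff)
    thus False using v2 by simp
  qed
  have "1 - exp (- p) = p * (1 + v)" using p0 by (simp add: v_def)
  also have "Ln (p * (1 + v)) = Ln p + Ln (1 + v)"
  proof (rule Ln_times_simple)
    have "\<bar>Im (Ln p)\<bar> < pi / 2" using p(1) Re_Ln_pos_lt[of p] by force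
    moreover have "\<bar>Im (Ln (1 + v))\<bar> < 1" using abs_Im_le_cmod[of "Ln (1 + v)"] Lv v2 by linarith
    ultimately show "- pi < Im (Ln p) + Im (Ln (1 + v))" "Im (Ln p) + Im (Ln (1 + v)) \<le> pi"
      using pi_gt3 by linarith+
  qed (use p0 v1 in auto)
  finally show ?thesis using Lv v by simp
qed

lemma norm_mult_Ln_le:
  assumes p: "0 < Re p" "norm p \<le> 1 / 3"
  shows "norm p * norm (Ln p) \<le> 3"
proof -
  define x where "x = norm p"
  have x: "0 < x" "x \<le> 1 / 3" using p by (auto simp: x_def)
  have p0: "p \<noteq> 0" using p by auto
  have "norm (Ln p) \<le> \<bar>Re (Ln p)\<bar> + \<bar>Im (Ln p)\<bar>" by (rule cmod_le)
  also have "\<bar>Im (Ln p)\<bar> \<le> pi" using mpi_less_Im_Ln[OF p0] Im_Ln_le_pi[OF p0] by linarith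
  also have "Re (Ln p) = ln x" using p0 by (simp add: x_def)
  finally have 1: "norm (Ln p) \<le> \<bar>ln x\<bar> + 4" using pi_less_4 by linarith
  have "ln (1 / x) \<le> 1 / x - 1" using x by (intro ln_le_minus_one) auto
  moreover have "ln x \<le> 0" using x by simp
  ultimately have "\<bar>ln x\<bar> \<le> 1 / x" using x by (simp add: ln_div)
  hence "x * \<bar>ln x\<bar> \<le> x * (1 / x)" using x by (intro mult_left_mono) auto
  hence 2: "x * \<bar>ln x\<bar> \<le> 1" using x by simp
  have "x * norm (Ln p) \<le> x * (\<bar>ln x\<bar> + 4)" using 1 x by (intro mult_left_mono) auto
  also have "\<dots> = x * \<bar>ln x\<bar> + 4 * x" by (simp add: distrib_left)
  also have "\<dots> \<le> 3" using 2 x by linarith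
  finally show ?thesis by (simp add: x_def)
qed

text \<open>A coarser form of the expansion: all lower-order terms, pi included, are absorbed by the
  cubed ratio, which is at least 1.\<close>

lemma zeta_laplace_near:
  obtains C where "C \<ge> 0" "\<And>p. 0 < Re p \<Longrightarrow> norm p \<le> 1 / 3 \<Longrightarrow>
    norm (zeta_laplace p - (of_real zeta_const - Ln p) / p) \<le> C * (norm p / Re p) ^ 3"
proof -
  obtain C where C: "C \<ge> 0" "\<And>p. 0 < Re p \<Longrightarrow> norm p \<le> 1 / 3 \<Longrightarrow>
    norm (zeta_laplace p - ((of_real zeta_const - Ln p) / p + of_real pi)) \<le> C * (norm p * (1 + norm (Ln p) + (norm p / Re p) ^ 3))"
  proof (rule zeta_laplace_asymp[folded zeta_const_def], goal_cases)
    case (1 C)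
    show ?case by (rule 1(1)[OF 1(2,3)])
  qed
  show ?thesis
  proof (rule that[of "5 * C + 4"])
    fix p :: complex assume p: "0 < Re p" "norm p \<le> 1 / 3"
    define q where "q = (norm p / Re p) ^ 3"
    have q: "q \<ge> 1" unfolding q_def using p complex_Re_le_cmod[of p] by (intro one_le_power) simp
    have "norm p * (1 + norm (Ln p) + q) = norm p + norm p * norm (Ln p) + norm p * q" by (simp add: distrib_left)
    also have "\<dots> \<le> 1 + 3 + 1 * q" using p norm_mult_Ln_le[OF p] q by (intro add_mono mult_right_mono) auto
    also have "\<dots> \<le> 5 * q" using q by simp
    finally have "C * (norm p * (1 + norm (Ln p) + q)) \<le> C * (5 * q)" using C(1) by (intro mult_left_mono) auto
    moreover have "norm (zeta_laplace p - (of_real zeta_const - Ln p) / p) \<le> 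
      norm (zeta_laplace p - ((of_real zeta_const - Ln p) / p + of_real pi)) + norm (complex_of_real pi)"
      using norm_triangle_ineq[of "zeta_laplace p - ((of_real zeta_const - Ln p) / p + of_real pi)" "of_real pi"] by (simp add: algebra_simps)
    moreover have "norm (complex_of_real pi) \<le> 4 * q" using q pi_less_4 by simp
    ultimately show "norm (zeta_laplace p - (of_real zeta_const - Ln p) / p) \<le> (5 * C + 4) * q"
      using C(2)[OF p] unfolding q_def[symmetric] by (simp add: algebra_simps)
  qed (use C in auto)
qed

lemma mean_excess_laplace:
  assumes p: "0 < Re p" "Re p < pi"
  shows "set_integrable lborel {0<..} (\<lambda>t. of_real (mean_excess t) * exp (- (p * of_real t)))"
    "(LINT t:{0<..}|lborel. of_real (mean_excess t) * exp (- (p * of_real t))) =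
       (zeta_laplace p - (of_real zeta_const - Ln (1 - exp (- p))) / p) / p"
  using laplace_of_primitive[OF zeta_excess_measurable zeta_excess_exp_integrable p(1)]
  unfolding mean_excess_def zeta_excess_laplace(2)[OF p] by auto

text \<open>The logarithmic singularities of the two transforms cancel, leaving a multiple of the
  cubed ratio; dividing by \<open>p\<close> for the primitive gives the stated quotient.\<close>

lemma mean_excess_laplace_near:
  obtains C where "C \<ge> 0" "\<And>p. 0 < Re p \<Longrightarrow> norm p \<le> 1 / 7 \<Longrightarrow>
    norm (LINT t:{0<..}|lborel. of_real (mean_excess t) * exp (- (p * of_real t))) \<le> C * ((norm p)\<^sup>2 / Re p ^ 3)"
proof -
  obtain C where C: "C \<ge> 0" "\<And>p. 0 < Re p \<Longrightarrow> norm p \<le> 1 / 3 \<Longrightarrow>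
    norm (zeta_laplace p - (of_real zeta_const - Ln p) / p) \<le> C * (norm p / Re p) ^ 3"
  proof (rule zeta_laplace_near, goal_cases)
    case (1 C)
    show ?case by (rule 1(1)[OF 1(2,3)])
  qed
  show ?thesis
  proof (rule that[of "C + 6"])
    fix p :: complex assume p: "0 < Re p" "norm p \<le> 1 / 7"
    have p0: "p \<noteq> 0" using p by auto
    have p3: "norm p \<le> 1 / 3" "Re p < pi" using p complex_Re_le_cmod[of p] pi_gt3 by linarith+
    define q where "q = (norm p / Re p) ^ 3"
    have q: "q \<ge> 1" unfolding q_def using p complex_Re_le_cmod[of p] by (intro one_le_power) simp
    have "zeta_laplace p - (of_real zeta_const - Ln (1 - exp (- p))) / p = 
      (zeta_laplace p - (of_real zeta_const - Ln p) / p) + (Ln (1 - exp (- p)) - Ln p) / p"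
      by (simp add: diff_divide_distrib)
    hence "norm (zeta_laplace p - (of_real zeta_const - Ln (1 - exp (- p))) / p) \<le> 
      norm (zeta_laplace p - (of_real zeta_const - Ln p) / p) + norm ((Ln (1 - exp (- p)) - Ln p) / p)"
      by (metis norm_triangle_ineq)
    also have "norm ((Ln (1 - exp (- p)) - Ln p) / p) \<le> 6"
      using Ln_one_minus_exp[OF p] p0 by (simp add: norm_divide field_simps)
    also have "norm (zeta_laplace p - (of_real zeta_const - Ln p) / p) + 6 \<le> (C + 6) * q"
      using C(2)[OF p(1) p3(1)] q unfolding q_def[symmetric] by (simp add: distrib_right)
    finally have "norm (zeta_laplace p - (of_real zeta_const - Ln (1 - exp (- p))) / p) / norm p \<le> (C + 6) * q / norm p"
      by (intro divide_right_mono) auto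
    also have "(C + 6) * q / norm p = (C + 6) * ((norm p)\<^sup>2 / Re p ^ 3)"
      using p0 by (simp add: q_def power_divide power3_eq_cube power2_eq_square)
    finally show "norm (LINT t:{0<..}|lborel. of_real (mean_excess t) * exp (- (p * of_real t))) \<le> (C + 6) * ((norm p)\<^sup>2 / Re p ^ 3)"
      unfolding mean_excess_laplace(2)[OF p(1) p3(2)] norm_divide .
  qed (use C in auto)
qed

text \<open>Away from 0 there is no cancellation to exploit, and only the modulus is used. The
  primitive \<open>U\<close> of a nonnegative majorant dominates |\<open>mean_excess\<close>|, and
  its transform is taken at the real point s = Re p, where crude bounds give order s^(-2) for the
  density and one more power for the primitive.\<close>

lemma mean_excess_laplace_trivial:
  obtains C where "C \<ge> 0" "\<And>p. 0 < Re p \<Longrightarrow> Re p \<le> 1 / 7 \<Longrightarrow>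
    norm (LINT t:{0<..}|lborel. of_real (mean_excess t) * exp (- (p * of_real t))) \<le> C / Re p ^ 3"
proof -
  obtain C where C: "C \<ge> 0" "\<And>p. 0 < Re p \<Longrightarrow> norm p \<le> 1 / 3 \<Longrightarrow>
    norm (zeta_laplace p - (of_real zeta_const - Ln p) / p) \<le> C * (norm p / Re p) ^ 3"
  proof (rule zeta_laplace_near, goal_cases)
    case (1 C)
    show ?case by (rule 1(1)[OF 1(2,3)])
  qed
  define D where "D = C + \<bar>zeta_const\<bar> + 3 + 4 + \<bar>zeta_const\<bar>"
  show ?thesis
  proof (rule that[of D])
    fix p :: complex assume p: "0 < Re p" "Re p \<le> 1 / 7"
    define s where "s = Re p"
    have s: "0 < s" "s \<le> 1 / 7" "s < pi" using p pi_gt3 by (auto simp: s_def)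
    define b where "b = (\<lambda>t. zeta_sq t + (harm_step t + \<bar>zeta_const\<bar>))"
    have bm [measurable]: "b \<in> borel_measurable borel" unfolding b_def by measurable
    have hi: "set_integrable lborel {0<..} (\<lambda>t. harm_step t * exp (- (\<sigma> * t)))" if "\<sigma> > 0" for \<sigma>
      by (rule set_integrable_bound[OF id_times_exp_integrable(1)[OF that]])
         (use harm_step_le harm_step_nonneg in \<open>auto simp: set_borel_measurable_def abs_mult intro!: AE_I2 mult_right_mono\<close>)
    have ei: "set_integrable lborel {0<..} (\<lambda>t. exp (- (\<sigma> * t)))" if "\<sigma> > 0" for \<sigma> :: real
      using set_integrable_norm[OF exp_integral_Ioi(1)[OF that]] by simp
    have bexp: "b t * exp (- (\<sigma> * t)) = zeta_sq t * exp (- (\<sigma> * t)) + (harm_step t * exp (- (\<sigma> * t)) + \<bar>zeta_const\<bar> * exp (- (\<sigma> * t)))" for t \<sigma>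
      by (simp add: b_def algebra_simps)
    have bi: "set_integrable lborel {0<..} (\<lambda>t. b t * exp (- (\<sigma> * t)))" if "\<sigma> > 0" for \<sigma>
      unfolding bexp by (intro set_integral_add(1) zeta_sq_exp_integrable hi set_integrable_mult_right ei that)
    have rs: "Re (complex_of_real s) > 0" using s by simp
    note lp = laplace_of_primitive[OF bm bi rs]
    define U where "U = (\<lambda>t. LINT u:{0<..<t}|lborel. b u)"
    have Ui: "set_integrable lborel {0<..} (\<lambda>t. U t * exp (- (s * t)))"
      by (rule set_integrable_of_complex) (use lp(1) in \<open>simp add: U_def exp_of_real[symmetric]\<close>)
    have Uv: "(LINT t:{0<..}|lborel. U t * exp (- (s * t))) = (LINT t:{0<..}|lborel. b t * exp (- (s * t))) / s"
    proof -
      have "complex_of_real (LINT t:{0<..}|lborel. U t * exp (- (s * t))) = (LINT t:{0<..}|lborel. of_real (U t) * exp (- (of_real s * complex_of_real t)))"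
        unfolding set_integral_complex_of_real[symmetric] by (simp add: exp_of_real[symmetric])
      also have "\<dots> = (LINT t:{0<..}|lborel. of_real (b t) * exp (- (of_real s * complex_of_real t))) / of_real s"
        using lp(2) by (simp add: U_def)
      also have "(LINT t:{0<..}|lborel. of_real (b t) * exp (- (of_real s * complex_of_real t))) = complex_of_real (LINT t:{0<..}|lborel. b t * exp (- (s * t)))"
        unfolding set_integral_complex_of_real[symmetric] by (simp add: exp_of_real[symmetric])
      finally show ?thesis unfolding of_real_divide[symmetric] of_real_eq_iff .
    qed
    have zl: "(LINT t:{0<..}|lborel. zeta_sq t * exp (- (s * t))) \<le> (C + \<bar>zeta_const\<bar> + 3) / s\<^sup>2"
    proof -
      have "complex_of_real (LINT t:{0<..}|lborel. zeta_sq t * exp (- (s * t))) = zeta_laplace (of_real s)"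
        unfolding set_integral_complex_of_real[symmetric] zeta_laplace_def by (simp add: exp_of_real[symmetric])
      hence "(LINT t:{0<..}|lborel. zeta_sq t * exp (- (s * t))) \<le> norm (zeta_laplace (of_real s))"
        by (metis abs_ge_self norm_of_real)
      also have "\<dots> \<le> norm (zeta_laplace (of_real s) - (of_real zeta_const - Ln (of_real s)) / of_real s) + norm ((of_real zeta_const - Ln (of_real s)) / complex_of_real s)"
        using norm_triangle_ineq[of "zeta_laplace (of_real s) - (of_real zeta_const - Ln (of_real s)) / of_real s" "(of_real zeta_const - Ln (of_real s)) / of_real s"] by simp
      also have "\<dots> \<le> C * 1 + (\<bar>zeta_const\<bar> / s + 3 / s\<^sup>2)"
      proof (rule add_mono)
        show "norm (zeta_laplace (of_real s) - (of_real zeta_const - Ln (of_real s)) / of_real s) \<le> C * 1"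
          using C(2)[of "of_real s"] s by simp
        have "s * norm (Ln (complex_of_real s)) \<le> 3" using norm_mult_Ln_le[of "of_real s"] s by simp
        hence l: "norm (Ln (complex_of_real s)) \<le> 3 / s" using s by (simp add: field_simps)
        have "norm ((of_real zeta_const - Ln (of_real s)) / complex_of_real s) \<le> (\<bar>zeta_const\<bar> + 3 / s) / s"
          unfolding norm_divide using s l norm_triangle_ineq4[of "complex_of_real zeta_const" "Ln (of_real s)"]
          by (intro frac_le) auto
        thus "norm ((of_real zeta_const - Ln (of_real s)) / complex_of_real s) \<le> \<bar>zeta_const\<bar> / s + 3 / s\<^sup>2"
          by (simp add: add_divide_distrib power2_eq_square)
      qed
      also have "\<dots> \<le> C * (1 / s\<^sup>2) + (\<bar>zeta_const\<bar> / s\<^sup>2 + 3 / s\<^sup>2)"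
      proof -
        have "s\<^sup>2 \<le> s * 1" unfolding power2_eq_square using s by (intro mult_left_mono) auto
        moreover have "0 < s\<^sup>2" using s by simp
        ultimately have "\<bar>zeta_const\<bar> / s \<le> \<bar>zeta_const\<bar> / s\<^sup>2" "1 \<le> 1 / s\<^sup>2" using s by (auto intro!: frac_le)
        thus ?thesis using C(1) by (intro add_mono mult_left_mono) auto
      qed
      finally show ?thesis by (simp add: add_divide_distrib)
    qed
    have el: "(LINT t:{0<..}|lborel. exp (- (s * t))) = 1 / s"
    proof -
      have "complex_of_real (LINT t:{0<..}|lborel. exp (- (s * t))) = (LINT t:{0<..}|lborel. complex_of_real (exp (- (s * t))))"
        by (rule set_integral_complex_of_real[symmetric])
      also have "\<dots> = complex_of_real (1 / s)" using exp_integral_Ioi(2)[OF s(1)] by simp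
      finally show ?thesis unfolding of_real_eq_iff .
    qed
    have s1: "1 / s \<le> 1 / s\<^sup>2"
    proof -
      have "s\<^sup>2 \<le> s * 1" unfolding power2_eq_square using s by (intro mult_left_mono) auto
      thus ?thesis using s by (intro frac_le) auto
    qed
    have hl: "(LINT t:{0<..}|lborel. harm_step t * exp (- (s * t))) \<le> 4 / s\<^sup>2"
    proof -
      have "(LINT t:{0<..}|lborel. harm_step t * exp (- (s * t))) \<le> (LINT t:{0<..}|lborel. t * exp (- (s * t)))"
        by (rule set_integral_mono[OF hi[OF s(1)] id_times_exp_integrable(1)[OF s(1)]])
           (use harm_step_le in \<open>auto intro!: mult_right_mono\<close>)
      thus ?thesis using id_times_exp_integrable(2)[OF s(1)] by linarith
    qed
    have "(LINT t:{0<..}|lborel. b t * exp (- (s * t))) = (LINT t:{0<..}|lborel. zeta_sq t * exp (- (s * t)))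
       + ((LINT t:{0<..}|lborel. harm_step t * exp (- (s * t))) + \<bar>zeta_const\<bar> * (1 / s))"
      unfolding bexp set_integral_add(2)[OF zeta_sq_exp_integrable[OF s(1)] set_integral_add(1)[OF hi[OF s(1)] set_integrable_mult_right[OF ei[OF s(1)]]]]
        set_integral_add(2)[OF hi[OF s(1)] set_integrable_mult_right[OF ei[OF s(1)]]] set_integral_mult_right el ..
    also have "\<dots> \<le> (C + \<bar>zeta_const\<bar> + 3) / s\<^sup>2 + (4 / s\<^sup>2 + \<bar>zeta_const\<bar> * (1 / s\<^sup>2))"
      by (intro add_mono zl hl mult_left_mono s1) auto
    also have "\<dots> = D / s\<^sup>2" by (simp add: D_def add_divide_distrib)
    finally have B: "(LINT t:{0<..}|lborel. b t * exp (- (s * t))) \<le> D / s\<^sup>2" .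
    have bf: "set_integrable lborel {0<..<t} b" for t
      by (rule set_integrable_finite_of_exp[OF bm]) (use bi[of 1] in simp)
    have VU: "\<bar>mean_excess t\<bar> \<le> U t" for t
    proof -
      have "norm (mean_excess t) \<le> (LINT u:{0<..<t}|lborel. norm (zeta_excess u))"
        unfolding mean_excess_def by (rule set_integral_norm_bound[OF zeta_excess_integrable])
      also have "\<dots> \<le> U t" unfolding U_def
      proof (rule set_integral_mono[OF set_integrable_norm[OF zeta_excess_integrable] bf])
        fix u show "norm (zeta_excess u) \<le> b u"
          using zeta_sq_nonneg[of u] harm_step_nonneg[of u] by (simp add: zeta_excess_def b_def abs_le_iff) linarith
      qed
      finally show ?thesis by simp
    qed
    have rp: "Re p < pi" using s by (simp add: s_def)
    note mi = mean_excess_laplace(1)[OF p(1) rp]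
    have "norm (LINT t:{0<..}|lborel. of_real (mean_excess t) * exp (- (p * of_real t)))
       \<le> (LINT t:{0<..}|lborel. norm (of_real (mean_excess t) * exp (- (p * of_real t))))"
      by (rule set_integral_norm_bound[OF mi])
    also have "\<dots> \<le> (LINT t:{0<..}|lborel. U t * exp (- (s * t)))"
      by (rule set_integral_mono[OF set_integrable_norm[OF mi] Ui])
         (use VU in \<open>auto simp: norm_mult norm_exp_eq_Re s_def intro!: mult_right_mono\<close>)
    also have "\<dots> \<le> D / s\<^sup>2 / s" unfolding Uv using B s by (intro divide_right_mono) auto
    also have "\<dots> = D / Re p ^ 3" by (simp add: s_def power2_eq_square power3_eq_cube)
    finally show "norm (LINT t:{0<..}|lborel. of_real (mean_excess t) * exp (- (p * of_real t))) \<le> D / Re p ^ 3" .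
  qed (use C in \<open>auto simp: D_def\<close>)
qed

text \<open>At p = 1/T - \<i> y the quotient norm p ^ 2 / Re p ^ 3 is exactly T + T^3 y^2. Where
  norm p exceeds 1/7, 49 norm p ^ 2 is at least 1, so the trivial bound can be brought to the same
  form.\<close>

lemma mean_excess_transform_bound:
  obtains C where "C > 0" "\<And>T y. T \<ge> 7 \<Longrightarrow>
    norm (LINT t:{0<..}|lborel. of_real (mean_excess t) * exp (- ((of_real (1 / T) - \<i> * of_real y) * of_real t))) \<le> C * (T + T ^ 3 * y\<^sup>2)"
proof -
  obtain C1 where C1: "C1 \<ge> 0" "\<And>p. 0 < Re p \<Longrightarrow> norm p \<le> 1 / 7 \<Longrightarrow>
    norm (LINT t:{0<..}|lborel. of_real (mean_excess t) * exp (- (p * of_real t))) \<le> C1 * ((norm p)\<^sup>2 / Re p ^ 3)"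
  proof (rule mean_excess_laplace_near, goal_cases)
    case (1 C)
    show ?case by (rule 1(1)[OF 1(2,3)])
  qed
  obtain C2 where C2: "C2 \<ge> 0" "\<And>p. 0 < Re p \<Longrightarrow> Re p \<le> 1 / 7 \<Longrightarrow>
    norm (LINT t:{0<..}|lborel. of_real (mean_excess t) * exp (- (p * of_real t))) \<le> C2 / Re p ^ 3"
  proof (rule mean_excess_laplace_trivial, goal_cases)
    case (1 C)
    show ?case by (rule 1(1)[OF 1(2,3)])
  qed
  show ?thesis
  proof (rule that[of "C1 + 49 * C2 + 1"])
    fix T y :: real assume T: "T \<ge> 7"
    define p where "p = complex_of_real (1 / T) - \<i> * of_real y"
    have rp: "Re p = 1 / T" "0 < Re p" "Re p \<le> 1 / 7" using T by (auto simp: p_def field_simps)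
    have np: "(norm p)\<^sup>2 = 1 / T\<^sup>2 + y\<^sup>2" by (simp add: cmod_power2 p_def power_divide)
    have e: "(norm p)\<^sup>2 / Re p ^ 3 = T + T ^ 3 * y\<^sup>2"
    proof -
      define q where "q = T\<^sup>2"
      have q: "q \<noteq> 0" using T by (simp add: q_def)
      have "(norm p)\<^sup>2 / Re p ^ 3 = (1 / q + y\<^sup>2) * (T * q)"
        unfolding np rp(1) power_divide q_def by (simp add: power2_eq_square power3_eq_cube)
      also have "\<dots> = T + T * q * y\<^sup>2" using q by (simp add: distrib_right)
      finally show ?thesis by (simp add: q_def power2_eq_square power3_eq_cube)
    qed
    have e0: "0 \<le> T + T ^ 3 * y\<^sup>2" using T by simp
    define J where "J = norm (LINT t:{0<..}|lborel. of_real (mean_excess t) * exp (- (p * of_real t)))"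
    have "J \<le> (C1 + 49 * C2 + 1) * (T + T ^ 3 * y\<^sup>2)"
    proof (cases "norm p \<le> 1 / 7")
      case True
      have "J \<le> C1 * (T + T ^ 3 * y\<^sup>2)" unfolding J_def e[symmetric] by (rule C1(2)[OF rp(2) True])
      also have "\<dots> \<le> (C1 + 49 * C2 + 1) * (T + T ^ 3 * y\<^sup>2)" using C2(1) e0 by (intro mult_right_mono) auto
      finally show ?thesis .
    next
      case False
      have "(1 / 7)\<^sup>2 \<le> (norm p)\<^sup>2" using False by (intro power_mono) auto
      hence "1 \<le> 49 * (norm p)\<^sup>2" unfolding power_divide by simp
      hence "1 / Re p ^ 3 \<le> 49 * (norm p)\<^sup>2 / Re p ^ 3" using rp by (intro divide_right_mono) auto
      hence "1 / Re p ^ 3 \<le> 49 * (T + T ^ 3 * y\<^sup>2)" using e by simp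
      hence "C2 * (1 / Re p ^ 3) \<le> C2 * (49 * (T + T ^ 3 * y\<^sup>2))" using C2(1) by (intro mult_left_mono) auto
      moreover have "J \<le> C2 * (1 / Re p ^ 3)" unfolding J_def using C2(2)[OF rp(2,3)] by simp
      moreover have "(49 * C2) * (T + T ^ 3 * y\<^sup>2) \<le> (C1 + 49 * C2 + 1) * (T + T ^ 3 * y\<^sup>2)"
        using C1(1) e0 by (intro mult_right_mono) auto
      moreover have "C2 * (49 * (T + T ^ 3 * y\<^sup>2)) = (49 * C2) * (T + T ^ 3 * y\<^sup>2)" by simp
      ultimately show ?thesis by linarith
    qed
    thus "norm (LINT t:{0<..}|lborel. of_real (mean_excess t) * exp (- ((of_real (1 / T) - \<i> * of_real y) * of_real t)))
       \<le> (C1 + 49 * C2 + 1) * (T + T ^ 3 * y\<^sup>2)" unfolding J_def p_def .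
  qed (use C1 C2 in auto)
qed

section \<open>Gaussian averages and slow decrease\<close>

lemma set_integrable_exp_decay:
  assumes s: "s > (0::real)"
  shows "set_integrable lborel {0<..} (\<lambda>t. exp (- (s * t)))" "(LINT t:{0<..}|lborel. exp (- (s * t))) = 1 / s"
proof -
  show "set_integrable lborel {0<..} (\<lambda>t. exp (- (s * t)))"
    using set_integrable_norm[OF exp_integral_Ioi(1)[OF s]] by simp
  have "complex_of_real (LINT t:{0<..}|lborel. exp (- (s * t))) = (LINT t:{0<..}|lborel. complex_of_real (exp (- (s * t))))"
    by (rule set_integral_complex_of_real[symmetric])
  also have "\<dots> = complex_of_real (1 / s)" using exp_integral_Ioi(2)[OF s] by simp
  finally show "(LINT t:{0<..}|lborel. exp (- (s * t))) = 1 / s" unfolding of_real_eq_iff .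
qed

text \<open>The Gaussian identity evaluates the transform at x / b for a standard normal x. The
  moments of order 0 and 2 turn T + T^3 y^2 into T + T^3 / b^2.\<close>

lemma smoothed_mean_excess:
  obtains C where "C > 0" "\<And>T a b. T \<ge> 7 \<Longrightarrow> b > 0 \<Longrightarrow>
    set_integrable lborel {0<..} (\<lambda>v. mean_excess v * exp (- (1 / T * v)) * exp (- ((v - a) / b)\<^sup>2 / 2)) \<and>
    (LINT v:{0<..}|lborel. mean_excess v * exp (- (1 / T * v)) * exp (- ((v - a) / b)\<^sup>2 / 2)) \<le> C * (T + T ^ 3 / b\<^sup>2)"
proof -
  obtain C where C: "C > 0" "\<And>T y. T \<ge> 7 \<Longrightarrow>
    norm (LINT t:{0<..}|lborel. of_real (mean_excess t) * exp (- ((of_real (1 / T) - \<i> * of_real y) * of_real t))) \<le> C * (T + T ^ 3 * y\<^sup>2)"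
  proof (rule mean_excess_transform_bound, goal_cases)
    case (1 C)
    show ?case by (rule 1(1)[OF 1(2,3)])
  qed
  show ?thesis
  proof (rule that[OF C(1)])
    fix T a b :: real assume T: "T \<ge> 7" and b: "b > 0"
    define F where "F = (\<lambda>v. indicator {0<..} v *\<^sub>R (of_real (mean_excess v) * exp (- (complex_of_real (1 / T) * of_real v))))"
    have Tp: "0 < Re (complex_of_real (1 / T))" "Re (complex_of_real (1 / T)) < pi"
    proof -
      show "0 < Re (complex_of_real (1 / T))" using T by simp
      have "1 / T \<le> 1" using T by simp
      thus "Re (complex_of_real (1 / T)) < pi" using pi_gt3 by simp
    qed
    have Fi: "integrable lborel F" using mean_excess_laplace(1)[OF Tp] unfolding F_def set_integrable_def .
    have Fr: "F v = of_real (indicator {0<..} v * (mean_excess v * exp (- (1 / T * v))))" for v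
      by (simp add: F_def scaleR_conv_of_real exp_of_real[symmetric])
    define G where "G = (\<lambda>v. F v * of_real (exp (- ((v - a) / b)\<^sup>2 / 2)))"
    have Gr: "G v = of_real (indicator {0<..} v * (mean_excess v * exp (- (1 / T * v)) * exp (- ((v - a) / b)\<^sup>2 / 2)))" for v
      by (simp add: G_def Fr)
    have [measurable]: "F \<in> borel_measurable lborel" using Fi by simp
    have Gi: "integrable lborel G"
      by (rule Bochner_Integration.integrable_bound[OF Fi]) (auto simp: G_def norm_mult intro!: AE_I2 mult_left_le)
    have four: "norm (fourier F y) \<le> C * (T + T ^ 3 * y\<^sup>2)" for y
    proof -
      have "F v * cis (y * v) = indicator {0<..} v *\<^sub>R (of_real (mean_excess v) * exp (- ((of_real (1 / T) - \<i> * of_real y) * of_real v)))" for v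
      proof -
        have "exp (- ((of_real (1 / T) - \<i> * of_real y) * of_real v)) = exp (- (complex_of_real (1 / T) * of_real v) + \<i> * of_real (y * v))"
          by (simp only: left_diff_distrib of_real_mult minus_diff_eq mult.assoc uminus_add_conv_diff)
        also have "\<dots> = exp (- (complex_of_real (1 / T) * of_real v)) * cis (y * v)"
          unfolding exp_add cis_conv_exp ..
        finally show ?thesis by (simp add: F_def)
      qed
      hence "fourier F y = (LINT t:{0<..}|lborel. of_real (mean_excess t) * exp (- ((of_real (1 / T) - \<i> * of_real y) * of_real t)))"
        unfolding fourier_def set_lebesgue_integral_def by simp
      thus ?thesis using C(2)[OF T] by simp
    qed
    define h where "h = (\<lambda>x. C * T * (std_normal_density x * x ^ (2 * 0)) + C * T ^ 3 / b\<^sup>2 * (std_normal_density x * x ^ (2 * 1)))"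
    have "has_bochner_integral lborel h (C * T * (fact (2 * 0) / (2 ^ 0 * fact 0)) + C * T ^ 3 / b\<^sup>2 * (fact (2 * 1) / (2 ^ 1 * fact 1)))"
      unfolding h_def by (intro has_bochner_integral_add has_bochner_integral_mult_right std_normal_moment_even)
    hence hb: "integrable lborel h" "(LINT x|lborel. h x) = C * (T + T ^ 3 / b\<^sup>2)"
      by (auto simp: has_bochner_integral_iff distrib_left)
    define k where "k = (\<lambda>x. of_real (std_normal_density x) * cis (- (a / b * x)) * fourier F (x / b))"
    have kh: "norm (k x) \<le> h x" for x
    proof -
      have "norm (k x) = std_normal_density x * norm (fourier F (x / b))" by (simp add: k_def norm_mult)
      also have "\<dots> \<le> std_normal_density x * (C * (T + T ^ 3 * (x / b)\<^sup>2))"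
        by (intro mult_left_mono four) simp
      also have "T ^ 3 * (x / b)\<^sup>2 = T ^ 3 / b\<^sup>2 * x\<^sup>2" by (simp add: power_divide)
      also have "std_normal_density x * (C * (T + T ^ 3 / b\<^sup>2 * x\<^sup>2)) = h x"
      proof -
        have "x ^ (2 * 0) = 1" "x ^ (2 * 1) = x\<^sup>2" by simp_all
        thus ?thesis unfolding h_def times_divide_eq_right[symmetric] by (simp only: algebra_simps mult_1_right mult_1_left)
      qed
      finally show ?thesis .
    qed
    have h0: "0 \<le> (LINT x|lborel. h x)" unfolding hb(2) using C(1) T by simp
    have "norm (LINT x|lborel. k x) \<le> (LINT x|lborel. h x)"
    \<comment> \<open>If \<open>k\<close> were not integrable its integral would be 0 by convention,
      and the bound is nonnegative.\<close>
    proof (cases "integrable lborel k")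
      case True
      thus ?thesis by (rule Bochner_Integration.integral_norm_bound_integral[OF _ hb(1)]) (use kh in auto)
    qed (use h0 in \<open>simp add: not_integrable_integral_eq\<close>)
    hence 1: "norm (LINT v|lborel. G v) \<le> C * (T + T ^ 3 / b\<^sup>2)"
      unfolding G_def gaussian_fourier[OF Fi b] k_def hb(2) .
    have i: "integrable lborel (\<lambda>v. indicator {0<..} v * (mean_excess v * exp (- (1 / T * v)) * exp (- ((v - a) / b)\<^sup>2 / 2)))"
      using integrable_Re[OF Gi] unfolding Gr by simp
    define X where "X = (LINT v|lborel. indicator {0<..} v * (mean_excess v * exp (- (1 / T * v)) * exp (- ((v - a) / b)\<^sup>2 / 2)))"
    have X: "(LINT v|lborel. G v) = of_real X"
      unfolding Gr X_def by (rule integral_complex_of_real)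
    have "X \<le> C * (T + T ^ 3 / b\<^sup>2)" using 1 unfolding X norm_of_real by linarith
    with i show "set_integrable lborel {0<..} (\<lambda>v. mean_excess v * exp (- (1 / T * v)) * exp (- ((v - a) / b)\<^sup>2 / 2)) \<and>
      (LINT v:{0<..}|lborel. mean_excess v * exp (- (1 / T * v)) * exp (- ((v - a) / b)\<^sup>2 / 2)) \<le> C * (T + T ^ 3 / b\<^sup>2)"
      unfolding set_integrable_def set_lebesgue_integral_def real_scaleR_def X_def ..
  qed
qed

lemma set_integrable_Ioo_imp_Icc:
  fixes f :: "real \<Rightarrow> real"
  assumes "set_integrable lborel {a<..<b} f"
  shows "f integrable_on {a..b}" "(LINT u:{a<..<b}|lborel. f u) = integral {a..b} f"
  using set_borel_integral_eq_integral[OF assms] integral_open_interval_real[of a b f] integrable_on_open_interval_real[of f a b] by simp_all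

lemma zeta_sq_integrable_on: "0 \<le> a \<Longrightarrow> zeta_sq integrable_on {a..b}"
  by (rule integrable_continuous_interval) (rule continuous_on_subset[OF zeta_sq_continuous], simp)

lemma zeta_excess_integrable_on: "0 \<le> a \<Longrightarrow> zeta_excess integrable_on {a..b}"
  using integrable_on_subinterval[OF set_integrable_Ioo_imp_Icc(1)[OF zeta_excess_integrable[of b]]] by simp

lemma harm_step_integrable_on: "0 \<le> a \<Longrightarrow> harm_step integrable_on {a..b}"
  using integrable_on_subinterval[OF set_integrable_Ioo_imp_Icc(1)[OF harm_step_integrable[of b]]] by simp

lemma mean_excess_eq: "mean_excess T = integral {0..T} zeta_excess"
  unfolding mean_excess_def by (rule set_integrable_Ioo_imp_Icc(2)[OF zeta_excess_integrable])

text \<open>As \<open>zeta_sq\<close> is nonnegative, \<open>mean_excess\<close> can fall no faster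
  than the subtracted density, which is at most 1 + ln t.\<close>

lemma mean_excess_increment:
  assumes "1 \<le> s" "s \<le> t"
  shows "mean_excess t \<ge> mean_excess s - (t - s) * (1 + ln t)"
proof -
  have "integral {s..t} (\<lambda>_. - (1 + ln t)) \<le> integral {s..t} zeta_excess"
  proof (rule integral_le)
    fix u assume u: "u \<in> {s..t}"
    have "harm_step u \<le> 1 + ln u" using u assms by (intro harm_step_le_ln) auto
    also have "\<dots> \<le> 1 + ln t" using u assms by simp
    finally show "- (1 + ln t) \<le> zeta_excess u"
      using zeta_sq_nonneg[of u] zeta_const_neg by (simp add: zeta_excess_def)
  qed (use zeta_excess_integrable_on assms in auto)
  moreover have "integral {0..s} zeta_excess + integral {s..t} zeta_excess = integral {0..t} zeta_excess"
    using assms by (intro Henstock_Kurzweil_Integration.integral_combine zeta_excess_integrable_on) auto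
  moreover have "integral {s..t} (\<lambda>_. - (1 + ln t)) = - ((t - s) * (1 + ln t))"
    unfolding integral_const_real using assms by (simp only: content_real real_scaleR_def mult_minus_right)
  ultimately show ?thesis unfolding mean_excess_eq by linarith
qed

text \<open>A crude bound, sufficient because it is only used where the Gaussian weight is at most
  exp (-8 (ln T)^2).\<close>

lemma mean_excess_lower: 
  assumes "0 < v" 
  shows "mean_excess v \<ge> - v\<^sup>2"
proof -
  have "integral {0..v} (\<lambda>_. - v) \<le> integral {0..v} zeta_excess"
  proof (rule integral_le)
    fix u assume u: "u \<in> {0..v}"
    have "harm_step u \<le> v"
    proof (cases "u = 0")
      case True thus ?thesis using assms by (simp add: harm_step_def harm_def)
    next
      case False thus ?thesis using harm_step_le[of u] u by simp
    qed
    thus "- v \<le> zeta_excess u"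
      using zeta_sq_nonneg[of u] zeta_const_neg by (simp add: zeta_excess_def)
  qed (use zeta_excess_integrable_on assms in auto)
  thus ?thesis unfolding mean_excess_eq using assms by (simp add: power2_eq_square)
qed

lemma sq_times_exp_integrable:
  assumes T: "T > (0::real)"
  shows "set_integrable lborel {0<..} (\<lambda>v. v\<^sup>2 * exp (- (1 / T * v)))"
    "(LINT v:{0<..}|lborel. v\<^sup>2 * exp (- (1 / T * v))) \<le> 32 * T ^ 3"
proof -
  have s: "1 / (2 * T) > 0" using T by simp
  have b: "v\<^sup>2 * exp (- (1 / T * v)) \<le> 16 * T\<^sup>2 * exp (- (1 / (2 * T) * v))" if "v > 0" for v
  proof -
    have "v / (4 * T) \<le> exp (v / (4 * T))" using exp_ge_add_one_self[of "v / (4 * T)"] by linarith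
    hence "v \<le> 4 * T * exp (v / (4 * T))" using T by (simp add: field_simps)
    hence "v\<^sup>2 \<le> (4 * T * exp (v / (4 * T)))\<^sup>2" using that by (intro power_mono) auto
    also have "\<dots> = 16 * T\<^sup>2 * exp (2 * (v / (4 * T)))" by (simp only: power_mult_distrib exp_double) simp
    finally have "v\<^sup>2 * exp (- (1 / T * v)) \<le> 16 * T\<^sup>2 * exp (2 * (v / (4 * T))) * exp (- (1 / T * v))"
      by (intro mult_right_mono) auto
    also have "\<dots> = 16 * T\<^sup>2 * exp (2 * (v / (4 * T)) + - (1 / T * v))" by (simp only: mult.assoc exp_add)
    also have "2 * (v / (4 * T)) + - (1 / T * v) = - (1 / (2 * T) * v)" using T by (simp add: field_simps)
    finally show ?thesis .
  qed
  note i2 = set_integrable_mult_right[OF set_integrable_exp_decay(1)[OF s], of "16 * T\<^sup>2"]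
  show i: "set_integrable lborel {0<..} (\<lambda>v. v\<^sup>2 * exp (- (1 / T * v)))"
    by (rule set_integrable_bound[OF i2]) (use b in \<open>auto simp: set_borel_measurable_def intro!: AE_I2\<close>)
  have "(LINT v:{0<..}|lborel. v\<^sup>2 * exp (- (1 / T * v))) \<le> (LINT v:{0<..}|lborel. 16 * T\<^sup>2 * exp (- (1 / (2 * T) * v)))"
    by (rule set_integral_mono[OF i i2]) (use b in auto)
  also have "\<dots> = 16 * T\<^sup>2 * (2 * T)" unfolding set_integral_mult_right set_integrable_exp_decay(2)[OF s] by simp
  finally show "(LINT v:{0<..}|lborel. v\<^sup>2 * exp (- (1 / T * v))) \<le> 32 * T ^ 3" by (simp add: power2_eq_square power3_eq_cube)
qed

text \<open>By contradiction. A value above \<eta> T persists, up to a factor 1/2, on an interval of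
  length of order T / ln T to the right of T. A Gaussian centred in this interval collects a total
  of order T^2 / (ln T)^2, whereas the smoothed bound allows only order T (ln T)^4.\<close>

lemma mean_excess_le:
  assumes \<eta>: "\<eta> > 0"
  shows "eventually (\<lambda>T. mean_excess T \<le> \<eta> * T) at_top"
proof -
  obtain C where C: "C > 0" "\<And>T a b. T \<ge> 7 \<Longrightarrow> b > 0 \<Longrightarrow>
    set_integrable lborel {0<..} (\<lambda>v. mean_excess v * exp (- (1 / T * v)) * exp (- ((v - a) / b)\<^sup>2 / 2)) \<and>
    (LINT v:{0<..}|lborel. mean_excess v * exp (- (1 / T * v)) * exp (- ((v - a) / b)\<^sup>2 / 2)) \<le> C * (T + T ^ 3 / b\<^sup>2)"
  proof (rule smoothed_mean_excess, goal_cases)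
    case (1 C)
    show ?case by (rule 1(1)[OF 1(2,3)])
  qed
  \<comment> \<open>4096 is the square of the 64 in
    \<open>b = \<eta> * T / (64 * L\<^sup>2)\<close>.\<close>
  define D where "D = 4096 * C / \<eta>\<^sup>2"
  have lims: "((\<lambda>T::real. (ln T)\<^sup>2 / T) \<longlongrightarrow> 0) at_top" "((\<lambda>T::real. (ln T) ^ 6 / T) \<longlongrightarrow> 0) at_top"
      "((\<lambda>T::real. exp (- (8 * (ln T)\<^sup>2)) * (T * (ln T)\<^sup>2)) \<longlongrightarrow> 0) at_top"
    by real_asymp+
  have "((\<lambda>T::real. C * ((ln T)\<^sup>2 / T) + D * ((ln T) ^ 6 / T) + 32 * (exp (- (8 * (ln T)\<^sup>2)) * (T * (ln T)\<^sup>2))) \<longlongrightarrow> C * 0 + D * 0 + 32 * 0) at_top"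
    by (intro tendsto_intros lims)
  moreover have "C * 0 + D * 0 + 32 * 0 < \<eta>\<^sup>2 / 128 * exp (- 3)" using \<eta> by simp
  ultimately have "eventually (\<lambda>T. C * ((ln T)\<^sup>2 / T) + D * ((ln T) ^ 6 / T) + 32 * (exp (- (8 * (ln T)\<^sup>2)) * (T * (ln T)\<^sup>2))
      < \<eta>\<^sup>2 / 128 * exp (- 3)) at_top" by (rule order_tendstoD)
  moreover have "eventually (\<lambda>T. T \<ge> 7 \<and> ln T \<ge> 2 \<and> ln T \<ge> \<eta>) (at_top :: real filter)"
    by (intro eventually_conj) real_asymp+
  ultimately show ?thesis
  proof eventually_elim
    case (elim T)
    define L where "L = ln T"
    \<comment> \<open>Over an interval of this length the loss is at most
      \<open>3 / 8 * (\<eta> * T)\<close>, less than half of the assumed excess.\<close>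
    define H where "H = \<eta> * T / (8 * L)"
    \<comment> \<open>The ends of the interval are then \<open>4 * L\<close> widths away from its
      midpoint \<open>a\<close>, so outside it the Gaussian is at most exp (-8 L^2).\<close>
    define b where "b = H / (8 * L)"
    define a where "a = T + H / 2"
    have T: "T \<ge> 7" and L: "L \<ge> 2" "L \<ge> \<eta>" using elim by (auto simp: L_def)
    have beq: "b = \<eta> * T / (64 * L\<^sup>2)" by (simp add: b_def H_def power2_eq_square)
    have H0: "H > 0" using \<eta> T L by (simp add: H_def)
    have b0: "b > 0" using H0 L by (simp add: b_def)
    have HT: "H \<le> T"
    proof -
      have "\<eta> * T \<le> T * (8 * L)" using L T by (subst mult.commute, intro mult_left_mono) auto
      thus ?thesis using L by (simp add: H_def divide_le_eq)
    qed
    have bH: "b \<le> H / 2"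
      unfolding b_def using H0 L by (intro frac_le) auto
    show ?case
    proof (rule ccontr)
      assume "\<not> mean_excess T \<le> \<eta> * T"
      hence big: "mean_excess T > \<eta> * T" by simp
      have near: "mean_excess v \<ge> \<eta> * T / 2" if "v \<in> {T..T + H}" for v
      proof -
        have "ln v \<le> ln (2 * T)" using that T HT by (subst ln_le_cancel_iff) auto
        also have "ln (2 * T) = ln 2 + L" using T by (simp add: ln_mult L_def)
        also have "ln 2 \<le> (1::real)" using ln_le_minus_one[of "2::real"] by simp
        finally have "1 + ln v \<le> 3 * L" using L by linarith
        moreover have "0 \<le> 1 + ln v" using that T by simp
        ultimately have "(v - T) * (1 + ln v) \<le> H * (3 * L)" using that by (intro mult_mono) auto
        also have "H * (3 * L) = 3 / 8 * (\<eta> * T)" using L by (simp add: H_def)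
        also have "\<dots> \<le> \<eta> * T / 2" using \<eta> T by simp
        finally show ?thesis using mean_excess_increment[of T v] that T big by simp
      qed
      \<comment> \<open>A minorant of the integrand: on [a, a + b] the two exponential weights
        together are at least exp (-3), and the subtracted term covers the possibly negative values
        outside [T, T + H].\<close>
      define g where "g = (\<lambda>v. (\<eta> * T / 2 * exp (- 3)) * indicator {a..a + b} v + - exp (- (8 * L\<^sup>2)) * (v\<^sup>2 * exp (- (1 / T * v))))"
      have a0: "a > 0" using T H0 by (simp add: a_def)
      have ind: "indicator {0<..} v *\<^sub>R (indicator {a..a + b} v :: real) = indicator {a..a + b} v" for v
        using a0 by (auto simp: indicator_def)
      have i1: "set_integrable lborel {0<..} (\<lambda>v. indicator {a..a + b} v :: real)"
        unfolding set_integrable_def ind by (intro integrable_real_indicator) (use b0 in auto)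
      have v1: "(LINT v:{0<..}|lborel. indicator {a..a + b} v :: real) = b"
        unfolding set_lebesgue_integral_def ind using b0 by simp
      have T0: "T > 0" using T by simp
      note i2 = sq_times_exp_integrable[OF T0]
      have gi: "set_integrable lborel {0<..} g" unfolding g_def
        by (intro set_integral_add(1) set_integrable_mult_right i1 i2(1))
      have gv: "(LINT v:{0<..}|lborel. g v) = \<eta> * T / 2 * exp (- 3) * b + - exp (- (8 * L\<^sup>2)) * (LINT v:{0<..}|lborel. v\<^sup>2 * exp (- (1 / T * v)))"
        unfolding g_def set_integral_add(2)[OF set_integrable_mult_right[OF i1] set_integrable_mult_right[OF i2(1)]] set_integral_mult_right v1 ..
      have "exp (- (8 * L\<^sup>2)) * (LINT v:{0<..}|lborel. v\<^sup>2 * exp (- (1 / T * v))) \<le> exp (- (8 * L\<^sup>2)) * (32 * T ^ 3)"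
        using i2(2) by (intro mult_left_mono) auto
      hence glow: "(LINT v:{0<..}|lborel. g v) \<ge> \<eta> * T / 2 * exp (- 3) * b - exp (- (8 * L\<^sup>2)) * (32 * T ^ 3)"
        unfolding gv by simp
      have "(LINT v:{0<..}|lborel. g v) \<le> (LINT v:{0<..}|lborel. mean_excess v * exp (- (1 / T * v)) * exp (- ((v - a) / b)\<^sup>2 / 2))"
      proof (rule set_integral_mono[OF gi conjunct1[OF C(2)[OF T b0]]])
        fix v :: real assume "v \<in> {0<..}"
        hence v0: "v > 0" by simp
        define w where "w = mean_excess v * exp (- (1 / T * v)) * exp (- ((v - a) / b)\<^sup>2 / 2)"
        define Q where "Q = exp (- (8 * L\<^sup>2)) * (v\<^sup>2 * exp (- (1 / T * v)))"
        have Q: "Q \<ge> 0" by (simp add: Q_def)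
        have gQ: "g v = \<eta> * T / 2 * exp (- 3) * indicator {a..a + b} v - Q"
          by (simp only: g_def Q_def mult_minus_left uminus_add_conv_diff[symmetric] add.commute)
        show "g v \<le> w"
        proof (cases "v \<in> {T..T + H}")
          case True
          note n = near[OF True]
          have \<eta>T: "\<eta> * T / 2 \<ge> 0" using \<eta> T by simp
          show ?thesis
          proof (cases "v \<in> {a..a + b}")
            case in_ab: True
            have "v \<le> 2 * T" using True HT by simp
            hence "1 / T * v \<le> 2" using T by (simp add: divide_le_eq)
            hence e1: "exp (- 2) \<le> exp (- (1 / T * v))" by simp
            have "((v - a) / b)\<^sup>2 \<le> 1\<^sup>2" using in_ab b0 by (intro power_mono) (auto simp: divide_le_eq)
            hence e2: "exp (- 1) \<le> exp (- ((v - a) / b)\<^sup>2 / 2)" by simp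
            have "\<eta> * T / 2 * exp (- 3) = \<eta> * T / 2 * exp (- 2) * exp (- 1)" unfolding mult.assoc exp_add[symmetric] by simp
            also have "\<dots> \<le> w" unfolding w_def using n \<eta>T e1 e2 by (intro mult_mono) auto
            finally have "\<eta> * T / 2 * exp (- 3) \<le> w" .
            moreover have "indicator {a..a + b} v = (1 :: real)" using in_ab by simp
            ultimately show ?thesis using Q unfolding gQ by simp
          next
            case False
            have "0 \<le> w" unfolding w_def using n \<eta>T by simp
            moreover have "indicator {a..a + b} v = (0 :: real)" using False by simp
            ultimately show ?thesis using Q unfolding gQ by simp
          qed
        next
          case False
          have nab: "v \<notin> {a..a + b}" using False bH H0 by (auto simp: a_def)
          have "v < T \<or> T + H < v" using False by auto
          hence "H / 2 \<le> \<bar>v - a\<bar>"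
            using abs_ge_self[of "v - a"] abs_ge_minus_self[of "v - a"] unfolding a_def by linarith
          hence "H / 2 / b \<le> \<bar>v - a\<bar> / b" using b0 by (intro divide_right_mono) auto
          moreover have "H / 2 / b = 4 * L" using H0 L by (simp add: b_def)
          ultimately have "4 * L \<le> \<bar>(v - a) / b\<bar>" using b0 by simp
          hence "(4 * L)\<^sup>2 \<le> \<bar>(v - a) / b\<bar>\<^sup>2" using L by (intro power_mono) auto
          hence "16 * L\<^sup>2 \<le> ((v - a) / b)\<^sup>2" by (simp only: power_mult_distrib power2_abs) simp
          hence e: "exp (- ((v - a) / b)\<^sup>2 / 2) \<le> exp (- (8 * L\<^sup>2))" by simp
          have "- w = - mean_excess v * exp (- (1 / T * v)) * exp (- ((v - a) / b)\<^sup>2 / 2)" by (simp add: w_def)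
          also have "\<dots> \<le> v\<^sup>2 * exp (- (1 / T * v)) * exp (- ((v - a) / b)\<^sup>2 / 2)"
            using mean_excess_lower[OF v0] by (intro mult_right_mono) auto
          also have "\<dots> \<le> v\<^sup>2 * exp (- (1 / T * v)) * exp (- (8 * L\<^sup>2))"
            using e by (intro mult_left_mono) auto
          also have "\<dots> = Q" unfolding Q_def by (rule mult.commute)
          finally have "- w \<le> Q" .
          moreover have "indicator {a..a + b} v = (0 :: real)" using nab by simp
          ultimately show ?thesis unfolding gQ by simp
        qed
      qed
      also have "\<dots> \<le> C * (T + T ^ 3 / b\<^sup>2)" using C(2)[OF T b0] by blast
      finally have "\<eta> * T / 2 * exp (- 3) * b - exp (- (8 * L\<^sup>2)) * (32 * T ^ 3) \<le> C * (T + T ^ 3 / b\<^sup>2)" using glow by linarith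
      moreover have "C * (T + T ^ 3 / b\<^sup>2) + exp (- (8 * L\<^sup>2)) * (32 * T ^ 3) < \<eta> * T / 2 * exp (- 3) * b"
      proof -
        \<comment> \<open>The common scale of both sides: divided by \<open>q\<close>, the claim
          becomes the inequality that holds for all large \<open>T\<close>.\<close>
        define q where "q = T\<^sup>2 / L\<^sup>2"
        define x where "x = exp (- (8 * L\<^sup>2))"
        define z where "z = exp (- 3 :: real)"
        have nz: "T \<noteq> 0" "L \<noteq> 0" "\<eta> \<noteq> 0" and q: "q > 0" using T L \<eta> by (auto simp: q_def)
        have e1: "L\<^sup>2 / T * q = T" "T * L\<^sup>2 * q = T ^ 3"
          using nz by (simp_all add: q_def power2_eq_square power3_eq_cube)
        have "L ^ 6 = L\<^sup>2 * (L\<^sup>2 * L\<^sup>2)" by (simp flip: power_add)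
        hence "L ^ 6 / T * q = T * (L\<^sup>2 * L\<^sup>2)" using e1(1) by (metis mult.commute mult.left_commute times_divide_eq_left)
        moreover have "T ^ 3 / b\<^sup>2 = 4096 / \<eta>\<^sup>2 * (T * (L\<^sup>2 * L\<^sup>2))"
          using nz unfolding beq by (simp add: power_divide power_mult_distrib power2_eq_square power3_eq_cube)
        ultimately have e2: "C * (T ^ 3 / b\<^sup>2) = D * (L ^ 6 / T * q)" by (simp add: D_def)
        have e3: "\<eta> * T / 2 * z * b = \<eta>\<^sup>2 / 128 * z * q"
          unfolding beq q_def by (simp add: power2_eq_square)
        have "C * (L\<^sup>2 / T) + D * (L ^ 6 / T) + 32 * (x * (T * L\<^sup>2)) < \<eta>\<^sup>2 / 128 * z"
          using elim unfolding L_def x_def z_def by blast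
        hence "(C * (L\<^sup>2 / T) + D * (L ^ 6 / T) + 32 * (x * (T * L\<^sup>2))) * q < \<eta>\<^sup>2 / 128 * z * q"
          using q by (rule mult_strict_right_mono)
        also have "(C * (L\<^sup>2 / T) + D * (L ^ 6 / T) + 32 * (x * (T * L\<^sup>2))) * q = C * (L\<^sup>2 / T * q) + D * (L ^ 6 / T * q) + x * (32 * (T * L\<^sup>2 * q))"
          by (simp only: distrib_right mult.assoc mult.left_commute)
        finally have "C * T + C * (T ^ 3 / b\<^sup>2) + x * (32 * T ^ 3) < \<eta> * T / 2 * z * b"
          unfolding e1 e2 e3 .
        thus ?thesis unfolding x_def z_def distrib_left .
      qed
      ultimately show False by linarith
    qed
  qed
qed

definition mean_main :: "real \<Rightarrow> real" where
  "mean_main y = y * ln y + zeta_const * y"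

text \<open>The numbers fit as follows: 1 - gamma exceeds 9/22; the bound for harmonic numbers and
  \<open>mean_excess\<close> cost 1/22 each, the constant \<open>K\<close> costs 2/22. A gap of 5/22
  > 1/5 remains.\<close>

lemma zeta_mean_less_main:
  "eventually (\<lambda>T. integral {0..T} zeta_sq \<le> mean_main T - T / 5) at_top"
proof -
  have "eventually (\<lambda>n. harm n - ln (real n) < euler_mascheroni + 1 / 22) sequentially"
    using euler_mascheroni_LIMSEQ by (rule order_tendstoD) simp
  then obtain N where N: "\<And>n. n \<ge> N \<Longrightarrow> harm n - ln (real n) < euler_mascheroni + (1 / 22 :: real)"
    unfolding eventually_sequentially by blast
  define u0 where "u0 = real N + 1"
  define \<beta> where "\<beta> = (euler_mascheroni + 1 / 22 :: real)"
  have step: "harm_step u \<le> ln u + \<beta>" if "u \<ge> u0" for u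
  proof -
    define n where "n = nat \<lfloor>u\<rfloor>"
    have n: "n \<ge> N" "n \<ge> 1" "real n \<le> u" using that by (auto simp: u0_def n_def le_nat_iff le_floor_iff)
    have "harm n < ln (real n) + \<beta>" using N[OF n(1)] by (simp add: \<beta>_def)
    moreover have "ln (real n) \<le> ln u" using n by simp
    ultimately show ?thesis by (simp add: harm_step_def n_def[symmetric])
  qed
  \<comment> \<open>Absorbs the initial range, where the bound for the harmonic numbers is not yet
    available.\<close>
  define K where "K = integral {0..u0} harm_step - (u0 * ln u0 - u0 + \<beta> * u0)"
  have bound: "integral {0..T} harm_step \<le> T * ln T - T + \<beta> * T + K" if T: "T \<ge> u0" for T
  proof -
    have u0: "u0 > 0" by (simp add: u0_def)
    have "((\<lambda>u. ln u + \<beta>) has_integral ((T * ln T - T + \<beta> * T) - (u0 * ln u0 - u0 + \<beta> * u0))) {u0..T}"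
    proof (rule fundamental_theorem_of_calculus[OF T])
      fix x assume x: "x \<in> {u0..T}"
      have "((\<lambda>x. x * ln x - x + \<beta> * x) has_real_derivative (ln x + \<beta>)) (at x within {u0..T})"
        using x u0 by (auto intro!: derivative_eq_intros)
      thus "((\<lambda>x. x * ln x - x + \<beta> * x) has_vector_derivative (ln x + \<beta>)) (at x within {u0..T})"
        by (simp add: has_real_derivative_iff_has_vector_derivative)
    qed
    moreover have "integral {u0..T} harm_step \<le> integral {u0..T} (\<lambda>u. ln u + \<beta>)"
      using calculation u0 by (intro integral_le harm_step_integrable_on) (auto intro: step simp: has_integral_integrable)
    moreover have "integral {0..u0} harm_step + integral {u0..T} harm_step = integral {0..T} harm_step"
      using u0 T by (intro Henstock_Kurzweil_Integration.integral_combine harm_step_integrable_on) auto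
    ultimately show ?thesis unfolding K_def by (simp add: integral_unique)
  qed
  have split: "integral {0..T} zeta_sq = mean_excess T + (integral {0..T} harm_step + zeta_const * T)" if "T \<ge> 0" for T
  proof -
    have "integral {0..T} zeta_sq = integral {0..T} (\<lambda>u. zeta_excess u + (harm_step u + zeta_const))"
      by (simp add: zeta_excess_def)
    also have "\<dots> = integral {0..T} zeta_excess + integral {0..T} (\<lambda>u. harm_step u + zeta_const)"
      by (intro Henstock_Kurzweil_Integration.integral_add integrable_add zeta_excess_integrable_on harm_step_integrable_on) auto
    also have "integral {0..T} (\<lambda>u. harm_step u + zeta_const) = integral {0..T} harm_step + integral {0..T} (\<lambda>u. zeta_const)"
      by (intro Henstock_Kurzweil_Integration.integral_add harm_step_integrable_on) auto
    finally show ?thesis using that by (simp add: mean_excess_eq mult.commute)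
  qed
  have "eventually (\<lambda>T. mean_excess T \<le> 1 / 22 * T) at_top" by (rule mean_excess_le) simp
  moreover have "eventually (\<lambda>T. T \<ge> u0 \<and> T \<ge> 0 \<and> K \<le> T / 11) at_top"
    by (intro eventually_conj) real_asymp+
  ultimately show ?thesis
  proof eventually_elim
    case (elim T)
    have "\<beta> * T \<le> 14 / 22 * T" using elim euler_mascheroni_less_13_over_22 by (intro mult_right_mono) (auto simp: \<beta>_def)
    thus ?case using split[of T] bound[of T] elim unfolding mean_main_def by linarith
  qed
qed

section \<open>The ladder and its inverse\<close>

text \<open>Here p = 2/x is real, so the ratio norm p / Re p is 1 and the error is of order p |ln
  p|. The condition x >= 6 is norm p <= 1/3, and 1/p = x/2 is the argument of the main term.\<close>

lemma zeta_sq_exp_integral: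
  obtains C where "C > 0" "\<And>x. x \<ge> 6 \<Longrightarrow>
    \<bar>(LINT t:{0<..}|lborel. zeta_sq t * exp (- (2 / x * t))) - (mean_main (x / 2) + pi)\<bar> \<le> C * (ln x / x)"
proof -
  obtain C where C: "C \<ge> 0" "\<And>p. 0 < Re p \<Longrightarrow> norm p \<le> 1 / 3 \<Longrightarrow>
    norm (zeta_laplace p - ((of_real zeta_const - Ln p) / p + of_real pi)) \<le> C * (norm p * (1 + norm (Ln p) + (norm p / Re p) ^ 3))"
  proof (rule zeta_laplace_asymp[folded zeta_const_def], goal_cases)
    case (1 C)
    show ?case by (rule 1(1)[OF 1(2,3)])
  qed
  show ?thesis
  proof (rule that[of "6 * C + 1"])
    fix x :: real assume x: "x \<ge> 6"
    define s where "s = 2 / x"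
    have s: "s > 0" "s \<le> 1 / 3" using x by (auto simp: s_def divide_le_eq)
    have ls: "ln s = - ln (x / 2)" using x by (simp add: s_def ln_div)
    define X where "X = (LINT t:{0<..}|lborel. zeta_sq t * exp (- (s * t)))"
    have "complex_of_real X = zeta_laplace (of_real s)"
      unfolding X_def set_integral_complex_of_real[symmetric] zeta_laplace_def by (simp add: exp_of_real[symmetric])
    moreover have "Ln (complex_of_real s) = of_real (ln s)" using s by (simp add: Ln_of_real)
    ultimately have "norm (complex_of_real (X - ((zeta_const - ln s) / s + pi))) \<le> C * (\<bar>s\<bar> * (1 + \<bar>ln s\<bar> + (\<bar>s\<bar> / s) ^ 3))"
      using C(2)[of "of_real s"] s by simp
    hence 1: "\<bar>X - ((zeta_const - ln s) / s + pi)\<bar> \<le> C * (\<bar>s\<bar> * (1 + \<bar>ln s\<bar> + (\<bar>s\<bar> / s) ^ 3))"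
      unfolding norm_of_real .
    have "exp 1 \<le> x" using exp_le x by linarith
    hence lx1: "1 \<le> ln x" using x by (subst ln_ge_iff) auto
    have lx2: "0 \<le> ln (x / 2)" "ln (x / 2) \<le> ln x" using x by auto
    have "\<bar>s\<bar> * (1 + \<bar>ln s\<bar> + (\<bar>s\<bar> / s) ^ 3) = s * (2 + ln (x / 2))"
      using s lx2 by (simp add: ls)
    also have "\<dots> \<le> s * (3 * ln x)" using s lx1 lx2 by (intro mult_left_mono) auto
    also have "\<dots> = 6 * (ln x / x)" by (simp add: s_def)
    finally have "C * (\<bar>s\<bar> * (1 + \<bar>ln s\<bar> + (\<bar>s\<bar> / s) ^ 3)) \<le> C * (6 * (ln x / x))" using C(1) by (intro mult_left_mono) auto
    moreover have "0 \<le> ln x / x" using lx1 x by simp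
    moreover have "(zeta_const - ln s) / s = mean_main (x / 2)"
    proof -
      have gen: "(c + l) * h = h * l + c * h" for c l h :: real by (simp add: algebra_simps)
      have "(zeta_const - ln s) / s = (zeta_const + ln (x / 2)) * (1 / s)" unfolding ls by simp
      also have "1 / s = x / 2" by (simp add: s_def)
      finally show ?thesis unfolding mean_main_def gen .
    qed
    ultimately have "\<bar>X - (mean_main (x / 2) + pi)\<bar> \<le> (6 * C + 1) * (ln x / x)" using 1 by (simp add: algebra_simps)
    thus "\<bar>(LINT t:{0<..}|lborel. zeta_sq t * exp (- (2 / x * t))) - (mean_main (x / 2) + pi)\<bar> \<le> (6 * C + 1) * (ln x / x)"
      by (simp add: X_def s_def)
  qed (use C in auto)
qed

text \<open>The left-hand side of the ladder equation as a function of x = \<phi>(T).\<close>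

definition cut_mean :: "(real \<Rightarrow> real) \<Rightarrow> real \<Rightarrow> real" where
  "cut_mean \<mu> x = integral {0..\<mu> x} (\<lambda>t. zeta_sq t * exp (- (2 / x) * t))"

lemma zeta_sq_exp_continuous: "continuous_on S (\<lambda>t. zeta_sq t * exp (- c * t))"
  by (intro continuous_intros continuous_on_subset[OF zeta_sq_continuous]) auto

text \<open>Half of the exponent is spent on the tail: for t >= 7 x ln x the factor exp (-t/x) is at
  most x^(-7). The other half leaves the full integral at 2 x in place of x, of order x ln x, so the
  tail is far below ln x / x.\<close>

lemma cut_mean_asymp:
  assumes \<mu>: "eventually (\<lambda>x. \<mu> x \<ge> 7 * x * ln x) at_top"
  obtains C where "C > 0" "eventually (\<lambda>x. \<bar>cut_mean \<mu> x - (mean_main (x / 2) + pi)\<bar> \<le> C * (ln x / x)) at_top"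
proof -
  obtain C where C: "C > 0" "\<And>x. x \<ge> 6 \<Longrightarrow>
    \<bar>(LINT t:{0<..}|lborel. zeta_sq t * exp (- (2 / x * t))) - (mean_main (x / 2) + pi)\<bar> \<le> C * (ln x / x)"
  proof (rule zeta_sq_exp_integral, goal_cases)
    case (1 C)
    show ?case by (rule 1(1)[OF 1(2,3)])
  qed
  have "eventually (\<lambda>x. exp (- (7 * ln x)) * (mean_main x + pi + C * (ln (2 * x) / (2 * x))) \<le> ln x / x) at_top"
    unfolding mean_main_def using C(1) by real_asymp
  moreover have "eventually (\<lambda>x. x \<ge> 6) (at_top :: real filter)" by (rule eventually_ge_at_top)
  ultimately have "eventually (\<lambda>x. \<bar>cut_mean \<mu> x - (mean_main (x / 2) + pi)\<bar> \<le> (C + 1) * (ln x / x)) at_top"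
    using \<mu>
  proof eventually_elim
    case (elim x)
    have x: "x \<ge> 6" by (rule elim)
    have x0: "2 / x > 0" "1 / x > 0" using x by auto
    have mpos: "\<mu> x > 0" using elim x by (intro less_le_trans[OF _ elim(3)]) auto
    define f where "f = (\<lambda>t. zeta_sq t * exp (- (2 / x * t)))"
    have f0: "f t \<ge> 0" for t by (simp add: f_def zeta_sq_nonneg)
    note fi = zeta_sq_exp_integrable[OF x0(1), folded f_def]
    have f1: "set_integrable lborel {0<..<\<mu> x} f" by (rule set_integrable_subset[OF fi]) auto
    have f2: "set_integrable lborel {\<mu> x..} f" by (rule set_integrable_subset[OF fi]) (use mpos in auto)
    have Un: "{0<..} = {0<..<\<mu> x} \<union> {\<mu> x..}" using mpos by auto
    have "(LINT t:{0<..}|lborel. f t) = (LINT t:{0<..<\<mu> x}|lborel. f t) + (LINT t:{\<mu> x..}|lborel. f t)"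
      unfolding Un by (rule set_integral_Un[OF _ f1 f2]) auto
    moreover have "(LINT t:{0<..<\<mu> x}|lborel. f t) = cut_mean \<mu> x"
    proof -
      have "cut_mean \<mu> x = integral {0..\<mu> x} f" unfolding cut_mean_def f_def by (simp only: mult_minus_left)
      thus ?thesis using set_integrable_Ioo_imp_Icc(2)[OF f1] by (simp only:)
    qed
    moreover have "0 \<le> (LINT t:{\<mu> x..}|lborel. f t)"
      unfolding set_lebesgue_integral_def using f0 by (intro Bochner_Integration.integral_nonneg) auto
    moreover have "(LINT t:{\<mu> x..}|lborel. f t) \<le> exp (- (7 * ln x)) * (LINT t:{0<..}|lborel. zeta_sq t * exp (- (1 / x * t)))"
      unfolding set_integral_mult_right[symmetric]
      unfolding set_lebesgue_integral_def
    proof (rule integral_mono)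
      show "integrable lborel (\<lambda>t. indicator {\<mu> x..} t *\<^sub>R f t)" using f2 unfolding set_integrable_def .
      show "integrable lborel (\<lambda>t. indicator {0<..} t *\<^sub>R (exp (- (7 * ln x)) * (zeta_sq t * exp (- (1 / x * t)))))"
        using set_integrable_mult_right[OF zeta_sq_exp_integrable[OF x0(2)], of "exp (- (7 * ln x))"] unfolding set_integrable_def .
      fix t :: real
      show "indicator {\<mu> x..} t *\<^sub>R f t \<le> indicator {0<..} t *\<^sub>R (exp (- (7 * ln x)) * (zeta_sq t * exp (- (1 / x * t))))"
      proof (cases "t \<ge> \<mu> x")
        case True
        hence "7 * x * ln x \<le> t" using elim by linarith
        hence "7 * ln x * x \<le> t" by (simp only: mult_ac)
        hence "7 * ln x \<le> t / x" using x by (subst pos_le_divide_eq) auto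
        hence "7 * ln x \<le> 1 / x * t" by simp
        hence "exp (- (2 / x * t)) \<le> exp (- (7 * ln x) + - (1 / x * t))" by simp
        hence "f t \<le> zeta_sq t * (exp (- (7 * ln x)) * exp (- (1 / x * t)))"
          unfolding f_def exp_add by (intro mult_left_mono zeta_sq_nonneg)
        moreover have "t > 0" using True mpos by linarith
        ultimately show ?thesis using True by (simp add: mult.left_commute)
      qed (use zeta_sq_nonneg in \<open>auto simp: indicator_def\<close>)
    qed
    moreover have "exp (- (7 * ln x)) * (LINT t:{0<..}|lborel. zeta_sq t * exp (- (1 / x * t))) \<le> exp (- (7 * ln x)) * (mean_main x + pi + C * (ln (2 * x) / (2 * x)))"
    proof (intro mult_left_mono)
      have "2 / (2 * x) = 1 / x" "2 * x / 2 = x" by auto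
      thus "(LINT t:{0<..}|lborel. zeta_sq t * exp (- (1 / x * t))) \<le> mean_main x + pi + C * (ln (2 * x) / (2 * x))"
        using C(2)[of "2 * x"] x by (simp only:) linarith
    qed simp
    ultimately have "\<bar>cut_mean \<mu> x - (LINT t:{0<..}|lborel. f t)\<bar> \<le> ln x / x" using elim by linarith
    moreover have "\<bar>(LINT t:{0<..}|lborel. f t) - (mean_main (x / 2) + pi)\<bar> \<le> C * (ln x / x)"
      unfolding f_def by (rule C(2)[OF x])
    moreover have "(C + 1) * (ln x / x) = C * (ln x / x) + ln x / x" by (simp only: distrib_right mult_1_left)
    ultimately show ?case by linarith
  qed
  thus ?thesis using C(1) by (intro that[of "C + 1"]) auto
qed

lemma zeta_mean_continuous:
  "continuous_on {0..} (\<lambda>T. integral {0..T} zeta_sq)"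
proof -
  have "continuous_on {0..b} (\<lambda>T. integral {0..T} zeta_sq)" for b
    by (rule indefinite_integral_continuous_1[OF zeta_sq_integrable_on]) simp
  hence "continuous (at T within {0..}) (\<lambda>T. integral {0..T} zeta_sq)" if "T \<ge> 0" for T
  proof -
    have "continuous (at T within {0..T + 1}) (\<lambda>T. integral {0..T} zeta_sq)"
      using \<open>\<And>b. continuous_on {0..b} (\<lambda>T. integral {0..T} zeta_sq)\<close>[of "T + 1"] that by (auto simp: continuous_on_eq_continuous_within)
    moreover have "at T within {0..T + 1} = at T within {0..}"
      by (rule at_within_nhd[of _ "{T - 1<..<T + 1}"]) (use that in auto)
    ultimately show ?thesis by simp
  qed
  thus ?thesis by (auto simp: continuous_on_eq_continuous_within)
qed

lemma zeta_mean_mono: "0 \<le> a \<Longrightarrow> a \<le> b \<Longrightarrow> integral {0..a} zeta_sq \<le> integral {0..b} zeta_sq"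
  by (rule integral_subset_le) (auto intro: zeta_sq_integrable_on zeta_sq_nonneg)

text \<open>Raising \<open>x\<close> enlarges both the weight and the range. If the integrals over
  the smaller range were equal, the continuous integrands would agree there, so
  \<open>zeta_sq\<close> would vanish on it and \<open>cut_mean\<close> would be 0, against the
  positivity hypothesis.\<close>

lemma cut_mean_strict_mono:
  assumes "0 < x" "x < y" "\<mu> x \<le> \<mu> y" "cut_mean \<mu> x > 0"
  shows "cut_mean \<mu> x < cut_mean \<mu> y"
proof -
  define f where "f = (\<lambda>t. zeta_sq t * exp (- (2 / x) * t))"
  define g where "g = (\<lambda>t. zeta_sq t * exp (- (2 / y) * t))"
  have fg: "f t \<le> g t" if "t \<ge> 0" for t
  proof -
    have "2 / y * t \<le> 2 / x * t" using assms that by (intro mult_right_mono frac_le) auto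
    thus ?thesis unfolding f_def g_def by (intro mult_left_mono zeta_sq_nonneg) auto
  qed
  have cf: "continuous_on S f" and cg: "continuous_on S g" for S unfolding f_def g_def by (rule zeta_sq_exp_continuous)+
  have mx: "\<mu> x > 0"
  proof (rule ccontr)
    assume "\<not> \<mu> x > 0"
    hence "{0..\<mu> x} = {} \<or> {0..\<mu> x} = {0}" by auto
    hence "cut_mean \<mu> x = 0" unfolding cut_mean_def by auto
    thus False using assms by simp
  qed
  have le: "integral {0..\<mu> x} f \<le> integral {0..\<mu> x} g"
    by (intro integral_le integrable_continuous_interval cf cg fg) auto
  have "integral {0..\<mu> x} f \<noteq> integral {0..\<mu> x} g"
  proof
    assume eq: "integral {0..\<mu> x} f = integral {0..\<mu> x} g"
    have "integral {0..\<mu> x} (\<lambda>t. g t - f t) = 0"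
      using eq by (subst Henstock_Kurzweil_Integration.integral_diff) (auto intro: integrable_continuous_interval cf cg)
    moreover have "integral {0..\<mu> x} (\<lambda>t. g t - f t) = 0 \<longleftrightarrow> (\<forall>t\<in>{0..\<mu> x}. g t - f t = 0)"
      by (rule integral_eq_0_iff[OF continuous_on_diff[OF cg cf] mx]) (use fg in auto)
    ultimately have z: "g t - f t = 0" if "t \<in> {0..\<mu> x}" for t using that by blast
    have "zeta_sq t = 0" if "t \<in> {0<..\<mu> x}" for t
    proof (rule ccontr)
      assume nz: "zeta_sq t \<noteq> 0"
      have "2 / y * t < 2 / x * t" using assms that by (intro mult_strict_right_mono) (auto intro!: divide_strict_left_mono)
      hence "exp (- (2 / x) * t) < exp (- (2 / y) * t)" by simp
      hence "f t < g t" unfolding f_def g_def using nz zeta_sq_nonneg[of t] by (intro mult_strict_left_mono) auto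
      thus False using z[of t] that by auto
    qed
    hence "f t = 0" if "t \<in> {0<..<\<mu> x}" for t using that by (simp add: f_def)
    hence "integral {0<..<\<mu> x} f = integral {0<..<\<mu> x} (\<lambda>_. 0)" by (rule Henstock_Kurzweil_Integration.integral_cong)
    hence "integral {0<..<\<mu> x} f = 0" by simp
    hence "integral {0..\<mu> x} f = 0" by (simp add: integral_open_interval_real)
    thus False using assms(4) by (simp add: cut_mean_def f_def)
  qed
  hence "cut_mean \<mu> x < integral {0..\<mu> x} g" using le by (simp add: cut_mean_def f_def)
  also have "\<dots> \<le> integral {0..\<mu> y} g"
    using assms by (intro integral_subset_le integrable_continuous_interval cg) (auto simp: g_def zeta_sq_nonneg)
  finally show ?thesis by (simp add: cut_mean_def g_def)
qed

text \<open>The exponential weight is at most 1, so the mean square dominates a truncated integral;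
  the model cutoff 7 x ln x gives one with known growth.\<close>

lemma zeta_mean_unbounded: "filterlim (\<lambda>T. integral {0..T} zeta_sq) at_top at_top"
proof -
  obtain C' where C': "C' > 0" "eventually (\<lambda>x. \<bar>cut_mean (\<lambda>x. 7 * x * ln x) x - (mean_main (x / 2) + pi)\<bar> \<le> C' * (ln x / x)) at_top"
    using cut_mean_asymp[of "\<lambda>x. 7 * x * ln x"] by auto
  show ?thesis unfolding filterlim_at_top
  proof
    fix Z :: real
    have "eventually (\<lambda>x. mean_main (x / 2) + pi - C' * (ln x / x) \<ge> Z) at_top"
      unfolding mean_main_def using C'(1) by real_asymp
    with C'(2) have "eventually (\<lambda>x. cut_mean (\<lambda>x. 7 * x * ln x) x \<ge> Z \<and> x \<ge> 1) at_top"
      using eventually_ge_at_top[of "1::real"] by eventually_elim linarith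
    from eventually_happens'[OF trivial_limit_at_top_linorder this]
    obtain x :: real where x: "cut_mean (\<lambda>x. 7 * x * ln x) x \<ge> Z" "x \<ge> 1" by blast
    define M where "M = 7 * x * ln x"
    have "Z \<le> integral {0..M} zeta_sq"
    proof -
      have "cut_mean (\<lambda>x. 7 * x * ln x) x \<le> integral {0..M} zeta_sq"
        unfolding cut_mean_def M_def
        by (intro integral_le integrable_continuous_interval zeta_sq_exp_continuous zeta_sq_integrable_on)
           (use x zeta_sq_nonneg in \<open>auto intro!: mult_left_le\<close>)
      thus ?thesis using x by linarith
    qed
    moreover have "M \<ge> 0" using x by (simp add: M_def)
    ultimately have "Z \<le> integral {0..T} zeta_sq" if "T \<ge> M" for T using zeta_mean_mono[of M T] that by linarith
    thus "eventually (\<lambda>T. Z \<le> integral {0..T} zeta_sq) at_top" by (auto simp: eventually_at_top_linorder)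
  qed
qed

text \<open>Raabe's argument: the difference equals the integral over [a + 1, b + 1] minus that over
  [a, b], and Gamma (t + 1) = t Gamma t reduces it to the integral of ln over [a, b].\<close>

lemma integral_ln_Gamma_diff:
  assumes "0 < a" "a \<le> b"
  shows "integral {b..b + 1} (\<lambda>t. ln (Gamma t)) - integral {a..a + 1} (\<lambda>t. ln (Gamma t))
       = (b * ln b - b) - (a * ln a - a :: real)"
proof -
  define f where "f = (\<lambda>t::real. ln (Gamma t))"
  have cont: "continuous_on {x..y} f" if "x > 0" for x y
  proof -
    have "{x..y} \<inter> \<int>\<^sub>\<le>\<^sub>0 = {}" using that by (auto elim!: nonpos_Ints_cases)
    moreover have "Gamma t \<noteq> 0" if "t \<in> {x..y}" for t
    proof -
      have "t > 0" using that \<open>x > 0\<close> by auto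
      hence "Gamma t > 0" by (rule Gamma_real_pos)
      thus ?thesis by linarith
    qed
    ultimately show ?thesis unfolding f_def by (intro continuous_on_ln continuous_on_Gamma) auto
  qed
  have fi: "f integrable_on {x..y}" if "x > 0" for x y
    by (rule integrable_continuous_interval[OF cont[OF that]])
  have "integral {a..a + 1} f + integral {a + 1..b + 1} f = integral {a..b + 1} f"
    using assms by (intro Henstock_Kurzweil_Integration.integral_combine fi) auto
  moreover have "integral {a..b} f + integral {b..b + 1} f = integral {a..b + 1} f"
    using assms by (intro Henstock_Kurzweil_Integration.integral_combine fi) auto
  moreover have "integral {a + 1..b + 1} f = integral {a..b} (\<lambda>t. f (t + 1))"
    using integral_shift_real_ivl[of "a + 1" 1 "b + 1" f] by simp
  moreover have "integral {a..b} (\<lambda>t. f (t + 1)) = integral {a..b} (\<lambda>t. ln t + f t)"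
  proof (rule Henstock_Kurzweil_Integration.integral_cong)
    fix t assume t: "t \<in> {a..b}"
    hence t0: "t > 0" using assms by auto
    hence "t \<notin> \<int>\<^sub>\<le>\<^sub>0" by (auto elim!: nonpos_Ints_cases)
    hence "Gamma (t + 1) = t * Gamma t" by (rule Gamma_plus1)
    thus "f (t + 1) = ln t + f t" unfolding f_def by (simp only: ln_mult_pos[OF t0 Gamma_real_pos[OF t0]])
  qed
  moreover have L: "((\<lambda>t. ln t) has_integral ((b * ln b - b) - (a * ln a - a))) {a..b}"
  proof (rule fundamental_theorem_of_calculus[OF assms(2)])
    fix x assume x: "x \<in> {a..b}"
    have "((\<lambda>x. x * ln x - x) has_real_derivative ln x) (at x within {a..b})"
      using x assms by (auto intro!: derivative_eq_intros)
    thus "((\<lambda>x. x * ln x - x) has_vector_derivative ln x) (at x within {a..b})"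
      by (simp add: has_real_derivative_iff_has_vector_derivative)
  qed
  moreover have "integral {a..b} (\<lambda>t. ln t + f t) = integral {a..b} ln + integral {a..b} f"
    using L assms by (intro Henstock_Kurzweil_Integration.integral_add fi) (auto simp: has_integral_integrable)
  ultimately show ?thesis unfolding f_def[symmetric] by (simp add: integral_unique)
qed

section \<open>The inverse of the ladder and its iterates\<close>

context
  fixes \<mu> \<phi> :: "real \<Rightarrow> real" and T0 :: real
  assumes adm: "admissible \<mu>" and sol: "ladder_solution \<mu> T0 \<phi>"
begin

lemma T0_pos: "T0 > 0" and ladder_tendsto: "filterlim \<phi> at_top at_top"
  and ladder_eq: "T \<ge> T0 \<Longrightarrow> cut_mean \<mu> (\<phi> T) = integral {0..T} zeta_sq"
  using sol by (auto simp: ladder_solution_def cut_mean_def)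

lemma cutoff_large: "eventually (\<lambda>x. \<mu> x \<ge> 7 * x * ln x) at_top"
proof -
  obtain y0 where "\<forall>y>y0. \<mu> y \<ge> 7 * y * ln y" 
    using adm unfolding admissible_def by (elim exE conjE) (rule that)
  thus ?thesis by (intro eventually_mono[OF eventually_gt_at_top[of y0]]) blast
qed

lemma cut_mean_tendsto: "filterlim (cut_mean \<mu>) at_top at_top"
proof -
  obtain C where C: "C > 0" "eventually (\<lambda>x. \<bar>cut_mean \<mu> x - (mean_main (x / 2) + pi)\<bar> \<le> C * (ln x / x)) at_top"
    by (rule cut_mean_asymp[OF cutoff_large])
  have "filterlim (\<lambda>x. mean_main (x / 2) + pi - C * (ln x / x)) at_top at_top"
    unfolding mean_main_def using C(1) by real_asymp
  thus ?thesis
    by (rule filterlim_at_top_mono) (use C(2) in \<open>auto elim!: eventually_mono\<close>)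
qed

definition ladder_inv :: "real \<Rightarrow> real" where
  "ladder_inv = inv_into {T0..} (jacobs_ladder \<phi>)"

text \<open>The mean square is continuous while nothing of the kind is known of
  \<open>\<phi>\<close>. So the intermediate value theorem is applied to the right-hand side of the
  equation, producing a \<open>T\<close> at which it equals \<open>cut_mean \<mu> (2 * y)\<close>.
  Strict monotonicity of \<open>cut_mean\<close> then forces \<open>\<phi> T = 2 * y\<close>, which
  puts \<open>y\<close> into the range of the ladder.\<close>

lemma ladder_inv_props: "eventually (\<lambda>y. ladder_inv y \<ge> T0 \<and> \<phi> (ladder_inv y) = 2 * y) at_top"
proof -
  obtain y0 where y0: "y0 > 0" "mono_on {y0<..} \<mu>" using adm by (auto simp: admissible_def)
  have "eventually (\<lambda>x. cut_mean \<mu> x > 0 \<and> x > y0) at_top"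
    using cut_mean_tendsto by (intro eventually_conj eventually_gt_at_top) (auto simp: filterlim_at_top_dense)
  then obtain x1 where x1: "\<And>x. x \<ge> x1 \<Longrightarrow> cut_mean \<mu> x > 0 \<and> x > y0"
    by (auto simp: eventually_at_top_linorder)
  have "eventually (\<lambda>T. \<phi> T \<ge> x1) at_top" using ladder_tendsto by (auto simp: filterlim_at_top)
  \<comment> \<open>Beyond \<open>T1\<close> the values of \<open>\<phi>\<close> lie in the region
    where \<open>cut_mean\<close> is strictly increasing, hence injective.\<close>
  then obtain T1 where T1: "T1 \<ge> T0" "\<And>T. T \<ge> T1 \<Longrightarrow> \<phi> T \<ge> x1"
    unfolding eventually_at_top_linorder by (meson max.bounded_iff max.cobounded2)
  have less: "cut_mean \<mu> x < cut_mean \<mu> y" if "x1 \<le> x" "x < y" for x y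
  proof (rule cut_mean_strict_mono)
    show "\<mu> x \<le> \<mu> y" using y0(2) x1[of x] x1[of y] that by (intro mono_onD[OF y0(2)]) auto
  qed (use that x1[of x] y0(1) in auto)
  have "filterlim (\<lambda>y::real. 2 * y) at_top at_top" by real_asymp
  hence "filterlim (\<lambda>y. cut_mean \<mu> (2 * y)) at_top at_top" by (rule filterlim_compose[OF cut_mean_tendsto])
  hence "eventually (\<lambda>y. cut_mean \<mu> (2 * y) \<ge> integral {0..T1} zeta_sq) at_top" by (auto simp: filterlim_at_top)
  moreover have "eventually (\<lambda>y. 2 * y \<ge> x1) at_top" by real_asymp
  ultimately show ?thesis
  proof eventually_elim
    case (elim y)
    have "eventually (\<lambda>T. integral {0..T} zeta_sq \<ge> cut_mean \<mu> (2 * y)) at_top"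
      using zeta_mean_unbounded by (auto simp: filterlim_at_top)
    then obtain b where b: "b \<ge> T1" "integral {0..b} zeta_sq \<ge> cut_mean \<mu> (2 * y)"
      unfolding eventually_at_top_linorder by (meson max.cobounded1 max.cobounded2)
    have "continuous_on {T1..b} (\<lambda>T. integral {0..T} zeta_sq)"
      by (rule continuous_on_subset[OF zeta_mean_continuous]) (use T1 T0_pos in auto)
    then obtain T where T: "T \<ge> T1" "integral {0..T} zeta_sq = cut_mean \<mu> (2 * y)"
      using IVT'[of "\<lambda>T. integral {0..T} zeta_sq" T1 "cut_mean \<mu> (2 * y)" b] elim b by blast
    have eq: "cut_mean \<mu> (\<phi> T) = cut_mean \<mu> (2 * y)" using ladder_eq[of T] T T1(1) by simp
    have "\<phi> T = 2 * y"
    proof (rule linorder_cases[of "\<phi> T" "2 * y"])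
      assume "\<phi> T < 2 * y" thus ?thesis using less[of "\<phi> T" "2 * y"] T1(2)[OF T(1)] eq by simp
    next
      assume "2 * y < \<phi> T" thus ?thesis using less[of "2 * y" "\<phi> T"] elim eq by simp
    qed
    hence "y \<in> jacobs_ladder \<phi> ` {T0..}" using T T1(1) by (intro image_eqI[of _ _ T]) (auto simp: jacobs_ladder_def)
    hence "jacobs_ladder \<phi> (ladder_inv y) = y" "ladder_inv y \<in> {T0..}"
      unfolding ladder_inv_def by (rule f_inv_into_f, rule inv_into_into)
    thus ?case by (simp add: jacobs_ladder_def)
  qed
qed

lemma zeta_mean_ladder_inv: "eventually (\<lambda>y. integral {0..ladder_inv y} zeta_sq = cut_mean \<mu> (2 * y)) at_top"
  using ladder_inv_props by eventually_elim (metis ladder_eq)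

lemma ladder_inv_asymp:
  obtains C where "C > 0"
    "eventually (\<lambda>y. \<bar>integral {0..ladder_inv y} zeta_sq - (mean_main y + pi)\<bar> \<le> C * (ln y / y)) at_top"
proof -
  obtain C where C: "C > 0" "eventually (\<lambda>x. \<bar>cut_mean \<mu> x - (mean_main (x / 2) + pi)\<bar> \<le> C * (ln x / x)) at_top"
    by (rule cut_mean_asymp[OF cutoff_large])
  have "filterlim (\<lambda>y::real. 2 * y) at_top at_top" by real_asymp
  hence "eventually (\<lambda>y. \<bar>cut_mean \<mu> (2 * y) - (mean_main (2 * y / 2) + pi)\<bar> \<le> C * (ln (2 * y) / (2 * y))) at_top"
    by (rule eventually_compose_filterlim[OF C(2)])
  moreover have "eventually (\<lambda>y::real. ln (2 * y) / (2 * y) \<le> ln y / y) at_top" by real_asymp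
  ultimately have "eventually (\<lambda>y. \<bar>integral {0..ladder_inv y} zeta_sq - (mean_main y + pi)\<bar> \<le> C * (ln y / y)) at_top"
    using zeta_mean_ladder_inv
  proof eventually_elim
    case (elim y)
    have "C * (ln (2 * y) / (2 * y)) \<le> C * (ln y / y)" using elim(2) C(1) by (intro mult_left_mono) auto
    moreover have "2 * y / 2 = y" by simp
    ultimately show ?case using elim(1) unfolding elim(3) by (simp only:)
  qed
  thus ?thesis using C(1) by (intro that)
qed

lemma ladder_inv_ge: "eventually (\<lambda>y. ladder_inv y \<ge> y) at_top"
proof -
  obtain C where C: "C > 0"
    "eventually (\<lambda>y. \<bar>integral {0..ladder_inv y} zeta_sq - (mean_main y + pi)\<bar> \<le> C * (ln y / y)) at_top"
    by (rule ladder_inv_asymp)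
  have "eventually (\<lambda>y. C * (ln y / y) < y / 5) at_top" using C(1) by real_asymp
  thus ?thesis using C(2) zeta_mean_less_main ladder_inv_props
  proof eventually_elim
    case (elim y)
    show ?case
    proof (rule ccontr)
      assume "\<not> ladder_inv y \<ge> y"
      hence "integral {0..ladder_inv y} zeta_sq \<le> integral {0..y} zeta_sq"
        using elim T0_pos by (intro zeta_mean_mono) auto
      thus False using elim pi_gt_zero by linarith
    qed
  qed
qed

text \<open>The induction feeds itself: the bound for one iterate sends that iterate to infinity,
  which is where the next application of the inverse ladder is known not to decrease its
  argument.\<close>

lemma reverse_iterate_ge:
  "eventually (\<lambda>T. reverse_iterate T0 \<phi> r T \<ge> T) at_top"
proof (induction r)
  case 0
  show ?case by (simp add: reverse_iterate_def)
next
  case (Suc r)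
  hence "filterlim (reverse_iterate T0 \<phi> r) at_top at_top"
    by (rule filterlim_at_top_mono[OF filterlim_ident])
  hence "eventually (\<lambda>T. ladder_inv (reverse_iterate T0 \<phi> r T) \<ge> reverse_iterate T0 \<phi> r T) at_top"
    by (rule eventually_compose_filterlim[OF ladder_inv_ge])
  with Suc show ?case
    by eventually_elim (simp add: reverse_iterate_def ladder_inv_def)
qed

lemma reverse_iterate_at_top: "filterlim (reverse_iterate T0 \<phi> r) at_top at_top"
  using reverse_iterate_ge by (rule filterlim_at_top_mono[OF filterlim_ident])

text \<open>With consecutive iterates a <= b <= c, the integral over [b, c] is the difference of the
  asymptotic formula for J at \<open>b\<close> and at \<open>a\<close>. The two constants pi cancel,
  and Raabe's formula rewrites the difference of the main terms. The factor 2 in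
  \<open>2 * C\<close> stands for the two error terms.\<close>

lemma ladder_step_integral:
  defines "R \<equiv> reverse_iterate T0 \<phi>"
  shows "(\<lambda>T. integral {R (Suc r) T..R (Suc (Suc r)) T} zeta_sq
       - (integral {R (Suc r) T..R (Suc r) T + 1} (\<lambda>t. ln (Gamma t))
          - integral {R r T..R r T + 1} (\<lambda>t. ln (Gamma t))
          - (ln (2 * pi) - 1 - euler_mascheroni) * (R (Suc r) T - R r T)))
    \<in> O[at_top](\<lambda>T. ln T / T)"
proof -
  obtain C where C: "C > 0"
    "eventually (\<lambda>y. \<bar>integral {0..ladder_inv y} zeta_sq - (mean_main y + pi)\<bar> \<le> C * (ln y / y)) at_top"
    by (rule ladder_inv_asymp)
  have Suc_R: "R (Suc r) T = ladder_inv (R r T)" for r T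
    by (simp add: R_def reverse_iterate_def ladder_inv_def)
  have lim: "filterlim (R r) at_top at_top" for r unfolding R_def by (rule reverse_iterate_at_top)
  have ge: "eventually (\<lambda>T. R (Suc r) T \<ge> R r T) at_top" for r
    unfolding Suc_R by (rule eventually_compose_filterlim[OF ladder_inv_ge lim])
  have asymp: "eventually (\<lambda>T. \<bar>integral {0..R (Suc r) T} zeta_sq - (mean_main (R r T) + pi)\<bar> \<le> C * (ln (R r T) / R r T)) at_top" for r
    unfolding Suc_R by (rule eventually_compose_filterlim[OF C(2) lim])
  show ?thesis
  proof (rule bigoI[of _ "2 * C"])
    have "eventually (\<lambda>T. R r T \<ge> T) at_top" unfolding R_def by (rule reverse_iterate_ge)
    thus "eventually (\<lambda>T. norm (integral {R (Suc r) T..R (Suc (Suc r)) T} zeta_sq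
       - (integral {R (Suc r) T..R (Suc r) T + 1} (\<lambda>t. ln (Gamma t))
          - integral {R r T..R r T + 1} (\<lambda>t. ln (Gamma t))
          - (ln (2 * pi) - 1 - euler_mascheroni) * (R (Suc r) T - R r T))) \<le> 2 * C * norm (ln T / T)) at_top"
      using eventually_ge_at_top[of "3 :: real"] ge[of r] ge[of "Suc r"] asymp[of r] asymp[of "Suc r"]
    proof eventually_elim
      case (elim T)
      define a where "a = R r T"
      define b where "b = R (Suc r) T"
      define c where "c = R (Suc (Suc r)) T"
      note e = elim[folded a_def b_def c_def]
      have ord: "0 < a" "T \<le> a" "a \<le> b" "T \<le> b" "b \<le> c" using e by auto
      \<comment> \<open>ln x / x decreases from e onwards, so the errors at \<open>a\<close> and
        \<open>b\<close>, both at least \<open>T\<close>, are bounded by the one at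
        \<open>T\<close>.\<close>
      have e3: "exp 1 \<le> T" using exp_le e(2) by linarith
      have "ln a / a \<le> ln T / T" "ln b / b \<le> ln T / T"
        using ord e3 by (auto intro: ln_x_over_x_mono)
      hence ab: "C * (ln a / a) \<le> C * (ln T / T)" "C * (ln b / b) \<le> C * (ln T / T)"
        using C(1) by (intro mult_left_mono; simp)+
      have "integral {0..b} zeta_sq + integral {b..c} zeta_sq = integral {0..c} zeta_sq"
        using ord by (intro Henstock_Kurzweil_Integration.integral_combine zeta_sq_integrable_on) auto
      moreover have "integral {b..b + 1} (\<lambda>t. ln (Gamma t)) - integral {a..a + 1} (\<lambda>t. ln (Gamma t))
          - (ln (2 * pi) - 1 - euler_mascheroni) * (b - a) = mean_main b - mean_main a"
        unfolding integral_ln_Gamma_diff[OF ord(1,3)] mean_main_def zeta_const_def by (simp add: algebra_simps)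
      ultimately have "\<bar>integral {b..c} zeta_sq - (integral {b..b + 1} (\<lambda>t. ln (Gamma t)) - integral {a..a + 1} (\<lambda>t. ln (Gamma t))
          - (ln (2 * pi) - 1 - euler_mascheroni) * (b - a))\<bar> \<le> 2 * (C * (ln T / T))"
        using e(5,6) ab by linarith
      also have "\<dots> = 2 * C * (ln T / T)" by (simp only: mult.assoc)
      also have "\<dots> \<le> 2 * C * norm (ln T / T)"
        unfolding real_norm_def using C(1) by (intro mult_left_mono abs_ge_self) simp
      finally show ?case unfolding a_def b_def c_def real_norm_def .
    qed
  qed
qed

end

theorem theorem1:
  fixes \<mu> \<phi> :: "real \<Rightarrow> real" and T0 :: real and k :: nat
  assumes "admissible \<mu>" and "ladder_solution \<mu> T0 \<phi>"
  defines "R \<equiv> reverse_iterate T0 \<phi>"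
  shows "\<forall>r\<in>{1..k}.
    (\<lambda>T. integral {R r T..R (r + 1) T} zeta_sq
       - (integral {R r T..R r T + 1} (\<lambda>t. ln (Gamma t))
          - integral {R (r - 1) T..R (r - 1) T + 1} (\<lambda>t. ln (Gamma t))
          - (ln (2 * pi) - 1 - euler_mascheroni) * (R r T - R (r - 1) T)))
    \<in> O[at_top](\<lambda>T. ln T / T)"
proof
  fix r assume "r \<in> {1..k}"
  then obtain q where r: "r = Suc q" by (cases r) auto
  show "(\<lambda>T. integral {R r T..R (r + 1) T} zeta_sq
       - (integral {R r T..R r T + 1} (\<lambda>t. ln (Gamma t))
          - integral {R (r - 1) T..R (r - 1) T + 1} (\<lambda>t. ln (Gamma t))
          - (ln (2 * pi) - 1 - euler_mascheroni) * (R r T - R (r - 1) T)))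
    \<in> O[at_top](\<lambda>T. ln T / T)"
    using ladder_step_integral[OF assms(1,2), of q] unfolding R_def r by simp
qed

end
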